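(* Let $\mathcal{R}\subset\mathbb{R}^N\setminus\{0\}$ be a reduced root system, $a>0$, and $k$ a non-negative multiplicity function with $a+2\langle k\rangle+N-2>0$. 1) The differential-difference operator $\Delta_{k,a}=\|x\|^{2-a}\Delta_k-\|x\|^a$ is an essentially self-adjoint operator on $L^2(\mathbb{R}^N,\vartheta_{k,a}(x)dx)$. 2) There is no continuous spectrum of $\Delta_{k,a}$. 3) The set of discrete spectra of $-\Delta_{k,a}$ is given by $$\{2a\ell+2m+2\langle k\rangle+N-2+a:\ \ell,m\in\mathbb{N}\}\quad(N\ge2),\qquad\{2a\ell+2\langle k\rangle+a\pm1:\ \ell\in\mathbb{N}\}\quad(N=1).$$
   Context: $\mathbb{N}=\{0,1,2,\dots\}$. Let $\langle\cdot,\cdot\rangle$ be the standard inner product on $\mathbb{R}^N$, $\|x\|=\langle x,x\rangle^{1/2}$, $r_\alpha(x)=x-2\frac{\langle\alpha,x\rangle}{\|\alpha\|^2}\alpha$. A (reduced) root system is a finite set $\mathcal{R}\subset\mathbb{R}^N\setminus\{0\}$ with $r_\alpha(\mathcal{R})=\mathcal{R}$ and $\mathcal{R}\cap\mathbb{R}\alpha=\{\pm\alpha\}$ for all $\alpha\in\mathcal{R}$. $\mathfrak{C}$ is the finite Coxeter group generated by $\{r_\alpha\}$, $\mathcal{R}^+$ a positive subsystem. A multiplicity function is a $\mathfrak{C}$-invariant function $k=(k_\alpha)$ on $\mathcal{R}$; non-negative means all $k_\alpha\ge0$; $\langle k\rangle=\sum_{\alpha\in\mathcal{R}^+}k_\alpha$.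 Dunkl operators: $T_\xi(k)f(x)=\partial_\xi f(x)+\sum_{\alpha\in\mathcal{R}^+}k_\alpha\langle\alpha,\xi\rangle\frac{f(x)-f(r_\alpha x)}{\langle\alpha,x\rangle}$; Dunkl Laplacian $\Delta_k=\sum_{j=1}^NT_{\xi_j}(k)^2$ for an orthonormal basis $(\xi_j)$. $\vartheta_{k,a}(x)=\|x\|^{a-2}\prod_{\alpha\in\mathcal{R}}|\langle\alpha,x\rangle|^{k_\alpha}$. Let $\mathcal{H}_k^m(\mathbb{R}^N)$ be the homogeneous polynomials $p$ of degree $m$ with $\Delta_kp=0$, $\lambda_{k,a,m}=\frac{2m+2\langle k\rangle+N-2}{a}$, $L_\ell^{(\lambda)}(t)=\sum_{j=0}^\ell\frac{(-1)^j\Gamma(\lambda+\ell+1)}{(\ell-j)!\,\Gamma(\lambda+j+1)}\frac{t^j}{j!}$. The operator $\Delta_{k,a}$ is regarded as densely defined with domain $W_{k,a}(\mathbb{R}^N)$, the complex span of the functions $p(x)L_\ell^{(\lambda_{k,a,m})}(\frac2a\|x\|^a)e^{-\|x\|^a/a}$ ($\ell,m\in\mathbb{N}$, $p\in\mathcal{H}_k^m(\mathbb{R}^N)$). A densely defined operator is essentially self-adjoint if it is symmetric and its closure is self-adjoint; spectra refer to the closure, and "discrete spectra" means eigenvalues. *)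

theory Defs
  imports "HOL-Analysis.Analysis"
begin

section \<open>Root systems and Dunkl operators\<close>

definition reflection :: "real^'n \<Rightarrow> real^'n \<Rightarrow> real^'n" where
  "reflection \<alpha> x = x - (2 * (\<alpha> \<bullet> x) / (norm \<alpha>)\<^sup>2) *\<^sub>R \<alpha>"

definition root_system :: "(real^'n) set \<Rightarrow> bool" where
  "root_system R \<longleftrightarrow> finite R \<and> 0 \<notin> R \<and>
     (\<forall>\<alpha>\<in>R. reflection \<alpha> ` R = R \<and> R \<inter> range (\<lambda>c. c *\<^sub>R \<alpha>) = {\<alpha>, - \<alpha>})"

text \<open>The generators are involutions, so closing under composition with them already
  gives the group they generate.\<close>

inductive_set coxeter_group :: "(real^'n) set \<Rightarrow> (real^'n \<Rightarrow> real^'n) set"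
  for R :: "(real^'n) set" where
  id: "id \<in> coxeter_group R"
| refl: "\<alpha> \<in> R \<Longrightarrow> w \<in> coxeter_group R \<Longrightarrow> reflection \<alpha> \<circ> w \<in> coxeter_group R"

definition positive_subsystem :: "(real^'n) set \<Rightarrow> (real^'n) set \<Rightarrow> bool" where
  "positive_subsystem R P \<longleftrightarrow>
     (\<exists>v. (\<forall>\<alpha>\<in>R. \<alpha> \<bullet> v \<noteq> 0) \<and> P = {\<alpha> \<in> R. \<alpha> \<bullet> v > 0})"

definition multiplicity_function :: "(real^'n) set \<Rightarrow> (real^'n \<Rightarrow> real) \<Rightarrow> bool" where
  "multiplicity_function R k \<longleftrightarrow> (\<forall>w\<in>coxeter_group R. \<forall>\<alpha>\<in>R. k (w \<alpha>) = k \<alpha>)"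

definition directional_deriv :: "real^'n \<Rightarrow> (real^'n \<Rightarrow> complex) \<Rightarrow> real^'n \<Rightarrow> complex" where
  "directional_deriv \<xi> f x = vector_derivative (\<lambda>t. f (x + t *\<^sub>R \<xi>)) (at 0)"

text \<open>On the hyperplane orthogonal to \<open>\<alpha>\<close> the difference quotient
  \<open>(f x - f (reflection \<alpha> x)) / (\<alpha> \<bullet> x)\<close> is understood as its continuous extension,
  which for \<open>C\<^sup>1\<close> functions is \<open>2 / \<parallel>\<alpha>\<parallel>\<^sup>2\<close> times the derivative in direction \<open>\<alpha>\<close>.\<close>

definition reflection_quotient :: "real^'n \<Rightarrow> (real^'n \<Rightarrow> complex) \<Rightarrow> real^'n \<Rightarrow> complex" where
  "reflection_quotient \<alpha> f x =
     (if \<alpha> \<bullet> x = 0 then (2 / (norm \<alpha>)\<^sup>2) *\<^sub>R directional_deriv \<alpha> f x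
      else (f x - f (reflection \<alpha> x)) / complex_of_real (\<alpha> \<bullet> x))"

definition dunkl_operator ::
  "(real^'n) set \<Rightarrow> (real^'n \<Rightarrow> real) \<Rightarrow> real^'n \<Rightarrow> (real^'n \<Rightarrow> complex) \<Rightarrow> real^'n \<Rightarrow> complex" where
  "dunkl_operator P k \<xi> f x = directional_deriv \<xi> f x +
     (\<Sum>\<alpha>\<in>P. complex_of_real (k \<alpha> * (\<alpha> \<bullet> \<xi>)) * reflection_quotient \<alpha> f x)"

definition dunkl_laplacian ::
  "(real^'n) set \<Rightarrow> (real^'n \<Rightarrow> real) \<Rightarrow> (real^'n \<Rightarrow> complex) \<Rightarrow> real^'n \<Rightarrow> complex" where
  "dunkl_laplacian P k f x =
     (\<Sum>\<xi>\<in>Basis. dunkl_operator P k \<xi> (dunkl_operator P k \<xi> f) x)"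

text \<open>Here and in the density below, \<open>0 powr s = 0\<close> for every \<open>s\<close>. This can deviate from the
  usual conventions only at the origin and on the reflecting hyperplanes, a null set.\<close>

definition Delta_ka ::
  "(real^'n) set \<Rightarrow> (real^'n \<Rightarrow> real) \<Rightarrow> real \<Rightarrow> (real^'n \<Rightarrow> complex) \<Rightarrow> real^'n \<Rightarrow> complex" where
  "Delta_ka P k a f x =
     complex_of_real (norm x powr (2 - a)) * dunkl_laplacian P k f x
     - complex_of_real (norm x powr a) * f x"

definition theta_ka :: "(real^'n) set \<Rightarrow> (real^'n \<Rightarrow> real) \<Rightarrow> real \<Rightarrow> real^'n \<Rightarrow> real" where
  "theta_ka R k a x = norm x powr (a - 2) * (\<Prod>\<alpha>\<in>R. \<bar>\<alpha> \<bullet> x\<bar> powr k \<alpha>)"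

definition theta_measure :: "(real^'n) set \<Rightarrow> (real^'n \<Rightarrow> real) \<Rightarrow> real \<Rightarrow> (real^'n) measure" where
  "theta_measure R k a = density lborel (\<lambda>x. ennreal (theta_ka R k a x))"


section \<open>The domain \<open>W\<close>\<close>

definition complex_span :: "('x \<Rightarrow> complex) set \<Rightarrow> ('x \<Rightarrow> complex) set" where
  "complex_span B = {\<lambda>x. \<Sum>b\<in>S. c b * b x | S c. finite S \<and> S \<subseteq> B}"

definition homogeneous_polynomials :: "nat \<Rightarrow> (real^'n \<Rightarrow> complex) set" where
  "homogeneous_polynomials m =
     complex_span {\<lambda>x. complex_of_real (\<Prod>i\<in>UNIV. (x $ i) ^ e i) | e. (\<Sum>i\<in>UNIV. e i) = m}"

definition dunkl_harmonics ::
  "(real^'n) set \<Rightarrow> (real^'n \<Rightarrow> real) \<Rightarrow> nat \<Rightarrow> (real^'n \<Rightarrow> complex) set" where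
  "dunkl_harmonics P k m =
     {p \<in> homogeneous_polynomials m. \<forall>x. dunkl_laplacian P k p x = 0}"

definition laguerre :: "nat \<Rightarrow> real \<Rightarrow> real \<Rightarrow> real" where
  "laguerre l s t =
     (\<Sum>j\<le>l. ((- 1) ^ j * Gamma (s + real l + 1)) / (fact (l - j) * Gamma (s + real j + 1))
              * (t ^ j / fact j))"

definition lambda_kam :: "(real^'n) set \<Rightarrow> (real^'n \<Rightarrow> real) \<Rightarrow> real \<Rightarrow> nat \<Rightarrow> real" where
  "lambda_kam P k a m = (2 * real m + 2 * (\<Sum>\<alpha>\<in>P. k \<alpha>) + real CARD('n) - 2) / a"

definition W_ka ::
  "(real^'n) set \<Rightarrow> (real^'n \<Rightarrow> real) \<Rightarrow> real \<Rightarrow> (real^'n \<Rightarrow> complex) set" where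
  "W_ka P k a = complex_span
     {\<lambda>x. p x * complex_of_real
            (laguerre l (lambda_kam P k a m) (2 / a * norm x powr a) * exp (- (norm x powr a) / a))
      | l m p. p \<in> dunkl_harmonics P k m}"


section \<open>Unbounded operators on \<open>L\<^sup>2\<close>\<close>

text \<open>Elements of \<open>L\<^sup>2(M)\<close> are represented by square-integrable functions, identified when
  equal almost everywhere. An operator is represented by its graph, a set of pairs of
  functions that is saturated under this identification.\<close>

definition L2 :: "'x measure \<Rightarrow> ('x \<Rightarrow> complex) set" where
  "L2 M = {f \<in> borel_measurable M. integrable M (\<lambda>x. (cmod (f x))\<^sup>2)}"

definition L2_inner :: "'x measure \<Rightarrow> ('x \<Rightarrow> complex) \<Rightarrow> ('x \<Rightarrow> complex) \<Rightarrow> complex" where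
  "L2_inner M f g = (\<integral>x. f x * cnj (g x) \<partial>M)"

definition L2_norm :: "'x measure \<Rightarrow> ('x \<Rightarrow> complex) \<Rightarrow> real" where
  "L2_norm M f = sqrt (\<integral>x. (cmod (f x))\<^sup>2 \<partial>M)"

definition L2_dense :: "'x measure \<Rightarrow> ('x \<Rightarrow> complex) set \<Rightarrow> bool" where
  "L2_dense M D \<longleftrightarrow> (\<forall>f\<in>L2 M. \<forall>\<epsilon>>0. \<exists>u\<in>D. L2_norm M (\<lambda>x. f x - u x) < \<epsilon>)"

type_synonym 'x L2_graph = "(('x \<Rightarrow> complex) \<times> ('x \<Rightarrow> complex)) set"

definition L2_operator :: "'x measure \<Rightarrow> 'x L2_graph \<Rightarrow> bool" where
  "L2_operator M A \<longleftrightarrow>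
     A \<subseteq> L2 M \<times> L2 M \<and>
     ((\<lambda>x. 0), (\<lambda>x. 0)) \<in> A \<and>
     (\<forall>c f g f' g'. (f, g) \<in> A \<longrightarrow> (f', g') \<in> A \<longrightarrow>
        ((\<lambda>x. c * f x + f' x), (\<lambda>x. c * g x + g' x)) \<in> A) \<and>
     (\<forall>f g. \<forall>f'\<in>L2 M. \<forall>g'\<in>L2 M. (f, g) \<in> A \<longrightarrow>
        (AE x in M. f' x = f x) \<longrightarrow> (AE x in M. g' x = g x) \<longrightarrow> (f', g') \<in> A) \<and>
     (\<forall>f g f' g'. (f, g) \<in> A \<longrightarrow> (f', g') \<in> A \<longrightarrow>
        (AE x in M. f x = f' x) \<longrightarrow> (AE x in M. g x = g' x))"

definition densely_defined :: "'x measure \<Rightarrow> 'x L2_graph \<Rightarrow> bool" where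
  "densely_defined M A \<longleftrightarrow> L2_operator M A \<and> L2_dense M (Domain A)"

definition op_symmetric :: "'x measure \<Rightarrow> 'x L2_graph \<Rightarrow> bool" where
  "op_symmetric M A \<longleftrightarrow>
     densely_defined M A \<and> (\<forall>(f, f')\<in>A. \<forall>(g, g')\<in>A. L2_inner M f' g = L2_inner M f g')"

definition op_adjoint :: "'x measure \<Rightarrow> 'x L2_graph \<Rightarrow> 'x L2_graph" where
  "op_adjoint M A =
     {(f, f') \<in> L2 M \<times> L2 M. \<forall>(g, g')\<in>A. L2_inner M g' f = L2_inner M g f'}"

definition op_self_adjoint :: "'x measure \<Rightarrow> 'x L2_graph \<Rightarrow> bool" where
  "op_self_adjoint M A \<longleftrightarrow> densely_defined M A \<and> op_adjoint M A = A"

definition op_closure :: "'x measure \<Rightarrow> 'x L2_graph \<Rightarrow> 'x L2_graph" where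
  "op_closure M A =
     {(f, f') \<in> L2 M \<times> L2 M. \<exists>u u'. (\<forall>n::nat. (u n, u' n) \<in> A) \<and>
        (\<lambda>n. L2_norm M (\<lambda>x. u n x - f x)) \<longlonglongrightarrow> 0 \<and>
        (\<lambda>n. L2_norm M (\<lambda>x. u' n x - f' x)) \<longlonglongrightarrow> 0}"

text \<open>The operator on \<open>L\<^sup>2(M)\<close> induced by a map \<open>T\<close> on functions, with domain \<open>D\<close>.\<close>

definition op_on :: "'x measure \<Rightarrow> ('x \<Rightarrow> complex) set \<Rightarrow>
    (('x \<Rightarrow> complex) \<Rightarrow> ('x \<Rightarrow> complex)) \<Rightarrow> 'x L2_graph" where
  "op_on M D T = {(f, f') \<in> L2 M \<times> L2 M.
     \<exists>u\<in>D. (AE x in M. f x = u x) \<and> (AE x in M. f' x = T u x)}"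

text \<open>The first conjunct is needed since \<open>op_on\<close> would silently drop any
  \<open>u \<in> D\<close> with \<open>u\<close> or \<open>T u\<close> outside \<open>L\<^sup>2(M)\<close>.\<close>

definition essentially_self_adjoint :: "'x measure \<Rightarrow> ('x \<Rightarrow> complex) set \<Rightarrow>
    (('x \<Rightarrow> complex) \<Rightarrow> ('x \<Rightarrow> complex)) \<Rightarrow> bool" where
  "essentially_self_adjoint M D T \<longleftrightarrow>
     (\<forall>u\<in>D. u \<in> L2 M \<and> T u \<in> L2 M) \<and>
     op_symmetric M (op_on M D T) \<and>
     op_self_adjoint M (op_closure M (op_on M D T))"

definition op_range_shift :: "'x L2_graph \<Rightarrow> complex \<Rightarrow> ('x \<Rightarrow> complex) set" where
  "op_range_shift A z = {\<lambda>x. f' x - z * f x | f f'. (f, f') \<in> A}"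

definition point_spectrum :: "'x measure \<Rightarrow> 'x L2_graph \<Rightarrow> complex set" where
  "point_spectrum M A = {z. \<exists>f f'. (f, f') \<in> A \<and> \<not> (AE x in M. f x = 0) \<and>
     (AE x in M. f' x = z * f x)}"

text \<open>For closed \<open>A\<close>: those \<open>z\<close> for which \<open>A - z\<close> is injective with dense range
  but not surjective.\<close>

definition continuous_spectrum :: "'x measure \<Rightarrow> 'x L2_graph \<Rightarrow> complex set" where
  "continuous_spectrum M A = {z. z \<notin> point_spectrum M A \<and>
     L2_dense M (op_range_shift A z) \<and> op_range_shift A z \<noteq> L2 M}"

end

theory Submission
  imports Defs "HOL-Computational_Algebra.Polynomial"
begin

text \<open>Why the theorem holds. For a harmonic polynomial \<open>p\<close> of degree \<open>m\<close>, the Dunkl Laplacian of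
\<open>p x * g (norm x)\<close> is \<open>p\<close> times an ordinary second-order operator applied to \<open>g\<close>, because
\<open>\<Sum>\<^sub>j (T\<^sub>j x\<^sub>j + x\<^sub>j T\<^sub>j) p\<close> is a multiple of \<open>p\<close> (\<open>Lap_radial\<close>). In the variable
\<open>2 / a * norm x powr a\<close> the eigenvalue equation for that operator is Laguerre's equation, so each
generator \<open>Phi l m p\<close> of the domain is an eigenfunction, with the real eigenvalue \<open>eigval l m\<close>
(\<open>Phi_eigenfunction\<close>). Everything then follows from having an orthogonal and complete system of
eigenvectors.

Orthogonality (\<open>Phi_orthogonal\<close>). The integral of \<open>p * cnj q\<close> times a radial function splits in
polar coordinates into an angular constant and a one-dimensional integral. If the degrees differ, the
angular constant vanishes. It is the same for every radial function, so it may be computed with the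
Gaussian, where integration by parts for Dunkl operators can be done on the whole space and
no sphere is needed: pairing the gradients of two harmonics in two ways gives
\<open>(m - n) * \<integral> p q = 0\<close> (\<open>harmonic_gauss_orthogonal\<close>). If the degrees agree, the
one-dimensional integral is the orthogonality integral of Laguerre polynomials, the integral of a
total derivative.

Completeness (\<open>W_dense\<close>). Spans of Laguerre polynomials are all polynomials, so the domain contains
\<open>p x * norm x powr (a * j) * exp (- norm x powr a / a)\<close>. Expanding exponentials moves the rate
\<open>1 / a\<close> to any positive rate inside the closure, and the Weierstrass theorem in the variable
\<open>exp (- norm x powr a)\<close> replaces the exponentials by arbitrary continuous functions of the norm with
support away from \<open>0\<close> and infinity. Fischer's decomposition, polynomial = harmonic + \<open>(norm x)\<^sup>2\<close> times
polynomial, turns the harmonic factor into any polynomial; a second use of the Weierstrass theorem gives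
continuous functions, and a Dynkin-class argument gives indicators of Borel sets.

Spectral theory (locale \<open>L2_eigensystem\<close>). If \<open>z\<close> is not an eigenvalue then, on linear combinations of
orthogonal eigenvectors, \<open>A - z\<close> multiplies norms by at least the distance of \<open>z\<close> to the eigenvalues
(\<open>resolvent_bound\<close>). With \<open>z = - \<i>\<close> this shows that the adjoint is contained in the closure, and with
\<open>z\<close> outside the point spectrum it makes the closure of \<open>A - z\<close> onto, so that there is no
continuous spectrum. An eigenvector of the closure for an eigenvalue not on the list would be
orthogonal to the whole system.

It remains to see which eigenvalues are attained by nonzero functions, that is, in which degrees
nonzero harmonic polynomials exist: in all degrees if the dimension is at least two, only in degrees
\<open>0\<close> and \<open>1\<close> on the line. The two degrees account for the two signs in the one-dimensional formula.\<close>

section \<open>Square-integrable functions\<close>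

lemma L2_measurable[measurable_dest]: "f \<in> L2 M \<Longrightarrow> f \<in> borel_measurable M"
  by (simp add: L2_def)

lemma L2_integrable: "f \<in> L2 M \<Longrightarrow> integrable M (\<lambda>x. (cmod (f x))\<^sup>2)"
  by (simp add: L2_def)

lemma L2_zero[simp]: "(\<lambda>x. 0) \<in> L2 M"
  by (simp add: L2_def)

lemma L2_bound:
  assumes "g \<in> L2 M" and [measurable]: "f \<in> borel_measurable M"
    and "AE x in M. cmod (f x) \<le> C * cmod (g x)"
  shows "f \<in> L2 M"
proof -
  have "integrable M (\<lambda>x. (cmod (f x))\<^sup>2)"
  proof (rule Bochner_Integration.integrable_bound)
    show "integrable M (\<lambda>x. C\<^sup>2 * (cmod (g x))\<^sup>2)"
      using L2_integrable[OF assms(1)] by simp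
    show "AE x in M. norm ((cmod (f x))\<^sup>2) \<le> norm (C\<^sup>2 * (cmod (g x))\<^sup>2)"
      using assms(3)
    proof eventually_elim
      case (elim x)
      then have "(cmod (f x))\<^sup>2 \<le> (C * cmod (g x))\<^sup>2"
        by (intro power_mono) auto
      then show ?case by (simp add: power_mult_distrib)
    qed
  qed measurable
  then show ?thesis by (simp add: L2_def)
qed

lemma L2_cong_AE:
  assumes "g \<in> L2 M" "f \<in> borel_measurable M" "AE x in M. f x = g x"
  shows "f \<in> L2 M"
proof (rule L2_bound[OF assms(1,2)])
  show "AE x in M. cmod (f x) \<le> 1 * cmod (g x)" using assms(3) by eventually_elim simp
qed

lemma L2_cmult: assumes "f \<in> L2 M" shows "(\<lambda>x. c * f x) \<in> L2 M"
proof -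
  have [measurable]: "f \<in> borel_measurable M" using assms by (simp add: L2_def)
  show ?thesis by (rule L2_bound[OF assms, of _ "cmod c"]) (auto simp: norm_mult)
qed

lemma L2_add: assumes "f \<in> L2 M" "g \<in> L2 M" shows "(\<lambda>x. f x + g x) \<in> L2 M"
proof -
  have [measurable]: "f \<in> borel_measurable M" "g \<in> borel_measurable M"
    using assms by (auto simp: L2_def)
  have "integrable M (\<lambda>x. (cmod (f x + g x))\<^sup>2)"
  proof (rule Bochner_Integration.integrable_bound)
    show "integrable M (\<lambda>x. 2 * (cmod (f x))\<^sup>2 + 2 * (cmod (g x))\<^sup>2)"
      using assms by (auto simp: L2_def)
    have "(cmod (f x + g x))\<^sup>2 \<le> 2 * (cmod (f x))\<^sup>2 + 2 * (cmod (g x))\<^sup>2" for x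
    proof -
      have "(cmod (f x + g x))\<^sup>2 \<le> (cmod (f x) + cmod (g x))\<^sup>2"
        by (intro power_mono norm_triangle_ineq) auto
      also have "\<dots> \<le> 2 * (cmod (f x))\<^sup>2 + 2 * (cmod (g x))\<^sup>2"
        using sum_squares_bound[of "cmod (f x)" "cmod (g x)"] by (simp add: power2_sum)
      finally show ?thesis .
    qed
    then show "AE x in M. norm ((cmod (f x + g x))\<^sup>2) \<le> norm (2 * (cmod (f x))\<^sup>2 + 2 * (cmod (g x))\<^sup>2)"
      by auto
  qed measurable
  then show ?thesis by (simp add: L2_def)
qed

lemma L2_diff: "f \<in> L2 M \<Longrightarrow> g \<in> L2 M \<Longrightarrow> (\<lambda>x. f x - g x) \<in> L2 M"
  using L2_add[of f M "\<lambda>x. (-1) * g x"] L2_cmult[of g M "-1"] by simp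

lemma L2_sum: "(\<And>i. i \<in> S \<Longrightarrow> f i \<in> L2 M) \<Longrightarrow> (\<lambda>x. \<Sum>i\<in>S. f i x) \<in> L2 M"
  by (induction S rule: infinite_finite_induct) (auto intro!: L2_add)

lemma L2_cnj: assumes "f \<in> L2 M" shows "(\<lambda>x. cnj (f x)) \<in> L2 M"
proof -
  have [measurable]: "f \<in> borel_measurable M" using assms by (simp add: L2_def)
  have "(\<lambda>x. cnj (f x)) \<in> borel_measurable M"
    by (rule measurable_compose[of f M borel cnj])
      (auto intro!: borel_measurable_continuous_onI continuous_intros)
  then show ?thesis using assms by (simp add: L2_def)
qed

lemma L2_norm_nonneg[simp]: "0 \<le> L2_norm M f"
  by (simp add: L2_norm_def)

lemma L2_norm_sq: "(L2_norm M f)\<^sup>2 = (\<integral>x. (cmod (f x))\<^sup>2 \<partial>M)"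
  by (simp add: L2_norm_def)

lemma L2_norm_inner: "complex_of_real ((L2_norm M f)\<^sup>2) = L2_inner M f f"
  unfolding L2_norm_sq L2_inner_def complex_norm_square[symmetric] integral_complex_of_real ..

lemma L2_norm_cong:
  assumes "AE x in M. f x = g x" "f \<in> borel_measurable M" "g \<in> borel_measurable M"
  shows "L2_norm M f = L2_norm M g"
proof -
  have "(\<integral>x. (cmod (f x))\<^sup>2 \<partial>M) = (\<integral>x. (cmod (g x))\<^sup>2 \<partial>M)"
    using assms by (intro integral_cong_AE) auto
  then show ?thesis by (simp add: L2_norm_def)
qed

lemma L2_inner_integrable:
  assumes "f \<in> L2 M" "g \<in> L2 M" shows "integrable M (\<lambda>x. f x * cnj (g x))"
proof -
  have [measurable]: "f \<in> borel_measurable M" "(\<lambda>x. cnj (g x)) \<in> borel_measurable M"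
    using assms L2_cnj[OF assms(2)] by (auto simp: L2_def)
  show ?thesis
  proof (rule Bochner_Integration.integrable_bound)
    show "integrable M (\<lambda>x. (cmod (f x))\<^sup>2 + (cmod (g x))\<^sup>2)"
      using assms by (auto simp: L2_def)
    have "cmod (f x * cnj (g x)) \<le> (cmod (f x))\<^sup>2 + (cmod (g x))\<^sup>2" for x
    proof -
      have "0 \<le> cmod (f x) * cmod (g x)" by simp
      moreover have "cmod (f x * cnj (g x)) = cmod (f x) * cmod (g x)" by (simp add: norm_mult)
      ultimately show ?thesis
        using sum_squares_bound[of "cmod (f x)" "cmod (g x)"] by linarith
    qed
    then show "AE x in M. cmod (f x * cnj (g x)) \<le> norm ((cmod (f x))\<^sup>2 + (cmod (g x))\<^sup>2)"
      by auto
  qed measurable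
qed

lemma L2_inner_cnj: "L2_inner M g f = cnj (L2_inner M f g)"
proof -
  have "cnj (L2_inner M f g) = (\<integral>x. cnj (f x * cnj (g x)) \<partial>M)"
    unfolding L2_inner_def by (rule Bochner_Integration.integral_cnj[symmetric])
  then show ?thesis by (simp add: L2_inner_def mult.commute)
qed

lemma L2_inner_add_left:
  "f \<in> L2 M \<Longrightarrow> g \<in> L2 M \<Longrightarrow> h \<in> L2 M \<Longrightarrow>
    L2_inner M (\<lambda>x. f x + g x) h = L2_inner M f h + L2_inner M g h"
  unfolding L2_inner_def
  by (simp add: distrib_right L2_inner_integrable)

lemma L2_inner_cmult_left: "L2_inner M (\<lambda>x. c * f x) h = c * L2_inner M f h"
  unfolding L2_inner_def by (simp add: mult.assoc)

lemma L2_inner_cmult_right: "L2_inner M f (\<lambda>x. c * g x) = cnj c * L2_inner M f g"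
  by (subst (1 2) L2_inner_cnj) (simp add: L2_inner_cmult_left)

lemma L2_inner_diff_left:
  "f \<in> L2 M \<Longrightarrow> g \<in> L2 M \<Longrightarrow> h \<in> L2 M \<Longrightarrow>
    L2_inner M (\<lambda>x. f x - g x) h = L2_inner M f h - L2_inner M g h"
  unfolding L2_inner_def
  by (simp add: left_diff_distrib L2_inner_integrable)

lemma L2_inner_diff_right:
  "f \<in> L2 M \<Longrightarrow> g \<in> L2 M \<Longrightarrow> h \<in> L2 M \<Longrightarrow>
    L2_inner M h (\<lambda>x. f x - g x) = L2_inner M h f - L2_inner M h g"
  by (subst (1 2 3) L2_inner_cnj) (simp add: L2_inner_diff_left)

lemma L2_inner_sum_left:
  "(\<And>i. i \<in> S \<Longrightarrow> f i \<in> L2 M) \<Longrightarrow> h \<in> L2 M \<Longrightarrow>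
    L2_inner M (\<lambda>x. \<Sum>i\<in>S. f i x) h = (\<Sum>i\<in>S. L2_inner M (f i) h)"
  unfolding L2_inner_def
  by (simp add: sum_distrib_right L2_inner_integrable)

lemma L2_inner_sum_right:
  "(\<And>i. i \<in> S \<Longrightarrow> f i \<in> L2 M) \<Longrightarrow> h \<in> L2 M \<Longrightarrow>
    L2_inner M h (\<lambda>x. \<Sum>i\<in>S. f i x) = (\<Sum>i\<in>S. L2_inner M h (f i))"
  by (subst L2_inner_cnj) (simp add: L2_inner_sum_left cnj_sum L2_inner_cnj[symmetric])

lemma L2_inner_cong:
  assumes "AE x in M. f x = f' x" "AE x in M. g x = g' x"
    "f \<in> L2 M" "f' \<in> L2 M" "g \<in> L2 M" "g' \<in> L2 M"
  shows "L2_inner M f g = L2_inner M f' g'"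
  unfolding L2_inner_def
proof (rule integral_cong_AE)
  show "AE x in M. f x * cnj (g x) = f' x * cnj (g' x)"
    using assms(1,2) by eventually_elim simp
qed (use assms(3-) L2_cnj[of g M] L2_cnj[of g' M] in \<open>auto simp: L2_def\<close>)

text \<open>The inequality for nonnegative integrals, applied to the moduli.\<close>

lemma L2_Cauchy_Schwarz:
  assumes "f \<in> L2 M" "g \<in> L2 M"
  shows "cmod (L2_inner M f g) \<le> L2_norm M f * L2_norm M g"
proof -
  have [measurable]: "f \<in> borel_measurable M" "g \<in> borel_measurable M"
    using assms by (auto simp: L2_def)
  have i: "integrable M (\<lambda>x. cmod (f x) * cmod (g x))"
    using integrable_norm[OF L2_inner_integrable[OF assms]] by (simp add: norm_mult)
  have "cmod (L2_inner M f g) \<le> (\<integral>x. cmod (f x) * cmod (g x) \<partial>M)"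
    unfolding L2_inner_def using integral_norm_bound[of M "\<lambda>x. f x * cnj (g x)"] by (simp add: norm_mult)
  also have "\<dots> \<le> L2_norm M f * L2_norm M g"
  proof (rule power2_le_imp_le)
    have e: "(\<integral>\<^sup>+x. ennreal (cmod (h x)) ^ 2 \<partial>M) = ennreal ((L2_norm M h)\<^sup>2)" if "h \<in> L2 M" for h
      unfolding L2_norm_sq using nn_integral_eq_integral[OF L2_integrable[OF that]]
      by (simp add: ennreal_power)
    have I: "(\<integral>\<^sup>+x. ennreal (cmod (f x)) * ennreal (cmod (g x)) \<partial>M)
        = ennreal (\<integral>x. cmod (f x) * cmod (g x) \<partial>M)"
      using nn_integral_eq_integral[OF i] by (simp add: ennreal_mult)
    have "(\<integral>\<^sup>+x. ennreal (cmod (f x)) * ennreal (cmod (g x)) \<partial>M)\<^sup>2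
       \<le> (\<integral>\<^sup>+x. ennreal (cmod (f x)) ^ 2 \<partial>M) * (\<integral>\<^sup>+x. ennreal (cmod (g x)) ^ 2 \<partial>M)"
      by (rule Cauchy_Schwarz_nn_integral) measurable
    then have "ennreal ((\<integral>x. cmod (f x) * cmod (g x) \<partial>M)\<^sup>2)
        \<le> ennreal ((L2_norm M f)\<^sup>2 * (L2_norm M g)\<^sup>2)"
      unfolding I e[OF assms(1)] e[OF assms(2)]
      by (subst (asm) ennreal_power) (auto simp del: ennreal_mult' simp: ennreal_mult)
    then show "(\<integral>x. cmod (f x) * cmod (g x) \<partial>M)\<^sup>2 \<le> (L2_norm M f * L2_norm M g)\<^sup>2"
      by (subst (asm) ennreal_le_iff) (auto simp: power_mult_distrib)
  qed simp
  finally show ?thesis .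
qed

lemma L2_norm_cmult: "L2_norm M (\<lambda>x. c * f x) = cmod c * L2_norm M f"
proof -
  have "(\<integral>x. (cmod (c * f x))\<^sup>2 \<partial>M) = (cmod c)\<^sup>2 * (\<integral>x. (cmod (f x))\<^sup>2 \<partial>M)"
    by (simp add: norm_mult power_mult_distrib)
  then show ?thesis unfolding L2_norm_def by (simp only: real_sqrt_mult real_sqrt_abs abs_norm_cancel)
qed

lemma L2_norm_minus: "L2_norm M (\<lambda>x. f x - g x) = L2_norm M (\<lambda>x. g x - f x)"
  by (simp add: L2_norm_def norm_minus_commute)

lemma of_real_le_norm_add: "complex_of_real a = x + y \<Longrightarrow> a \<le> cmod x + cmod y"
  using norm_triangle_ineq[of x y] abs_ge_self[of a] norm_of_real[of a, where 'a=complex] by simp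

lemma L2_norm_triangle:
  assumes "f \<in> L2 M" "g \<in> L2 M"
  shows "L2_norm M (\<lambda>x. f x + g x) \<le> L2_norm M f + L2_norm M g"
proof (rule power2_le_imp_le)
  let ?h = "\<lambda>x. f x + g x"
  have h: "?h \<in> L2 M" using assms by (rule L2_add)
  have "complex_of_real ((L2_norm M ?h)\<^sup>2) = L2_inner M f ?h + L2_inner M g ?h"
    unfolding L2_norm_inner by (rule L2_inner_add_left[OF assms h])
  then have "(L2_norm M ?h)\<^sup>2 \<le> cmod (L2_inner M f ?h) + cmod (L2_inner M g ?h)"
    by (rule of_real_le_norm_add)
  also have "\<dots> \<le> L2_norm M f * L2_norm M ?h + L2_norm M g * L2_norm M ?h"
    by (intro add_mono L2_Cauchy_Schwarz assms h)
  finally have *: "L2_norm M ?h * L2_norm M ?h \<le> (L2_norm M f + L2_norm M g) * L2_norm M ?h"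
    by (simp add: power2_eq_square distrib_right)
  have "L2_norm M ?h \<le> L2_norm M f + L2_norm M g"
  proof (cases "L2_norm M ?h = 0")
    case False
    then have "0 < L2_norm M ?h" using L2_norm_nonneg[of M ?h] by linarith
    then show ?thesis using * by (meson mult_right_le_imp_le)
  qed simp
  then show "(L2_norm M ?h)\<^sup>2 \<le> (L2_norm M f + L2_norm M g)\<^sup>2"
    by (intro power_mono) auto
qed simp

lemma L2_norm_triangle_diff:
  assumes "f \<in> L2 M" "g \<in> L2 M" "h \<in> L2 M"
  shows "L2_norm M (\<lambda>x. f x - h x) \<le> L2_norm M (\<lambda>x. f x - g x) + L2_norm M (\<lambda>x. g x - h x)"
  using L2_norm_triangle[OF L2_diff[OF assms(1,2)] L2_diff[OF assms(2,3)]] by simp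

lemma L2_norm_eq_0:
  assumes "f \<in> L2 M" "L2_norm M f = 0" shows "AE x in M. f x = 0"
proof -
  have "(\<integral>x. (cmod (f x))\<^sup>2 \<partial>M) = 0" using assms(2) by (simp add: L2_norm_def)
  then have "AE x in M. (cmod (f x))\<^sup>2 = 0"
    using integral_nonneg_eq_0_iff_AE[OF L2_integrable[OF assms(1)]] by simp
  then show ?thesis by simp
qed

text \<open>The dominated convergence theorem for the integrands \<open>\<bar>f - s n\<bar>\<^sup>2\<close>, which are bounded by
\<open>(2 * \<bar>g\<bar>)\<^sup>2\<close>. All approximation steps in the completeness proof go through this lemma.\<close>

lemma L2_dominated_convergence:
  assumes g: "g \<in> L2 M" and f[measurable]: "f \<in> borel_measurable M"
    and s[measurable]: "\<And>n. s n \<in> borel_measurable M"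
    and lim: "AE x in M. (\<lambda>n. s n x) \<longlonglongrightarrow> f x"
    and bd: "\<And>n. AE x in M. cmod (s n x) \<le> cmod (g x)"
  shows "f \<in> L2 M" "(\<lambda>n. L2_norm M (\<lambda>x. f x - s n x)) \<longlonglongrightarrow> 0"
proof -
  have fg: "AE x in M. cmod (f x) \<le> cmod (g x)"
  proof -
    have "AE x in M. \<forall>n. cmod (s n x) \<le> cmod (g x)" using bd by (simp add: AE_all_countable)
    then show ?thesis using lim
      by eventually_elim (rule Lim_bounded[OF tendsto_norm], auto)
  qed
  then show "f \<in> L2 M" by (intro L2_bound[OF g f, of 1]) simp
  have [measurable]: "g \<in> borel_measurable M" using g by (simp add: L2_def)
  have "(\<lambda>n. \<integral>x. (cmod (f x - s n x))\<^sup>2 \<partial>M) \<longlonglongrightarrow> (\<integral>x. 0 \<partial>M)"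
  proof (rule integral_dominated_convergence)
    show "integrable M (\<lambda>x. 4 * (cmod (g x))\<^sup>2)" using g by (simp add: L2_def)
    show "AE x in M. (\<lambda>n. (cmod (f x - s n x))\<^sup>2) \<longlonglongrightarrow> 0"
      using lim
    proof eventually_elim
      case (elim x)
      have "(\<lambda>n. (cmod (f x - s n x))\<^sup>2) \<longlonglongrightarrow> (cmod (f x - f x))\<^sup>2"
        by (intro tendsto_intros elim)
      then show ?case by simp
    qed
    show "AE x in M. norm ((cmod (f x - s n x))\<^sup>2) \<le> 4 * (cmod (g x))\<^sup>2" for n
      using fg bd[of n]
    proof eventually_elim
      case (elim x)
      have "cmod (f x - s n x) \<le> 2 * cmod (g x)"
        using norm_triangle_ineq4[of "f x" "s n x"] elim by linarith
      then have "(cmod (f x - s n x))\<^sup>2 \<le> (2 * cmod (g x))\<^sup>2" by (intro power_mono) auto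
      then show ?case by (simp add: power_mult_distrib)
    qed
  qed measurable
  then have "(\<lambda>n. sqrt (\<integral>x. (cmod (f x - s n x))\<^sup>2 \<partial>M)) \<longlonglongrightarrow> sqrt 0"
    by (intro tendsto_real_sqrt) simp
  then show "(\<lambda>n. L2_norm M (\<lambda>x. f x - s n x)) \<longlonglongrightarrow> 0" by (simp add: L2_norm_def)
qed

text \<open>A functional that is bounded by \<open>C\<close> on a dense subset is bounded by \<open>C\<close>, and the functional of pairing
with \<open>d\<close> has norm \<open>\<parallel>d\<parallel>\<close>: test it on elements of \<open>D\<close> that tend to \<open>d\<close> itself. This is how norms of
unknown functions are estimated from information on a dense domain only.\<close>

lemma L2_dense_bound:
  assumes D: "L2_dense M D" "D \<subseteq> L2 M" and d: "d \<in> L2 M"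
    and bd: "\<And>w. w \<in> D \<Longrightarrow> cmod (L2_inner M w d) \<le> C * L2_norm M w" and C: "C \<ge> 0"
  shows "L2_norm M d \<le> C"
proof -
  have "(L2_norm M d)\<^sup>2 \<le> C * L2_norm M d + e" if e: "e > 0" for e
  proof -
    define \<epsilon> where "\<epsilon> = e / (L2_norm M d + C + 1)"
    have pos: "L2_norm M d + C + 1 > 0" using C L2_norm_nonneg[of M d] by linarith
    then have \<epsilon>: "\<epsilon> > 0" using e by (simp add: \<epsilon>_def)
    obtain w where w: "w \<in> D" "L2_norm M (\<lambda>x. d x - w x) < \<epsilon>"
      using D(1) d \<epsilon> unfolding L2_dense_def by blast
    have wL: "w \<in> L2 M" using w D by auto
    have "complex_of_real ((L2_norm M d)\<^sup>2) = L2_inner M (\<lambda>x. d x - w x) d + L2_inner M w d"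
      unfolding L2_norm_inner by (simp add: L2_inner_diff_left d wL)
    then have "(L2_norm M d)\<^sup>2 \<le> cmod (L2_inner M (\<lambda>x. d x - w x) d) + cmod (L2_inner M w d)"
      by (rule of_real_le_norm_add)
    also have "\<dots> \<le> \<epsilon> * L2_norm M d + C * L2_norm M w"
    proof (rule add_mono)
      have "cmod (L2_inner M (\<lambda>x. d x - w x) d) \<le> L2_norm M (\<lambda>x. d x - w x) * L2_norm M d"
        by (intro L2_Cauchy_Schwarz L2_diff d wL)
      also have "\<dots> \<le> \<epsilon> * L2_norm M d" using w(2) by (intro mult_right_mono) auto
      finally show "cmod (L2_inner M (\<lambda>x. d x - w x) d) \<le> \<epsilon> * L2_norm M d" .
    qed (rule bd[OF w(1)])
    also have "\<dots> \<le> \<epsilon> * L2_norm M d + C * (L2_norm M d + \<epsilon>)"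
    proof (intro add_left_mono mult_left_mono C)
      show "L2_norm M w \<le> L2_norm M d + \<epsilon>"
        using L2_norm_triangle[OF L2_diff[OF wL d] d] w(2) by (simp add: L2_norm_minus[of _ w d])
    qed
    also have "\<dots> = C * L2_norm M d + \<epsilon> * (L2_norm M d + C)" by (simp add: algebra_simps)
    also have "\<dots> \<le> C * L2_norm M d + e"
    proof -
      have "e * (L2_norm M d + C) \<le> e * (L2_norm M d + C + 1)"
        using e by (intro mult_left_mono) auto
      then show ?thesis using pos by (simp add: \<epsilon>_def pos_divide_le_eq)
    qed
    finally show ?thesis .
  qed
  then have "(L2_norm M d)\<^sup>2 \<le> C * L2_norm M d" by (rule field_le_epsilon)
  then show ?thesis
    using C L2_norm_nonneg[of M d]
    by (cases "L2_norm M d = 0") (auto simp: power2_eq_square)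
qed

lemma L2_dense_orthogonal:
  assumes "L2_dense M D" "D \<subseteq> L2 M" "d \<in> L2 M" "\<And>w. w \<in> D \<Longrightarrow> L2_inner M w d = 0"
  shows "AE x in M. d x = 0"
proof (rule L2_norm_eq_0[OF assms(3)])
  have "L2_norm M d \<le> 0" by (rule L2_dense_bound[OF assms(1-3)]) (simp_all add: assms(4))
  then show "L2_norm M d = 0" using L2_norm_nonneg[of M d] by linarith
qed

lemma L2_inner_tendsto:
  assumes "f \<in> L2 M" "g \<in> L2 M" "\<And>n. s n \<in> L2 M" "(\<lambda>n. L2_norm M (\<lambda>x. s n x - f x)) \<longlonglongrightarrow> 0"
  shows "(\<lambda>n. L2_inner M (s n) g) \<longlonglongrightarrow> L2_inner M f g"
proof -
  have bd: "cmod (L2_inner M (s n) g - L2_inner M f g) \<le> L2_norm M (\<lambda>x. s n x - f x) * L2_norm M g" for n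
    using L2_Cauchy_Schwarz[OF L2_diff[OF assms(3,1)] assms(2)]
    by (simp add: L2_inner_diff_left assms(1-3))
  have "(\<lambda>n. L2_norm M (\<lambda>x. s n x - f x) * L2_norm M g) \<longlonglongrightarrow> 0"
    by (rule tendsto_mult_left_zero[OF assms(4)])
  then have "(\<lambda>n. L2_inner M (s n) g - L2_inner M f g) \<longlonglongrightarrow> 0"
    by (rule Lim_null_comparison[OF always_eventually, rotated]) (use bd in blast)
  then show ?thesis by (rule LIM_zero_cancel)
qed

section \<open>Completeness of the space of square-integrable functions\<close>

text \<open>The Riesz-Fischer argument. A subsequence \<open>t\<close> whose consecutive distances are at most
\<open>(1/2) ^ k\<close> has an absolutely convergent telescoping series almost everywhere, by monotone convergence
for the partial sums of the moduli; \<open>\<bar>t 0\<bar>\<close> plus the sum of the moduli dominates the subsequence, so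
it converges in \<open>L\<^sup>2\<close>, and with it the whole Cauchy sequence.\<close>

theorem L2_complete:
  assumes s: "\<And>n. s n \<in> L2 M"
    and Cauchy: "\<And>\<epsilon>. \<epsilon> > 0 \<Longrightarrow> \<exists>N. \<forall>m\<ge>N. \<forall>n\<ge>N. L2_norm M (\<lambda>x. s m x - s n x) < \<epsilon>"
  shows "\<exists>f\<in>L2 M. (\<lambda>n. L2_norm M (\<lambda>x. s n x - f x)) \<longlonglongrightarrow> 0"
proof -
  have "\<exists>r. \<forall>k. (\<forall>m\<ge>r k. \<forall>n\<ge>r k. L2_norm M (\<lambda>x. s m x - s n x) < (1/2)^k) \<and> r k < r (Suc k)"
  proof (intro dependent_nat_choice, goal_cases)
    case 1 show ?case using Cauchy[of 1] by simp
  next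
    case (2 x k)
    obtain N where N: "\<forall>m\<ge>N. \<forall>n\<ge>N. L2_norm M (\<lambda>x. s m x - s n x) < (1/2)^Suc k"
      using Cauchy[of "(1/2)^Suc k"] by auto
    show ?case by (rule exI[of _ "max N (Suc x)"]) (use N in auto)
  qed
  then obtain r where r: "\<And>k m n. m \<ge> r k \<Longrightarrow> n \<ge> r k \<Longrightarrow> L2_norm M (\<lambda>x. s m x - s n x) < (1/2)^k"
    and r_Suc: "\<And>k. r k < r (Suc k)" by blast
  define t where "t k = s (r k)" for k
  have tL: "t k \<in> L2 M" for k by (simp add: t_def s)
  have [measurable]: "t k \<in> borel_measurable M" for k using tL by (simp add: L2_def)
  have step: "L2_norm M (\<lambda>x. t (Suc k) x - t k x) \<le> (1/2)^k" for k
    unfolding t_def using r[of k "r (Suc k)" "r k"] r_Suc[of k] by simp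
  define g where "g K x = (\<Sum>k<K. cmod (t (Suc k) x - t k x))" for K x
  have [measurable]: "g K \<in> borel_measurable M" for K unfolding g_def by measurable
  have g_nn: "0 \<le> g K x" for K x by (simp add: g_def sum_nonneg)
  have gL: "(\<lambda>x. complex_of_real (g K x)) \<in> L2 M"
    and gn: "L2_norm M (\<lambda>x. complex_of_real (g K x)) \<le> (\<Sum>k<K. (1/2)^k)" for K
  proof (induction K)
    case 0
    { case 1 show ?case by (simp add: g_def)
    next case 2 show ?case by (simp add: g_def L2_norm_def) }
  next
    case (Suc K)
    let ?d = "\<lambda>x. complex_of_real (cmod (t (Suc K) x - t K x))"
    have d: "?d \<in> L2 M"
      by (rule L2_bound[OF L2_diff[OF tL tL], of _ 1]) auto
    have dn: "L2_norm M ?d = L2_norm M (\<lambda>x. t (Suc K) x - t K x)" by (simp add: L2_norm_def)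
    have e: "(\<lambda>x. complex_of_real (g (Suc K) x)) = (\<lambda>x. complex_of_real (g K x) + ?d x)"
      by (simp add: g_def)
    { case 1 show ?case unfolding e by (rule L2_add[OF Suc(1) d])
    next case 2 show ?case unfolding e
        using L2_norm_triangle[OF Suc(1) d] Suc(2) step[of K] dn by simp }
  qed
  have gb: "(\<integral>\<^sup>+x. ennreal ((g K x)\<^sup>2) \<partial>M) \<le> 4" for K
  proof -
    have "(\<Sum>k<K. (1/2)^k :: real) = 2 - 2 * (1/2)^K" by (simp add: sum_gp_strict)
    also have "\<dots> \<le> 2" by simp
    finally have n: "L2_norm M (\<lambda>x. complex_of_real (g K x)) \<le> 2" using gn[of K] by linarith
    have "(\<integral>\<^sup>+x. ennreal ((g K x)\<^sup>2) \<partial>M) = ennreal ((L2_norm M (\<lambda>x. complex_of_real (g K x)))\<^sup>2)"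
      unfolding L2_norm_sq using nn_integral_eq_integral[OF L2_integrable[OF gL[of K]]] by simp
    also have "\<dots> \<le> ennreal (2\<^sup>2)" using n by (intro ennreal_leI power_mono) auto
    finally show ?thesis by simp
  qed
  have mono: "incseq (\<lambda>K x. ennreal ((g K x)\<^sup>2))"
    by (intro incseq_SucI le_funI ennreal_leI power_mono g_nn) (simp add: g_def)
  have sup: "(\<integral>\<^sup>+x. (SUP K. ennreal ((g K x)\<^sup>2)) \<partial>M) \<le> 4"
    by (subst nn_integral_monotone_convergence_SUP[OF mono]) (auto intro: SUP_least gb)
  have "AE x in M. (SUP K. ennreal ((g K x)\<^sup>2)) \<noteq> \<infinity>"
    using sup by (intro nn_integral_PInf_AE) (auto simp: top_unique)
  then have sm: "AE x in M. summable (\<lambda>k. cmod (t (Suc k) x - t k x))"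
  proof eventually_elim
    case (elim x)
    then obtain C where C: "C \<ge> 0" "(SUP K. ennreal ((g K x)\<^sup>2)) = ennreal C"
      by (cases "SUP K. ennreal ((g K x)\<^sup>2)") auto
    have "(g K x)\<^sup>2 \<le> C" for K
    proof -
      have "ennreal ((g K x)\<^sup>2) \<le> ennreal C" unfolding C(2)[symmetric] by (rule SUP_upper) simp
      then show ?thesis using C(1) by (simp add: ennreal_le_iff)
    qed
    then have "g K x \<le> sqrt C" for K by (rule real_le_rsqrt)
    then show ?case unfolding g_def by (intro summableI_nonneg_bounded) auto
  qed
  define G where "G x = (\<Sum>k. cmod (t (Suc k) x - t k x))" for x
  have [measurable]: "G \<in> borel_measurable M" unfolding G_def by measurable
  have G: "AE x in M. (\<forall>K. g K x \<le> G x) \<and> (\<lambda>K. g K x) \<longlonglongrightarrow> G x"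
    using sm
  proof eventually_elim
    case (elim x)
    show ?case unfolding g_def G_def
      using sum_le_suminf[OF elim] summable_LIMSEQ[OF elim] by auto
  qed
  have GL: "(\<lambda>x. complex_of_real (G x)) \<in> L2 M"
  proof -
    have "(\<integral>\<^sup>+x. ennreal ((G x)\<^sup>2) \<partial>M) \<le> (\<integral>\<^sup>+x. (SUP K. ennreal ((g K x)\<^sup>2)) \<partial>M)"
    proof (rule nn_integral_mono_AE, use G in eventually_elim)
      case (elim x)
      have "(\<lambda>K. ennreal ((g K x)\<^sup>2)) \<longlonglongrightarrow> ennreal ((G x)\<^sup>2)"
        using elim by (intro tendsto_ennrealI tendsto_power) auto
      then show ?case by (rule LIMSEQ_le_const2) (intro exI allI impI SUP_upper, simp)
    qed
    also note sup
    finally have "(\<integral>\<^sup>+x. ennreal ((G x)\<^sup>2) \<partial>M) < \<infinity>"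
      by (rule le_less_trans) simp
    then show ?thesis by (simp add: L2_def integrable_iff_bounded)
  qed
  define f where "f x = lim (\<lambda>k. t k x)" for x
  have [measurable]: "f \<in> borel_measurable M" unfolding f_def by measurable
  have lim: "AE x in M. (\<lambda>k. t k x) \<longlonglongrightarrow> f x"
    using sm
  proof eventually_elim
    case (elim x)
    then have "summable (\<lambda>k. t (Suc k) x - t k x)" by (rule summable_norm_cancel)
    then have "convergent (\<lambda>n. \<Sum>k<n. t (Suc k) x - t k x)" by (simp add: summable_iff_convergent)
    then have "convergent (\<lambda>n. t n x - t 0 x)"
      unfolding sum_lessThan_telescope[of "\<lambda>k. t k x"] .
    then have "convergent (\<lambda>n. (t n x - t 0 x) + t 0 x)" by (intro convergent_add convergent_const)
    then show ?case by (simp add: f_def convergent_LIMSEQ_iff)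
  qed
  let ?dom = "\<lambda>x. complex_of_real (cmod (t 0 x)) + complex_of_real (G x)"
  have dom: "?dom \<in> L2 M"
    by (intro L2_add GL L2_bound[OF tL[of 0], of _ 1]) auto
  have bd: "AE x in M. cmod (t n x) \<le> cmod (?dom x)" for n
    using G
  proof eventually_elim
    case (elim x)
    have "t n x = t 0 x + (\<Sum>k<n. t (Suc k) x - t k x)" by (simp add: sum_lessThan_telescope[of "\<lambda>k. t k x"])
    then have "cmod (t n x) \<le> cmod (t 0 x) + cmod (\<Sum>k<n. t (Suc k) x - t k x)"
      by (metis norm_triangle_ineq)
    also have "\<dots> \<le> cmod (t 0 x) + g n x" unfolding g_def by (intro add_left_mono norm_sum)
    also have "\<dots> \<le> cmod (t 0 x) + G x" using elim by simp
    also have "\<dots> \<le> cmod (?dom x)"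
      by (metis abs_ge_self norm_of_real of_real_add)
    finally show ?case .
  qed
  have fL: "f \<in> L2 M" and conv: "(\<lambda>k. L2_norm M (\<lambda>x. f x - t k x)) \<longlonglongrightarrow> 0"
    using L2_dominated_convergence[OF dom _ _ lim bd] by auto
  have "(\<lambda>n. L2_norm M (\<lambda>x. s n x - f x)) \<longlonglongrightarrow> 0"
  proof (rule LIMSEQ_I)
    fix \<epsilon> :: real assume \<epsilon>: "\<epsilon> > 0"
    obtain N where N: "\<forall>m\<ge>N. \<forall>n\<ge>N. L2_norm M (\<lambda>x. s m x - s n x) < \<epsilon>/2"
      using Cauchy[of "\<epsilon>/2"] \<epsilon> by auto
    obtain K where K: "\<forall>k\<ge>K. L2_norm M (\<lambda>x. f x - t k x) < \<epsilon>/2"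
      using LIMSEQ_D[OF conv, of "\<epsilon>/2"] \<epsilon> by auto
    define k where "k = max K N"
    have "k \<le> r k" using r_Suc by (intro strict_mono_imp_increasing) (simp add: strict_mono_Suc_iff)
    then have k: "N \<le> r k" "K \<le> k" by (auto simp: k_def)
    show "\<exists>no. \<forall>n\<ge>no. norm (L2_norm M (\<lambda>x. s n x - f x) - 0) < \<epsilon>"
    proof (intro exI allI impI)
      fix n assume n: "n \<ge> N"
      have "L2_norm M (\<lambda>x. s n x - f x) \<le> L2_norm M (\<lambda>x. s n x - t k x) + L2_norm M (\<lambda>x. t k x - f x)"
        by (intro L2_norm_triangle_diff s tL fL)
      also have "\<dots> < \<epsilon>/2 + \<epsilon>/2"
        using N n k K by (intro add_strict_mono) (auto simp: t_def L2_norm_minus[of M "s (r k)" f])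
      finally show "norm (L2_norm M (\<lambda>x. s n x - f x) - 0) < \<epsilon>" by simp
    qed
  qed
  with fL show ?thesis by blast
qed

section \<open>Operators with a complete system of orthogonal eigenvectors\<close>

abbreviation lincomb :: "('x \<Rightarrow> complex) set \<Rightarrow> (('x \<Rightarrow> complex) \<Rightarrow> complex) \<Rightarrow> 'x \<Rightarrow> complex" where
  "lincomb S c \<equiv> (\<lambda>x. \<Sum>b\<in>S. c b * b x)"

lemma lincomb_in_span: "finite S \<Longrightarrow> S \<subseteq> B \<Longrightarrow> lincomb S c \<in> complex_span B"
  unfolding complex_span_def by blast

lemma complex_span_cases:
  assumes "u \<in> complex_span B"
  obtains S c where "finite S" "S \<subseteq> B" "u = lincomb S c"
  using assms unfolding complex_span_def by blast

lemma complex_span_superset: "b \<in> B \<Longrightarrow> b \<in> complex_span B"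
  using lincomb_in_span[of "{b}" B "\<lambda>_. 1"] by simp

lemma lincomb_extend:
  assumes "finite S'" "S \<subseteq> S'"
  shows "lincomb S c = lincomb S' (\<lambda>b. if b \<in> S then c b else 0)"
  using assms by (intro ext sum.mono_neutral_cong_left) auto

lemma lincomb_combine:
  assumes "finite S" "finite S'"
  shows "(\<lambda>x. z * lincomb S c x + lincomb S' c' x)
    = lincomb (S \<union> S') (\<lambda>b. z * (if b \<in> S then c b else 0) + (if b \<in> S' then c' b else 0))"
proof
  fix x
  have 1: "lincomb S c x = lincomb (S \<union> S') (\<lambda>b. if b \<in> S then c b else 0) x"
    by (rule fun_cong[OF lincomb_extend]) (use assms in auto)
  have 2: "lincomb S' c' x = lincomb (S \<union> S') (\<lambda>b. if b \<in> S' then c' b else 0) x"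
    by (rule fun_cong[OF lincomb_extend]) (use assms in auto)
  show "z * lincomb S c x + lincomb S' c' x = lincomb (S \<union> S') (\<lambda>b. z * (if b \<in> S then c b else 0) + (if b \<in> S' then c' b else 0)) x"
    unfolding 1 2 by (simp only: sum_distrib_left sum.distrib[symmetric] distrib_right mult.assoc)
qed

lemma complex_span_combine:
  assumes "u \<in> complex_span B" "v \<in> complex_span B"
  shows "(\<lambda>x. z * u x + v x) \<in> complex_span B"
proof -
  obtain S c S' c' where "finite S" "S \<subseteq> B" "u = lincomb S c" "finite S'" "S' \<subseteq> B" "v = lincomb S' c'"
    using assms by (auto elim!: complex_span_cases)
  then show ?thesis
    by (simp only: lincomb_combine lincomb_in_span finite_Un Un_subset_iff)
qed

lemma complex_span_add:
  "u \<in> complex_span B \<Longrightarrow> v \<in> complex_span B \<Longrightarrow> (\<lambda>x. u x + v x) \<in> complex_span B"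
  using complex_span_combine[of u B v 1] by simp

lemma complex_span_zero: "(\<lambda>x. 0) \<in> complex_span B"
  using lincomb_in_span[of "{}" B] by simp

lemma complex_span_cmult: "u \<in> complex_span B \<Longrightarrow> (\<lambda>x. z * u x) \<in> complex_span B"
  using complex_span_combine[of u B "\<lambda>x. 0" z] complex_span_zero[of B] by simp

lemma complex_span_sum:
  "(\<And>i. i \<in> I \<Longrightarrow> u i \<in> complex_span B) \<Longrightarrow> (\<lambda>x. \<Sum>i\<in>I. u i x) \<in> complex_span B"
  by (induction I rule: infinite_finite_induct) (auto intro: complex_span_add complex_span_zero)

text \<open>A map \<open>T\<close> on functions that acts on the span of a complete system \<open>B\<close> by multiplying each \<open>b\<close> by a real
number \<open>e b\<close>. Members of \<open>B\<close> may be null functions, may coincide almost everywhere, and need not be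
orthogonal within one eigenspace: this is what a generating set indexed by all harmonic polynomials
provides, and it avoids the choice of a basis. The last condition says that the numbers \<open>e b\<close> accumulate
nowhere.\<close>

locale L2_eigensystem =
  fixes M :: "'x measure" and B :: "('x \<Rightarrow> complex) set"
    and T :: "('x \<Rightarrow> complex) \<Rightarrow> 'x \<Rightarrow> complex" and e :: "('x \<Rightarrow> complex) \<Rightarrow> real"
  assumes B_L2: "b \<in> B \<Longrightarrow> b \<in> L2 M"
    and T_measurable: "u \<in> complex_span B \<Longrightarrow> T u \<in> borel_measurable M"
    and T_lincomb: "finite S \<Longrightarrow> S \<subseteq> B \<Longrightarrow>
      AE x in M. T (lincomb S c) x = lincomb S (\<lambda>b. c b * complex_of_real (e b)) x"
    and orthogonal: "b \<in> B \<Longrightarrow> b' \<in> B \<Longrightarrow> e b \<noteq> e b' \<Longrightarrow> L2_inner M b b' = 0"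
    and dense: "L2_dense M (complex_span B)"
    and gap: "\<exists>\<delta>>0. \<forall>b\<in>B. complex_of_real (e b) \<noteq> z \<longrightarrow> \<delta> \<le> cmod (complex_of_real (e b) - z)"
begin

definition A :: "'x L2_graph" where "A = op_on M (complex_span B) T"

lemma lincomb_L2: "S \<subseteq> B \<Longrightarrow> lincomb S c \<in> L2 M"
  by (intro L2_sum L2_cmult B_L2) auto

lemma span_L2: "complex_span B \<subseteq> L2 M"
  by (auto elim!: complex_span_cases intro: lincomb_L2)

lemma T_L2: "u \<in> complex_span B \<Longrightarrow> T u \<in> L2 M"
proof (erule complex_span_cases)
  fix S c assume S: "finite S" "S \<subseteq> B" "u = lincomb S c"
  show "T u \<in> L2 M" unfolding S(3)
    by (rule L2_cong_AE[OF lincomb_L2 T_measurable T_lincomb])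
      (simp_all only: S lincomb_in_span)
qed

lemma A_L2: "(f, g) \<in> A \<Longrightarrow> f \<in> L2 M \<and> g \<in> L2 M"
  by (auto simp: A_def op_on_def)

lemma lincomb_in_A:
  assumes "finite S" "S \<subseteq> B"
  shows "(lincomb S c, lincomb S (\<lambda>b. c b * complex_of_real (e b))) \<in> A"
proof -
  have "AE x in M. lincomb S (\<lambda>b. c b * complex_of_real (e b)) x = T (lincomb S c) x"
    using T_lincomb[OF assms, of c] by eventually_elim simp
  then have "\<exists>u\<in>complex_span B. (AE x in M. lincomb S c x = u x) \<and>
      (AE x in M. lincomb S (\<lambda>b. c b * complex_of_real (e b)) x = T u x)"
    using lincomb_in_span[OF assms] by (intro bexI[of _ "lincomb S c"] conjI) auto
  then show ?thesis
    by (simp add: A_def op_on_def lincomb_L2 assms)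
qed

lemma A_cases:
  assumes "(f, g) \<in> A"
  obtains S c where "finite S" "S \<subseteq> B" "AE x in M. f x = lincomb S c x"
    "AE x in M. g x = lincomb S (\<lambda>b. c b * complex_of_real (e b)) x"
proof -
  obtain u where u: "u \<in> complex_span B" "AE x in M. f x = u x" "AE x in M. g x = T u x"
    using assms by (auto simp: A_def op_on_def)
  obtain S c where S: "finite S" "S \<subseteq> B" "u = lincomb S c" using complex_span_cases[OF u(1)] .
  have "AE x in M. g x = lincomb S (\<lambda>b. c b * complex_of_real (e b)) x"
    using u(3) T_lincomb[OF S(1,2), of c] unfolding S(3) by eventually_elim simp
  then show thesis using that S u(2) by blast
qed

lemma A_saturated:
  assumes "(f, g) \<in> A" "f' \<in> L2 M" "g' \<in> L2 M" "AE x in M. f' x = f x" "AE x in M. g' x = g x"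
  shows "(f', g') \<in> A"
proof -
  obtain u where u: "u \<in> complex_span B" "AE x in M. f x = u x" "AE x in M. g x = T u x"
    using assms by (auto simp: A_def op_on_def)
  have "AE x in M. f' x = u x" using u(2) assms(4) by eventually_elim simp
  moreover have "AE x in M. g' x = T u x" using u(3) assms(5) by eventually_elim simp
  ultimately show ?thesis using assms(2,3) u(1) by (auto simp: A_def op_on_def)
qed

lemma A_combine:
  assumes "(f, g) \<in> A" "(f', g') \<in> A"
  shows "(\<lambda>x. z * f x + f' x, \<lambda>x. z * g x + g' x) \<in> A"
proof -
  obtain S c where S: "finite S" "S \<subseteq> B" "AE x in M. f x = lincomb S c x"
    "AE x in M. g x = lincomb S (\<lambda>b. c b * complex_of_real (e b)) x" by (rule A_cases[OF assms(1)])
  obtain S' c' where S': "finite S'" "S' \<subseteq> B" "AE x in M. f' x = lincomb S' c' x"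
    "AE x in M. g' x = lincomb S' (\<lambda>b. c' b * complex_of_real (e b)) x" by (rule A_cases[OF assms(2)])
  let ?c = "\<lambda>b. z * (if b \<in> S then c b else 0) + (if b \<in> S' then c' b else 0)"
  have fin: "finite (S \<union> S')" "S \<union> S' \<subseteq> B" using S S' by auto
  show ?thesis
  proof (rule A_saturated[OF lincomb_in_A[OF fin, of ?c]])
    show "AE x in M. z * f x + f' x = lincomb (S \<union> S') ?c x"
      using S(3) S'(3)
      by eventually_elim (simp only: fun_cong[OF lincomb_combine[OF S(1) S'(1), symmetric]])
    have eq: "lincomb (S \<union> S') (\<lambda>b. ?c b * complex_of_real (e b)) =
      (\<lambda>x. z * lincomb S (\<lambda>b. c b * complex_of_real (e b)) x + lincomb S' (\<lambda>b. c' b * complex_of_real (e b)) x)"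
      unfolding lincomb_combine[OF S(1) S'(1)]
      by (intro ext sum.cong HOL.refl arg_cong2[of _ _ _ _ "(*)"]) (auto simp: algebra_simps)
    show "AE x in M. z * g x + g' x = lincomb (S \<union> S') (\<lambda>b. ?c b * complex_of_real (e b)) x"
      using S(4) S'(4) by eventually_elim (simp only: fun_cong[OF eq])
  qed (use assms[THEN A_L2] in \<open>auto intro: L2_add L2_cmult\<close>)
qed

text \<open>Expansion into a double sum, the form in which orthogonality between different eigenvalues is
used: in every surviving term the two eigenvalues are equal.\<close>

lemma inner_lincomb:
  assumes "S \<subseteq> B" "S' \<subseteq> B"
  shows "L2_inner M (lincomb S c) (lincomb S' d) = (\<Sum>b\<in>S. \<Sum>b'\<in>S'. c b * cnj (d b') * L2_inner M b b')"
proof -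
  have "L2_inner M (lincomb S c) (lincomb S' d) = (\<Sum>b\<in>S. L2_inner M (\<lambda>x. c b * b x) (lincomb S' d))"
    using assms by (intro L2_inner_sum_left lincomb_L2 L2_cmult B_L2) auto
  also have "\<dots> = (\<Sum>b\<in>S. \<Sum>b'\<in>S'. L2_inner M (\<lambda>x. c b * b x) (\<lambda>x. d b' * b' x))"
    using assms by (intro sum.cong HOL.refl L2_inner_sum_right L2_cmult B_L2) auto
  also have "\<dots> = (\<Sum>b\<in>S. \<Sum>b'\<in>S'. c b * cnj (d b') * L2_inner M b b')"
    by (simp add: L2_inner_cmult_left L2_inner_cmult_right mult.assoc)
  finally show ?thesis .
qed

lemma A_symmetric:
  assumes "(f, f') \<in> A" "(g, g') \<in> A"
  shows "L2_inner M f' g = L2_inner M f g'"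
proof -
  obtain S c where S: "finite S" "S \<subseteq> B" "AE x in M. f x = lincomb S c x"
    "AE x in M. f' x = lincomb S (\<lambda>b. c b * complex_of_real (e b)) x" by (rule A_cases[OF assms(1)])
  obtain S' d where S': "finite S'" "S' \<subseteq> B" "AE x in M. g x = lincomb S' d x"
    "AE x in M. g' x = lincomb S' (\<lambda>b. d b * complex_of_real (e b)) x" by (rule A_cases[OF assms(2)])
  have "L2_inner M f' g = L2_inner M (lincomb S (\<lambda>b. c b * complex_of_real (e b))) (lincomb S' d)"
    using S S' assms by (intro L2_inner_cong lincomb_L2) (auto dest: A_L2)
  also have "\<dots> = L2_inner M (lincomb S c) (lincomb S' (\<lambda>b. d b * complex_of_real (e b)))"
    unfolding inner_lincomb[OF S(2) S'(2)]
  proof (intro sum.cong HOL.refl)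
    fix b b' assume "b \<in> S" "b' \<in> S'"
    then have "e b = e b' \<or> L2_inner M b b' = 0" using orthogonal S S' by blast
    then show "c b * complex_of_real (e b) * cnj (d b') * L2_inner M b b'
      = c b * cnj (d b' * complex_of_real (e b')) * L2_inner M b b'" by auto
  qed
  also have "\<dots> = L2_inner M f g'"
    using S S' assms by (intro L2_inner_cong[symmetric] lincomb_L2) (auto dest: A_L2)
  finally show ?thesis .
qed

lemma span_in_Domain: "u \<in> complex_span B \<Longrightarrow> u \<in> Domain A"
proof (erule complex_span_cases)
  fix S c assume S: "finite S" "S \<subseteq> B" "u = lincomb S c"
  show "u \<in> Domain A" unfolding S(3) using lincomb_in_A[OF S(1,2)] by (rule DomainI)
qed

text \<open>If \<open>f\<close> vanishes then so do all pairings \<open>\<langle>g, b\<rangle> = \<langle>f, b'\<rangle>\<close>, and \<open>g\<close> is orthogonal to a dense set. A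
symmetric relation with dense domain is therefore the graph of a function.\<close>

lemma symmetric_single_valued:
  assumes "\<And>b. b \<in> B \<Longrightarrow> \<exists>b'\<in>L2 M. L2_inner M g b = L2_inner M f b'"
    and "f \<in> L2 M" "g \<in> L2 M" "AE x in M. f x = 0"
  shows "AE x in M. g x = 0"
proof (rule L2_dense_orthogonal[OF dense span_L2 assms(3)])
  fix w assume "w \<in> complex_span B"
  then obtain S c where S: "finite S" "S \<subseteq> B" "w = lincomb S c" by (rule complex_span_cases)
  have "L2_inner M g b = 0" if b: "b \<in> B" for b
  proof -
    obtain b' where b': "b' \<in> L2 M" "L2_inner M g b = L2_inner M f b'" using assms(1)[OF b] by blast
    have "L2_inner M f b' = L2_inner M (\<lambda>x. 0) b'"
      using assms(2,4) b' by (intro L2_inner_cong) auto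
    also have "\<dots> = 0" by (simp add: L2_inner_def)
    finally show ?thesis using b' by simp
  qed
  then have *: "L2_inner M b g = 0" if "b \<in> B" for b
    using that L2_inner_cnj[of M b g] by simp
  have "L2_inner M w g = (\<Sum>b\<in>S. L2_inner M (\<lambda>x. c b * b x) g)"
    unfolding S(3) using S(2) by (intro L2_inner_sum_left L2_cmult B_L2 assms(3)) auto
  also have "\<dots> = 0" using S(2) by (intro sum.neutral ballI) (auto simp: L2_inner_cmult_left *)
  finally show "L2_inner M w g = 0" .
qed

text \<open>By orthogonality both sides are sums over eigenspaces, and on each eigenspace containing a non-null vector \<open>A - z\<close>
multiplies by a number of modulus at least \<open>\<delta>\<close>. Since \<open>B\<close> need not be orthogonal within an eigenspace, the
comparison is made without decomposing into eigenspaces: \<open>\<bar>e b - z\<bar>\<^sup>2 = \<delta>\<^sup>2 + (r (e b))\<^sup>2\<close> with a real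
\<open>r\<close>, so that the squared norm on the right is \<open>\<delta>\<^sup>2\<close> times the one on the left plus the squared norm of
another linear combination.\<close>

lemma resolvent_bound:
  assumes "finite S" "S \<subseteq> B" "\<delta> > 0"
    and \<delta>: "\<And>b. b \<in> B \<Longrightarrow> complex_of_real (e b) \<noteq> z \<Longrightarrow> \<delta> \<le> cmod (complex_of_real (e b) - z)"
    and null: "\<And>b. b \<in> B \<Longrightarrow> complex_of_real (e b) = z \<Longrightarrow> AE x in M. b x = 0"
  shows "\<delta> * L2_norm M (lincomb S c) \<le> L2_norm M (lincomb S (\<lambda>b. c b * (complex_of_real (e b) - z)))"
proof -
  \<comment> \<open>The maximum only guards the root at eigenvalues equal to \<open>z\<close>, whose vectors are null.\<close>
  define r where "r t = sqrt (max 0 ((cmod (complex_of_real t - z))\<^sup>2 - \<delta>\<^sup>2))" for t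
  have trm: "(complex_of_real (e b) - z) * cnj (complex_of_real (e b') - z) * L2_inner M b b'
     = complex_of_real (\<delta>\<^sup>2) * L2_inner M b b' + complex_of_real (r (e b) * r (e b')) * L2_inner M b b'"
    if "b \<in> S" "b' \<in> S" for b b'
  proof -
    have b: "b \<in> B" "b' \<in> B" using that assms by auto
    consider "e b \<noteq> e b'" | "e b = e b'" "complex_of_real (e b) = z" | "e b = e b'" "complex_of_real (e b) \<noteq> z"
      by blast
    then show ?thesis
    proof cases
      case 1 then show ?thesis using orthogonal[OF b] by simp
    next
      case 2
      have "L2_inner M b b' = L2_inner M (\<lambda>x. 0) b'"
        using null[OF b(1) 2(2)] B_L2 b by (intro L2_inner_cong) auto
      then have "L2_inner M b b' = 0" by (simp add: L2_inner_def)
      then show ?thesis by simp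
    next
      case 3
      have "\<delta>\<^sup>2 \<le> (cmod (complex_of_real (e b) - z))\<^sup>2"
        using \<delta>[OF b(1) 3(2)] assms(3) by (intro power_mono) auto
      then have "r (e b) * r (e b') = (cmod (complex_of_real (e b) - z))\<^sup>2 - \<delta>\<^sup>2"
        using 3(1) by (simp add: r_def)
      then have "complex_of_real (\<delta>\<^sup>2) + complex_of_real (r (e b) * r (e b'))
          = complex_of_real ((cmod (complex_of_real (e b) - z))\<^sup>2)" by simp
      also have "\<dots> = (complex_of_real (e b) - z) * cnj (complex_of_real (e b') - z)"
        unfolding 3(1) by (rule complex_norm_square)
      finally show ?thesis by (simp only: distrib_right[symmetric])
    qed
  qed
  have "complex_of_real ((L2_norm M (lincomb S (\<lambda>b. c b * (complex_of_real (e b) - z))))\<^sup>2)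
     = (\<Sum>b\<in>S. \<Sum>b'\<in>S. c b * cnj (c b') *
          ((complex_of_real (e b) - z) * cnj (complex_of_real (e b') - z) * L2_inner M b b'))"
    unfolding L2_norm_inner inner_lincomb[OF assms(2,2)]
    by (intro sum.cong HOL.refl) (simp add: mult_ac)
  also have "\<dots> = (\<Sum>b\<in>S. \<Sum>b'\<in>S. c b * cnj (c b') *
      (complex_of_real (\<delta>\<^sup>2) * L2_inner M b b' + complex_of_real (r (e b) * r (e b')) * L2_inner M b b'))"
    by (intro sum.cong HOL.refl) (simp only: trm)
  also have "\<dots> = complex_of_real (\<delta>\<^sup>2) * (\<Sum>b\<in>S. \<Sum>b'\<in>S. c b * cnj (c b') * L2_inner M b b')
     + (\<Sum>b\<in>S. \<Sum>b'\<in>S. (c b * complex_of_real (r (e b))) * cnj (c b' * complex_of_real (r (e b'))) * L2_inner M b b')"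
    by (simp add: sum_distrib_left sum.distrib[symmetric] algebra_simps)
  also have "\<dots> = complex_of_real (\<delta>\<^sup>2 * (L2_norm M (lincomb S c))\<^sup>2
      + (L2_norm M (lincomb S (\<lambda>b. c b * complex_of_real (r (e b)))))\<^sup>2)"
    unfolding inner_lincomb[OF assms(2,2), symmetric] L2_norm_inner[symmetric] by simp
  finally have "(L2_norm M (lincomb S (\<lambda>b. c b * (complex_of_real (e b) - z))))\<^sup>2 = \<delta>\<^sup>2 * (L2_norm M (lincomb S c))\<^sup>2
      + (L2_norm M (lincomb S (\<lambda>b. c b * complex_of_real (r (e b)))))\<^sup>2"
    by (simp only: of_real_eq_iff)
  then have "(\<delta> * L2_norm M (lincomb S c))\<^sup>2 \<le> (L2_norm M (lincomb S (\<lambda>b. c b * (complex_of_real (e b) - z))))\<^sup>2"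
    by (simp add: power_mult_distrib)
  then show ?thesis by (rule power2_le_imp_le) simp
qed

text \<open>Density by approximating sequences of linear combinations, with the finite sets and coefficients kept
explicit so that the resolvent can be applied to them termwise.\<close>

lemma dense_sequence:
  assumes "f \<in> L2 M"
  obtains S c where "\<forall>n::nat. finite (S n)" "\<forall>n. S n \<subseteq> B"
    "(\<lambda>n. L2_norm M (\<lambda>x. lincomb (S n) (c n) x - f x)) \<longlonglongrightarrow> 0"
proof -
  have "\<forall>n. \<exists>p. finite (fst p) \<and> fst p \<subseteq> B \<and>
      L2_norm M (\<lambda>x. f x - lincomb (fst p) (snd p) x) < inverse (real (Suc n))"
  proof
    fix n
    have "inverse (real (Suc n)) > 0" by simp
    then obtain u where u: "u \<in> complex_span B" "L2_norm M (\<lambda>x. f x - u x) < inverse (real (Suc n))"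
      using dense assms unfolding L2_dense_def by blast
    obtain S c where "finite S" "S \<subseteq> B" "u = lincomb S c" by (rule complex_span_cases[OF u(1)])
    then show "\<exists>p. finite (fst p) \<and> fst p \<subseteq> B \<and>
      L2_norm M (\<lambda>x. f x - lincomb (fst p) (snd p) x) < inverse (real (Suc n))"
      using u(2) by (intro exI[of _ "(S, c)"]) simp
  qed
  from choice[OF this] obtain p where p: "\<forall>n. finite (fst (p n)) \<and> fst (p n) \<subseteq> B \<and>
      L2_norm M (\<lambda>x. f x - lincomb (fst (p n)) (snd (p n)) x) < inverse (real (Suc n))" ..
  define S where "S n = fst (p n)" for n
  define c where "c n = snd (p n)" for n
  have S: "\<forall>n. finite (S n)" "\<forall>n. S n \<subseteq> B"
    "\<And>n. L2_norm M (\<lambda>x. f x - lincomb (S n) (c n) x) < inverse (real (Suc n))"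
    using p by (auto simp: S_def c_def)
  have "(\<lambda>n. L2_norm M (\<lambda>x. lincomb (S n) (c n) x - f x)) \<longlonglongrightarrow> 0"
  proof (rule Lim_null_comparison[OF always_eventually LIMSEQ_inverse_real_of_nat], intro allI)
    show "norm (L2_norm M (\<lambda>x. lincomb (S n) (c n) x - f x)) \<le> inverse (real (Suc n))" for n
      using S(3)[of n] unfolding L2_norm_minus[of M f] by simp
  qed
  with S(1,2) show thesis by (rule that)
qed

abbreviation Abar :: "'x L2_graph" where "Abar \<equiv> op_closure M A"

lemma Abar_L2: "(f, g) \<in> Abar \<Longrightarrow> f \<in> L2 M \<and> g \<in> L2 M"
  by (auto simp: op_closure_def)

lemma Abar_cases:
  assumes "(f, g) \<in> Abar"
  obtains u v where "\<forall>n::nat. (u n, v n) \<in> A" "(\<lambda>n. L2_norm M (\<lambda>x. u n x - f x)) \<longlonglongrightarrow> 0"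
    "(\<lambda>n. L2_norm M (\<lambda>x. v n x - g x)) \<longlonglongrightarrow> 0"
  using assms unfolding op_closure_def mem_Collect_eq case_prod_conv by (elim conjE exE)

lemma AbarI:
  assumes "\<And>n::nat. (u n, v n) \<in> A" "(\<lambda>n. L2_norm M (\<lambda>x. u n x - f x)) \<longlonglongrightarrow> 0"
    "(\<lambda>n. L2_norm M (\<lambda>x. v n x - g x)) \<longlonglongrightarrow> 0" "f \<in> L2 M" "g \<in> L2 M"
  shows "(f, g) \<in> Abar"
proof -
  have "(\<forall>n. (u n, v n) \<in> A) \<and> (\<lambda>n. L2_norm M (\<lambda>x. u n x - f x)) \<longlonglongrightarrow> 0 \<and>
    (\<lambda>n. L2_norm M (\<lambda>x. v n x - g x)) \<longlonglongrightarrow> 0"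
    using assms(1-3) by simp
  then have "\<exists>u v. (\<forall>n::nat. (u n, v n) \<in> A) \<and> (\<lambda>n. L2_norm M (\<lambda>x. u n x - f x)) \<longlonglongrightarrow> 0 \<and>
    (\<lambda>n. L2_norm M (\<lambda>x. v n x - g x)) \<longlonglongrightarrow> 0"
    by (intro exI)
  then show ?thesis
    unfolding op_closure_def mem_Collect_eq case_prod_conv mem_Sigma_iff
    using assms(4,5) by (intro conjI)
qed

lemma A_in_Abar:
  assumes "(f, g) \<in> A"
  shows "(f, g) \<in> Abar"
proof -
  have "(\<lambda>n::nat. L2_norm M (\<lambda>x. f x - f x)) \<longlonglongrightarrow> 0" "(\<lambda>n::nat. L2_norm M (\<lambda>x. g x - g x)) \<longlonglongrightarrow> 0"
    by (simp_all add: L2_norm_def)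
  then show ?thesis
    using A_L2[OF assms] assms by (intro AbarI[where u = "\<lambda>_. f" and v = "\<lambda>_. g"]) blast+
qed

lemma Abar_inner_A:
  assumes ff': "(f, f') \<in> Abar" and gg': "(g, g') \<in> A"
  shows "L2_inner M f' g = L2_inner M f g'"
proof -
  obtain u v where uv': "\<forall>n::nat. (u n, v n) \<in> A" "(\<lambda>n. L2_norm M (\<lambda>x. u n x - f x)) \<longlonglongrightarrow> 0"
    "(\<lambda>n. L2_norm M (\<lambda>x. v n x - f' x)) \<longlonglongrightarrow> 0" by (rule Abar_cases[OF ff'])
  note uv = spec[OF uv'(1)] uv'(2,3)
  note L = A_L2[OF uv(1)] Abar_L2[OF ff'] A_L2[OF gg']
  have "(\<lambda>n. L2_inner M (v n) g) \<longlonglongrightarrow> L2_inner M f' g"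
    by (rule L2_inner_tendsto[OF _ _ _ uv(3)]) (simp_all add: L)
  moreover have "(\<lambda>n. L2_inner M (u n) g') \<longlonglongrightarrow> L2_inner M f g'"
    by (rule L2_inner_tendsto[OF _ _ _ uv(2)]) (simp_all add: L)
  ultimately show ?thesis
    unfolding A_symmetric[OF uv(1) gg'] by (rule LIMSEQ_unique)
qed

lemma Abar_symmetric:
  assumes ff': "(f, f') \<in> Abar" and gg': "(g, g') \<in> Abar"
  shows "L2_inner M g' f = L2_inner M g f'"
proof -
  obtain u v where uv': "\<forall>n::nat. (u n, v n) \<in> A" "(\<lambda>n. L2_norm M (\<lambda>x. u n x - g x)) \<longlonglongrightarrow> 0"
    "(\<lambda>n. L2_norm M (\<lambda>x. v n x - g' x)) \<longlonglongrightarrow> 0" by (rule Abar_cases[OF gg'])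
  note uv = spec[OF uv'(1)] uv'(2,3)
  note L = A_L2[OF uv(1)] Abar_L2[OF ff'] Abar_L2[OF gg']
  have v: "(\<lambda>n. L2_inner M (v n) f) \<longlonglongrightarrow> L2_inner M g' f"
    by (rule L2_inner_tendsto[OF _ _ _ uv(3)]) (simp_all add: L)
  have u: "(\<lambda>n. L2_inner M (u n) f') \<longlonglongrightarrow> L2_inner M g f'"
    by (rule L2_inner_tendsto[OF _ _ _ uv(2)]) (simp_all add: L)
  have eq: "L2_inner M (v n) f = L2_inner M (u n) f'" for n
    using Abar_inner_A[OF ff' uv(1)[of n]] L2_inner_cnj[of M "v n" f] L2_inner_cnj[of M "u n" f'] by simp
  show ?thesis by (rule LIMSEQ_unique[OF v u[folded eq]])
qed

end

context L2_eigensystem begin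

lemma eigenpair_in_A: "b \<in> B \<Longrightarrow> (b, \<lambda>x. complex_of_real (e b) * b x) \<in> A"
  using lincomb_in_A[of "{b}" "\<lambda>_. 1"] by simp

lemma Abar_single_valued:
  assumes "(f, g) \<in> Abar" "AE x in M. f x = 0"
  shows "AE x in M. g x = 0"
proof (rule symmetric_single_valued[of g f])
  fix b assume "b \<in> B"
  from eigenpair_in_A[OF this] show "\<exists>b'\<in>L2 M. L2_inner M g b = L2_inner M f b'"
    using Abar_inner_A[OF assms(1)] A_L2 by (intro bexI[of _ "\<lambda>x. complex_of_real (e b) * b x"]) auto
qed (use Abar_L2[OF assms(1)] assms(2) in auto)

lemma L2_tendsto_combine:
  assumes "\<And>n::nat. u n \<in> L2 M" "\<And>n. u' n \<in> L2 M" "f \<in> L2 M" "f' \<in> L2 M"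
    and lim: "(\<lambda>n. L2_norm M (\<lambda>x. u n x - f x)) \<longlonglongrightarrow> 0" "(\<lambda>n. L2_norm M (\<lambda>x. u' n x - f' x)) \<longlonglongrightarrow> 0"
  shows "(\<lambda>n. L2_norm M (\<lambda>x. (z * u n x + u' n x) - (z * f x + f' x))) \<longlonglongrightarrow> 0"
proof (rule Lim_null_comparison[OF always_eventually], intro allI)
  show "norm (L2_norm M (\<lambda>x. (z * u n x + u' n x) - (z * f x + f' x)))
      \<le> cmod z * L2_norm M (\<lambda>x. u n x - f x) + L2_norm M (\<lambda>x. u' n x - f' x)" for n
  proof -
    have "(\<lambda>x. (z * u n x + u' n x) - (z * f x + f' x)) = (\<lambda>x. z * (u n x - f x) + (u' n x - f' x))"
      by (simp add: algebra_simps)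
    then show ?thesis
      using L2_norm_triangle[OF L2_cmult[OF L2_diff[OF assms(1,3)], of z n] L2_diff[OF assms(2,4), of n]]
      by (simp add: L2_norm_cmult)
  qed
  show "(\<lambda>n. cmod z * L2_norm M (\<lambda>x. u n x - f x) + L2_norm M (\<lambda>x. u' n x - f' x)) \<longlonglongrightarrow> 0"
    using tendsto_add[OF tendsto_mult_left[OF lim(1), of "cmod z"] lim(2)] by simp
qed

lemma Abar_combine:
  assumes "(f, g) \<in> Abar" "(f', g') \<in> Abar"
  shows "(\<lambda>x. z * f x + f' x, \<lambda>x. z * g x + g' x) \<in> Abar"
proof -
  obtain u v where uv: "\<forall>n::nat. (u n, v n) \<in> A" "(\<lambda>n. L2_norm M (\<lambda>x. u n x - f x)) \<longlonglongrightarrow> 0"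
    "(\<lambda>n. L2_norm M (\<lambda>x. v n x - g x)) \<longlonglongrightarrow> 0" by (rule Abar_cases[OF assms(1)])
  obtain u' v' where uv': "\<forall>n::nat. (u' n, v' n) \<in> A" "(\<lambda>n. L2_norm M (\<lambda>x. u' n x - f' x)) \<longlonglongrightarrow> 0"
    "(\<lambda>n. L2_norm M (\<lambda>x. v' n x - g' x)) \<longlonglongrightarrow> 0" by (rule Abar_cases[OF assms(2)])
  note L = A_L2[OF spec[OF uv(1)]] A_L2[OF spec[OF uv'(1)]] assms[THEN Abar_L2]
  show ?thesis
  proof (rule AbarI)
    show "(\<lambda>x. z * u n x + u' n x, \<lambda>x. z * v n x + v' n x) \<in> A" for n
      using uv(1) uv'(1) by (intro A_combine) auto
    show "(\<lambda>n. L2_norm M (\<lambda>x. (z * u n x + u' n x) - (z * f x + f' x))) \<longlonglongrightarrow> 0"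
      by (rule L2_tendsto_combine[OF _ _ _ _ uv(2) uv'(2)]) (simp_all add: L)
    show "(\<lambda>n. L2_norm M (\<lambda>x. (z * v n x + v' n x) - (z * g x + g' x))) \<longlonglongrightarrow> 0"
      by (rule L2_tendsto_combine[OF _ _ _ _ uv(3) uv'(3)]) (simp_all add: L)
  qed (simp_all add: L L2_add L2_cmult)
qed

lemma Abar_saturated:
  assumes "(f, g) \<in> Abar" "f' \<in> L2 M" "g' \<in> L2 M" "AE x in M. f' x = f x" "AE x in M. g' x = g x"
  shows "(f', g') \<in> Abar"
proof -
  obtain u v where uv: "\<forall>n::nat. (u n, v n) \<in> A" "(\<lambda>n. L2_norm M (\<lambda>x. u n x - f x)) \<longlonglongrightarrow> 0"
    "(\<lambda>n. L2_norm M (\<lambda>x. v n x - g x)) \<longlonglongrightarrow> 0" by (rule Abar_cases[OF assms(1)])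
  note L = A_L2[OF spec[OF uv(1)]] Abar_L2[OF assms(1)]
  have m: "(\<lambda>x. h x - h' x) \<in> borel_measurable M" if "h \<in> L2 M" "h' \<in> L2 M" for h h'
    using L2_diff[OF that] by (simp add: L2_def)
  have 1: "L2_norm M (\<lambda>x. u n x - f' x) = L2_norm M (\<lambda>x. u n x - f x)" for n
  proof (rule L2_norm_cong)
    show "AE x in M. u n x - f' x = u n x - f x" using assms(4) by eventually_elim simp
  qed (simp_all add: m L assms)
  have 2: "L2_norm M (\<lambda>x. v n x - g' x) = L2_norm M (\<lambda>x. v n x - g x)" for n
  proof (rule L2_norm_cong)
    show "AE x in M. v n x - g' x = v n x - g x" using assms(5) by eventually_elim simp
  qed (simp_all add: m L assms)
  show ?thesis
    by (rule AbarI[of u v]) (simp_all only: 1 2 uv spec[OF uv(1)] assms)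
qed

lemma linear_operatorI:
  assumes "G \<subseteq> Abar" "(\<lambda>x. 0, \<lambda>x. 0) \<in> G"
    and comb: "\<And>c f g f' g'. (f, g) \<in> G \<Longrightarrow> (f', g') \<in> G \<Longrightarrow> (\<lambda>x. c * f x + f' x, \<lambda>x. c * g x + g' x) \<in> G"
    and sat: "\<And>f g f' g'. (f, g) \<in> G \<Longrightarrow> f' \<in> L2 M \<Longrightarrow> g' \<in> L2 M \<Longrightarrow> AE x in M. f' x = f x \<Longrightarrow>
      AE x in M. g' x = g x \<Longrightarrow> (f', g') \<in> G"
    and dom: "A \<subseteq> G"
  shows "densely_defined M G"
proof -
  have sv: "AE x in M. g x = g' x" if "(f, g) \<in> G" "(f', g') \<in> G" "AE x in M. f x = f' x" for f g f' g'
  proof -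
    have "(\<lambda>x. (-1) * f' x + f x, \<lambda>x. (-1) * g' x + g x) \<in> Abar"
      using comb[OF that(2,1)] assms(1) by blast
    moreover have "AE x in M. (-1) * f' x + f x = 0" using that(3) by eventually_elim simp
    ultimately have "AE x in M. (-1) * g' x + g x = 0" by (rule Abar_single_valued)
    then show ?thesis by eventually_elim simp
  qed
  have "L2_dense M (Domain G)"
    unfolding L2_dense_def
  proof (intro ballI allI impI)
    fix f and \<epsilon> :: real assume "f \<in> L2 M" "\<epsilon> > 0"
    then obtain u where "u \<in> complex_span B" "L2_norm M (\<lambda>x. f x - u x) < \<epsilon>"
      using dense unfolding L2_dense_def by blast
    then show "\<exists>u\<in>Domain G. L2_norm M (\<lambda>x. f x - u x) < \<epsilon>"
      using span_in_Domain dom by blast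
  qed
  moreover have "G \<subseteq> L2 M \<times> L2 M" using assms(1) Abar_L2 by auto
  ultimately show ?thesis
    unfolding densely_defined_def L2_operator_def
    using assms(2) sv
    by (intro conjI) (blast intro: comb sat)+
qed

lemma zero_in_A: "(\<lambda>x. 0, \<lambda>x. 0) \<in> A"
  using lincomb_in_A[of "{}"] by simp

lemma A_subset_Abar: "A \<subseteq> Abar"
  using A_in_Abar by auto

lemma densely_defined_A: "densely_defined M A"
  by (rule linear_operatorI[OF A_subset_Abar zero_in_A A_combine A_saturated order.refl])

lemma densely_defined_Abar: "densely_defined M Abar"
  by (rule linear_operatorI[OF order.refl _ Abar_combine Abar_saturated A_subset_Abar])
    (rule A_in_Abar[OF zero_in_A])

lemma op_symmetric_A: "op_symmetric M A"
  unfolding op_symmetric_def using densely_defined_A A_symmetric by auto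

text \<open>Division by \<open>e b - z\<close> loses the terms with \<open>e b = z\<close>, since the quotient is then \<open>0\<close>; those \<open>b\<close> are null
functions when \<open>z\<close> is not an eigenvalue.\<close>

lemma resolvent_lincomb:
  assumes "finite S" "S \<subseteq> B"
    and null: "\<And>b. b \<in> B \<Longrightarrow> complex_of_real (e b) = z \<Longrightarrow> AE x in M. b x = 0"
  shows "AE x in M. lincomb S (\<lambda>b. c b / (complex_of_real (e b) - z) * (complex_of_real (e b) - z)) x = lincomb S c x"
proof -
  have "AE x in M. \<forall>b\<in>S. complex_of_real (e b) = z \<longrightarrow> b x = 0"
    using assms by (intro AE_finite_allI) auto
  then show ?thesis
    by eventually_elim (rule sum.cong, auto)
qed

text \<open>The basic criterion for self-adjointness. Approximate \<open>g = f' - \<i> f\<close> by linear combinations, which lie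
in the range of \<open>A - \<i>\<close>: \<open>A (u n) - \<i> u n \<longlonglongrightarrow> g\<close>. Every \<open>w\<close> in the span is \<open>(A + \<i>) h\<close> with
\<open>\<parallel>h\<parallel> \<le> \<parallel>w\<parallel>\<close>, and since \<open>f\<close> and \<open>u n\<close> both satisfy the adjoint relation,
\<open>\<langle>w, f - u n\<rangle> = \<langle>h, g - (A - \<i>) (u n)\<rangle>\<close>. Hence \<open>\<parallel>f - u n\<parallel>\<close> is bounded by the error for \<open>g\<close>, so
\<open>u n\<close> tends to \<open>f\<close> and \<open>A (u n)\<close> tends to \<open>f'\<close>.\<close>

lemma adjoint_subset_Abar:
  assumes "f \<in> L2 M" "f' \<in> L2 M"
    and adj: "\<And>g g'. (g, g') \<in> A \<Longrightarrow> L2_inner M g' f = L2_inner M g f'"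
  shows "(f, f') \<in> Abar"
proof -
  \<comment> \<open>The element that \<open>(f, f')\<close> should have under \<open>A - \<i>\<close>.\<close>
  define g where "g x = f' x - \<i> * f x" for x
  have gL: "g \<in> L2 M" unfolding g_def by (intro L2_diff L2_cmult assms)
  obtain S c where S': "\<forall>n::nat. finite (S n)" "\<forall>n. S n \<subseteq> B"
    and lim: "(\<lambda>n. L2_norm M (\<lambda>x. lincomb (S n) (c n) x - g x)) \<longlonglongrightarrow> 0"
    by (rule dense_sequence[OF gL])
  note S = spec[OF S'(1)] spec[OF S'(2)]
  define d where "d n b = c n b / (complex_of_real (e b) - \<i>)" for n b
  define u where "u n = lincomb (S n) (d n)" for n
  define v where "v n = lincomb (S n) (\<lambda>b. d n b * complex_of_real (e b))" for n
  have nz: "complex_of_real t \<noteq> \<i>" "complex_of_real t \<noteq> - \<i>" for t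
    by (auto simp: complex_eq_iff)
  have uvA: "(u n, v n) \<in> A" for n unfolding u_def v_def by (rule lincomb_in_A[OF S])
  then have uL: "u n \<in> L2 M" "v n \<in> L2 M" for n using A_L2 by auto
  have w: "v n x - \<i> * u n x = lincomb (S n) (c n) x" for n x
    unfolding v_def u_def sum_distrib_left sum_subtractf[symmetric]
  proof (rule sum.cong)
    fix b
    have "d n b * complex_of_real (e b) * b x - \<i> * (d n b * b x) = d n b * (complex_of_real (e b) - \<i>) * b x"
      by (simp add: algebra_simps)
    also have "d n b * (complex_of_real (e b) - \<i>) = c n b" using nz by (simp add: d_def)
    finally show "d n b * complex_of_real (e b) * b x - \<i> * (d n b * b x) = c n b * b x" .
  qed simp
  have close: "L2_norm M (\<lambda>x. f x - u n x) \<le> L2_norm M (\<lambda>x. lincomb (S n) (c n) x - g x)" for n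
  proof (rule L2_dense_bound[OF dense span_L2 L2_diff[OF assms(1) uL(1)]])
    fix w assume "w \<in> complex_span B"
    then obtain S' c' where S': "finite S'" "S' \<subseteq> B" "w = lincomb S' c'" by (rule complex_span_cases)
    \<comment> \<open>\<open>h = (A + \<i>)\<^sup>-\<^sup>1 w\<close>, computed termwise.\<close>
    define d' where "d' b = c' b / (complex_of_real (e b) + \<i>)" for b
    define h where "h = lincomb S' d'"
    define h' where "h' = lincomb S' (\<lambda>b. d' b * complex_of_real (e b))"
    have hA: "(h, h') \<in> A" unfolding h_def h'_def by (rule lincomb_in_A[OF S'(1,2)])
    then have hL: "h \<in> L2 M" "h' \<in> L2 M" using A_L2 by auto
    have d': "d' b * (complex_of_real (e b) - (- \<i>)) = c' b" for b
    proof -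
      have "complex_of_real (e b) + \<i> \<noteq> 0" using nz(2)[of "e b"] by (auto simp: add_eq_0_iff2)
      then show ?thesis by (simp add: d'_def)
    qed
    have wh: "w = (\<lambda>x. \<i> * h x + h' x)"
    proof
      fix x
      have "w x = (\<Sum>b\<in>S'. \<i> * (d' b * b x) + d' b * complex_of_real (e b) * b x)"
        unfolding S'(3) by (intro sum.cong) (auto simp: d'[symmetric] algebra_simps)
      then show "w x = \<i> * h x + h' x"
        by (simp add: h_def h'_def sum.distrib sum_distrib_left)
    qed
    have "1 * L2_norm M (lincomb S' d') \<le> L2_norm M (lincomb S' (\<lambda>b. d' b * (complex_of_real (e b) - (- \<i>))))"
    proof (rule resolvent_bound[OF S'(1,2)])
      show "1 \<le> cmod (complex_of_real (e b) - - \<i>)" for b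
        using abs_Im_le_cmod[of "complex_of_real (e b) + \<i>"] by simp
      show "AE x in M. b x = 0" if "complex_of_real (e b) = - \<i>" for b using nz(2) that by blast
    qed simp
    then have hn: "L2_norm M h \<le> L2_norm M w" unfolding h_def S'(3) d' by simp
    let ?r = "\<lambda>x. g x - lincomb (S n) (c n) x"
    have rL: "?r \<in> L2 M" by (intro L2_diff gL lincomb_L2 S)
    have req: "?r = (\<lambda>x. (f' x - \<i> * f x) - (v n x - \<i> * u n x))" unfolding w g_def ..
    have "L2_inner M w (\<lambda>x. f x - u n x) =
        \<i> * L2_inner M h f + L2_inner M h' f - (\<i> * L2_inner M h (u n) + L2_inner M h' (u n))"
      unfolding wh by (simp add: L2_inner_diff_right L2_inner_add_left L2_inner_cmult_left L2_add L2_cmult hL assms uL)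
    also have "\<dots> = \<i> * L2_inner M h f + L2_inner M h f' - (\<i> * L2_inner M h (u n) + L2_inner M h (v n))"
      by (simp add: adj[OF hA] A_symmetric[OF hA uvA])
    also have "\<dots> = L2_inner M h ?r"
      unfolding req
      by (simp add: L2_inner_diff_right L2_inner_cmult_right L2_diff L2_cmult hL assms uL)
    finally have "cmod (L2_inner M w (\<lambda>x. f x - u n x)) \<le> L2_norm M h * L2_norm M ?r"
      using L2_Cauchy_Schwarz[OF hL(1) rL] by simp
    also have "\<dots> \<le> L2_norm M w * L2_norm M ?r" by (intro mult_right_mono hn) simp
    finally show "cmod (L2_inner M w (\<lambda>x. f x - u n x)) \<le> L2_norm M (\<lambda>x. lincomb (S n) (c n) x - g x) * L2_norm M w"
      by (simp add: L2_norm_minus[of M g] mult.commute)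
  qed simp
  have ulim: "(\<lambda>n. L2_norm M (\<lambda>x. u n x - f x)) \<longlonglongrightarrow> 0"
  proof (rule Lim_null_comparison[OF always_eventually lim], intro allI)
    show "norm (L2_norm M (\<lambda>x. u n x - f x)) \<le> L2_norm M (\<lambda>x. lincomb (S n) (c n) x - g x)" for n
      using close[of n] by (simp add: L2_norm_minus[of M f])
  qed
  have "(\<lambda>n. L2_norm M (\<lambda>x. (\<i> * u n x + lincomb (S n) (c n) x) - (\<i> * f x + g x))) \<longlonglongrightarrow> 0"
    by (rule L2_tendsto_combine[OF uL(1) lincomb_L2[OF S(2)] assms(1) gL ulim lim])
  then have vlim: "(\<lambda>n. L2_norm M (\<lambda>x. v n x - f' x)) \<longlonglongrightarrow> 0"
    unfolding w[symmetric] g_def by simp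
  show ?thesis by (rule AbarI[OF uvA ulim vlim assms(1,2)])
qed

theorem op_self_adjoint_Abar: "op_self_adjoint M Abar"
proof -
  have "op_adjoint M Abar \<subseteq> Abar"
  proof (rule subsetI)
    fix p assume "p \<in> op_adjoint M Abar"
    then obtain f f' where p: "p = (f, f')" "f \<in> L2 M" "f' \<in> L2 M"
      and adj: "\<forall>(g, g')\<in>Abar. L2_inner M g' f = L2_inner M g f'"
      unfolding op_adjoint_def by blast
    have "(f, f') \<in> Abar"
      by (rule adjoint_subset_Abar[OF p(2,3)]) (use adj A_in_Abar in blast)
    then show "p \<in> Abar" by (simp add: p)
  qed
  moreover have "Abar \<subseteq> op_adjoint M Abar"
    unfolding op_adjoint_def using Abar_symmetric Abar_L2 by auto
  ultimately show ?thesis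
    unfolding op_self_adjoint_def using densely_defined_Abar by blast
qed

theorem essentially_self_adjoint: "essentially_self_adjoint M (complex_span B) T"
  unfolding essentially_self_adjoint_def
  using span_L2 T_L2 op_symmetric_A op_self_adjoint_Abar by (auto simp: A_def)

text \<open>An eigenvector whose eigenvalue is not among the \<open>e b\<close> is orthogonal to every \<open>b\<close> by symmetry, hence
null by completeness. Null members of \<open>B\<close> contribute no eigenvalue.\<close>

theorem point_spectrum_eq:
  "point_spectrum M Abar = {complex_of_real (e b) | b. b \<in> B \<and> \<not> (AE x in M. b x = 0)}"
proof (intro set_eqI iffI)
  fix z assume "z \<in> point_spectrum M Abar"
  then obtain f f' where ff': "(f, f') \<in> Abar" "\<not> (AE x in M. f x = 0)" "AE x in M. f' x = z * f x"
    unfolding point_spectrum_def by blast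
  note L = Abar_L2[OF ff'(1)]
  show "z \<in> {complex_of_real (e b) | b. b \<in> B \<and> \<not> (AE x in M. b x = 0)}"
  proof (rule ccontr)
    assume z: "z \<notin> {complex_of_real (e b) | b. b \<in> B \<and> \<not> (AE x in M. b x = 0)}"
    have "L2_inner M f b = 0" if b: "b \<in> B" for b
    proof (cases "AE x in M. b x = 0")
      case True
      have "L2_inner M f b = L2_inner M f (\<lambda>x. 0)"
        using True L B_L2[OF b] by (intro L2_inner_cong) auto
      then show ?thesis by (simp add: L2_inner_def)
    next
      case False
      have "z * L2_inner M f b = L2_inner M f' b"
        using L ff'(3) B_L2[OF b] unfolding L2_inner_cmult_left[symmetric]
        by (intro L2_inner_cong[symmetric] L2_cmult) auto
      also have "\<dots> = L2_inner M f (\<lambda>x. complex_of_real (e b) * b x)"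
        by (rule Abar_inner_A[OF ff'(1) eigenpair_in_A[OF b]])
      also have "\<dots> = complex_of_real (e b) * L2_inner M f b" by (simp add: L2_inner_cmult_right)
      finally show ?thesis using z b False by auto
    qed
    then have *: "L2_inner M b f = 0" if "b \<in> B" for b using L2_inner_cnj[of M b f] that by simp
    have "AE x in M. f x = 0"
    proof (rule L2_dense_orthogonal[OF dense span_L2])
      fix w assume "w \<in> complex_span B"
      then obtain S c where S: "finite S" "S \<subseteq> B" "w = lincomb S c" by (rule complex_span_cases)
      have "L2_inner M w f = (\<Sum>b\<in>S. L2_inner M (\<lambda>x. c b * b x) f)"
        unfolding S(3) using S(2) L by (intro L2_inner_sum_left) (auto intro: L2_cmult B_L2)
      also have "\<dots> = 0" using S(2) by (intro sum.neutral ballI) (auto simp: L2_inner_cmult_left *)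
      finally show "L2_inner M w f = 0" .
    qed (use L in simp)
    then show False using ff'(2) by simp
  qed
next
  fix z assume "z \<in> {complex_of_real (e b) | b. b \<in> B \<and> \<not> (AE x in M. b x = 0)}"
  then obtain b where b: "z = complex_of_real (e b)" "b \<in> B" "\<not> (AE x in M. b x = 0)" by blast
  have "(b, \<lambda>x. z * b x) \<in> Abar" unfolding b(1) by (rule A_in_Abar[OF eigenpair_in_A[OF b(2)]])
  then show "z \<in> point_spectrum M Abar" unfolding point_spectrum_def using b(3) by auto
qed

text \<open>Solve \<open>(A - z) (u n) = c n\<close> termwise for linear combinations \<open>c n\<close> tending to \<open>f\<close>. Because the
eigenvalues stay away from \<open>z\<close>, \<open>resolvent_bound\<close> makes \<open>u n\<close> a Cauchy sequence, and its limit is a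
preimage of \<open>f\<close>.\<close>

lemma surjective_off_spectrum:
  assumes z: "z \<notin> point_spectrum M Abar" and f: "f \<in> L2 M"
  shows "f \<in> op_range_shift Abar z"
proof -
  have null: "AE x in M. b x = 0" if "b \<in> B" "complex_of_real (e b) = z" for b
    using z that unfolding point_spectrum_eq by blast
  obtain \<delta> where \<delta>: "\<delta> > 0" "\<And>b. b \<in> B \<Longrightarrow> complex_of_real (e b) \<noteq> z \<Longrightarrow> \<delta> \<le> cmod (complex_of_real (e b) - z)"
    using gap[of z] by blast
  obtain S c where S': "\<forall>n::nat. finite (S n)" "\<forall>n. S n \<subseteq> B"
    and lim: "(\<lambda>n. L2_norm M (\<lambda>x. lincomb (S n) (c n) x - f x)) \<longlonglongrightarrow> 0"
    by (rule dense_sequence[OF f])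
  note S = spec[OF S'(1)] spec[OF S'(2)]
  define d where "d n b = c n b / (complex_of_real (e b) - z)" for n b
  define u where "u n = lincomb (S n) (d n)" for n
  define v where "v n = lincomb (S n) (\<lambda>b. d n b * complex_of_real (e b))" for n
  define w where "w n = lincomb (S n) (\<lambda>b. d n b * (complex_of_real (e b) - z))" for n
  have uvA: "(u n, v n) \<in> A" for n unfolding u_def v_def by (rule lincomb_in_A[OF S])
  then have uL: "u n \<in> L2 M" "v n \<in> L2 M" for n using A_L2 by auto
  have wL: "w n \<in> L2 M" for n unfolding w_def by (rule lincomb_L2[OF S(2)])
  have vw: "v n x = z * u n x + w n x" for n x
    by (simp add: v_def u_def w_def sum_distrib_left sum.distrib[symmetric] algebra_simps)
  have wAE: "AE x in M. w n x = lincomb (S n) (c n) x" for n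
    unfolding w_def d_def by (rule resolvent_lincomb[OF S null])
  have wlim: "(\<lambda>n. L2_norm M (\<lambda>x. w n x - f x)) \<longlonglongrightarrow> 0"
  proof -
    have "L2_norm M (\<lambda>x. w n x - f x) = L2_norm M (\<lambda>x. lincomb (S n) (c n) x - f x)" for n
    proof (rule L2_norm_cong)
      show "AE x in M. w n x - f x = lincomb (S n) (c n) x - f x" using wAE[of n] by eventually_elim simp
    qed (use L2_diff[OF wL f] L2_diff[OF lincomb_L2[OF S(2)] f] in \<open>simp_all add: L2_def\<close>)
    then show ?thesis using lim by simp
  qed
  have diff: "\<delta> * L2_norm M (\<lambda>x. u m x - u n x) \<le> L2_norm M (\<lambda>x. w m x - w n x)" for m n
  proof -
    let ?c = "\<lambda>b. (-1) * (if b \<in> S n then d n b else 0) + (if b \<in> S m then d m b else 0)"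
    have fin: "finite (S n \<union> S m)" "S n \<union> S m \<subseteq> B" using S by auto
    have 1: "(\<lambda>x. u m x - u n x) = lincomb (S n \<union> S m) ?c"
      using lincomb_combine[OF S(1)[of n] S(1)[of m], where z="-1" and c="d n" and c'="d m"] by (simp add: u_def)
    have 2: "(\<lambda>x. w m x - w n x) = lincomb (S n \<union> S m) (\<lambda>b. ?c b * (complex_of_real (e b) - z))"
    proof -
      have "(\<lambda>x. w m x - w n x) = (\<lambda>x. (-1) * w n x + w m x)" by simp
      also have "\<dots> = lincomb (S n \<union> S m) (\<lambda>b. ?c b * (complex_of_real (e b) - z))"
        unfolding w_def lincomb_combine[OF S(1) S(1)]
        by (intro ext sum.cong HOL.refl arg_cong2[of _ _ _ _ "(*)"]) (auto simp: algebra_simps)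
      finally show ?thesis .
    qed
    show ?thesis unfolding 1 2 by (rule resolvent_bound[OF fin \<delta> null])
  qed
  have "\<exists>g\<in>L2 M. (\<lambda>n. L2_norm M (\<lambda>x. u n x - g x)) \<longlonglongrightarrow> 0"
  proof (rule L2_complete[OF uL(1)])
    fix \<epsilon> :: real assume \<epsilon>: "\<epsilon> > 0"
    then have "\<delta> * \<epsilon> / 2 > 0" using \<delta>(1) by simp
    from LIMSEQ_D[OF wlim this] obtain N where N: "\<And>n. n \<ge> N \<Longrightarrow> L2_norm M (\<lambda>x. w n x - f x) < \<delta> * \<epsilon> / 2"
      by auto
    have "L2_norm M (\<lambda>x. u m x - u n x) < \<epsilon>" if "m \<ge> N" "n \<ge> N" for m n
    proof -
      have "\<delta> * L2_norm M (\<lambda>x. u m x - u n x) \<le> L2_norm M (\<lambda>x. w m x - w n x)" by (rule diff)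
      also have "\<dots> \<le> L2_norm M (\<lambda>x. w m x - f x) + L2_norm M (\<lambda>x. f x - w n x)"
        by (rule L2_norm_triangle_diff[OF wL f wL])
      also have "\<dots> < \<delta> * \<epsilon>"
        using N[OF that(1)] N[OF that(2)] by (simp add: L2_norm_minus[of M f])
      finally show ?thesis using \<delta>(1) by simp
    qed
    then show "\<exists>N. \<forall>m\<ge>N. \<forall>n\<ge>N. L2_norm M (\<lambda>x. u m x - u n x) < \<epsilon>" by blast
  qed
  then obtain g where g: "g \<in> L2 M" "(\<lambda>n. L2_norm M (\<lambda>x. u n x - g x)) \<longlonglongrightarrow> 0" by blast
  have gL: "(\<lambda>x. z * g x + f x) \<in> L2 M" by (intro L2_add L2_cmult g f)
  have "(g, \<lambda>x. z * g x + f x) \<in> Abar"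
  proof (rule AbarI[OF uvA g(2) _ g(1) gL])
    show "(\<lambda>n. L2_norm M (\<lambda>x. v n x - (z * g x + f x))) \<longlonglongrightarrow> 0"
      unfolding vw by (rule L2_tendsto_combine[OF uL(1) wL g(1) f g(2) wlim])
  qed
  then show ?thesis unfolding op_range_shift_def
    by (intro CollectI exI[of _ "\<lambda>x. z * g x + f x"] exI[of _ g]) simp
qed

theorem continuous_spectrum_empty: "continuous_spectrum M Abar = {}"
proof -
  have "op_range_shift Abar z = L2 M" if "z \<notin> point_spectrum M Abar" for z
  proof
    show "op_range_shift Abar z \<subseteq> L2 M"
      unfolding op_range_shift_def using Abar_L2 by (auto intro!: L2_diff L2_cmult)
    show "L2 M \<subseteq> op_range_shift Abar z" using surjective_off_spectrum[OF that] by blast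
  qed
  then show ?thesis unfolding continuous_spectrum_def by blast
qed

end

section \<open>Reflections and Dunkl operators\<close>

lemma inner_reflection: "reflection \<alpha> x \<bullet> y = x \<bullet> y - 2 * (\<alpha> \<bullet> x) * (\<alpha> \<bullet> y) / (norm \<alpha>)\<^sup>2"
  by (simp add: reflection_def inner_diff_left)

lemma inner_root_reflection: "\<alpha> \<noteq> 0 \<Longrightarrow> \<alpha> \<bullet> reflection \<alpha> x = - (\<alpha> \<bullet> x)"
  by (simp add: reflection_def inner_diff_right dot_square_norm)

lemma inner_reflection_reflection: "reflection \<alpha> x \<bullet> reflection \<alpha> y = x \<bullet> y"
proof (cases "\<alpha> = 0")
  case False
  then have "\<alpha> \<bullet> reflection \<alpha> y = - (\<alpha> \<bullet> y)" by (rule inner_root_reflection)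
  moreover have "x \<bullet> reflection \<alpha> y = x \<bullet> y - 2 * (\<alpha> \<bullet> y) * (\<alpha> \<bullet> x) / (norm \<alpha>)\<^sup>2"
    using inner_reflection[of \<alpha> y x] by (simp add: inner_commute)
  ultimately show ?thesis by (simp add: inner_reflection)
qed (simp add: reflection_def)

lemma norm_reflection[simp]: "norm (reflection \<alpha> x) = norm x"
  by (simp add: norm_eq_sqrt_inner inner_reflection_reflection)

lemma reflection_reflection[simp]: "reflection \<alpha> (reflection \<alpha> x) = x"
proof (cases "\<alpha> = 0")
  case False
  then have "\<alpha> \<bullet> reflection \<alpha> x = - (\<alpha> \<bullet> x)" by (rule inner_root_reflection)
  then show ?thesis by (subst reflection_def) (simp add: reflection_def)
qed (simp add: reflection_def)

lemma linear_reflection: "linear (reflection \<alpha>)"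
  by (rule linearI) (simp_all add: reflection_def inner_add_right scaleR_right_diff_distrib
      add_divide_distrib distrib_left scaleR_left_distrib)

lemma bounded_linear_reflection: "bounded_linear (reflection \<alpha>)"
  using linear_reflection by (rule linear_conv_bounded_linear[THEN iffD1])

lemma reflection_fixed: "\<alpha> \<bullet> x = 0 \<Longrightarrow> reflection \<alpha> x = x"
  by (simp add: reflection_def)

lemma reflection_root: "\<alpha> \<noteq> 0 \<Longrightarrow> reflection \<alpha> \<alpha> = - \<alpha>"
  by (simp add: reflection_def dot_square_norm scaleR_2)

lemma reflection_uminus: "reflection (- \<alpha>) x = reflection \<alpha> x"
  by (simp add: reflection_def)

lemma directional_deriv_eq:
  assumes "(f has_derivative f') (at x)"
  shows "directional_deriv \<xi> f x = f' \<xi>"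
proof -
  have "((\<lambda>t. f (x + t *\<^sub>R \<xi>)) has_derivative (\<lambda>t. f' (t *\<^sub>R \<xi>))) (at 0)"
    by (rule has_derivative_compose[of "\<lambda>t. x + t *\<^sub>R \<xi>" "\<lambda>t. t *\<^sub>R \<xi>"])
      (use assms in \<open>auto intro!: derivative_eq_intros\<close>)
  moreover have "f' (t *\<^sub>R \<xi>) = t *\<^sub>R f' \<xi>" for t
    using has_derivative_linear[OF assms] by (rule linear_scale)
  ultimately have "((\<lambda>t. f (x + t *\<^sub>R \<xi>)) has_vector_derivative f' \<xi>) (at 0)"
    by (simp add: has_vector_derivative_def)
  then show ?thesis unfolding directional_deriv_def by (rule vector_derivative_at)
qed

lemma has_derivative_directional:
  assumes "f differentiable (at x)"
  shows "(f has_derivative (\<lambda>\<xi>. directional_deriv \<xi> f x)) (at x)"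
proof -
  obtain f' where f': "(f has_derivative f') (at x)" using assms by (auto simp: differentiable_def)
  then have "(\<lambda>\<xi>. directional_deriv \<xi> f x) = f'" by (intro ext directional_deriv_eq)
  then show ?thesis using f' by simp
qed

lemma directional_deriv_cong:
  assumes "open U" "x \<in> U" "\<And>y. y \<in> U \<Longrightarrow> f y = g y"
  shows "directional_deriv \<xi> f x = directional_deriv \<xi> g x"
proof -
  have "((\<lambda>t. x + t *\<^sub>R \<xi>) \<longlongrightarrow> x + 0 *\<^sub>R \<xi>) (nhds 0)"
    by (intro tendsto_intros filterlim_ident)
  then have "\<forall>\<^sub>F t in nhds 0. x + t *\<^sub>R \<xi> \<in> U"
    using assms(1,2) by (simp add: topological_tendstoD)
  then have "\<forall>\<^sub>F t in nhds 0. f (x + t *\<^sub>R \<xi>) = g (x + t *\<^sub>R \<xi>)"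
    by eventually_elim (rule assms(3))
  then show ?thesis unfolding directional_deriv_def by (intro vector_derivative_cong_eq) auto
qed

lemma sum_Basis_inner: "(\<Sum>\<xi>\<in>Basis. (x \<bullet> \<xi>) * (y \<bullet> \<xi>)) = x \<bullet> (y :: 'a::euclidean_space)"
  by (rule euclidean_inner[symmetric])

text \<open>Sums over coordinate directions are basis-free: they reassemble the derivative in direction \<open>a\<close>.\<close>

lemma sum_Basis_directional_deriv:
  assumes "f differentiable (at x)"
  shows "(\<Sum>\<xi>\<in>Basis. complex_of_real (a \<bullet> \<xi>) * directional_deriv \<xi> f x) = directional_deriv a f x"
proof -
  have lin: "linear (\<lambda>\<xi>. directional_deriv \<xi> f x)"
    by (rule has_derivative_linear[OF has_derivative_directional[OF assms]])
  have "directional_deriv a f x = directional_deriv (\<Sum>\<xi>\<in>Basis. (a \<bullet> \<xi>) *\<^sub>R \<xi>) f x"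
    by (simp add: euclidean_representation)
  also have "\<dots> = (\<Sum>\<xi>\<in>Basis. (a \<bullet> \<xi>) *\<^sub>R directional_deriv \<xi> f x)"
    by (simp only: linear_sum[OF lin] linear_scale[OF lin])
  finally show ?thesis by (simp add: scaleR_conv_of_real)
qed

text \<open>A differentiable \<open>q\<close> with \<open>f - f \<circ> reflection \<alpha> = \<langle>\<alpha>, \<cdot>\<rangle> q\<close> must be the reflection quotient also on the
hyperplane: differentiating the identity there in direction \<open>\<alpha>\<close> gives \<open>2 \<partial>\<^sub>\<alpha> f = \<parallel>\<alpha>\<parallel>\<^sup>2 q\<close>. This removes
the case distinction in the definition once and for all for polynomials.\<close>

lemma reflection_quotient_eqI:
  assumes "\<alpha> \<noteq> 0" and f: "f differentiable (at x)" and q: "q differentiable (at x)"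
    and eq: "\<And>y. f y - f (reflection \<alpha> y) = complex_of_real (\<alpha> \<bullet> y) * q y"
  shows "reflection_quotient \<alpha> f x = q x"
proof (cases "\<alpha> \<bullet> x = 0")
  case True
  let ?D = "\<lambda>\<xi>. directional_deriv \<xi> f x"
  have r: "reflection \<alpha> x = x" using True by (rule reflection_fixed)
  have 1: "(f has_derivative ?D) (at x)" using f by (rule has_derivative_directional)
  have 2: "((\<lambda>y. f (reflection \<alpha> y)) has_derivative (\<lambda>h. ?D (reflection \<alpha> h))) (at x)"
    by (rule has_derivative_compose[OF bounded_linear_imp_has_derivative[OF bounded_linear_reflection]])
      (simp add: r 1)
  obtain q' where q': "(q has_derivative q') (at x)" using q by (auto simp: differentiable_def)
  have 3: "((\<lambda>y. complex_of_real (\<alpha> \<bullet> y) * q y) has_derivative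
      (\<lambda>h. complex_of_real (\<alpha> \<bullet> x) * q' h + complex_of_real (\<alpha> \<bullet> h) * q x)) (at x)"
    by (auto intro!: derivative_eq_intros q')
  have "(\<lambda>h. ?D h - ?D (reflection \<alpha> h)) = (\<lambda>h. complex_of_real (\<alpha> \<bullet> x) * q' h + complex_of_real (\<alpha> \<bullet> h) * q x)"
    by (rule has_derivative_unique[OF has_derivative_diff[OF 1 2, unfolded eq] 3])
  from fun_cong[OF this, of \<alpha>]
  have "?D \<alpha> - ?D (- \<alpha>) = complex_of_real ((norm \<alpha>)\<^sup>2) * q x"
    using True by (simp add: reflection_root[OF assms(1)] dot_square_norm)
  moreover have "?D (- \<alpha>) = - ?D \<alpha>" by (rule linear_neg[OF has_derivative_linear[OF 1]])
  ultimately have "2 * ?D \<alpha> = complex_of_real ((norm \<alpha>)\<^sup>2) * q x" by simp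
  moreover have "complex_of_real ((norm \<alpha>)\<^sup>2) \<noteq> 0" using assms(1) by simp
  ultimately show ?thesis using True by (simp add: reflection_quotient_def scaleR_conv_of_real field_simps)
next
  case False
  then show ?thesis by (simp add: reflection_quotient_def eq)
qed

lemma reflection_quotient_add:
  assumes "f differentiable (at x)" "g differentiable (at x)"
  shows "reflection_quotient \<alpha> (\<lambda>y. f y + g y) x = reflection_quotient \<alpha> f x + reflection_quotient \<alpha> g x"
  unfolding reflection_quotient_def
  using directional_deriv_eq[OF has_derivative_add[OF assms[THEN has_derivative_directional]]]
  by (simp add: scaleR_add_right add_divide_distrib[symmetric] algebra_simps)

lemma reflection_quotient_cmult:
  assumes "f differentiable (at x)"
  shows "reflection_quotient \<alpha> (\<lambda>y. c * f y) x = c * reflection_quotient \<alpha> f x"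
  unfolding reflection_quotient_def
  using directional_deriv_eq[OF has_derivative_mult_right[OF has_derivative_directional[OF assms]]]
  by (simp add: scaleR_conv_of_real mult.left_commute right_diff_distrib[symmetric])

lemma dunkl_operator_add:
  assumes "f differentiable (at x)" "g differentiable (at x)"
  shows "dunkl_operator P k \<xi> (\<lambda>y. f y + g y) x = dunkl_operator P k \<xi> f x + dunkl_operator P k \<xi> g x"
  unfolding dunkl_operator_def reflection_quotient_add[OF assms]
  using directional_deriv_eq[OF has_derivative_add[OF assms[THEN has_derivative_directional]]]
  by (simp add: distrib_left sum.distrib)

lemma dunkl_operator_cmult:
  assumes "f differentiable (at x)"
  shows "dunkl_operator P k \<xi> (\<lambda>y. c * f y) x = c * dunkl_operator P k \<xi> f x"
  unfolding dunkl_operator_def reflection_quotient_cmult[OF assms]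
  using directional_deriv_eq[OF has_derivative_mult_right[OF has_derivative_directional[OF assms]]]
  by (simp add: distrib_left sum_distrib_left mult.left_commute)

lemma dunkl_operator_const: "dunkl_operator P k \<xi> (\<lambda>y. c) x = 0"
proof -
  have "directional_deriv \<eta> (\<lambda>y. c) x = 0" for \<eta>
    by (rule directional_deriv_eq[OF has_derivative_const])
  then show ?thesis by (auto simp: dunkl_operator_def reflection_quotient_def intro!: sum.neutral)
qed

lemma dunkl_operator_sum:
  assumes "finite I" "\<And>i. i \<in> I \<Longrightarrow> f i differentiable (at x)"
  shows "dunkl_operator P k \<xi> (\<lambda>y. \<Sum>i\<in>I. c i * f i y) x = (\<Sum>i\<in>I. c i * dunkl_operator P k \<xi> (f i) x)"
  using assms
proof (induction I rule: finite_induct)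
  case empty then show ?case by (simp add: dunkl_operator_const)
next
  case (insert i I)
  have d: "(\<lambda>y. c j * f j y) differentiable (at x)" if "j \<in> insert i I" for j
    using insert.prems[OF that] by (intro differentiable_mult) auto
  have "(\<lambda>y. \<Sum>i\<in>I. c i * f i y) differentiable (at x)"
    using d insert.hyps by (intro differentiable_sum) auto
  then have "dunkl_operator P k \<xi> (\<lambda>y. c i * f i y + (\<Sum>i\<in>I. c i * f i y)) x
    = c i * dunkl_operator P k \<xi> (f i) x + (\<Sum>i\<in>I. c i * dunkl_operator P k \<xi> (f i) x)"
    using d[of i] insert by (simp add: dunkl_operator_add dunkl_operator_cmult)
  then show ?case using insert.hyps by simp
qed

text \<open>Dunkl operators are not local, but only the reflected points enter besides a neighbourhood of \<open>x\<close>. For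
the complement of the origin and for radial regions these lie in the same set.\<close>

lemma dunkl_operator_cong:
  assumes "open U" "x \<in> U" "\<And>y. y \<in> U \<Longrightarrow> f y = g y" "\<And>\<alpha>. \<alpha> \<in> P \<Longrightarrow> reflection \<alpha> x \<in> U"
  shows "dunkl_operator P k \<xi> f x = dunkl_operator P k \<xi> g x"
  unfolding dunkl_operator_def reflection_quotient_def
  using assms by (auto intro!: sum.cong arg_cong2[of _ _ _ _ "(+)"] directional_deriv_cong)

lemma has_derivative_norm_sq: "((\<lambda>y::real^'n. (norm y)\<^sup>2) has_derivative (\<lambda>h. 2 * (x \<bullet> h))) (at x)"
  unfolding power2_norm_eq_inner
  by (auto intro!: derivative_eq_intros simp: inner_commute)

lemma has_derivative_radial:
  fixes x :: "real^'n"
  assumes "(\<gamma> has_real_derivative \<gamma>') (at ((norm x)\<^sup>2))"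
  shows "((\<lambda>y. complex_of_real (\<gamma> ((norm y)\<^sup>2))) has_derivative (\<lambda>h. complex_of_real (2 * \<gamma>' * (x \<bullet> h)))) (at x)"
proof -
  have "((\<lambda>y. \<gamma> ((norm y)\<^sup>2)) has_derivative (\<lambda>h. \<gamma>' * (2 * (x \<bullet> h)))) (at x)"
    by (rule has_derivative_compose[OF has_derivative_norm_sq])
      (use assms in \<open>simp add: has_field_derivative_def\<close>)
  then have "((\<lambda>y. complex_of_real (\<gamma> ((norm y)\<^sup>2))) has_derivative
      (\<lambda>h. complex_of_real (\<gamma>' * (2 * (x \<bullet> h))))) (at x)"
    by (rule has_derivative_of_real)
  then show ?thesis by (simp add: mult_ac)
qed

text \<open>Radial factors are invariant under reflections, so the difference part of the operator does not see
them and the Leibniz rule holds as for ordinary derivatives.\<close>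

lemma dunkl_operator_radial:
  fixes x :: "real^'n"
  assumes p: "p differentiable (at x)"
    and \<gamma>: "(\<gamma> has_real_derivative \<gamma>') (at ((norm x)\<^sup>2))"
  shows "dunkl_operator P k \<xi> (\<lambda>y. complex_of_real (\<gamma> ((norm y)\<^sup>2)) * p y) x
    = complex_of_real (\<gamma> ((norm x)\<^sup>2)) * dunkl_operator P k \<xi> p x + complex_of_real (2 * \<gamma>' * (x \<bullet> \<xi>)) * p x"
proof -
  let ?G = "\<lambda>y. complex_of_real (\<gamma> ((norm y)\<^sup>2))"
  have D: "directional_deriv \<eta> (\<lambda>y. ?G y * p y) x
      = ?G x * directional_deriv \<eta> p x + complex_of_real (2 * \<gamma>' * (x \<bullet> \<eta>)) * p x" for \<eta>
    using directional_deriv_eq[OF has_derivative_mult[OF has_derivative_radial[OF \<gamma>] has_derivative_directional[OF p]]]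
    by simp
  have Q: "reflection_quotient \<alpha> (\<lambda>y. ?G y * p y) x = ?G x * reflection_quotient \<alpha> p x" for \<alpha>
    unfolding reflection_quotient_def D
    by (simp add: scaleR_conv_of_real inner_commute[of \<alpha>] right_diff_distrib mult.left_commute)
  show ?thesis
    unfolding dunkl_operator_def D Q by (simp add: distrib_left sum_distrib_left mult.left_commute)
qed

text \<open>Off the hyperplane the sum telescopes to
\<open>(\<langle>\<alpha>, x\<rangle> p x - \<langle>\<alpha>, reflection \<alpha> x\<rangle> p (reflection \<alpha> x)) / \<langle>\<alpha>, x\<rangle>\<close>, and reflecting changes the sign of
\<open>\<langle>\<alpha>, x\<rangle>\<close>.\<close>

lemma reflection_quotient_coordinate_sum:
  assumes p: "p differentiable (at x)" and "\<alpha> \<noteq> 0"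
  shows "(\<Sum>\<xi>\<in>Basis. complex_of_real (\<alpha> \<bullet> \<xi>) * reflection_quotient \<alpha> (\<lambda>y. complex_of_real (y \<bullet> \<xi>) * p y) x)
    = p x + p (reflection \<alpha> x)"
proof -
  have D: "directional_deriv \<eta> (\<lambda>y. complex_of_real (y \<bullet> \<xi>) * p y) x
      = complex_of_real (x \<bullet> \<xi>) * directional_deriv \<eta> p x + complex_of_real (\<eta> \<bullet> \<xi>) * p x" for \<xi> \<eta>
    by (rule directional_deriv_eq)
      (auto intro!: derivative_eq_intros has_derivative_directional p)
  have S: "(\<Sum>\<xi>\<in>Basis. complex_of_real (a \<bullet> \<xi>) * (complex_of_real (b \<bullet> \<xi>) * c)) = complex_of_real (a \<bullet> b) * c" for a b c
    by (subst sum_Basis_inner[of a b, symmetric]) (simp only: sum_distrib_right mult.assoc of_real_sum of_real_mult)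
  show ?thesis
  proof (cases "\<alpha> \<bullet> x = 0")
    case True
    have n: "(norm \<alpha>)\<^sup>2 \<noteq> 0" using assms(2) by simp
    have "(\<Sum>\<xi>\<in>Basis. complex_of_real (\<alpha> \<bullet> \<xi>) * reflection_quotient \<alpha> (\<lambda>y. complex_of_real (y \<bullet> \<xi>) * p y) x)
      = complex_of_real (2 / (norm \<alpha>)\<^sup>2) * ((\<Sum>\<xi>\<in>Basis. complex_of_real (\<alpha> \<bullet> \<xi>) * (complex_of_real (x \<bullet> \<xi>) * directional_deriv \<alpha> p x))
        + (\<Sum>\<xi>\<in>Basis. complex_of_real (\<alpha> \<bullet> \<xi>) * (complex_of_real (\<alpha> \<bullet> \<xi>) * p x)))"
      using True unfolding reflection_quotient_def D
      by (simp add: scaleR_conv_of_real sum_distrib_left sum.distrib[symmetric] distrib_left mult_ac)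
    also have "\<dots> = 2 * p x" unfolding S using True n by (simp add: dot_square_norm)
    finally show ?thesis using True by (simp add: reflection_fixed)
  next
    case False
    have "(\<Sum>\<xi>\<in>Basis. complex_of_real (\<alpha> \<bullet> \<xi>) * reflection_quotient \<alpha> (\<lambda>y. complex_of_real (y \<bullet> \<xi>) * p y) x)
      = ((\<Sum>\<xi>\<in>Basis. complex_of_real (\<alpha> \<bullet> \<xi>) * (complex_of_real (x \<bullet> \<xi>) * p x))
        - (\<Sum>\<xi>\<in>Basis. complex_of_real (\<alpha> \<bullet> \<xi>) * (complex_of_real (reflection \<alpha> x \<bullet> \<xi>) * p (reflection \<alpha> x)))) / complex_of_real (\<alpha> \<bullet> x)"
      using False unfolding reflection_quotient_def
      by (simp add: sum_divide_distrib sum_subtractf[symmetric] right_diff_distrib)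
    also have "\<dots> = p x + p (reflection \<alpha> x)"
      unfolding S using False by (simp add: inner_root_reflection[OF assms(2)] add_divide_distrib)
    finally show ?thesis .
  qed
qed

lemma reflection_quotient_inner_mult:
  "complex_of_real (\<alpha> \<bullet> x) * reflection_quotient \<alpha> p x = p x - p (reflection \<alpha> x)"
  by (simp add: reflection_quotient_def reflection_fixed)

text \<open>The commutation relation behind the \<open>sl\<^sub>2\<close> structure: \<open>\<Sum>\<^sub>j (T\<^sub>j x\<^sub>j + x\<^sub>j T\<^sub>j)\<close> is twice the Euler operator
plus the constant \<open>N + 2 \<langle>k\<rangle>\<close>. The terms \<open>p (reflection \<alpha> x)\<close> from the two summands cancel.\<close>

lemma dunkl_operator_coordinate_sum:
  fixes x :: "real^'n"
  assumes p: "p differentiable (at x)" and P: "0 \<notin> P"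
  shows "(\<Sum>\<xi>\<in>Basis. dunkl_operator P k \<xi> (\<lambda>y. complex_of_real (y \<bullet> \<xi>) * p y) x
      + complex_of_real (x \<bullet> \<xi>) * dunkl_operator P k \<xi> p x)
    = complex_of_real (real CARD('n) + 2 * (\<Sum>\<alpha>\<in>P. k \<alpha>)) * p x + 2 * directional_deriv x p x"
proof -
  have D: "directional_deriv \<xi> (\<lambda>y. complex_of_real (y \<bullet> \<xi>) * p y) x
      = complex_of_real (x \<bullet> \<xi>) * directional_deriv \<xi> p x + p x" if "\<xi> \<in> Basis" for \<xi>
  proof -
    have "\<xi> \<bullet> \<xi> = 1" using that by simp
    then show ?thesis
      by (intro directional_deriv_eq[of _ "\<lambda>h. complex_of_real (x \<bullet> \<xi>) * directional_deriv h p x + complex_of_real (h \<bullet> \<xi>) * p x" x \<xi>, THEN trans])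
        (auto intro!: derivative_eq_intros has_derivative_directional p)
  qed
  have 1: "(\<Sum>\<xi>\<in>Basis. directional_deriv \<xi> (\<lambda>y. complex_of_real (y \<bullet> \<xi>) * p y) x + complex_of_real (x \<bullet> \<xi>) * directional_deriv \<xi> p x)
     = of_nat CARD('n) * p x + 2 * directional_deriv x p x"
  proof -
    have "(\<Sum>\<xi>\<in>Basis. directional_deriv \<xi> (\<lambda>y. complex_of_real (y \<bullet> \<xi>) * p y) x + complex_of_real (x \<bullet> \<xi>) * directional_deriv \<xi> p x)
      = (\<Sum>\<xi>\<in>Basis. p x + 2 * (complex_of_real (x \<bullet> \<xi>) * directional_deriv \<xi> p x))"
      by (intro sum.cong) (simp_all add: D)
    also have "\<dots> = (\<Sum>\<xi>\<in>(Basis :: (real^'n) set). p x) + 2 * (\<Sum>\<xi>\<in>Basis. complex_of_real (x \<bullet> \<xi>) * directional_deriv \<xi> p x)"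
      by (simp only: sum.distrib sum_distrib_left)
    finally show ?thesis by (simp add: sum_Basis_directional_deriv[OF p])
  qed
  have 2: "(\<Sum>\<xi>\<in>Basis. complex_of_real (k \<alpha> * (\<alpha> \<bullet> \<xi>)) * reflection_quotient \<alpha> (\<lambda>y. complex_of_real (y \<bullet> \<xi>) * p y) x
      + complex_of_real (x \<bullet> \<xi>) * (complex_of_real (k \<alpha> * (\<alpha> \<bullet> \<xi>)) * reflection_quotient \<alpha> p x))
     = complex_of_real (2 * k \<alpha>) * p x" if "\<alpha> \<in> P" for \<alpha>
  proof -
    have "\<alpha> \<noteq> 0" using that P by auto
    have "(\<Sum>\<xi>\<in>Basis. complex_of_real (x \<bullet> \<xi>) * (complex_of_real (\<alpha> \<bullet> \<xi>) * reflection_quotient \<alpha> p x))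
        = p x - p (reflection \<alpha> x)"
    proof -
      have "complex_of_real (\<alpha> \<bullet> x) = (\<Sum>\<xi>\<in>Basis. complex_of_real (x \<bullet> \<xi>) * complex_of_real (\<alpha> \<bullet> \<xi>))"
        by (subst inner_commute, subst sum_Basis_inner[of x \<alpha>, symmetric]) (simp only: of_real_sum of_real_mult)
      then show ?thesis
        unfolding reflection_quotient_inner_mult[of \<alpha> x p, symmetric]
        by (simp only: sum_distrib_right mult.assoc)
    qed
    with reflection_quotient_coordinate_sum[OF p \<open>\<alpha> \<noteq> 0\<close>]
    have "(\<Sum>\<xi>\<in>Basis. complex_of_real (\<alpha> \<bullet> \<xi>) * reflection_quotient \<alpha> (\<lambda>y. complex_of_real (y \<bullet> \<xi>) * p y) x
      + complex_of_real (x \<bullet> \<xi>) * (complex_of_real (\<alpha> \<bullet> \<xi>) * reflection_quotient \<alpha> p x)) = 2 * p x"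
      by (simp add: sum.distrib)
    then have "complex_of_real (k \<alpha>) * (\<Sum>\<xi>\<in>Basis. complex_of_real (\<alpha> \<bullet> \<xi>) * reflection_quotient \<alpha> (\<lambda>y. complex_of_real (y \<bullet> \<xi>) * p y) x
      + complex_of_real (x \<bullet> \<xi>) * (complex_of_real (\<alpha> \<bullet> \<xi>) * reflection_quotient \<alpha> p x)) = complex_of_real (k \<alpha>) * (2 * p x)"
      by simp
    then show ?thesis by (simp add: sum_distrib_left distrib_left mult_ac)
  qed
  have e: "dunkl_operator P k \<xi> (\<lambda>y. complex_of_real (y \<bullet> \<xi>) * p y) x
      + complex_of_real (x \<bullet> \<xi>) * dunkl_operator P k \<xi> p x
    = (directional_deriv \<xi> (\<lambda>y. complex_of_real (y \<bullet> \<xi>) * p y) x + complex_of_real (x \<bullet> \<xi>) * directional_deriv \<xi> p x)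
     + (\<Sum>\<alpha>\<in>P. complex_of_real (k \<alpha> * (\<alpha> \<bullet> \<xi>)) * reflection_quotient \<alpha> (\<lambda>y. complex_of_real (y \<bullet> \<xi>) * p y) x
      + complex_of_real (x \<bullet> \<xi>) * (complex_of_real (k \<alpha> * (\<alpha> \<bullet> \<xi>)) * reflection_quotient \<alpha> p x))" for \<xi>
    unfolding dunkl_operator_def by (simp only: distrib_left sum_distrib_left sum.distrib) (simp only: add_ac)
  have "(\<Sum>\<xi>\<in>Basis. \<Sum>\<alpha>\<in>P. complex_of_real (k \<alpha> * (\<alpha> \<bullet> \<xi>)) * reflection_quotient \<alpha> (\<lambda>y. complex_of_real (y \<bullet> \<xi>) * p y) x
      + complex_of_real (x \<bullet> \<xi>) * (complex_of_real (k \<alpha> * (\<alpha> \<bullet> \<xi>)) * reflection_quotient \<alpha> p x))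
     = (\<Sum>\<alpha>\<in>P. complex_of_real (2 * k \<alpha>) * p x)"
    by (subst sum.swap) (rule sum.cong[OF HOL.refl 2])
  also have "\<dots> = complex_of_real (2 * (\<Sum>\<alpha>\<in>P. k \<alpha>)) * p x"
    by (simp only: sum_distrib_left of_real_sum sum_distrib_right)
  finally have 3: "(\<Sum>\<xi>\<in>Basis. \<Sum>\<alpha>\<in>P. complex_of_real (k \<alpha> * (\<alpha> \<bullet> \<xi>)) * reflection_quotient \<alpha> (\<lambda>y. complex_of_real (y \<bullet> \<xi>) * p y) x
      + complex_of_real (x \<bullet> \<xi>) * (complex_of_real (k \<alpha> * (\<alpha> \<bullet> \<xi>)) * reflection_quotient \<alpha> p x))
     = complex_of_real (2 * (\<Sum>\<alpha>\<in>P. k \<alpha>)) * p x" .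
  show ?thesis
    by (simp only: e sum.distrib[of "\<lambda>\<xi>. directional_deriv \<xi> (\<lambda>y. complex_of_real (y \<bullet> \<xi>) * p y) x + complex_of_real (x \<bullet> \<xi>) * directional_deriv \<xi> p x"] 1 3)
      (simp add: distrib_right)
qed

section \<open>Homogeneous polynomials\<close>

text \<open>Homogeneous polynomial functions of degree \<open>m\<close>, generated by multiplication with coordinates. Compared
with the span of monomials this gives an induction principle that follows products; \<open>hpoly_iff\<close> shows
that the two notions agree. The rule for zero is stated for every degree, so that the degree is an
upper index rather than a function of the polynomial.\<close>

inductive hpoly :: "nat \<Rightarrow> (real^'n \<Rightarrow> complex) \<Rightarrow> bool" where
  hpoly_zero: "hpoly m (\<lambda>x. 0)"
| hpoly_const: "hpoly 0 (\<lambda>x. c)"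
| hpoly_coord: "hpoly m f \<Longrightarrow> hpoly (Suc m) (\<lambda>x. complex_of_real (x $ i) * f x)"
| hpoly_add: "hpoly m f \<Longrightarrow> hpoly m g \<Longrightarrow> hpoly m (\<lambda>x. f x + g x)"

lemma hpoly_cmult: "hpoly m f \<Longrightarrow> hpoly m (\<lambda>x. c * f x)"
proof (induction rule: hpoly.induct)
  case (hpoly_coord m f i)
  from hpoly.hpoly_coord[OF hpoly_coord.IH, of i] show ?case by (simp add: mult.left_commute)
qed (auto simp: distrib_left intro: hpoly.intros)

lemma hpoly_diff: "hpoly m f \<Longrightarrow> hpoly m g \<Longrightarrow> hpoly m (\<lambda>x. f x - g x)"
  using hpoly_add[OF _ hpoly_cmult[of m g "-1"], of f] by simp

lemma hpoly_sum: "(\<And>i. i \<in> I \<Longrightarrow> hpoly m (f i)) \<Longrightarrow> hpoly m (\<lambda>x. \<Sum>i\<in>I. f i x)"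
  by (induction I rule: infinite_finite_induct) (auto intro: hpoly_add hpoly_zero)

lemma hpoly_mult: "hpoly m f \<Longrightarrow> hpoly n g \<Longrightarrow> hpoly (m + n) (\<lambda>x. f x * g x)"
proof (induction rule: hpoly.induct)
  case (hpoly_coord m f i)
  from hpoly.hpoly_coord[OF hpoly_coord.IH[OF hpoly_coord.prems], of i] show ?case by (simp add: mult.assoc)
qed (auto simp: distrib_right intro: hpoly.intros hpoly_cmult)

lemma hpoly_inner:
  assumes "hpoly m f" shows "hpoly (Suc m) (\<lambda>x. complex_of_real (x \<bullet> a) * f x)"
proof -
  have "(\<lambda>x. complex_of_real (x \<bullet> a) * f x) = (\<lambda>x. \<Sum>i\<in>UNIV. complex_of_real (a $ i) * (complex_of_real (x $ i) * f x))"
    by (intro ext) (simp add: inner_vec_def sum_distrib_left mult_ac)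
  then show ?thesis using assms by (simp only:) (intro hpoly_sum hpoly_cmult hpoly.hpoly_coord)
qed

lemma hpoly_norm_sq: "hpoly m f \<Longrightarrow> hpoly (m + 2) (\<lambda>x. complex_of_real ((norm x)\<^sup>2) * f x)"
proof -
  assume f: "hpoly m f"
  have "(\<lambda>x. complex_of_real ((norm x)\<^sup>2) * f x) = (\<lambda>x. \<Sum>i\<in>UNIV. complex_of_real (x $ i) * (complex_of_real (x $ i) * f x))"
    by (intro ext) (simp add: power2_norm_eq_inner inner_vec_def sum_distrib_left mult_ac)
  then show ?thesis using f by (simp only: add_2_eq_Suc') (intro hpoly_sum hpoly.hpoly_coord)
qed

lemma hpoly_cnj: "hpoly m f \<Longrightarrow> hpoly m (\<lambda>x. cnj (f x))"
  by (induction rule: hpoly.induct) (auto intro: hpoly.intros)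

lemma hpoly_reflection: "hpoly m f \<Longrightarrow> hpoly m (\<lambda>x. f (reflection \<alpha> x))"
proof (induction rule: hpoly.induct)
  case (hpoly_coord m f i)
  have "(\<lambda>x. complex_of_real (reflection \<alpha> x $ i) * f (reflection \<alpha> x))
    = (\<lambda>x. complex_of_real (x $ i) * f (reflection \<alpha> x)
        - complex_of_real (2 * \<alpha> $ i / (norm \<alpha>)\<^sup>2) * (complex_of_real (x \<bullet> \<alpha>) * f (reflection \<alpha> x)))"
    by (simp add: reflection_def inner_commute algebra_simps)
  then show ?case
    by (simp only:) (intro hpoly_diff hpoly_cmult hpoly_inner hpoly.hpoly_coord hpoly_coord.IH)
qed (auto intro: hpoly.intros)

lemma hpoly_homogeneous: "hpoly m f \<Longrightarrow> f (c *\<^sub>R x) = complex_of_real c ^ m * f x"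
  by (induction rule: hpoly.induct) (auto simp: algebra_simps)

text \<open>One induction for the existence of the derivative, for its being a polynomial of one degree less, and for
Euler's identity. The clause for \<open>m = 0\<close> records that truncated subtraction in \<open>m - 1\<close> is harmless.\<close>

lemma hpoly_derivative:
  "hpoly m f \<Longrightarrow> \<exists>f'. (\<forall>x. (f has_derivative f' x) (at x)) \<and> (\<forall>\<xi>. hpoly (m - 1) (\<lambda>x. f' x \<xi>)) \<and>
      (\<forall>x \<xi>. m = 0 \<longrightarrow> f' x \<xi> = 0) \<and> (\<forall>x. f' x x = of_nat m * f x)"
proof (induction rule: hpoly.induct)
  case (hpoly_zero m)
  show ?case by (rule exI[of _ "\<lambda>x \<xi>. 0"]) (auto intro: hpoly.intros)
next
  case (hpoly_const c)
  show ?case by (rule exI[of _ "\<lambda>x \<xi>. 0"]) (auto intro: hpoly.intros)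
next
  case (hpoly_coord m f i)
  then obtain f' where f': "\<forall>x. (f has_derivative f' x) (at x)" "\<forall>\<xi>. hpoly (m - 1) (\<lambda>x. f' x \<xi>)"
    "\<forall>x \<xi>. m = 0 \<longrightarrow> f' x \<xi> = 0" "\<forall>x. f' x x = of_nat m * f x" by blast
  have "((\<lambda>x. complex_of_real (x $ i) * f x) has_derivative
      (\<lambda>\<xi>. complex_of_real (x $ i) * f' x \<xi> + complex_of_real (\<xi> $ i) * f x)) (at x)" for x
    using f'(1) by (auto intro!: derivative_eq_intros bounded_linear_imp_has_derivative bounded_linear_vec_nth)
  moreover have "hpoly (Suc m - 1) (\<lambda>x. complex_of_real (x $ i) * f' x \<xi> + complex_of_real (\<xi> $ i) * f x)" for \<xi>
  proof (cases m)
    case 0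
    then show ?thesis using f'(3) hpoly_coord(1) by (simp add: hpoly_cmult)
  next
    case (Suc n)
    then have "hpoly m (\<lambda>x. complex_of_real (x $ i) * f' x \<xi>)"
      using hpoly.hpoly_coord[OF spec[OF f'(2)], where i = i] by simp
    then show ?thesis using hpoly_coord(1) by (auto intro: hpoly_add hpoly_cmult)
  qed
  moreover have "complex_of_real (x $ i) * f' x x + complex_of_real (x $ i) * f x
      = of_nat (Suc m) * (complex_of_real (x $ i) * f x)" for x
    using f'(4) by (simp add: algebra_simps)
  ultimately show ?case
    by (intro exI[of _ "\<lambda>x \<xi>. complex_of_real (x $ i) * f' x \<xi> + complex_of_real (\<xi> $ i) * f x"]) auto
next
  case (hpoly_add m f g)
  then obtain f' g' where f': "\<forall>x. (f has_derivative f' x) (at x)" "\<forall>\<xi>. hpoly (m - 1) (\<lambda>x. f' x \<xi>)"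
    "\<forall>x \<xi>. m = 0 \<longrightarrow> f' x \<xi> = 0" "\<forall>x. f' x x = of_nat m * f x"
    and g': "\<forall>x. (g has_derivative g' x) (at x)" "\<forall>\<xi>. hpoly (m - 1) (\<lambda>x. g' x \<xi>)"
    "\<forall>x \<xi>. m = 0 \<longrightarrow> g' x \<xi> = 0" "\<forall>x. g' x x = of_nat m * g x" by blast
  show ?case
    by (rule exI[of _ "\<lambda>x \<xi>. f' x \<xi> + g' x \<xi>"])
      (use f' g' in \<open>auto intro!: has_derivative_add hpoly.hpoly_add simp: distrib_left\<close>)
qed

lemma
  assumes "hpoly m f"
  shows hpoly_differentiable: "f differentiable (at x)"
    and hpoly_directional_deriv: "hpoly (m - 1) (directional_deriv \<xi> f)"
    and hpoly_directional_deriv_0: "m = 0 \<Longrightarrow> directional_deriv \<xi> f x = 0"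
    and hpoly_euler: "directional_deriv x f x = of_nat m * f x"
proof -
  obtain f' where f': "\<forall>x. (f has_derivative f' x) (at x)" "\<forall>\<xi>. hpoly (m - 1) (\<lambda>x. f' x \<xi>)"
    "\<forall>x \<xi>. m = 0 \<longrightarrow> f' x \<xi> = 0" "\<forall>x. f' x x = of_nat m * f x" using hpoly_derivative[OF assms] by blast
  have eq: "directional_deriv \<xi> f x = f' x \<xi>" for x \<xi>
    by (rule directional_deriv_eq) (use f' in blast)
  show "f differentiable (at x)" using f' unfolding differentiable_def by blast
  have "directional_deriv \<xi> f = (\<lambda>x. f' x \<xi>)" using eq by (intro ext)
  then show "hpoly (m - 1) (directional_deriv \<xi> f)" using f'(2) by simp
  show "m = 0 \<Longrightarrow> directional_deriv \<xi> f x = 0" using f'(3) eq by simp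
  show "directional_deriv x f x = of_nat m * f x" using f'(4) eq by simp
qed

lemma hpoly_continuous: assumes "hpoly m f" shows "continuous_on A f"
  using differentiable_imp_continuous_within[OF hpoly_differentiable[OF assms]]
  by (simp add: continuous_at_imp_continuous_on)

lemma hpoly_measurable: "hpoly m f \<Longrightarrow> f \<in> borel_measurable borel"
  by (intro borel_measurable_continuous_onI hpoly_continuous)

text \<open>Divisibility of \<open>f - f \<circ> reflection \<alpha>\<close> by \<open>\<langle>\<alpha>, \<cdot>\<rangle>\<close>. For a product of a coordinate with \<open>f\<close> the quotient is
given by the Leibniz-like formula \<open>x\<^sub>i q + c f \<circ> reflection \<alpha>\<close>, where \<open>c\<close> is the quotient belonging to the
coordinate.\<close>

lemma hpoly_reflection_quotient:
  assumes "hpoly m f" and \<alpha>: "\<alpha> \<noteq> 0"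
  shows "\<exists>q. hpoly (m - 1) q \<and> (m = 0 \<longrightarrow> q = (\<lambda>x. 0)) \<and>
      (\<forall>x. f x - f (reflection \<alpha> x) = complex_of_real (\<alpha> \<bullet> x) * q x)"
  using assms(1)
proof (induction rule: hpoly.induct)
  case (hpoly_zero m)
  show ?case by (rule exI[of _ "\<lambda>x. 0"]) (auto intro: hpoly.intros)
next
  case (hpoly_const c)
  show ?case by (rule exI[of _ "\<lambda>x. 0"]) (auto intro: hpoly.intros)
next
  case (hpoly_coord m f i)
  then obtain q where q: "hpoly (m - 1) q" "m = 0 \<longrightarrow> q = (\<lambda>x. 0)"
    "\<forall>x. f x - f (reflection \<alpha> x) = complex_of_real (\<alpha> \<bullet> x) * q x" by blast
  define c where "c = complex_of_real (2 * \<alpha> $ i / (norm \<alpha>)\<^sup>2)"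
  let ?q = "\<lambda>x. complex_of_real (x $ i) * q x + c * f (reflection \<alpha> x)"
  have "hpoly (Suc m - 1) ?q"
  proof (cases m)
    case 0
    then show ?thesis using q(2) hpoly_coord(1) by (simp add: hpoly_cmult hpoly_reflection)
  next
    case (Suc n)
    then have "hpoly m (\<lambda>x. complex_of_real (x $ i) * q x)"
      using hpoly.hpoly_coord[OF q(1), of i] by simp
    then show ?thesis
      using hpoly_add[OF _ hpoly_cmult[OF hpoly_reflection[OF hpoly_coord(1)]]] by simp
  qed
  moreover have "complex_of_real (x $ i) * f x - complex_of_real (reflection \<alpha> x $ i) * f (reflection \<alpha> x)
      = complex_of_real (\<alpha> \<bullet> x) * ?q x" for x
  proof -
    have r: "complex_of_real (reflection \<alpha> x $ i) = complex_of_real (x $ i) - complex_of_real (\<alpha> \<bullet> x) * c"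
      by (simp add: reflection_def c_def)
    have "complex_of_real (x $ i) * f x - complex_of_real (reflection \<alpha> x $ i) * f (reflection \<alpha> x)
      = complex_of_real (x $ i) * (f x - f (reflection \<alpha> x))
        + complex_of_real (\<alpha> \<bullet> x) * c * f (reflection \<alpha> x)"
      unfolding r by (simp only: algebra_simps)
    then show ?thesis using q(3) by (simp only: distrib_left mult_ac)
  qed
  ultimately show ?case by (intro exI[of _ ?q]) auto
next
  case (hpoly_add m f g)
  then obtain q r where q: "hpoly (m - 1) q" "m = 0 \<longrightarrow> q = (\<lambda>x. 0)"
    "\<forall>x. f x - f (reflection \<alpha> x) = complex_of_real (\<alpha> \<bullet> x) * q x"
    and r: "hpoly (m - 1) r" "m = 0 \<longrightarrow> r = (\<lambda>x. 0)"
    "\<forall>x. g x - g (reflection \<alpha> x) = complex_of_real (\<alpha> \<bullet> x) * r x" by blast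
  have "f x + g x - (f (reflection \<alpha> x) + g (reflection \<alpha> x)) = complex_of_real (\<alpha> \<bullet> x) * (q x + r x)" for x
    using q(3) r(3) by (simp add: distrib_left flip: q(3) r(3))
  then show ?case
    by (intro exI[of _ "\<lambda>x. q x + r x"]) (use q r in \<open>auto intro: hpoly.hpoly_add\<close>)
qed

lemma
  assumes "hpoly m f" "\<alpha> \<noteq> 0"
  shows hpoly_quotient: "hpoly (m - 1) (reflection_quotient \<alpha> f)"
    and hpoly_quotient_0: "m = 0 \<Longrightarrow> reflection_quotient \<alpha> f x = 0"
    and hpoly_quotient_eq: "f x - f (reflection \<alpha> x) = complex_of_real (\<alpha> \<bullet> x) * reflection_quotient \<alpha> f x"
proof -
  obtain q where q: "hpoly (m - 1) q" "m = 0 \<longrightarrow> q = (\<lambda>x. 0)"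
    "\<forall>x. f x - f (reflection \<alpha> x) = complex_of_real (\<alpha> \<bullet> x) * q x"
    using hpoly_reflection_quotient[OF assms] by blast
  have eq: "reflection_quotient \<alpha> f = q"
    by (intro ext reflection_quotient_eqI assms hpoly_differentiable[OF assms(1)] hpoly_differentiable[OF q(1)])
      (use q(3) in blast)
  show "hpoly (m - 1) (reflection_quotient \<alpha> f)" using q eq by simp
  show "m = 0 \<Longrightarrow> reflection_quotient \<alpha> f x = 0" using q eq by simp
  show "f x - f (reflection \<alpha> x) = complex_of_real (\<alpha> \<bullet> x) * reflection_quotient \<alpha> f x" using q eq by simp
qed

lemma hpoly_dunkl_operator:
  assumes "hpoly m p" "0 \<notin> P" shows "hpoly (m - 1) (dunkl_operator P k \<xi> p)"
proof -
  have "hpoly (m - 1) (\<lambda>x. directional_deriv \<xi> p x + (\<Sum>\<alpha>\<in>P. complex_of_real (k \<alpha> * (\<alpha> \<bullet> \<xi>)) * reflection_quotient \<alpha> p x))"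
    using assms by (intro hpoly_add hpoly_sum hpoly_cmult hpoly_quotient hpoly_directional_deriv) auto
  then show ?thesis unfolding dunkl_operator_def[abs_def] .
qed

lemma hpoly_dunkl_operator_0:
  assumes "hpoly 0 p" "0 \<notin> P" shows "dunkl_operator P k \<xi> p x = 0"
proof -
  have "reflection_quotient \<alpha> p x = 0" if "\<alpha> \<in> P" for \<alpha>
    using hpoly_quotient_0[OF assms(1), of \<alpha> x] assms(2) that by (cases "\<alpha> = 0") auto
  then show ?thesis using hpoly_directional_deriv_0[OF assms(1)] by (simp add: dunkl_operator_def)
qed

lemma hpoly_dunkl_laplacian:
  assumes "hpoly m p" "0 \<notin> P" shows "hpoly (m - 2) (dunkl_laplacian P k p)"
proof -
  have "hpoly (m - 1 - 1) (dunkl_operator P k \<xi> (dunkl_operator P k \<xi> p))" for \<xi>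
    by (intro hpoly_dunkl_operator assms)
  then have "hpoly (m - 2) (\<lambda>x. \<Sum>\<xi>\<in>Basis. dunkl_operator P k \<xi> (dunkl_operator P k \<xi> p) x)"
    by (intro hpoly_sum) (simp add: numeral_2_eq_2)
  then show ?thesis unfolding dunkl_laplacian_def[abs_def] .
qed

lemma hpoly_dunkl_laplacian_0:
  assumes "hpoly m p" "0 \<notin> P" "m < 2" shows "dunkl_laplacian P k p x = 0"
proof -
  have "hpoly (m - 1) (dunkl_operator P k \<xi> p)" for \<xi> by (intro hpoly_dunkl_operator assms)
  moreover have "m - 1 = 0" using assms by simp
  ultimately have "dunkl_operator P k \<xi> (dunkl_operator P k \<xi> p) x = 0" for \<xi>
    by (intro hpoly_dunkl_operator_0 assms) simp
  then show ?thesis by (simp add: dunkl_laplacian_def)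
qed

lemma hpoly_prod_coords:
  "finite I \<Longrightarrow> hpoly (\<Sum>i\<in>I. e i) (\<lambda>x. complex_of_real (\<Prod>i\<in>I. (x $ i) ^ e i))"
proof (induction I rule: finite_induct)
  case empty then show ?case by (simp add: hpoly_const)
next
  case (insert i I)
  have "hpoly m f \<Longrightarrow> hpoly (n + m) (\<lambda>x. complex_of_real ((x $ i) ^ n) * f x)" for n m f
    by (induction n) (auto simp: mult.assoc intro: hpoly_coord)
  from this[OF insert.IH, of "e i"] show ?case using insert by simp
qed

text \<open>From right to left, a coordinate times a monomial is again a monomial, with the exponent vector raised
in one entry.\<close>

lemma hpoly_iff: "homogeneous_polynomials m = {f. hpoly m f}"
proof (intro set_eqI iffI)
  fix f :: "real^'n \<Rightarrow> complex"
  assume "f \<in> homogeneous_polynomials m"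
  then obtain S c where S: "finite S" "f = lincomb S c"
    "S \<subseteq> {\<lambda>x. complex_of_real (\<Prod>i\<in>UNIV. (x $ i) ^ e i) | e. (\<Sum>i\<in>UNIV. e i) = m}"
    unfolding homogeneous_polynomials_def by (rule complex_span_cases)
  have "hpoly m (lincomb S c)"
  proof (intro hpoly_sum hpoly_cmult)
    fix b assume "b \<in> S"
    then obtain e where "b = (\<lambda>x. complex_of_real (\<Prod>i\<in>UNIV. (x $ i) ^ e i))" "(\<Sum>i\<in>UNIV. e i) = m"
      using S(3) by blast
    then show "hpoly m b" using hpoly_prod_coords[of UNIV e] by simp
  qed
  then show "f \<in> {f. hpoly m f}" by (simp add: S(2))
next
  fix f :: "real^'n \<Rightarrow> complex"
  assume "f \<in> {f. hpoly m f}"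
  then have "hpoly m f" by simp
  then show "f \<in> homogeneous_polynomials m"
    unfolding homogeneous_polynomials_def
  proof (induction rule: hpoly.induct)
    case (hpoly_zero m) show ?case by (rule complex_span_zero)
  next
    case (hpoly_const c)
    have "(\<lambda>x::real^'n. 1) \<in> complex_span {\<lambda>x. complex_of_real (\<Prod>i\<in>UNIV. (x $ i) ^ e i) | e. (\<Sum>i\<in>UNIV. e i) = 0}"
      by (rule complex_span_superset, rule CollectI, rule exI[of _ "\<lambda>_. 0"]) simp
    from complex_span_cmult[OF this, of c] show ?case by simp
  next
    case (hpoly_coord m f i)
    then obtain S c where S: "finite S" "f = lincomb S c"
      "S \<subseteq> {\<lambda>x. complex_of_real (\<Prod>i\<in>UNIV. (x $ i) ^ e i) | e. (\<Sum>i\<in>UNIV. e i) = m}"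
      by (blast elim: complex_span_cases)
    have "(\<lambda>x. \<Sum>b\<in>S. c b * (complex_of_real (x $ i) * b x)) \<in>
        complex_span {\<lambda>x. complex_of_real (\<Prod>i\<in>UNIV. (x $ i) ^ e i) | e. (\<Sum>i\<in>UNIV. e i) = Suc m}"
    proof (intro complex_span_sum complex_span_cmult complex_span_superset CollectI)
      fix b assume "b \<in> S"
      then obtain e where e: "b = (\<lambda>x. complex_of_real (\<Prod>i\<in>UNIV. (x $ i) ^ e i))" "(\<Sum>i\<in>UNIV. e i) = m"
        using S(3) by blast
      have 1: "x $ i * (\<Prod>j\<in>UNIV. (x $ j) ^ e j) = (\<Prod>j\<in>UNIV. (x $ j) ^ (e(i := Suc (e i))) j)" for x :: "real^'n"
      proof -
        have "(\<Prod>j\<in>UNIV - {i}. (x $ j) ^ (e(i := Suc (e i))) j) = (\<Prod>j\<in>UNIV - {i}. (x $ j) ^ e j)"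
          by (intro prod.cong) auto
        then show ?thesis by (simp add: prod.remove[of UNIV i] mult.assoc)
      qed
      have 2: "(\<Sum>j\<in>UNIV. (e(i := Suc (e i))) j) = Suc m"
      proof -
        have "(\<Sum>j\<in>UNIV - {i}. (e(i := Suc (e i))) j) = (\<Sum>j\<in>UNIV - {i}. e j)"
          by (intro sum.cong) auto
        then show ?thesis using e(2) by (simp add: sum.remove[of UNIV i])
      qed
      show "\<exists>e'. (\<lambda>x. complex_of_real (x $ i) * b x) = (\<lambda>x. complex_of_real (\<Prod>j\<in>UNIV. (x $ j) ^ e' j)) \<and> sum e' UNIV = Suc m"
        unfolding e(1) of_real_mult[symmetric] 1 by (intro exI conjI) (rule HOL.refl, rule 2)
    qed
    moreover have "(\<lambda>x. complex_of_real (x $ i) * f x) = (\<lambda>x. \<Sum>b\<in>S. c b * (complex_of_real (x $ i) * b x))"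
      unfolding S(2) by (simp add: sum_distrib_left mult.left_commute)
    ultimately show ?case by simp
  next
    case (hpoly_add m f g)
    then show ?case by (intro complex_span_add)
  qed
qed

section \<open>The Dunkl Laplacian and harmonic polynomials\<close>

locale dunkl_setting =
  fixes R P :: "(real^'n) set" and k :: "real^'n \<Rightarrow> real"
  assumes R: "root_system R" and P: "positive_subsystem R P"
    and k: "multiplicity_function R k" and k_nonneg: "\<forall>\<alpha>\<in>R. k \<alpha> \<ge> 0"
begin

abbreviation T :: "real^'n \<Rightarrow> (real^'n \<Rightarrow> complex) \<Rightarrow> real^'n \<Rightarrow> complex" where
  "T \<equiv> dunkl_operator P k"

abbreviation Lap :: "(real^'n \<Rightarrow> complex) \<Rightarrow> real^'n \<Rightarrow> complex" where
  "Lap \<equiv> dunkl_laplacian P k"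

definition ksum :: real where "ksum = (\<Sum>\<alpha>\<in>P. k \<alpha>)"

text \<open>Twice the degree plus the homogeneous dimension \<open>N + 2 \<langle>k\<rangle>\<close> attached to the root system; polar
coordinates for \<open>\<bar>p\<bar>\<^sup>2\<close> times the weight have density \<open>r powr (hdim m - 1)\<close>, and the Dunkl Laplacian of
\<open>(norm x)\<^sup>2 * p x\<close> produces \<open>2 * hdim m\<close>.\<close>

definition hdim :: "nat \<Rightarrow> real" where "hdim m = 2 * real m + 2 * ksum + real CARD('n)"

lemma P_subset: "P \<subseteq> R" using P unfolding positive_subsystem_def by auto

lemma finite_R: "finite R" using R by (simp add: root_system_def)

lemma zero_notin_R: "0 \<notin> R" using R by (simp add: root_system_def)

lemma finite_P: "finite P" using finite_R P_subset by (rule finite_subset[rotated])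

lemma zero_notin_P: "0 \<notin> P" using zero_notin_R P_subset by auto

lemma ksum_nonneg: "ksum \<ge> 0"
  unfolding ksum_def using k_nonneg P_subset by (auto intro: sum_nonneg)

lemma hdim_pos: "hdim m > 0"
  unfolding hdim_def using ksum_nonneg by (simp add: add_nonneg_pos)

lemma Lap_diff:
  assumes "hpoly m p" "hpoly n q" shows "Lap (\<lambda>y. p y - q y) x = Lap p x - Lap q x"
proof -
  have T1: "T \<xi> (\<lambda>y. f y + (-1) * g y) x = T \<xi> f x + (-1) * T \<xi> g x" if "hpoly i f" "hpoly j g" for i j f g \<xi> x
    unfolding dunkl_operator_add[OF hpoly_differentiable[OF that(1)] hpoly_differentiable[OF hpoly_cmult[OF that(2)]]]
      dunkl_operator_cmult[OF hpoly_differentiable[OF that(2)]] ..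
  have "T \<xi> (T \<xi> (\<lambda>y. p y + (-1) * q y)) x = T \<xi> (T \<xi> p) x + (-1) * T \<xi> (T \<xi> q) x" for \<xi>
    unfolding T1[OF assms, abs_def]
    by (rule T1[OF hpoly_dunkl_operator[OF assms(1) zero_notin_P] hpoly_dunkl_operator[OF assms(2) zero_notin_P]])
  then show ?thesis by (simp add: dunkl_laplacian_def sum_subtractf)
qed

lemma Lap_cmult:
  assumes "hpoly m p" shows "Lap (\<lambda>y. c * p y) x = c * Lap p x"
proof -
  have T1: "T \<xi> (\<lambda>y. c * f y) x = c * T \<xi> f x" if "hpoly i f" for i f \<xi> x
    by (rule dunkl_operator_cmult[OF hpoly_differentiable[OF that]])
  have "T \<xi> (T \<xi> (\<lambda>y. c * p y)) x = c * T \<xi> (T \<xi> p) x" for \<xi>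
    unfolding T1[OF assms, abs_def] by (rule T1[OF hpoly_dunkl_operator[OF assms zero_notin_P]])
  then show ?thesis by (simp add: dunkl_laplacian_def sum_distrib_left)
qed

lemma differentiable_radial_mult:
  fixes x :: "real^'n"
  assumes "(\<gamma> has_real_derivative \<gamma>') (at ((norm x)\<^sup>2))" "p differentiable (at x)"
  shows "(\<lambda>y. complex_of_real (\<gamma> ((norm y)\<^sup>2)) * p y) differentiable (at x)"
  using has_derivative_mult[OF has_derivative_radial[OF assms(1)] has_derivative_directional[OF assms(2)]]
  unfolding differentiable_def by blast

lemma T_radial:
  fixes x :: "real^'n"
  assumes "hpoly m p" "(\<gamma> has_real_derivative \<gamma>') (at ((norm x)\<^sup>2))"
  shows "T \<xi> (\<lambda>y. complex_of_real (\<gamma> ((norm y)\<^sup>2)) * p y) x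
    = complex_of_real (\<gamma> ((norm x)\<^sup>2)) * T \<xi> p x + complex_of_real \<gamma>' * (2 * (complex_of_real (x \<bullet> \<xi>) * p x))"
  using dunkl_operator_radial[OF hpoly_differentiable[OF assms(1)] assms(2), of P k \<xi>] by simp

context
  fixes \<gamma> \<gamma>' \<gamma>'' :: "real \<Rightarrow> real" and Q :: "real set"
  assumes Q: "open Q" and \<gamma>': "\<And>q. q \<in> Q \<Longrightarrow> (\<gamma> has_real_derivative \<gamma>' q) (at q)"
    and \<gamma>'': "\<And>q. q \<in> Q \<Longrightarrow> (\<gamma>' has_real_derivative \<gamma>'' q) (at q)"
begin

lemma open_radial: "open {y::real^'n. (norm y)\<^sup>2 \<in> Q}"
  using open_vimage[OF Q, of "\<lambda>y::real^'n. (norm y)\<^sup>2"]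
  by (simp add: vimage_def continuous_intros)

lemma T_radial_differentiable:
  fixes x :: "real^'n"
  assumes p: "hpoly m p" and x: "(norm x)\<^sup>2 \<in> Q"
  shows "(T \<xi> (\<lambda>y. complex_of_real (\<gamma> ((norm y)\<^sup>2)) * p y)) differentiable (at x)"
proof -
  let ?F = "\<lambda>y. complex_of_real (\<gamma> ((norm y)\<^sup>2)) * T \<xi> p y + complex_of_real (\<gamma>' ((norm y)\<^sup>2)) * (2 * (complex_of_real (y \<bullet> \<xi>) * p y))"
  have "?F differentiable (at x)"
    by (intro differentiable_add differentiable_radial_mult[OF \<gamma>'[OF x]] differentiable_radial_mult[OF \<gamma>''[OF x]]
        hpoly_differentiable[OF hpoly_dunkl_operator[OF p zero_notin_P]]
        hpoly_differentiable[OF hpoly_cmult[OF hpoly_inner[OF p]]])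
  then obtain F' where F': "(?F has_derivative F') (at x)" by (auto simp: differentiable_def)
  have "(T \<xi> (\<lambda>y. complex_of_real (\<gamma> ((norm y)\<^sup>2)) * p y) has_derivative F') (at x)"
    by (rule has_derivative_transform_within_open[OF F' open_radial])
      (use x T_radial[OF p \<gamma>'] in auto)
  then show ?thesis unfolding differentiable_def by blast
qed

text \<open>Apply the radial Leibniz rule twice. The mixed terms are \<open>2 \<gamma>'\<close> times
\<open>\<Sum>\<^sub>j (T\<^sub>j x\<^sub>j + x\<^sub>j T\<^sub>j) p\<close>, which by \<open>dunkl_operator_coordinate_sum\<close> and Euler's identity is a scalar
multiple of \<open>p\<close>. Writing the radial factor as a function of the squared norm keeps it smooth away from the
origin and lets one lemma serve both the eigenfunctions and the factor \<open>(norm x)\<^sup>2\<close>.\<close>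

lemma Lap_radial:
  fixes x :: "real^'n"
  assumes p: "hpoly m p" and x: "(norm x)\<^sup>2 \<in> Q"
  shows "Lap (\<lambda>y. complex_of_real (\<gamma> ((norm y)\<^sup>2)) * p y) x
    = complex_of_real (\<gamma> ((norm x)\<^sup>2)) * Lap p x
    + complex_of_real (2 * hdim m * \<gamma>' ((norm x)\<^sup>2) + 4 * (norm x)\<^sup>2 * \<gamma>'' ((norm x)\<^sup>2)) * p x"
proof -
  let ?g = "complex_of_real (\<gamma> ((norm x)\<^sup>2))" and ?g1 = "complex_of_real (\<gamma>' ((norm x)\<^sup>2))"
    and ?g2 = "complex_of_real (\<gamma>'' ((norm x)\<^sup>2))"
  let ?h = "\<lambda>\<xi> y. 2 * (complex_of_real (y \<bullet> \<xi>) * p y)"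
  note Tp = hpoly_dunkl_operator[OF p zero_notin_P] and yp = hpoly_inner[OF p]
  note hp = hpoly_cmult[OF yp, of 2]
  have TT: "T \<xi> (T \<xi> (\<lambda>y. complex_of_real (\<gamma> ((norm y)\<^sup>2)) * p y)) x
    = ?g * T \<xi> (T \<xi> p) x + 2 * ?g1 * (T \<xi> (\<lambda>y. complex_of_real (y \<bullet> \<xi>) * p y) x + complex_of_real (x \<bullet> \<xi>) * T \<xi> p x)
      + 4 * ?g2 * p x * (complex_of_real (x \<bullet> \<xi>) * complex_of_real (x \<bullet> \<xi>))" for \<xi>
  proof -
    let ?F = "\<lambda>y. complex_of_real (\<gamma> ((norm y)\<^sup>2)) * T \<xi> p y + complex_of_real (\<gamma>' ((norm y)\<^sup>2)) * ?h \<xi> y"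
    have "T \<xi> (T \<xi> (\<lambda>y. complex_of_real (\<gamma> ((norm y)\<^sup>2)) * p y)) x = T \<xi> ?F x"
      by (rule dunkl_operator_cong[OF open_radial]) (use x T_radial[OF p \<gamma>'] in auto)
    also have "\<dots> = T \<xi> (\<lambda>y. complex_of_real (\<gamma> ((norm y)\<^sup>2)) * T \<xi> p y) x
        + T \<xi> (\<lambda>y. complex_of_real (\<gamma>' ((norm y)\<^sup>2)) * ?h \<xi> y) x"
      by (intro dunkl_operator_add differentiable_radial_mult[OF \<gamma>'[OF x]] differentiable_radial_mult[OF \<gamma>''[OF x]]
        hpoly_differentiable[OF Tp] hpoly_differentiable[OF hp])
    also have "\<dots> = (?g * T \<xi> (T \<xi> p) x + ?g1 * (2 * (complex_of_real (x \<bullet> \<xi>) * T \<xi> p x)))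
        + (?g1 * T \<xi> (?h \<xi>) x + ?g2 * (2 * (complex_of_real (x \<bullet> \<xi>) * ?h \<xi> x)))"
      by (simp only: T_radial[OF Tp \<gamma>'[OF x]] T_radial[OF hp \<gamma>''[OF x]])
    also have "T \<xi> (?h \<xi>) x = 2 * T \<xi> (\<lambda>y. complex_of_real (y \<bullet> \<xi>) * p y) x"
      by (rule dunkl_operator_cmult[OF hpoly_differentiable[OF yp]])
    finally show ?thesis by (simp add: algebra_simps)
  qed
  have "Lap (\<lambda>y. complex_of_real (\<gamma> ((norm y)\<^sup>2)) * p y) x
    = ?g * Lap p x + 2 * ?g1 * (\<Sum>\<xi>\<in>Basis. T \<xi> (\<lambda>y. complex_of_real (y \<bullet> \<xi>) * p y) x + complex_of_real (x \<bullet> \<xi>) * T \<xi> p x)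
      + 4 * ?g2 * p x * (\<Sum>\<xi>\<in>Basis. complex_of_real (x \<bullet> \<xi>) * complex_of_real (x \<bullet> \<xi>))"
    by (simp only: dunkl_laplacian_def TT distrib_left sum.distrib sum_distrib_left)
  also have "(\<Sum>\<xi>\<in>Basis. T \<xi> (\<lambda>y. complex_of_real (y \<bullet> \<xi>) * p y) x + complex_of_real (x \<bullet> \<xi>) * T \<xi> p x) = complex_of_real (hdim m) * p x"
    unfolding dunkl_operator_coordinate_sum[OF hpoly_differentiable[OF p] zero_notin_P] hpoly_euler[OF p]
    by (simp add: hdim_def ksum_def algebra_simps)
  also have "(\<Sum>\<xi>\<in>Basis. complex_of_real (x \<bullet> \<xi>) * complex_of_real (x \<bullet> \<xi>)) = complex_of_real ((norm x)\<^sup>2)"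
    unfolding power2_norm_eq_inner by (subst sum_Basis_inner[of x x, symmetric]) simp
  finally show ?thesis by (simp add: algebra_simps)
qed

end

lemma Lap_norm_sq:
  assumes p: "hpoly m p"
  shows "Lap (\<lambda>y. complex_of_real ((norm y)\<^sup>2) * p y) x
    = complex_of_real ((norm x)\<^sup>2) * Lap p x + complex_of_real (2 * hdim m) * p x"
  using Lap_radial[of UNIV "\<lambda>q. q" "\<lambda>q. 1" "\<lambda>q. 0", OF _ _ _ p] by simp

text \<open>Look for \<open>q' = (q - \<parallel>x\<parallel>\<^sup>2 r) / c\<close>; the equation says \<open>r = Lap q'\<close>, and applying the Laplacian to the ansatz
turns this into the same kind of equation for \<open>r\<close>, of degree two less and with \<open>c\<close> replaced by
\<open>c + 2 * hdim n\<close>. Positivity of the constant is preserved, so the recursion never meets a zero division.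
This replaces the usual argument with the positive definite Fischer form.\<close>

lemma fischer_solvable:
  assumes "c > 0" "hpoly m q"
  shows "\<exists>q'. hpoly m q' \<and> (\<forall>x. complex_of_real ((norm x)\<^sup>2) * Lap q' x + complex_of_real c * q' x = q x)"
  using assms
proof (induction m arbitrary: c q rule: less_induct)
  case (less m)
  let ?c = "complex_of_real c"
  have c: "?c \<noteq> 0" using less.prems by simp
  show ?case
  proof (cases "m < 2")
    case True
    have "hpoly m (\<lambda>x. (1 / ?c) * q x)" by (rule hpoly_cmult[OF less.prems(2)])
    then show ?thesis
      using c hpoly_dunkl_laplacian_0[OF _ zero_notin_P True] by (intro exI[of _ "\<lambda>x. (1 / ?c) * q x"]) simp
  next
    case False
    then obtain n where m: "m = n + 2" by (metis add.commute le_iff_add not_less)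
    have Lq: "hpoly n (Lap q)" using hpoly_dunkl_laplacian[OF less.prems(2) zero_notin_P, of k] by (simp add: m)
    obtain r where r: "hpoly n r"
      "\<And>x. complex_of_real ((norm x)\<^sup>2) * Lap r x + complex_of_real (c + 2 * hdim n) * r x = Lap q x"
      using less.IH[OF _ _ Lq, of "c + 2 * hdim n"] less.prems(1) hdim_pos[of n] m by auto
    let ?q = "\<lambda>x. (1 / ?c) * (q x - complex_of_real ((norm x)\<^sup>2) * r x)"
    have nr: "hpoly m (\<lambda>x. complex_of_real ((norm x)\<^sup>2) * r x)" unfolding m by (rule hpoly_norm_sq[OF r(1)])
    have d: "hpoly m (\<lambda>x. q x - complex_of_real ((norm x)\<^sup>2) * r x)"
      by (rule hpoly_diff[OF less.prems(2) nr])
    have "Lap ?q x = r x" for x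
      unfolding Lap_cmult[OF d] Lap_diff[OF less.prems(2) nr] Lap_norm_sq[OF r(1)]
      using r(2)[of x] c by (simp add: field_simps)
    then show ?thesis
      using hpoly_cmult[OF d, of "1 / ?c"] c by (intro exI[of _ ?q]) (simp add: field_simps)
  qed
qed

text \<open>The uniqueness counterpart, by the same recursion: \<open>q\<close> is \<open>\<parallel>x\<parallel>\<^sup>2\<close> times a multiple of \<open>Lap q\<close>, which solves
the equation in degree two less.\<close>

lemma fischer_injective:
  assumes "c > 0" "hpoly m q" "\<And>x. complex_of_real ((norm x)\<^sup>2) * Lap q x + complex_of_real c * q x = 0"
  shows "q x = 0"
  using assms
proof (induction m arbitrary: c q x rule: less_induct)
  case (less m)
  let ?c = "complex_of_real c"
  have c: "?c \<noteq> 0" using less.prems by simp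
  show ?case
  proof (cases "m < 2")
    case True
    then show ?thesis using less.prems(3)[of x] c hpoly_dunkl_laplacian_0[OF less.prems(2) zero_notin_P True] by simp
  next
    case False
    then obtain n where m: "m = n + 2" by (metis add.commute le_iff_add not_less)
    let ?r = "\<lambda>x. (- 1 / ?c) * Lap q x"
    have r: "hpoly n ?r" using hpoly_dunkl_laplacian[OF less.prems(2) zero_notin_P, of k] by (intro hpoly_cmult) (simp add: m)
    have q: "q = (\<lambda>x. complex_of_real ((norm x)\<^sup>2) * ?r x)"
    proof
      fix x
      have "?c * q x = - (complex_of_real ((norm x)\<^sup>2) * Lap q x)"
        using less.prems(3)[of x] by (simp add: add_eq_0_iff)
      then show "q x = complex_of_real ((norm x)\<^sup>2) * ?r x" using c by (simp add: field_simps)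
    qed
    have "complex_of_real ((norm y)\<^sup>2) * Lap ?r y + complex_of_real (c + 2 * hdim n) * ?r y = 0" for y
    proof -
      have "Lap q y = complex_of_real ((norm y)\<^sup>2) * Lap ?r y + complex_of_real (2 * hdim n) * ?r y"
        by (subst q) (rule Lap_norm_sq[OF r])
      moreover have "Lap q y = - (?c * ?r y)" using c by simp
      ultimately show ?thesis by (simp add: algebra_simps)
    qed
    from less.IH[OF _ _ r this] have "?r x = 0"
      using less.prems(1) hdim_pos[of n] by (simp add: m)
    then show ?thesis by (subst q) simp
  qed
qed

definition harmonic :: "nat \<Rightarrow> (real^'n \<Rightarrow> complex) \<Rightarrow> bool" where
  "harmonic m p \<longleftrightarrow> hpoly m p \<and> (\<forall>x. Lap p x = 0)"

lemma harmonic_iff: "p \<in> dunkl_harmonics P k m \<longleftrightarrow> harmonic m p"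
  by (simp add: dunkl_harmonics_def hpoly_iff harmonic_def)

lemma harmonic_low: "hpoly m p \<Longrightarrow> m < 2 \<Longrightarrow> harmonic m p"
  unfolding harmonic_def using hpoly_dunkl_laplacian_0[OF _ zero_notin_P] by blast

text \<open>\<open>q - \<parallel>x\<parallel>\<^sup>2 r\<close> is harmonic exactly when \<open>\<parallel>x\<parallel>\<^sup>2 Lap r + 2 * hdim n * r = Lap q\<close>, which is solvable by
\<open>fischer_solvable\<close>.\<close>

lemma fischer_decomposition:
  assumes "hpoly (n + 2) q"
  obtains p r where "harmonic (n + 2) p" "hpoly n r" "\<And>x. q x = p x + complex_of_real ((norm x)\<^sup>2) * r x"
proof -
  have Lq: "hpoly n (Lap q)" using hpoly_dunkl_laplacian[OF assms zero_notin_P, of k] by simp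
  have "2 * hdim n > 0" using hdim_pos[of n] by simp
  from fischer_solvable[OF this Lq] obtain r where r: "hpoly n r"
    "\<forall>x. complex_of_real ((norm x)\<^sup>2) * Lap r x + complex_of_real (2 * hdim n) * r x = Lap q x" by blast
  let ?p = "\<lambda>x. q x - complex_of_real ((norm x)\<^sup>2) * r x"
  have "Lap ?p x = 0" for x
    unfolding Lap_diff[OF assms hpoly_norm_sq[OF r(1)]] Lap_norm_sq[OF r(1)] using r(2) by simp
  then have "harmonic (n + 2) ?p"
    unfolding harmonic_def using hpoly_diff[OF assms hpoly_norm_sq[OF r(1)]] by blast
  then show thesis by (rule that[OF _ r(1)]) simp
qed

lemma hpoly_coord_power: "hpoly m (\<lambda>y. complex_of_real (y $ i) ^ m * c)"
  by (induction m) (auto simp: mult.assoc intro: hpoly_const hpoly_coord)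

text \<open>On the line every homogeneous polynomial of degree at least two is divisible by \<open>\<parallel>x\<parallel>\<^sup>2\<close>, and the
Laplacian is injective on such multiples.\<close>

lemma harmonic_trivial_dim1:
  assumes "CARD('n) = 1" "harmonic m p" "m \<ge> 2"
  shows "p x = 0"
proof -
  obtain n where m: "m = n + 2" using assms(3) by (metis add.commute le_iff_add)
  obtain i :: 'n where UNIV: "(UNIV :: 'n set) = {i}" using assms(1) by (auto simp: card_1_singleton_iff)
  have p: "hpoly m p" "Lap p y = 0" for y using assms(2) by (auto simp: harmonic_def)
  have x: "y = (y $ i) *\<^sub>R axis i 1" for y :: "real^'n"
    using UNIV by (auto simp: vec_eq_iff axis_def)
  have n: "(norm y)\<^sup>2 = (y $ i)\<^sup>2" for y :: "real^'n"
    unfolding power2_norm_eq_inner inner_vec_def UNIV by (simp add: power2_eq_square)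
  define r where "r y = complex_of_real (y $ i) ^ n * p (axis i 1)" for y :: "real^'n"
  have r: "hpoly n r" unfolding r_def[abs_def] by (rule hpoly_coord_power)
  have pr: "p = (\<lambda>y. complex_of_real ((norm y)\<^sup>2) * r y)"
  proof
    fix y
    have "p y = complex_of_real (y $ i) ^ m * p (axis i 1)"
      by (subst x) (rule hpoly_homogeneous[OF p(1)])
    then show "p y = complex_of_real ((norm y)\<^sup>2) * r y"
      unfolding n r_def by (simp add: m power_add power2_eq_square mult_ac)
  qed
  have "r x = 0"
  proof (rule fischer_injective[OF _ r])
    show "2 * hdim n > 0" using hdim_pos[of n] by simp
    show "complex_of_real ((norm y)\<^sup>2) * Lap r y + complex_of_real (2 * hdim n) * r y = 0" for y
      using p(2)[of y] by (subst (asm) pr) (simp only: Lap_norm_sq[OF r])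
  qed
  then show ?thesis by (subst pr) simp
qed

text \<open>Restriction to a real line extends to complex parameters, where \<open>\<parallel>x\<parallel>\<^sup>2\<close> may vanish.\<close>

lemma hpoly_line:
  "hpoly m f \<Longrightarrow> \<exists>q :: complex poly. \<forall>s::real. f (u + s *\<^sub>R v) = poly q (complex_of_real s)"
proof (induction rule: hpoly.induct)
  case (hpoly_zero m) show ?case by (rule exI[of _ 0]) simp
next
  case (hpoly_const c) show ?case by (rule exI[of _ "[:c:]"]) simp
next
  case (hpoly_coord m f i)
  then obtain q where "\<forall>s::real. f (u + s *\<^sub>R v) = poly q (complex_of_real s)" by blast
  then show ?case
    by (intro exI[of _ "[:complex_of_real (u $ i), complex_of_real (v $ i):] * q"]) (simp add: algebra_simps)
next
  case (hpoly_add m f g)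
  then obtain q r where "\<forall>s::real. f (u + s *\<^sub>R v) = poly q (complex_of_real s)"
    "\<forall>s::real. g (u + s *\<^sub>R v) = poly r (complex_of_real s)" by blast
  then show ?case by (intro exI[of _ "q + r"]) simp
qed

text \<open>In degree at least two, take the harmonic part of a power of a coordinate. If it were zero, the power would
be divisible by \<open>\<parallel>x\<parallel>\<^sup>2\<close>; on the line \<open>e\<^sub>i + s e\<^sub>j\<close> this reads \<open>1 = (1 + s\<^sup>2) q s\<close>, which is absurd at
\<open>s = \<i>\<close>.\<close>

lemma harmonic_exists:
  assumes "m < 2 \<or> CARD('n) \<ge> 2"
  obtains p x where "harmonic m p" "p x \<noteq> 0"
proof -
  obtain i :: 'n where True by blast
  have Qm: "hpoly m (\<lambda>y. complex_of_real (y $ i) ^ m)" for m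
    using hpoly_coord_power[of m i 1] by simp
  have Qx: "complex_of_real (axis i 1 $ i) ^ m \<noteq> 0" by (simp add: axis_def)
  show thesis
  proof (cases "m < 2")
    case True
    then show thesis using that[OF harmonic_low[OF Qm]] Qx by blast
  next
    case False
    then obtain n where m: "m = n + 2" by (metis add.commute le_iff_add not_less)
    have "CARD('n) \<ge> 2" using assms False by simp
    then obtain j :: 'n where ij: "j \<noteq> i"
      by (metis (full_types) UNIV_I card_2_iff' card_le_Suc0_iff_eq finite not_less_eq_eq numeral_2_eq_2)
    obtain p r where pr: "harmonic m p" "hpoly n r"
      "\<And>x. complex_of_real (x $ i) ^ m = p x + complex_of_real ((norm x)\<^sup>2) * r x"
      using fischer_decomposition Qm[of m] unfolding m by blast
    have "\<exists>x. p x \<noteq> 0"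
    proof (rule ccontr)
      assume "\<nexists>x. p x \<noteq> 0"
      then have p0: "p x = 0" for x by blast
      let ?v = "\<lambda>s. axis i 1 + s *\<^sub>R axis j 1 :: real^'n"
      obtain q where q: "\<forall>s. r (?v s) = poly q (complex_of_real s)" using hpoly_line[OF pr(2)] by blast
      have "poly ([:1, 0, 1:] * q - 1) (complex_of_real s) = 0" for s
      proof -
        have n: "(norm (?v s))\<^sup>2 = 1 + s * s"
          using ij unfolding power2_norm_eq_inner
          by (simp add: inner_add_left inner_add_right inner_axis_axis)
        have i: "?v s $ i = 1" using ij by (simp add: axis_def)
        have "1 = complex_of_real (1 + s * s) * poly q (complex_of_real s)"
          using pr(3)[of "?v s"] unfolding i n p0 spec[OF q, of s] by simp
        then show ?thesis by (simp add: algebra_simps)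
      qed
      then have "range complex_of_real \<subseteq> {z. poly ([:1, 0, 1:] * q - 1) z = 0}" by auto
      moreover have "infinite (range complex_of_real)"
        using finite_imageD[of complex_of_real UNIV] infinite_UNIV_char_0 by (auto simp: inj_on_def)
      ultimately have "[:1, 0, 1:] * q - 1 = 0" using poly_roots_finite finite_subset by blast
      \<comment> \<open>The polynomial \<open>(1 + s\<^sup>2) q s - 1\<close> vanishes for all real \<open>s\<close>, hence identically, but its value at \<open>\<i>\<close> is \<open>- 1\<close>.\<close>
      then have "poly ([:1, 0, 1:] * q - 1) \<i> = 0" by simp
      then show False by simp
    qed
    then show thesis using that pr(1) by blast
  qed
qed

end

section \<open>The Laguerre-type eigenfunctions\<close>

definition laguerre_poly :: "nat \<Rightarrow> real \<Rightarrow> real poly" where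
  "laguerre_poly l s = (\<Sum>j\<le>l. monom ((- 1) ^ j * Gamma (s + real l + 1) / (fact (l - j) * Gamma (s + real j + 1) * fact j)) j)"

lemma poly_laguerre: "poly (laguerre_poly l s) t = laguerre l s t"
  unfolding laguerre_poly_def laguerre_def by (simp add: poly_sum poly_monom mult.assoc)

lemma coeff_laguerre: "coeff (laguerre_poly l s) n =
  (if n \<le> l then (- 1) ^ n * Gamma (s + real l + 1) / (fact (l - n) * Gamma (s + real n + 1) * fact n) else 0)"
  unfolding laguerre_poly_def by (simp add: coeff_sum if_distrib cong: if_cong)

text \<open>The ratio of consecutive coefficients, with denominators cleared so that it also covers the indices at and
beyond the degree. The bound on \<open>s\<close> keeps the Gamma function away from its poles.\<close>

lemma laguerre_recurrence:
  assumes "s > -1"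
  shows "real (Suc n) * (s + real n + 1) * coeff (laguerre_poly l s) (Suc n) + (real l - real n) * coeff (laguerre_poly l s) n = 0"
proof (cases "n < l")
  case True
  then obtain d where d: "l = Suc (n + d)" by (metis less_iff_Suc_add)
  define G where "G = Gamma (s + real n + 1)"
  have pos: "s + real n + 1 > 0" using assms by simp
  then have "Gamma (s + real n + 1 + 1) = (s + real n + 1) * Gamma (s + real n + 1)"
    by (intro Gamma_plus1) (auto simp: nonpos_Ints_def)
  then have G: "Gamma (s + real (Suc n) + 1) = (s + real n + 1) * G" by (simp add: add_ac G_def)
  have nz: "G \<noteq> 0" using Gamma_real_pos[OF pos] by (simp add: G_def)
  have "coeff (laguerre_poly l s) (Suc n) = - ((- 1) ^ n * Gamma (s + real l + 1) / (fact d * ((s + real n + 1) * G) * (real (Suc n) * fact n)))"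
    using True unfolding coeff_laguerre G by (simp add: d)
  moreover have "coeff (laguerre_poly l s) n = (- 1) ^ n * Gamma (s + real l + 1) / (real (Suc d) * fact d * G * fact n)"
    using True by (simp add: coeff_laguerre d Suc_diff_le G_def)
  moreover have "real l - real n = real (Suc d)" by (simp add: d)
  moreover have "S * w * (- (A / (F * (w * G) * (S * f)))) + D * (A / (D * F * G * f)) = 0"
    if "S \<noteq> 0" "w \<noteq> 0" "F \<noteq> 0" "f \<noteq> 0" "D \<noteq> 0" for S w A F f D :: real
    using that nz by (simp add: field_simps)
  from this[of "real (Suc n)" "s + real n + 1" "fact d" "fact n" "real (Suc d)" "(- 1) ^ n * Gamma (s + real l + 1)"]
  have "real (Suc n) * (s + real n + 1) * (- ((- 1) ^ n * Gamma (s + real l + 1) / (fact d * ((s + real n + 1) * G) * (real (Suc n) * fact n))))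
      + real (Suc d) * ((- 1) ^ n * Gamma (s + real l + 1) / (real (Suc d) * fact d * G * fact n)) = 0"
    using pos by simp
  ultimately show ?thesis by (simp only:)
next
  case False
  then show ?thesis by (cases "n = l") (auto simp: coeff_laguerre)
qed

text \<open>Laguerre's equation \<open>t L'' + (s + 1 - t) L' + l L = 0\<close> as an identity of polynomials.\<close>

lemma laguerre_ode:
  assumes "s > -1"
  shows "[:0, 1:] * pderiv (pderiv (laguerre_poly l s)) + [:s + 1, -1:] * pderiv (laguerre_poly l s)
    + smult (real l) (laguerre_poly l s) = 0"
proof (rule poly_eqI)
  fix n
  let ?c = "coeff (laguerre_poly l s)"
  have 1: "coeff ([:0, 1:] * pderiv (pderiv (laguerre_poly l s))) n = real n * real (Suc n) * ?c (Suc n)"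
    by (cases n) (auto simp: coeff_pderiv coeff_pCons)
  have 2: "coeff ([:s + 1, -1:] * pderiv (laguerre_poly l s)) n = (s + 1) * real (Suc n) * ?c (Suc n) - real n * ?c n"
    by (cases n) (auto simp: coeff_pderiv coeff_pCons algebra_simps)
  show "coeff ([:0, 1:] * pderiv (pderiv (laguerre_poly l s)) + [:s + 1, -1:] * pderiv (laguerre_poly l s)
    + smult (real l) (laguerre_poly l s)) n = coeff 0 n"
    unfolding coeff_add 1 2 using laguerre_recurrence[OF assms, of n l] by (simp add: algebra_simps)
qed

lemma sq_powr:
  assumes "r \<ge> 0" shows "(r\<^sup>2) powr (a / 2) = r powr (a::real)"
proof (cases "r = 0")
  case False
  then have "r\<^sup>2 = r powr 2" using assms by (simp add: powr_numeral)
  then show ?thesis by (simp add: powr_powr)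
qed simp

locale dunkl_ka = dunkl_setting R P k for R P :: "(real^'n) set" and k :: "real^'n \<Rightarrow> real" +
  fixes a :: real
  assumes a_pos: "a > 0" and a_ksum: "a + 2 * ksum + real CARD('n) - 2 > 0"
begin

definition laguerre_index :: "nat \<Rightarrow> real" where "laguerre_index m = (hdim m - 2) / a"

lemma lambda_eq: "lambda_kam P k a m = laguerre_index m"
  by (simp add: lambda_kam_def laguerre_index_def hdim_def ksum_def)

lemma laguerre_index_gt: "laguerre_index m > -1"
  unfolding laguerre_index_def hdim_def using a_pos a_ksum by (simp add: field_simps)

definition eigval :: "nat \<Rightarrow> nat \<Rightarrow> real" where
  "eigval l m = - (2 * a * real l + hdim m - 2 + a)"

definition profile :: "nat \<Rightarrow> nat \<Rightarrow> real \<Rightarrow> real" where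
  "profile l m r = laguerre l (laguerre_index m) (2 / a * r powr a) * exp (- (r powr a) / a)"

definition Phi :: "nat \<Rightarrow> nat \<Rightarrow> (real^'n \<Rightarrow> complex) \<Rightarrow> real^'n \<Rightarrow> complex" where
  "Phi l m p x = p x * complex_of_real (profile l m (norm x))"

lemma W_eq: "W_ka P k a = complex_span {Phi l m p | l m p. harmonic m p}"
  unfolding W_ka_def Phi_def[abs_def] profile_def lambda_eq harmonic_iff ..

text \<open>The argument of the Laguerre polynomial as a function of \<open>q = (norm x)\<^sup>2\<close>.\<close>

definition radial_var :: "real \<Rightarrow> real" where "radial_var q = 2 / a * q powr (a / 2)"

text \<open>The derivative with respect to \<open>t\<close> of \<open>L t * exp (- t / 2)\<close>, with \<open>L\<close> the Laguerre polynomial.\<close>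

definition psi1 :: "nat \<Rightarrow> nat \<Rightarrow> real \<Rightarrow> real" where
  "psi1 l m t = (poly (pderiv (laguerre_poly l (laguerre_index m))) t - poly (laguerre_poly l (laguerre_index m)) t / 2) * exp (- t / 2)"

text \<open>The second derivative of the same function.\<close>

definition psi2 :: "nat \<Rightarrow> nat \<Rightarrow> real \<Rightarrow> real" where
  "psi2 l m t = (poly (pderiv (pderiv (laguerre_poly l (laguerre_index m)))) t - poly (pderiv (laguerre_poly l (laguerre_index m))) t
      + poly (laguerre_poly l (laguerre_index m)) t / 4) * exp (- t / 2)"

context
  fixes l m :: nat
begin

private abbreviation L :: "real poly" where "L \<equiv> laguerre_poly l (laguerre_index m)"
private abbreviation \<gamma> :: "real \<Rightarrow> real" where "\<gamma> q \<equiv> poly L (radial_var q) * exp (- radial_var q / 2)"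
private abbreviation \<gamma>' :: "real \<Rightarrow> real" where "\<gamma>' q \<equiv> a / 2 * radial_var q / q * psi1 l m (radial_var q)"
private abbreviation \<gamma>'' :: "real \<Rightarrow> real" where
  "\<gamma>'' q \<equiv> a / 2 / q\<^sup>2 * radial_var q * (a / 2 * (psi1 l m (radial_var q) + radial_var q * psi2 l m (radial_var q)) - psi1 l m (radial_var q))"

lemma profile_sq: "r \<ge> 0 \<Longrightarrow> profile l m r = \<gamma> (r\<^sup>2)"
  using a_pos by (simp add: profile_def poly_laguerre sq_powr radial_var_def)

lemma radial_var_deriv: assumes "q > 0" shows "(radial_var has_real_derivative a / 2 * radial_var q / q) (at q)"
  unfolding radial_var_def[abs_def] using a_pos assms
  by (intro DERIV_cong[OF DERIV_cmult[OF has_real_derivative_powr]]) (auto simp: powr_diff)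

lemma gamma_deriv:
  assumes "q > 0" shows "(\<gamma> has_real_derivative \<gamma>' q) (at q)"
proof -
  have "((\<lambda>t. poly L t * exp (- t / 2)) has_real_derivative psi1 l m t) (at t)" for t
    by (auto intro!: derivative_eq_intros simp: psi1_def algebra_simps)
  from DERIV_chain2[OF this radial_var_deriv[OF assms]] show ?thesis by (simp add: mult.commute)
qed

lemma psi1_deriv: "(psi1 l m has_real_derivative psi2 l m t) (at t)"
  unfolding psi1_def[abs_def]
  by (auto intro!: derivative_eq_intros simp: psi2_def field_simps)

lemma gamma'_deriv:
  assumes "q > 0" shows "(\<gamma>' has_real_derivative \<gamma>'' q) (at q)"
proof -
  have "((\<lambda>t. a / 2 * t * psi1 l m t) has_real_derivative a / 2 * (psi1 l m t + t * psi2 l m t)) (at t)" for t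
    by (rule DERIV_cong[OF DERIV_mult[OF DERIV_cmult_Id psi1_deriv]]) (simp only: distrib_left mult_ac)
  from DERIV_chain2[OF this radial_var_deriv[OF assms]]
  have D: "((\<lambda>q. a / 2 * radial_var q * psi1 l m (radial_var q)) has_real_derivative
      a / 2 * (psi1 l m (radial_var q) + radial_var q * psi2 l m (radial_var q)) * (a / 2 * radial_var q / q)) (at q)" .
  have gen: "(A * (a / 2 * U / q) * q - a / 2 * U * B * 1) / (q * q) = a / 2 / q\<^sup>2 * U * (A - B)" for A B U :: real
    using assms by (simp add: divide_simps power2_eq_square) (simp add: algebra_simps)
  have "((\<lambda>q. a / 2 * radial_var q * psi1 l m (radial_var q) / q) has_real_derivative \<gamma>'' q) (at q)"
    by (rule DERIV_cong[OF DERIV_divide[OF D DERIV_ident]], use assms in simp, rule gen)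
  then show ?thesis by (simp only: times_divide_eq_left)
qed

text \<open>Laguerre's equation for \<open>L t * exp (- t / 2)\<close>: the exponential removes the first-order term
\<open>- t L'\<close> and produces the potential \<open>t / 4\<close>. For \<open>t = 2 / a * norm x powr a\<close>, \<open>2 * a\<close> times this is the potential
\<open>norm x powr a\<close>.\<close>

lemma psi_ode: "2 * a * (t * psi2 l m t + (laguerre_index m + 1) * psi1 l m t) - a / 2 * t * (poly L t * exp (- t / 2))
    = eigval l m * (poly L t * exp (- t / 2))"
proof -
  have "poly ([:0, 1:] * pderiv (pderiv L) + [:laguerre_index m + 1, -1:] * pderiv L + smult (real l) L) t = 0"
    unfolding laguerre_ode[OF laguerre_index_gt] by simp
  then have ode: "t * poly (pderiv (pderiv L)) t = - (laguerre_index m + 1 - t) * poly (pderiv L) t - real l * poly L t"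
    by (simp add: algebra_simps)
  have "2 * a * (t * (poly (pderiv (pderiv L)) t - poly (pderiv L) t + poly L t / 4) + (laguerre_index m + 1) * (poly (pderiv L) t - poly L t / 2))
      - a / 2 * t * poly L t
    = 2 * a * (t * poly (pderiv (pderiv L)) t + (laguerre_index m + 1 - t) * poly (pderiv L) t) - a * (laguerre_index m + 1) * poly L t"
    by (simp add: algebra_simps)
  also have "\<dots> = - (2 * a * real l + a * laguerre_index m + a) * poly L t" unfolding ode by (simp add: algebra_simps)
  also have "a * laguerre_index m = hdim m - 2" using a_pos by (simp add: laguerre_index_def)
  finally have "2 * a * (t * (poly (pderiv (pderiv L)) t - poly (pderiv L) t + poly L t / 4) + (laguerre_index m + 1) * (poly (pderiv L) t - poly L t / 2))
      - a / 2 * t * poly L t = eigval l m * poly L t"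
    by (simp add: eigval_def algebra_simps)
  from arg_cong[OF this, of "\<lambda>z. z * exp (- t / 2)"]
  show ?thesis unfolding psi1_def psi2_def by (simp add: algebra_simps)
qed

lemma Phi_radial: "Phi l m p = (\<lambda>y. complex_of_real (\<gamma> ((norm y)\<^sup>2)) * p y)"
  by (intro ext) (simp only: Phi_def profile_sq[OF norm_ge_zero] mult.commute)

lemma Phi_differentiable:
  assumes p: "hpoly m p" and x: "x \<noteq> 0"
  shows "Phi l m p differentiable (at x)" "T \<xi> (Phi l m p) differentiable (at x)"
proof -
  have q: "(norm x)\<^sup>2 > 0" using x by simp
  show "Phi l m p differentiable (at x)"
    unfolding Phi_radial by (rule differentiable_radial_mult[OF gamma_deriv[OF q] hpoly_differentiable[OF p]])
  show "T \<xi> (Phi l m p) differentiable (at x)"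
    unfolding Phi_radial
    by (rule T_radial_differentiable[where Q = "{0<..}" and \<gamma>'' = \<gamma>'', OF _ gamma_deriv gamma'_deriv p]) (use q in auto)
qed

text \<open>\<open>Lap_radial\<close> with \<open>Lap p = 0\<close> leaves an ordinary differential operator in \<open>q = (norm x)\<^sup>2\<close>. In terms of the
Laguerre variable, multiplication with \<open>norm x powr (2 - a)\<close> cancels the power of \<open>q\<close>, and what remains is
\<open>psi_ode\<close>. The origin is excluded because \<open>norm x powr a\<close> need not be twice differentiable there.\<close>

lemma Phi_eigenfunction:
  assumes p: "harmonic m p" and x: "x \<noteq> 0"
  shows "Delta_ka P k a (Phi l m p) x = complex_of_real (eigval l m) * Phi l m p x"
proof -
  define q where "q = (norm x)\<^sup>2"
  have q: "q > 0" using x by (simp add: q_def)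
  define U where "U = radial_var q"
  have U: "U > 0" using q a_pos by (simp add: U_def radial_var_def)
  have hp: "hpoly m p" "Lap p x = 0" using p by (auto simp: harmonic_def)
  have "Lap (Phi l m p) x = complex_of_real (2 * hdim m * (a / 2 * U / q * psi1 l m U)
     + 4 * q * (a / 2 / q\<^sup>2 * U * (a / 2 * (psi1 l m U + U * psi2 l m U) - psi1 l m U))) * p x"
    unfolding Phi_radial U_def q_def
    by (subst Lap_radial[where Q = "{0<..}" and \<gamma>'' = \<gamma>'', OF _ gamma_deriv gamma'_deriv hp(1)]) (use q in \<open>auto simp: hp q_def\<close>)
  also have "2 * hdim m * (a / 2 * U / q * psi1 l m U) + 4 * q * (a / 2 / q\<^sup>2 * U * (a / 2 * (psi1 l m U + U * psi2 l m U) - psi1 l m U))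
     = a * U / q * (a * U * psi2 l m U + (hdim m - 2 + a) * psi1 l m U)"
  proof -
    have "2 * h * (a / 2 * U / q * A) + 4 * q * (a / 2 / q\<^sup>2 * U * (a / 2 * (A + U * B) - A))
       = a * U / q * (a * U * B + (h - 2 + a) * A)" for A B h
      using q by (simp add: divide_simps power2_eq_square) (simp add: algebra_simps)
    then show ?thesis .
  qed
  also have "hdim m - 2 + a = a * (laguerre_index m + 1)" using a_pos by (simp add: laguerre_index_def field_simps)
  finally have Lp: "Lap (Phi l m p) x = complex_of_real (a * U / q * (a * U * psi2 l m U + a * (laguerre_index m + 1) * psi1 l m U)) * p x" .
  have r1: "norm x powr a = a / 2 * U"
    using a_pos sq_powr[of "norm x" a] by (simp add: U_def q_def radial_var_def)
  have r2: "norm x powr (2 - a) = q * 2 / (a * U)"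
  proof -
    have "norm x powr (2 - a) = norm x powr 2 / norm x powr a" by (rule powr_diff)
    also have "norm x powr 2 = q" using x by (simp add: q_def powr_numeral)
    finally show ?thesis unfolding r1 by simp
  qed
  have Ph: "Phi l m p x = complex_of_real (poly L U * exp (- U / 2)) * p x"
    unfolding Phi_radial U_def q_def ..
  have "Delta_ka P k a (Phi l m p) x
    = complex_of_real (q * 2 / (a * U) * (a * U / q * (a * U * psi2 l m U + a * (laguerre_index m + 1) * psi1 l m U))
        - a / 2 * U * (poly L U * exp (- U / 2))) * p x"
    unfolding Delta_ka_def r1 r2 Lp Ph by (simp only: of_real_mult of_real_diff left_diff_distrib mult.assoc)
  also have "q * 2 / (a * U) * (a * U / q * (a * U * psi2 l m U + a * (laguerre_index m + 1) * psi1 l m U))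
     = 2 * a * (U * psi2 l m U + (laguerre_index m + 1) * psi1 l m U)"
  proof -
    have "q * 2 / (a * U) * (a * U / q * (a * U * B + a * h * A)) = 2 * a * (U * B + h * A)" for A B h
      using q U a_pos by (simp add: field_simps)
    then show ?thesis .
  qed
  also have "2 * a * (U * psi2 l m U + (laguerre_index m + 1) * psi1 l m U) - a / 2 * U * (poly L U * exp (- U / 2)) = eigval l m * (poly L U * exp (- U / 2))"
    by (rule psi_ode)
  finally show ?thesis unfolding Ph by (simp only: of_real_mult mult.assoc)
qed

end

text \<open>The operator is linear on the span of the eigenfunctions. This has to be argued pointwise away from the
origin, as derivatives are only additive for differentiable functions.\<close>

lemma Delta_lincomb:
  assumes "finite S" "\<And>b. b \<in> S \<Longrightarrow> \<exists>l m p. harmonic m p \<and> b = Phi l m p" and x: "x \<noteq> 0"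
  shows "Delta_ka P k a (lincomb S c) x = (\<Sum>b\<in>S. c b * Delta_ka P k a b x)"
proof -
  have d: "b differentiable (at y)" "T \<xi> b differentiable (at y)" if b: "b \<in> S" and y: "y \<noteq> 0" for b y \<xi>
  proof -
    obtain l m p where p: "harmonic m p" "b = Phi l m p" using assms(2)[OF b] by blast
    then have "hpoly m p" by (simp add: harmonic_def)
    from Phi_differentiable[OF this y] show "b differentiable (at y)" "T \<xi> b differentiable (at y)"
      unfolding p(2) by blast+
  qed
  have "T \<xi> (T \<xi> (lincomb S c)) x = (\<Sum>b\<in>S. c b * T \<xi> (T \<xi> b) x)" for \<xi>
  proof -
    have "T \<xi> (T \<xi> (lincomb S c)) x = T \<xi> (\<lambda>y. \<Sum>b\<in>S. c b * T \<xi> b y) x"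
    proof (rule dunkl_operator_cong[of "- {0}"])
      show "T \<xi> (lincomb S c) y = (\<Sum>b\<in>S. c b * T \<xi> b y)" if "y \<in> - {0}" for y
        using that d by (intro dunkl_operator_sum assms) auto
      show "reflection \<alpha> x \<in> - {0}" for \<alpha> using x norm_reflection[of \<alpha> x] by (metis Compl_iff norm_eq_zero singletonD)
    qed (use x in auto)
    also have "\<dots> = (\<Sum>b\<in>S. c b * T \<xi> (T \<xi> b) x)"
      using x d by (intro dunkl_operator_sum assms) auto
    finally show ?thesis .
  qed
  then have "Lap (lincomb S c) x = (\<Sum>\<xi>\<in>Basis. \<Sum>b\<in>S. c b * T \<xi> (T \<xi> b) x)"
    by (simp add: dunkl_laplacian_def)
  also have "\<dots> = (\<Sum>b\<in>S. c b * Lap b x)"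
    by (subst sum.swap) (simp add: dunkl_laplacian_def sum_distrib_left)
  finally show ?thesis
    unfolding Delta_ka_def by (simp add: sum_distrib_left sum_subtractf[symmetric] right_diff_distrib mult.left_commute)
qed

end

section \<open>Radial integrals\<close>

text \<open>From \<open>(y / n) ^ n \<le> exp y\<close> with \<open>y = b * r powr a\<close> and \<open>n\<close> large.\<close>

lemma exp_powr_bound:
  fixes a b \<kappa> :: real
  assumes "a > 0" "b > 0"
  obtains C where "C \<ge> 0" "\<And>r. r \<ge> 1 \<Longrightarrow> exp (- b * r powr a) \<le> C * r powr (- \<kappa>)"
proof -
  define n where "n = Suc (nat \<lceil>\<kappa> / a\<rceil>)"
  have n: "n > 0" "a * real n \<ge> \<kappa>"
  proof -
    have "\<kappa> / a \<le> real n" unfolding n_def by linarith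
    then show "a * real n \<ge> \<kappa>" using assms(1) by (simp add: pos_divide_le_eq mult.commute)
  qed (simp add: n_def)
  show thesis
  proof (rule that[of "(real n / b) ^ n"])
    show "0 \<le> (real n / b) ^ n" using assms by simp
    fix r :: real assume r: "r \<ge> 1"
    define y where "y = b * r powr a"
    have y: "y > 0" using assms r by (simp add: y_def)
    have "y / real n \<le> exp (y / real n)" using exp_ge_add_one_self[of "y / real n"] by linarith
    then have "(y / real n) ^ n \<le> exp (y / real n) ^ n" using y by (intro power_mono) auto
    also have "\<dots> = exp y" using n by (simp add: exp_of_nat_mult[symmetric])
    finally have "exp (- y) \<le> inverse ((y / real n) ^ n)"
      using y n by (simp add: exp_minus le_imp_inverse_le)
    also have "\<dots> = (real n / b) ^ n * r powr (- (a * real n))"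
      using r assms n by (simp add: y_def power_divide power_mult_distrib powr_minus powr_powr[symmetric] powr_realpow field_simps)
    also have "\<dots> \<le> (real n / b) ^ n * r powr (- \<kappa>)"
      using r n assms by (intro mult_left_mono powr_mono) auto
    finally show "exp (- b * r powr a) \<le> (real n / b) ^ n * r powr (- \<kappa>)" by (simp add: y_def)
  qed
qed

lemma integrable_lborelI_nonneg:
  fixes f :: "real \<Rightarrow> real"
  assumes "f \<in> borel_measurable borel" "\<And>x. x \<in> S \<Longrightarrow> 0 \<le> f x" "S \<in> sets borel" "f integrable_on S"
  shows "set_integrable lborel S f"
proof -
  have "set_integrable lebesgue S f"
    using assms by (intro nonnegative_absolutely_integrable_1) auto
  then show ?thesis unfolding set_integrable_def
    using assms by (subst (asm) integrable_completion) auto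
qed

lemma powr_exp_integrable:
  fixes a b c :: real
  assumes "a > 0" "b > 0" "c > 0"
  shows "set_integrable lborel {0<..} (\<lambda>r. r powr (c - 1) * exp (- b * r powr a))"
proof -
  obtain C where C: "C \<ge> 0" "\<And>r. r \<ge> 1 \<Longrightarrow> exp (- b * r powr a) \<le> C * r powr (- (c + 1))"
    using exp_powr_bound[OF assms(1,2)] by blast
  have 1: "set_integrable lborel {0..1} (\<lambda>r::real. r powr (c - 1))"
    using assms by (intro integrable_lborelI_nonneg integrable_on_powr_from_0) auto
  have "(\<lambda>r::real. r powr (-2)) integrable_on {1..}"
    using has_integral_powr_to_inf[of "-2" 1] by (intro has_integral_integrable) auto
  then have 2: "set_integrable lborel {1..} (\<lambda>r::real. r powr (-2))"
    by (intro integrable_lborelI_nonneg) auto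
  show ?thesis
    unfolding set_integrable_def
  proof (rule Bochner_Integration.integrable_bound)
    show "integrable lborel (\<lambda>r. indicator {0..1} r *\<^sub>R r powr (c - 1) + C * (indicator {1..} r *\<^sub>R r powr (-2)))"
      using 1 2 unfolding set_integrable_def by (intro Bochner_Integration.integrable_add integrable_mult_right)
    show "AE r in lborel. norm (indicator {0<..} r *\<^sub>R (r powr (c - 1) * exp (- b * r powr a)))
      \<le> norm (indicator {0..1} r *\<^sub>R r powr (c - 1) + C * (indicator {1..} r *\<^sub>R r powr (-2)))"
    proof (intro AE_I2)
      fix r :: real
      consider "r \<le> 0" | "0 < r" "r \<le> 1" | "r > 1" by linarith
      then show "norm (indicator {0<..} r *\<^sub>R (r powr (c - 1) * exp (- b * r powr a)))
        \<le> norm (indicator {0..1} r *\<^sub>R r powr (c - 1) + C * (indicator {1..} r *\<^sub>R r powr (-2)))"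
      proof cases
        case 1 then show ?thesis by simp
      next
        case 2
        have "norm (indicator {0<..} r *\<^sub>R (r powr (c - 1) * exp (- b * r powr a))) = r powr (c - 1) * exp (- b * r powr a)"
          using 2 by simp
        also have "\<dots> \<le> r powr (c - 1)"
          using assms by (intro mult_left_le) auto
        also have "\<dots> \<le> norm (indicator {0..1} r *\<^sub>R r powr (c - 1) + C * (indicator {1..} r *\<^sub>R r powr (-2)))"
        proof -
          have "0 \<le> C * (indicator {1..} r *\<^sub>R r powr (-2))" using C by simp
          then show ?thesis using 2 by simp
        qed
        finally show ?thesis .
      next
        case 3
        have "r powr (c - 1) * exp (- b * r powr a) \<le> r powr (c - 1) * (C * r powr (- (c + 1)))"
          using 3 C by (intro mult_left_mono) auto
        also have "\<dots> = C * r powr (-2)" using 3 by (simp add: powr_add[symmetric])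
        finally show ?thesis using 3 C by simp
      qed
    qed
  qed measurable
qed

text \<open>Reduces a polynomial in \<open>r powr a\<close> to monomials, for which integrability and limits are known.\<close>

lemma poly_powr_expand:
  fixes a c d r E :: real
  assumes "r > 0"
  shows "(\<Sum>i\<le>degree p. (coeff p i * d ^ i) * (r powr (c + a * real i) * E)) = r powr c * (poly p (d * r powr a) * E)"
proof -
  have "r powr (c + a * real i) = r powr c * (r powr a) ^ i" for i
  proof -
    have "(r powr a) ^ i = (r powr a) powr real i" using assms by (intro powr_realpow[symmetric]) auto
    also have "\<dots> = r powr (a * real i)" by (rule powr_powr)
    finally show ?thesis by (simp add: powr_add)
  qed
  then show ?thesis
    by (simp add: poly_altdef sum_distrib_left sum_distrib_right power_mult_distrib mult_ac)
qed

lemma poly_exp_integrable: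
  fixes a b c :: real
  assumes "a > 0" "b > 0" "c > 0"
  shows "set_integrable lborel {0<..} (\<lambda>r. r powr (c - 1) * (poly p (d * r powr a) * exp (- b * r powr a)))"
proof -
  have "set_integrable lborel {0<..} (\<lambda>r. (coeff p i * d ^ i) * (r powr ((c + a * real i) - 1) * exp (- b * r powr a)))" for i
    using assms by (intro set_integrable_mult_right powr_exp_integrable) (auto intro: add_pos_nonneg)
  then have "integrable lborel (\<lambda>r. \<Sum>i\<le>degree p. indicator {0<..} r *\<^sub>R ((coeff p i * d ^ i) * (r powr ((c + a * real i) - 1) * exp (- b * r powr a))))"
    unfolding set_integrable_def by (intro Bochner_Integration.integrable_sum)
  then have "set_integrable lborel {0<..} (\<lambda>r. \<Sum>i\<le>degree p. (coeff p i * d ^ i) * (r powr ((c - 1) + a * real i) * exp (- b * r powr a)))"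
    unfolding set_integrable_def scaleR_sum_right by (simp add: algebra_simps)
  also have "?this \<longleftrightarrow> set_integrable lborel {0<..} (\<lambda>r. r powr (c - 1) * (poly p (d * r powr a) * exp (- b * r powr a)))"
    by (intro set_integrable_cong HOL.refl poly_powr_expand) auto
  finally show ?thesis .
qed

text \<open>The integrand is \<open>1 / a\<close> times the derivative of \<open>r powr c * poly p (b r powr a) * exp (- b r powr a)\<close>, which tends
to \<open>0\<close> at both ends of the half-line. The condition \<open>c > 0\<close> is needed at the origin.\<close>

lemma radial_total_derivative:
  fixes a b c :: real and p :: "real poly"
  assumes "a > 0" "b > 0" "c > 0"
  shows "(LINT r:{0<..}|lborel. r powr (c - 1) *
      (poly (smult (c / a) p + [:0, 1:] * pderiv p - [:0, 1:] * p) (b * r powr a) * exp (- b * r powr a))) = 0"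
proof -
  let ?s = "\<lambda>r. b * r powr a"
  let ?q = "smult (c / a) p + [:0, 1:] * pderiv p - [:0, 1:] * p"
  let ?F = "\<lambda>r. r powr c * (poly p (?s r) * exp (- ?s r))"
  let ?f = "\<lambda>r. a * (r powr (c - 1) * (poly ?q (?s r) * exp (- b * r powr a)))"
  have int: "set_integrable lborel {0<..} ?f"
    by (intro set_integrable_mult_right poly_exp_integrable assms)
  have "(LBINT r=ereal 0..\<infinity>. ?f r) = 0 - 0"
  proof (rule interval_integral_FTC_integrable)
    fix x :: real assume x: "ereal 0 < ereal x" "ereal x < \<infinity>"
    then have x0: "x > 0" by simp
    have s: "(?s has_real_derivative a * ?s x / x) (at x)"
      using x0 by (intro DERIV_cong[OF DERIV_cmult[OF has_real_derivative_powr]]) (auto simp: powr_diff)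
    have "((\<lambda>t. poly p t * exp (- t)) has_real_derivative (poly (pderiv p) t - poly p t) * exp (- t)) (at t)" for t
      by (auto intro!: derivative_eq_intros simp: algebra_simps)
    note 1 = DERIV_chain2[OF this s]
    have "(?F has_real_derivative c * x powr (c - 1) * (poly p (?s x) * exp (- ?s x))
        + ((poly (pderiv p) (?s x) - poly p (?s x)) * exp (- ?s x)) * (a * ?s x / x) * x powr c) (at x)"
      by (rule DERIV_mult[OF has_real_derivative_powr[OF x0] 1])
    moreover have w: "x powr c = x powr (c - 1) * x" using x0 by (simp add: powr_diff)
    have gen: "c * w * (P * E) + ((P' - P) * E) * (a * S / x) * (w * x) = a * (w * ((c / a * P + S * P' - S * P) * E))"
      for w P P' E S :: real
      using assms x0 by (simp add: field_simps)
    ultimately have "(?F has_real_derivative ?f x) (at x)"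
      unfolding w using gen[of "x powr (c - 1)" "poly p (?s x)" "exp (- ?s x)" "poly (pderiv p) (?s x)" "?s x"] by simp
    then show "(?F has_vector_derivative ?f x) (at x)"
      by (simp add: has_real_derivative_iff_has_vector_derivative)
    show "isCont ?f x" using x0 by (intro continuous_intros) auto
  next
    show "set_integrable lborel (einterval (ereal 0) \<infinity>) ?f"
      using int by (simp add: einterval_def greaterThan_def)
    have "((\<lambda>r. r powr c * (poly p (?s r) * exp (- ?s r))) \<longlongrightarrow> 0 * (poly p (b * 0) * exp (- (b * 0)))) (at_right 0)"
    proof (intro tendsto_mult tendsto_poly tendsto_exp tendsto_minus tendsto_const)
      have t: "((\<lambda>r. r powr e) \<longlongrightarrow> 0) (at_right 0)" if "e > 0" for e :: real
        using that tendsto_powr[of "\<lambda>r. r" 0 "at_right 0" "\<lambda>_. e" e]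
        by (auto intro!: tendsto_eq_intros simp: eventually_at_right_less eventually_at_filter)
      show "((\<lambda>r. r powr c) \<longlongrightarrow> 0) (at_right 0)" by (rule t) (rule assms)
      show "((\<lambda>r. r powr a) \<longlongrightarrow> 0) (at_right 0)" "((\<lambda>r. r powr a) \<longlongrightarrow> 0) (at_right 0)" by (rule t, rule assms)+
    qed
    then show "((?F \<circ> real_of_ereal) \<longlongrightarrow> 0) (at_right (ereal 0))"
      by (simp add: ereal_tendsto_simps)
    have "((\<lambda>r. \<Sum>i\<le>degree p. (coeff p i * b ^ i) * (r powr (c + a * real i) * exp (- b * r powr a))) \<longlongrightarrow> (\<Sum>i\<le>degree p. (coeff p i * b ^ i) * 0)) at_top"
    proof (intro tendsto_sum tendsto_mult tendsto_const)
      fix i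
      obtain C where C: "C \<ge> 0" "\<And>r. r \<ge> 1 \<Longrightarrow> exp (- b * r powr a) \<le> C * r powr (- (c + a * real i + 1))"
        using exp_powr_bound[OF assms(1,2)] by blast
      have l: "((\<lambda>r::real. C * r powr (-1)) \<longlongrightarrow> C * 0) at_top"
        by (intro tendsto_mult tendsto_const tendsto_neg_powr filterlim_ident) auto
      show "((\<lambda>r. r powr (c + a * real i) * exp (- b * r powr a)) \<longlongrightarrow> 0) at_top"
      proof (rule Lim_null_comparison)
        show "((\<lambda>r::real. C * r powr (-1)) \<longlongrightarrow> 0) at_top" using l by simp
        show "\<forall>\<^sub>F r in at_top. norm (r powr (c + a * real i) * exp (- b * r powr a)) \<le> C * r powr (-1)"
          using eventually_ge_at_top[of 1]
        proof eventually_elim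
          case (elim r)
          have "r powr (c + a * real i) * exp (- b * r powr a) \<le> r powr (c + a * real i) * (C * r powr (- (c + a * real i + 1)))"
            using C(2)[OF elim] by (intro mult_left_mono) auto
          also have "\<dots> = C * (r powr (c + a * real i) * r powr (- (c + a * real i + 1)))" by simp
          also have "r powr (c + a * real i) * r powr (- (c + a * real i + 1)) = r powr (-1)"
            by (simp only: powr_add[symmetric]) simp
          finally show ?case by simp
        qed
      qed
    qed
    then have "((\<lambda>r. \<Sum>i\<le>degree p. (coeff p i * b ^ i) * (r powr (c + a * real i) * exp (- b * r powr a))) \<longlongrightarrow> 0) at_top"
      by simp
    also have "?this \<longleftrightarrow> (?F \<longlongrightarrow> 0) at_top"
    proof (rule tendsto_cong)
      show "\<forall>\<^sub>F r in at_top. (\<Sum>i\<le>degree p. (coeff p i * b ^ i) * (r powr (c + a * real i) * exp (- b * r powr a))) = ?F r"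
        using eventually_gt_at_top[of 0] by eventually_elim (simp only: poly_powr_expand mult_minus_left)
    qed
    finally show "((?F \<circ> real_of_ereal) \<longlongrightarrow> 0) (at_left \<infinity>)"
      by (simp add: ereal_tendsto_simps)
  qed auto
  then have "(LINT r:{0<..}|lborel. ?f r) = 0"
    by (simp add: interval_lebesgue_integral_def einterval_def greaterThan_def)
  then show ?thesis using assms(1) by simp
qed

section \<open>Polar coordinates for homogeneous densities\<close>

lemma nn_integral_lborel_scaleR:
  fixes f :: "'a::euclidean_space \<Rightarrow> ennreal"
  assumes [measurable]: "f \<in> borel_measurable borel" and "c > 0"
  shows "(\<integral>\<^sup>+x. f x \<partial>lborel) = ennreal (c ^ DIM('a)) * (\<integral>\<^sup>+x. f (c *\<^sub>R x) \<partial>lborel)"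
  using assms(2)
  by (subst lborel_affine[of c 0]) (auto simp: nn_integral_density nn_integral_distr nn_integral_cmult)

text \<open>Homogeneity determines the mass of every ball up to the mass \<open>K0\<close> of the unit ball: the ball of
radius \<open>r\<close> has mass \<open>K0 * r powr d\<close>. Hence the image measure under the norm has density
\<open>K0 * d * r powr (d - 1)\<close>. This gives polar coordinates for a fixed angular factor without a surface
measure on the sphere.\<close>

lemma polar_measure:
  fixes h :: "'a::euclidean_space \<Rightarrow> real" and d :: real
  assumes [measurable]: "h \<in> borel_measurable borel" and nn: "\<And>x. h x \<ge> 0"
    and hom: "\<And>c x. c > 0 \<Longrightarrow> h (c *\<^sub>R x) = c powr (d - real DIM('a)) * h x"
    and bd: "\<And>x. norm x \<le> 1 \<Longrightarrow> h x \<le> C" and d: "d > 0"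
  obtains K where "K \<ge> 0"
    "distr (density lborel (\<lambda>x. ennreal (h x))) borel norm
      = density lborel (\<lambda>r. ennreal (K * (indicator {0<..} r * r powr (d - 1))))"
proof -
  have [measurable]: "cball (0::'a) r \<in> sets borel" for r by simp
  define I where "I = (\<integral>\<^sup>+x. ennreal (h x) * indicator (cball 0 1) x \<partial>lborel)"
  have "I \<le> (\<integral>\<^sup>+x. ennreal (max C 0) * indicator (cball (0::'a) 1) x \<partial>lborel)"
    unfolding I_def by (intro nn_integral_mono) (auto simp: indicator_def intro!: ennreal_leI max.coboundedI1 bd)
  also have "\<dots> < \<infinity>"
    using emeasure_lborel_cball_finite[of "0::'a" 1]
    by (simp add: nn_integral_cmult_indicator ennreal_mult_less_top)
  finally obtain K0 where K0: "K0 \<ge> 0" "I = ennreal K0" by (cases I) auto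
  define K where "K = K0 * d"
  have K: "K \<ge> 0" using K0 d by (simp add: K_def)
  let ?M = "distr (density lborel (\<lambda>x. ennreal (h x))) borel norm"
  let ?N = "density lborel (\<lambda>r. ennreal (K * (indicator {0<..} r * r powr (d - 1))))"
  have eM: "emeasure ?M {..r} = (\<integral>\<^sup>+x. ennreal (h x) * indicator (cball 0 r) x \<partial>lborel)" for r
  proof -
    have "norm -` {..r} = cball (0::'a) r" by auto
    then show ?thesis by (simp add: emeasure_distr emeasure_density)
  qed
  have eq: "emeasure ?M {..r} = emeasure ?N {..r} \<and> emeasure ?M {..r} < \<infinity>" for r
  proof (cases "r > 0")
    case False
    have "(\<integral>\<^sup>+x. ennreal (h x) * indicator (cball 0 r) x \<partial>lborel) = (\<integral>\<^sup>+x. 0 \<partial>(lborel :: 'a measure))"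
    proof (rule nn_integral_cong_AE)
      show "AE x in lborel. ennreal (h x) * indicator (cball 0 r) x = 0"
        using AE_lborel_singleton[of 0]
      proof eventually_elim
        case (elim x)
        then have "norm x > 0" by simp
        then have "\<not> norm x \<le> r" using False by linarith
        then show ?case by (simp add: indicator_def)
      qed
    qed
    moreover have "emeasure ?N {..r} = 0"
    proof -
      have "emeasure ?N {..r} = (\<integral>\<^sup>+s. 0 \<partial>(lborel :: real measure))"
        using False by (subst emeasure_density, measurable, intro nn_integral_cong) (auto simp: indicator_def)
      then show ?thesis by simp
    qed
    ultimately show ?thesis unfolding eM by simp
  next
    case True
    have "emeasure ?M {..r} = ennreal (r ^ DIM('a)) * (\<integral>\<^sup>+x. ennreal (h (r *\<^sub>R x)) * indicator (cball 0 r) (r *\<^sub>R x) \<partial>lborel)"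
      unfolding eM by (rule nn_integral_lborel_scaleR) (use True in auto)
    also have "(\<integral>\<^sup>+x. ennreal (h (r *\<^sub>R x)) * indicator (cball 0 r) (r *\<^sub>R x) \<partial>lborel)
       = (\<integral>\<^sup>+x. ennreal (r powr (d - real DIM('a))) * (ennreal (h x) * indicator (cball 0 1) x) \<partial>lborel)"
    proof (intro nn_integral_cong)
      fix x :: 'a
      have "indicator (cball 0 r) (r *\<^sub>R x) = (indicator (cball 0 1) x :: ennreal)"
        using True by (auto simp: indicator_def)
      then show "ennreal (h (r *\<^sub>R x)) * indicator (cball 0 r) (r *\<^sub>R x)
         = ennreal (r powr (d - real DIM('a))) * (ennreal (h x) * indicator (cball 0 1) x)"
        using True nn by (simp add: hom ennreal_mult mult.assoc)
    qed
    also have "\<dots> = ennreal (r powr (d - real DIM('a))) * I" unfolding I_def by (intro nn_integral_cmult) simp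
    also have "ennreal (r ^ DIM('a)) * (ennreal (r powr (d - real DIM('a))) * I) = ennreal (K0 * r powr d)"
      unfolding K0 using True K0 by (simp add: ennreal_mult[symmetric] powr_realpow[symmetric] powr_add[symmetric] mult.assoc[symmetric] mult.commute)
    finally have 1: "emeasure ?M {..r} = ennreal (K0 * r powr d)" .
    have hi: "((\<lambda>s. K * s powr (d - 1)) has_integral K * (r powr (d - 1 + 1) / (d - 1 + 1))) {0..r}"
      using d True by (intro has_integral_mult_right has_integral_powr_from_0) auto
    have "emeasure ?N {..r} = (\<integral>\<^sup>+s. ennreal (K * s powr (d - 1)) * indicator {0..r} s \<partial>lborel)"
      by (subst emeasure_density, measurable, intro nn_integral_cong) (auto simp: indicator_def)
    also have "\<dots> = ennreal (K * (r powr (d - 1 + 1) / (d - 1 + 1)))"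
    proof -
      have "(\<lambda>s. indicator {0..r} s * (K * s powr (d - 1))) = (\<lambda>s. if s \<in> {0..r} then K * s powr (d - 1) else 0)"
        by (auto simp: indicator_def)
      then have "((\<lambda>s. indicator {0..r} s * (K * s powr (d - 1))) has_integral K * (r powr (d - 1 + 1) / (d - 1 + 1))) UNIV"
        using hi by (simp only: has_integral_restrict_UNIV)
      then have "(\<integral>\<^sup>+s. ennreal (indicator {0..r} s * (K * s powr (d - 1))) \<partial>lborel) = ennreal (K * (r powr (d - 1 + 1) / (d - 1 + 1)))"
        using K by (intro nn_integral_has_integral_lborel) auto
      moreover have "ennreal (K * s powr (d - 1)) * indicator {0..r} s = ennreal (indicator {0..r} s * (K * s powr (d - 1)))" for s
        by (auto simp: indicator_def)
      ultimately show ?thesis by simp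
    qed
    also have "K * (r powr (d - 1 + 1) / (d - 1 + 1)) = K0 * r powr d" using d by (simp add: K_def)
    finally show ?thesis using 1 by simp
  qed
  have "?M = ?N"
  proof (rule measure_eqI_generator_eq[where E = "range (\<lambda>r. {..r::real})" and \<Omega> = UNIV and A = "\<lambda>i. {..real i}"])
    show "Int_stable (range (\<lambda>r. {..r::real}))" by (auto simp: Int_stable_def)
    have "sets (borel :: real measure) = sigma_sets UNIV (range (\<lambda>r. {..r}))"
      by (subst borel_eq_atMost) (simp add: sets_measure_of)
    then show "sets ?M = sigma_sets UNIV (range (\<lambda>r. {..r::real}))" "sets ?N = sigma_sets UNIV (range (\<lambda>r. {..r::real}))"
      by (simp_all only: sets_density sets_distr sets_lborel)
    show "(\<Union>i. {..real i}) = UNIV" using real_arch_simple by auto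
    show "emeasure ?M {..real i} \<noteq> \<infinity>" for i
      using conjunct2[OF eq[of "real i"]] by (rule less_imp_neq)
    show "emeasure ?M X = emeasure ?N X" if "X \<in> range (\<lambda>r. {..r::real})" for X using that eq by blast
  qed blast+
  then show thesis using that K by blast
qed

text \<open>The constant is the same for all radial functions \<open>\<phi>\<close>; the whole orthogonality argument depends on
this uniformity.\<close>

lemma polar_integral_nonneg:
  fixes h :: "'a::euclidean_space \<Rightarrow> real" and d :: real
  assumes [measurable]: "h \<in> borel_measurable borel" and nn: "\<And>x. h x \<ge> 0"
    and hom: "\<And>c x. c > 0 \<Longrightarrow> h (c *\<^sub>R x) = c powr (d - real DIM('a)) * h x"
    and bd: "\<And>x. norm x \<le> 1 \<Longrightarrow> h x \<le> C" and d: "d > 0"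
  obtains K :: real where "\<And>\<phi> :: real \<Rightarrow> real. \<phi> \<in> borel_measurable borel \<Longrightarrow>
    set_integrable lborel {0<..} (\<lambda>r. \<phi> r * r powr (d - 1)) \<Longrightarrow>
    has_bochner_integral lborel (\<lambda>x. h x * \<phi> (norm x)) (K * (LINT r:{0<..}|lborel. \<phi> r * r powr (d - 1)))"
proof -
  obtain K where K: "K \<ge> 0" and eq: "distr (density lborel (\<lambda>x. ennreal (h x))) borel norm
      = density lborel (\<lambda>r. ennreal (K * (indicator {0<..} r * r powr (d - 1))))"
    by (rule polar_measure[OF assms])
  show thesis
  proof (rule that[of K])
    fix \<phi> :: "real \<Rightarrow> real"
    assume [measurable]: "\<phi> \<in> borel_measurable borel"
      and int: "set_integrable lborel {0<..} (\<lambda>r. \<phi> r * r powr (d - 1))"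
    let ?g = "\<lambda>r. K * (indicator {0<..} r * r powr (d - 1))"
    have g: "AE r in lborel. 0 \<le> ?g r" using K by auto
    have e: "(\<lambda>r. ?g r *\<^sub>R \<phi> r) = (\<lambda>r. K *\<^sub>R (indicator {0<..} r *\<^sub>R (\<phi> r * r powr (d - 1))))"
      by (auto simp: indicator_def)
    have "integrable lborel (\<lambda>r. ?g r *\<^sub>R \<phi> r)"
      unfolding e using int unfolding set_integrable_def by (intro integrable_scaleR_right)
    then have "integrable (density lborel (\<lambda>r. ennreal (?g r))) \<phi>"
      using g by (subst integrable_density) auto
    then have "integrable (density lborel (\<lambda>x. ennreal (h x))) (\<lambda>x. \<phi> (norm x))"
      unfolding eq[symmetric] by (subst (asm) integrable_distr_eq) auto
    then have 1: "integrable lborel (\<lambda>x. h x * \<phi> (norm x))"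
      using nn by (subst (asm) integrable_density) auto
    have "(\<integral>x. h x * \<phi> (norm x) \<partial>lborel) = (\<integral>x. \<phi> (norm x) \<partial>density lborel (\<lambda>x. ennreal (h x)))"
      using nn by (subst integral_density) auto
    also have "\<dots> = integral\<^sup>L (distr (density lborel (\<lambda>x. ennreal (h x))) borel norm) \<phi>"
      by (subst integral_distr) auto
    also have "\<dots> = (\<integral>r. ?g r *\<^sub>R \<phi> r \<partial>lborel)"
      unfolding eq using g by (subst integral_density) auto
    also have "\<dots> = K * (LINT r:{0<..}|lborel. \<phi> r * r powr (d - 1))"
      unfolding e set_lebesgue_integral_def by simp
    finally show "has_bochner_integral lborel (\<lambda>x. h x * \<phi> (norm x)) (K * (LINT r:{0<..}|lborel. \<phi> r * r powr (d - 1)))"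
      using 1 by (simp add: has_bochner_integral_iff)
  qed
qed

text \<open>Positive and negative parts of a homogeneous function are homogeneous of the same degree.\<close>

lemma polar_integral_real:
  fixes h :: "'a::euclidean_space \<Rightarrow> real" and d :: real
  assumes [measurable]: "h \<in> borel_measurable borel"
    and hom: "\<And>c x. c > 0 \<Longrightarrow> h (c *\<^sub>R x) = c powr (d - real DIM('a)) * h x"
    and bd: "\<And>x. norm x \<le> 1 \<Longrightarrow> \<bar>h x\<bar> \<le> C" and d: "d > 0"
  obtains K :: real where "\<And>\<phi> :: real \<Rightarrow> real. \<phi> \<in> borel_measurable borel \<Longrightarrow>
    set_integrable lborel {0<..} (\<lambda>r. \<phi> r * r powr (d - 1)) \<Longrightarrow>
    has_bochner_integral lborel (\<lambda>x. h x * \<phi> (norm x)) (K * (LINT r:{0<..}|lborel. \<phi> r * r powr (d - 1)))"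
proof -
  have hom1: "max 0 (h (c *\<^sub>R x)) = c powr (d - real DIM('a)) * max 0 (h x)" if "c > 0" for c x
    using hom[OF that, of x] by (auto simp: max_def mult_le_0_iff zero_le_mult_iff)
  have hom2: "max 0 (- h (c *\<^sub>R x)) = c powr (d - real DIM('a)) * max 0 (- h x)" if "c > 0" for c x
    using hom[OF that, of x] by (auto simp: max_def mult_le_0_iff zero_le_mult_iff)
  obtain K1 :: real where K1: "\<And>\<phi> :: real \<Rightarrow> real. \<phi> \<in> borel_measurable borel \<Longrightarrow>
    set_integrable lborel {0<..} (\<lambda>r. \<phi> r * r powr (d - 1)) \<Longrightarrow>
    has_bochner_integral lborel (\<lambda>x. max 0 (h x) * \<phi> (norm x)) (K1 * (LINT r:{0<..}|lborel. \<phi> r * r powr (d - 1)))"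
    by (rule polar_integral_nonneg[of "\<lambda>x. max 0 (h x)" d "max 0 C"]) (use hom1 bd d in \<open>auto dest!: bd simp: abs_le_iff\<close>)
  obtain K2 :: real where K2: "\<And>\<phi> :: real \<Rightarrow> real. \<phi> \<in> borel_measurable borel \<Longrightarrow>
    set_integrable lborel {0<..} (\<lambda>r. \<phi> r * r powr (d - 1)) \<Longrightarrow>
    has_bochner_integral lborel (\<lambda>x. max 0 (- h x) * \<phi> (norm x)) (K2 * (LINT r:{0<..}|lborel. \<phi> r * r powr (d - 1)))"
    by (rule polar_integral_nonneg[of "\<lambda>x. max 0 (- h x)" d "max 0 C"]) (use hom2 bd d in \<open>auto dest!: bd simp: abs_le_iff\<close>)
  show thesis
  proof (rule that[of "K1 - K2"])
    fix \<phi> :: "real \<Rightarrow> real"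
    assume \<phi>: "\<phi> \<in> borel_measurable borel" "set_integrable lborel {0<..} (\<lambda>r. \<phi> r * r powr (d - 1))"
    have "(\<lambda>x. max 0 (h x) * \<phi> (norm x) - max 0 (- h x) * \<phi> (norm x)) = (\<lambda>x. h x * \<phi> (norm x))"
      by (auto simp: max_def)
    then show "has_bochner_integral lborel (\<lambda>x. h x * \<phi> (norm x)) ((K1 - K2) * (LINT r:{0<..}|lborel. \<phi> r * r powr (d - 1)))"
      using has_bochner_integral_diff[OF K1[OF \<phi>] K2[OF \<phi>]] by (simp add: left_diff_distrib)
  qed
qed

lemma polar_integral:
  fixes h :: "'a::euclidean_space \<Rightarrow> complex" and d :: real
  assumes [measurable]: "h \<in> borel_measurable borel"
    and hom: "\<And>c x. c > 0 \<Longrightarrow> h (c *\<^sub>R x) = complex_of_real (c powr (d - real DIM('a))) * h x"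
    and bd: "\<And>x. norm x \<le> 1 \<Longrightarrow> cmod (h x) \<le> C" and d: "d > 0"
  obtains K :: complex where "\<And>\<phi> :: real \<Rightarrow> real. \<phi> \<in> borel_measurable borel \<Longrightarrow>
    set_integrable lborel {0<..} (\<lambda>r. \<phi> r * r powr (d - 1)) \<Longrightarrow>
    has_bochner_integral lborel (\<lambda>x. h x * complex_of_real (\<phi> (norm x)))
      (K * complex_of_real (LINT r:{0<..}|lborel. \<phi> r * r powr (d - 1)))"
proof -
  have bRe: "\<bar>Re (h x)\<bar> \<le> C" and bIm: "\<bar>Im (h x)\<bar> \<le> C" if "norm x \<le> 1" for x
    using bd[OF that] abs_Re_le_cmod[of "h x"] abs_Im_le_cmod[of "h x"] by linarith+
  obtain K1 :: real where K1: "\<And>\<phi> :: real \<Rightarrow> real. \<phi> \<in> borel_measurable borel \<Longrightarrow>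
    set_integrable lborel {0<..} (\<lambda>r. \<phi> r * r powr (d - 1)) \<Longrightarrow>
    has_bochner_integral lborel (\<lambda>x. Re (h x) * \<phi> (norm x)) (K1 * (LINT r:{0<..}|lborel. \<phi> r * r powr (d - 1)))"
    by (rule polar_integral_real[of "\<lambda>x. Re (h x)" d C]) (use hom bRe d in \<open>auto\<close>)
  obtain K2 :: real where K2: "\<And>\<phi> :: real \<Rightarrow> real. \<phi> \<in> borel_measurable borel \<Longrightarrow>
    set_integrable lborel {0<..} (\<lambda>r. \<phi> r * r powr (d - 1)) \<Longrightarrow>
    has_bochner_integral lborel (\<lambda>x. Im (h x) * \<phi> (norm x)) (K2 * (LINT r:{0<..}|lborel. \<phi> r * r powr (d - 1)))"
    by (rule polar_integral_real[of "\<lambda>x. Im (h x)" d C]) (use hom bIm d in \<open>auto\<close>)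
  show thesis
  proof (rule that[of "complex_of_real K1 + \<i> * complex_of_real K2"])
    fix \<phi> :: "real \<Rightarrow> real"
    assume \<phi>: "\<phi> \<in> borel_measurable borel" "set_integrable lborel {0<..} (\<lambda>r. \<phi> r * r powr (d - 1))"
    let ?I = "LINT r:{0<..}|lborel. \<phi> r * r powr (d - 1)"
    have 1: "has_bochner_integral lborel (\<lambda>x. complex_of_real (Re (h x) * \<phi> (norm x))) (complex_of_real (K1 * ?I))"
      by (rule has_bochner_integral_of_real[OF K1[OF \<phi>]])
    have "has_bochner_integral lborel (\<lambda>x. complex_of_real (Im (h x) * \<phi> (norm x))) (complex_of_real (K2 * ?I))"
      by (rule has_bochner_integral_of_real[OF K2[OF \<phi>]])
    then have 2: "has_bochner_integral lborel (\<lambda>x. \<i> * complex_of_real (Im (h x) * \<phi> (norm x))) (\<i> * complex_of_real (K2 * ?I))"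
      by (intro has_bochner_integral_mult_right) auto
    have e: "complex_of_real (Re (h x) * \<phi> (norm x)) + \<i> * complex_of_real (Im (h x) * \<phi> (norm x))
      = h x * complex_of_real (\<phi> (norm x))" for x
      by (simp add: complex_eq_iff)
    show "has_bochner_integral lborel (\<lambda>x. h x * complex_of_real (\<phi> (norm x)))
      ((complex_of_real K1 + \<i> * complex_of_real K2) * complex_of_real ?I)"
      using has_bochner_integral_add[OF 1 2] unfolding e by (simp add: distrib_right mult.assoc)
  qed
qed

section \<open>Reflections and directional derivatives under the Lebesgue integral\<close>

text \<open>Averaging over translations. Integrate \<open>g x * f (T y + x)\<close> over both variables, where \<open>g\<close> is the indicator
of the unit ball: integrating first over \<open>y\<close> and using \<open>T y + x = T (y + T x)\<close> gives
\<open>\<integral> g\<close> times \<open>\<integral> f \<circ> T\<close>, while translating \<open>x\<close> by \<open>T y\<close> first gives \<open>\<integral> g\<close> times \<open>\<integral> f\<close>, because the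
ball is invariant under \<open>T\<close>. No determinant is involved.\<close>

lemma lborel_distr_involution:
  fixes T :: "'a::euclidean_space \<Rightarrow> 'a"
  assumes lin: "linear T" and inv: "\<And>x. T (T x) = x" and iso: "\<And>x. norm (T x) = norm x"
  shows "distr lborel borel T = lborel"
proof -
  have T[measurable]: "T \<in> borel_measurable borel"
    using lin by (intro borel_measurable_continuous_onI linear_continuous_on linear_conv_bounded_linear[THEN iffD1])
  have shift: "(\<integral>\<^sup>+x. f (x + c) \<partial>lborel) = (\<integral>\<^sup>+x. f x \<partial>(lborel :: 'a measure))"
    if [measurable]: "f \<in> borel_measurable borel" for f :: "'a \<Rightarrow> ennreal" and c
  proof -
    have "(\<integral>\<^sup>+x. f x \<partial>(lborel :: 'a measure)) = (\<integral>\<^sup>+x. f x \<partial>distr lborel borel ((+) c))"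
      by (simp only: lborel_distr_plus)
    also have "\<dots> = (\<integral>\<^sup>+x. f (x + c) \<partial>lborel)" by (subst nn_integral_distr) (auto simp: add.commute)
    finally show ?thesis ..
  qed
  let ?B = "ball (0::'a) 1"
  define g :: "'a \<Rightarrow> ennreal" where "g = indicator ?B"
  have [measurable]: "g \<in> borel_measurable borel" unfolding g_def by (intro borel_measurable_indicator) simp
  have gT: "g (T x) = g x" "g (- x) = g x" for x by (auto simp: g_def indicator_def iso)
  define I where "I = (\<integral>\<^sup>+x. g x \<partial>lborel)"
  have I: "I \<noteq> 0" "I \<noteq> \<infinity>"
  proof -
    have e: "I = emeasure lborel ?B" by (simp add: I_def g_def)
    have fin: "emeasure lborel ?B < \<infinity>" by (rule emeasure_lborel_ball_finite)
    then show "I \<noteq> \<infinity>" using e by simp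
    have "measure lborel ?B > 0" using content_ball_pos[of 1 "0::'a"] by simp
    then show "I \<noteq> 0" unfolding e by (auto simp: measure_def)
  qed
  have key: "(\<integral>\<^sup>+y. f (T y) \<partial>lborel) = (\<integral>\<^sup>+x. f x \<partial>lborel)"
    if [measurable]: "f \<in> borel_measurable borel" for f :: "'a \<Rightarrow> ennreal"
  proof -
    have tr: "(\<integral>\<^sup>+y. h (T y + x) \<partial>lborel) = (\<integral>\<^sup>+y. h (T y) \<partial>lborel)"
      if [measurable]: "h \<in> borel_measurable borel" for h :: "'a \<Rightarrow> ennreal" and x
      using shift[of "\<lambda>y. h (T y)" "T x"] by (simp add: linear_add[OF lin] inv)
    have "I * (\<integral>\<^sup>+y. f (T y) \<partial>lborel) = (\<integral>\<^sup>+x. g x * (\<integral>\<^sup>+y. f (T y + x) \<partial>lborel) \<partial>lborel)"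
      by (simp add: tr I_def nn_integral_multc)
    also have "\<dots> = (\<integral>\<^sup>+x. (\<integral>\<^sup>+y. g x * f (T y + x) \<partial>lborel) \<partial>lborel)"
      by (simp add: nn_integral_cmult)
    also have "\<dots> = (\<integral>\<^sup>+y. (\<integral>\<^sup>+x. g x * f (T y + x) \<partial>lborel) \<partial>lborel)"
      by (rule lborel_pair.Fubini'[symmetric]) measurable
    also have "\<dots> = (\<integral>\<^sup>+y. (\<integral>\<^sup>+x. g (x - T y) * f x \<partial>lborel) \<partial>lborel)"
    proof (rule nn_integral_cong)
      fix y
      show "(\<integral>\<^sup>+x. g x * f (T y + x) \<partial>lborel) = (\<integral>\<^sup>+x. g (x - T y) * f x \<partial>lborel)"
        using shift[of "\<lambda>x. g (x - T y) * f x" "T y"] by (simp add: add.commute)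
    qed
    also have "\<dots> = (\<integral>\<^sup>+x. (\<integral>\<^sup>+y. g (x - T y) * f x \<partial>lborel) \<partial>lborel)"
      by (rule lborel_pair.Fubini') measurable
    also have "\<dots> = (\<integral>\<^sup>+x. I * f x \<partial>lborel)"
    proof (rule nn_integral_cong)
      fix x
      have "(\<integral>\<^sup>+y. g (x - T y) \<partial>lborel) = (\<integral>\<^sup>+y. g (T y + (- x)) \<partial>lborel)"
        using gT(2) by (intro nn_integral_cong) (metis minus_diff_eq uminus_add_conv_diff add.commute)
      also have "\<dots> = (\<integral>\<^sup>+y. g (T y) \<partial>lborel)" by (rule tr) measurable
      also have "\<dots> = I" by (simp add: gT I_def)
      finally show "(\<integral>\<^sup>+y. g (x - T y) * f x \<partial>lborel) = I * f x" by (simp add: nn_integral_multc)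
    qed
    also have "\<dots> = I * (\<integral>\<^sup>+x. f x \<partial>lborel)" by (rule nn_integral_cmult) measurable
    finally show ?thesis using I by (simp add: ennreal_mult_cancel_left)
  qed
  show ?thesis
  proof (rule measure_eqI)
    fix A assume "A \<in> sets (distr lborel borel T)"
    then have [measurable]: "A \<in> sets borel" by simp
    have "emeasure (distr lborel borel T) A = (\<integral>\<^sup>+x. indicator A x \<partial>distr lborel borel T)" by simp
    also have "\<dots> = (\<integral>\<^sup>+x. indicator A (T x) \<partial>lborel)" by (rule nn_integral_distr) measurable
    also have "\<dots> = emeasure lborel A" by (subst key) auto
    finally show "emeasure (distr lborel borel T) A = emeasure lborel A" .
  qed simp
qed

lemma reflection_measurable[measurable]: "reflection \<alpha> \<in> borel_measurable borel"
  by (intro borel_measurable_continuous_onI linear_continuous_on bounded_linear_reflection)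

lemma lborel_distr_reflection: "distr lborel borel (reflection \<alpha>) = lborel"
  by (rule lborel_distr_involution) (auto simp: linear_reflection)

lemma integral_reflection:
  fixes f :: "real^'n \<Rightarrow> 'b::{banach, second_countable_topology}"
  assumes [measurable]: "f \<in> borel_measurable borel"
  shows "(\<integral>x. f (reflection \<alpha> x) \<partial>lborel) = (\<integral>x. f x \<partial>lborel)"
  using integral_distr[of "reflection \<alpha>" lborel borel f] by (simp add: lborel_distr_reflection)

text \<open>The integral of \<open>G (x + \<xi>) - G x\<close> vanishes by translation invariance; by the fundamental theorem of calculus
and Fubini it is also the integral over \<open>s\<close> in the unit interval of the integrals of \<open>G' (x + s \<xi>)\<close>, which
do not depend on \<open>s\<close>.\<close>

lemma integral_directional_derivative:
  fixes G G' :: "'a::euclidean_space \<Rightarrow> complex"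
  assumes deriv: "\<And>x t. ((\<lambda>t. G (x + t *\<^sub>R \<xi>)) has_vector_derivative G' (x + t *\<^sub>R \<xi>)) (at t)"
    and cont: "continuous_on UNIV G'" and G: "integrable lborel G" and G': "integrable lborel G'"
  shows "(\<integral>x. G' x \<partial>lborel) = 0"
proof -
  have [measurable]: "G' \<in> borel_measurable borel" using cont by (rule borel_measurable_continuous_onI)
  have int_shift: "integrable lborel (\<lambda>x. f (x + c))" and shift: "(\<integral>x. f (x + c) \<partial>lborel) = (\<integral>x. f x \<partial>lborel)"
    if f: "integrable lborel f" for f :: "'a \<Rightarrow> 'b::{banach, second_countable_topology}" and c
  proof -
    have [measurable]: "f \<in> borel_measurable borel" using f by (simp add: borel_measurable_integrable)
    have "integrable (distr lborel borel ((+) c)) f" using f by (simp only: lborel_distr_plus)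
    then show "integrable lborel (\<lambda>x. f (x + c))"
      by (subst (asm) integrable_distr_eq) (auto simp: add.commute)
    have "(\<integral>x. f x \<partial>lborel) = (\<integral>x. f x \<partial>distr lborel borel ((+) c))" by (simp only: lborel_distr_plus)
    then show "(\<integral>x. f (x + c) \<partial>lborel) = (\<integral>x. f x \<partial>lborel)"
      by (subst (asm) integral_distr) (auto simp: add.commute)
  qed
  let ?f = "\<lambda>s x. indicator {0..1::real} s *\<^sub>R G' (x + s *\<^sub>R \<xi>)"
  have ftc: "(\<integral>s. ?f s x \<partial>lborel) = G (x + \<xi>) - G x" for x
  proof -
    have "(\<integral>s. indicator {0..1::real} s *\<^sub>R G' (x + s *\<^sub>R \<xi>) \<partial>lborel) = G (x + 1 *\<^sub>R \<xi>) - G (x + 0 *\<^sub>R \<xi>)"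
    proof (rule integral_FTC_Icc)
      show "continuous_on {0..1} (\<lambda>s. G' (x + s *\<^sub>R \<xi>))"
        by (intro continuous_on_compose2[OF cont] continuous_intros) auto
    qed (use deriv in \<open>auto intro: has_vector_derivative_at_within\<close>)
    then show ?thesis by simp
  qed
  have int: "integrable (lborel \<Otimes>\<^sub>M lborel) (\<lambda>(s, x). ?f s x)"
  proof (rule lborel_pair.Fubini_integrable)
    show "(\<lambda>(s, x). ?f s x) \<in> borel_measurable (lborel \<Otimes>\<^sub>M lborel)" by measurable
    have e: "(\<integral>x. norm (?f s x) \<partial>lborel) = indicator {0..1} s *\<^sub>R (\<integral>x. norm (G' x) \<partial>lborel)" for s
      using shift[OF integrable_norm[OF G'], of "s *\<^sub>R \<xi>"] by (auto simp: indicator_def)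
    show "integrable lborel (\<lambda>s. \<integral>x. norm (case (s, x) of (s, x) \<Rightarrow> ?f s x) \<partial>lborel)"
      unfolding prod.case e by simp
    show "AE s in lborel. integrable lborel (\<lambda>x. case (s, x) of (s, x) \<Rightarrow> ?f s x)"
      using int_shift[OF G'] by (intro AE_I2) (auto intro: integrable_scaleR_right)
  qed
  have "(\<integral>x. (\<integral>s. ?f s x \<partial>lborel) \<partial>lborel) = (\<integral>s. (\<integral>x. ?f s x \<partial>lborel) \<partial>lborel)"
    by (rule lborel_pair.Fubini_integral[OF int])
  also have "\<dots> = (\<integral>s. indicator {0..1::real} s *\<^sub>R (\<integral>x. G' x \<partial>lborel) \<partial>lborel)"
    using shift[OF G'] by simp
  also have "\<dots> = (\<integral>x. G' x \<partial>lborel)" by simp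
  finally have "(\<integral>x. G' x \<partial>lborel) = (\<integral>x. G (x + \<xi>) - G x \<partial>lborel)" unfolding ftc ..
  also have "\<dots> = 0" using int_shift[OF G] shift[OF G] G by simp
  finally show ?thesis .
qed

lemma hpoly_bound:
  assumes "hpoly m p" obtains C where "C \<ge> 0" "\<And>x. cmod (p x) \<le> C * norm x ^ m"
proof -
  have "compact (p ` cball 0 1)" by (intro compact_continuous_image hpoly_continuous[OF assms] compact_cball)
  then obtain C where C: "\<And>x. x \<in> cball 0 1 \<Longrightarrow> cmod (p x) \<le> C"
    using compact_imp_bounded bounded_iff by (metis imageI)
  have C0: "C \<ge> 0" using C[of 0] norm_ge_zero[of "p 0"] by (simp add: order_trans del: norm_ge_zero)
  show thesis
  proof (rule that[OF C0])
    fix x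
    show "cmod (p x) \<le> C * norm x ^ m"
    proof (cases "x = 0")
      case True
      have "cmod (p 0) = 0 ^ m * cmod (p 0)"
        using hpoly_homogeneous[OF assms, of 0 0] by (metis norm_mult norm_of_real norm_power of_real_0 norm_zero scaleR_zero_left)
      also have "\<dots> \<le> C * 0 ^ m" using C[of 0] by (cases m) auto
      finally show ?thesis using True by simp
    next
      case False
      have "p x = p (norm x *\<^sub>R (inverse (norm x) *\<^sub>R x))" using False by simp
      also have "\<dots> = complex_of_real (norm x) ^ m * p (inverse (norm x) *\<^sub>R x)" by (rule hpoly_homogeneous[OF assms])
      finally have "cmod (p x) = norm x ^ m * cmod (p (inverse (norm x) *\<^sub>R x))" by (simp add: norm_mult norm_power)
      also have "\<dots> \<le> norm x ^ m * C" by (intro mult_left_mono C) (use False in auto)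
      finally show ?thesis by (simp add: mult.commute)
    qed
  qed
qed

lemma AE_hyperplane:
  fixes \<alpha> :: "real^'n" assumes "\<alpha> \<noteq> 0" shows "AE x in lborel. \<alpha> \<bullet> x \<noteq> 0"
proof -
  have "negligible {x. \<alpha> \<bullet> x = 0}" using assms by (intro negligible_hyperplane) auto
  then have "{x. \<alpha> \<bullet> x = 0} \<in> null_sets lebesgue" by (simp add: negligible_iff_null_sets)
  moreover have "closed {x. \<alpha> \<bullet> x = 0}" by (rule closed_hyperplane)
  ultimately have "{x. \<alpha> \<bullet> x = 0} \<in> null_sets lborel"
    by (subst (asm) null_sets_completion_iff) auto
  then show ?thesis by (rule AE_I') auto
qed

lemma integrable_poly_gaussian:
  "integrable (lborel :: 'a::euclidean_space measure) (\<lambda>x. norm x ^ m * exp (- (norm x)\<^sup>2 / 4))"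
proof -
  obtain K :: real where K: "\<And>\<phi> :: real \<Rightarrow> real. \<phi> \<in> borel_measurable borel \<Longrightarrow>
    set_integrable lborel {0<..} (\<lambda>r. \<phi> r * r powr (real DIM('a) - 1)) \<Longrightarrow>
    has_bochner_integral lborel (\<lambda>x::'a. 1 * \<phi> (norm x)) (K * (LINT r:{0<..}|lborel. \<phi> r * r powr (real DIM('a) - 1)))"
    by (rule polar_integral_nonneg[of "\<lambda>x::'a. 1" "real DIM('a)" 1]) (auto simp: DIM_positive)
  have "set_integrable lborel {0<..} (\<lambda>r. r powr (real m + real DIM('a) - 1) * exp (- (1/4) * r powr 2))"
    by (rule powr_exp_integrable) (auto simp: DIM_positive intro: add_nonneg_pos)
  also have "?this \<longleftrightarrow> set_integrable lborel {0<..} (\<lambda>r. (r ^ m * exp (- r\<^sup>2 / 4)) * r powr (real DIM('a) - 1))"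
  proof (rule set_integrable_cong)
    fix r :: real assume "r \<in> {0<..}"
    then show "r powr (real m + real DIM('a) - 1) * exp (- (1/4) * r powr 2) = (r ^ m * exp (- r\<^sup>2 / 4)) * r powr (real DIM('a) - 1)"
      using powr_add[of r "real m" "real DIM('a) - 1"] by (simp add: powr_realpow powr_numeral add_diff_eq mult_ac)
  qed auto
  finally have "has_bochner_integral lborel (\<lambda>x::'a. 1 * (norm x ^ m * exp (- (norm x)\<^sup>2 / 4)))
    (K * (LINT r:{0<..}|lborel. (r ^ m * exp (- r\<^sup>2 / 4)) * r powr (real DIM('a) - 1)))"
    by (intro K) auto
  then show ?thesis by (simp add: has_bochner_integral_iff)
qed

section \<open>The weight and its regularization\<close>

lemma reflection_self_adjoint: "\<alpha> \<bullet> reflection \<beta> x = reflection \<beta> \<alpha> \<bullet> x"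
  using inner_reflection_reflection[of \<beta> \<alpha> "reflection \<beta> x"] by simp

text \<open>The tangent to the concave logarithm at \<open>1 / \<eta>\<close>: logarithms grow more slowly than any linear function.\<close>

lemma ln_add_one_bound:
  fixes y \<eta> :: real assumes "y \<ge> 0" "\<eta> > 0" shows "ln (y + 1) \<le> \<eta> * y + (\<eta> - 1 - ln \<eta>)"
proof -
  have "ln (\<eta> * (y + 1)) \<le> \<eta> * (y + 1) - 1" using assms by (intro ln_le_minus_one) auto
  moreover have "ln (\<eta> * (y + 1)) = ln \<eta> + ln (y + 1)" using assms by (intro ln_mult_pos) auto
  ultimately show ?thesis by (simp only: distrib_left)
qed

context dunkl_setting begin

lemma root_nonzero: "\<alpha> \<in> R \<Longrightarrow> \<alpha> \<noteq> 0" using zero_notin_R by auto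

lemma reflection_root_image: "\<beta> \<in> R \<Longrightarrow> reflection \<beta> ` R = R"
  using R by (simp add: root_system_def)

lemma reflection_root_bij: "\<beta> \<in> R \<Longrightarrow> bij_betw (reflection \<beta>) R R"
  unfolding bij_betw_def using reflection_root_image by (auto intro!: inj_onI dest: arg_cong[of _ _ "reflection \<beta>"])

lemma k_reflection: assumes "\<beta> \<in> R" "\<alpha> \<in> R" shows "k (reflection \<beta> \<alpha>) = k \<alpha>"
proof -
  have "reflection \<beta> \<circ> id \<in> coxeter_group R" by (intro coxeter_group.intros assms)
  then show ?thesis using k assms unfolding multiplicity_function_def by fastforce
qed

lemma uminus_root: "\<alpha> \<in> R \<Longrightarrow> - \<alpha> \<in> R"
  using reflection_root_image[of \<alpha>] reflection_root[OF root_nonzero, of \<alpha>] by force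

lemma k_uminus: "\<alpha> \<in> R \<Longrightarrow> k (- \<alpha>) = k \<alpha>"
  using k_reflection[of \<alpha> \<alpha>] reflection_root[OF root_nonzero, of \<alpha>] by simp

lemma R_split: "R = P \<union> uminus ` P" "P \<inter> uminus ` P = {}"
proof -
  obtain v where v: "\<forall>\<alpha>\<in>R. \<alpha> \<bullet> v \<noteq> 0" "P = {\<alpha> \<in> R. \<alpha> \<bullet> v > 0}"
    using P unfolding positive_subsystem_def by blast
  show "R = P \<union> uminus ` P"
  proof (intro set_eqI iffI)
    fix \<alpha> assume \<alpha>: "\<alpha> \<in> R"
    then have "\<alpha> \<bullet> v > 0 \<or> (- \<alpha>) \<bullet> v > 0" using v(1) by (auto simp: linorder_neq_iff)
    then show "\<alpha> \<in> P \<union> uminus ` P"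
      using \<alpha> uminus_root[OF \<alpha>] v(2) by (auto intro: image_eqI[of _ _ "- \<alpha>"])
  next
    fix \<alpha> assume "\<alpha> \<in> P \<union> uminus ` P"
    then show "\<alpha> \<in> R" using P_subset uminus_root by auto
  qed
  show "P \<inter> uminus ` P = {}" using v(2) by auto
qed

lemma sum_R:
  assumes "\<And>\<alpha>. \<alpha> \<in> P \<Longrightarrow> f (- \<alpha>) = (f \<alpha> :: 'b::comm_semiring_1)"
  shows "(\<Sum>\<alpha>\<in>R. f \<alpha>) = 2 * (\<Sum>\<alpha>\<in>P. f \<alpha>)"
proof -
  have "(\<Sum>\<alpha>\<in>R. f \<alpha>) = (\<Sum>\<alpha>\<in>P. f \<alpha>) + (\<Sum>\<alpha>\<in>uminus ` P. f \<alpha>)"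
    by (subst R_split(1), rule sum.union_disjoint) (use finite_P R_split(2) in auto)
  also have "(\<Sum>\<alpha>\<in>uminus ` P. f \<alpha>) = (\<Sum>\<alpha>\<in>P. f (- \<alpha>))" by (subst sum.reindex) (auto simp: inj_on_def)
  also have "\<dots> = (\<Sum>\<alpha>\<in>P. f \<alpha>)" using assms by (intro sum.cong) auto
  finally show ?thesis by (simp add: mult_2)
qed

text \<open>The part of the density that carries the root system; the factor \<open>norm x powr (a - 2)\<close> is radial and joins the
radial integrals.\<close>

definition weight :: "real^'n \<Rightarrow> real" where "weight x = (\<Prod>\<alpha>\<in>R. \<bar>\<alpha> \<bullet> x\<bar> powr k \<alpha>)"

text \<open>The weight with \<open>\<bar>\<langle>\<alpha>, x\<rangle>\<bar>\<close> replaced by \<open>sqrt (\<langle>\<alpha>, x\<rangle>\<^sup>2 + \<epsilon>)\<close>. For small multiplicities the weight itself is not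
differentiable on the hyperplanes, and its logarithmic derivative is not bounded; the regularized weight is
smooth and still invariant under the reflections.\<close>

definition reg_weight :: "real \<Rightarrow> real^'n \<Rightarrow> real" where
  "reg_weight \<epsilon> x = exp (\<Sum>\<alpha>\<in>R. k \<alpha> / 2 * ln ((\<alpha> \<bullet> x)\<^sup>2 + \<epsilon>))"

lemma weight_nonneg: "weight x \<ge> 0" by (simp add: weight_def prod_nonneg)

lemma weight_measurable[measurable]: "weight \<in> borel_measurable borel"
  unfolding weight_def[abs_def] by measurable

lemma reg_weight_measurable[measurable]: "reg_weight \<epsilon> \<in> borel_measurable borel"
  unfolding reg_weight_def[abs_def] by measurable

lemma reg_weight_reflection: assumes "\<beta> \<in> R" shows "reg_weight \<epsilon> (reflection \<beta> x) = reg_weight \<epsilon> x"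
proof -
  have "(\<Sum>\<alpha>\<in>R. k \<alpha> / 2 * ln ((\<alpha> \<bullet> reflection \<beta> x)\<^sup>2 + \<epsilon>))
    = (\<Sum>\<alpha>\<in>R. k (reflection \<beta> \<alpha>) / 2 * ln ((reflection \<beta> \<alpha> \<bullet> x)\<^sup>2 + \<epsilon>))"
    by (intro sum.cong) (auto simp: k_reflection[OF assms] reflection_self_adjoint)
  also have "\<dots> = (\<Sum>\<alpha>\<in>R. k \<alpha> / 2 * ln ((\<alpha> \<bullet> x)\<^sup>2 + \<epsilon>))"
    by (rule sum.reindex_bij_betw[OF reflection_root_bij[OF assms]])
  finally show ?thesis by (simp add: reg_weight_def)
qed

lemma weight_reflection: assumes "\<beta> \<in> R" shows "weight (reflection \<beta> x) = weight x"
proof -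
  have "(\<Prod>\<alpha>\<in>R. \<bar>\<alpha> \<bullet> reflection \<beta> x\<bar> powr k \<alpha>) = (\<Prod>\<alpha>\<in>R. \<bar>reflection \<beta> \<alpha> \<bullet> x\<bar> powr k (reflection \<beta> \<alpha>))"
    by (intro prod.cong) (auto simp: k_reflection[OF assms] reflection_self_adjoint)
  also have "\<dots> = (\<Prod>\<alpha>\<in>R. \<bar>\<alpha> \<bullet> x\<bar> powr k \<alpha>)"
    by (rule prod.reindex_bij_betw[OF reflection_root_bij[OF assms]])
  finally show ?thesis by (simp add: weight_def)
qed

lemma weight_homogeneous: assumes "c > 0" shows "weight (c *\<^sub>R x) = c powr (2 * ksum) * weight x"
proof -
  have "weight (c *\<^sub>R x) = (\<Prod>\<alpha>\<in>R. c powr k \<alpha> * \<bar>\<alpha> \<bullet> x\<bar> powr k \<alpha>)"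
    unfolding weight_def using assms by (intro prod.cong) (auto simp: abs_mult powr_mult)
  also have "\<dots> = (\<Prod>\<alpha>\<in>R. c powr k \<alpha>) * weight x" by (simp add: weight_def prod.distrib)
  also have "(\<Prod>\<alpha>\<in>R. c powr k \<alpha>) = c powr (\<Sum>\<alpha>\<in>R. k \<alpha>)"
    using assms by (simp add: powr_sum)
  also have "(\<Sum>\<alpha>\<in>R. k \<alpha>) = 2 * ksum"
    unfolding ksum_def using k_uminus P_subset by (intro sum_R) auto
  finally show ?thesis .
qed

lemma weight_bounded: obtains C where "C \<ge> 0" "\<And>x. norm x \<le> 1 \<Longrightarrow> weight x \<le> C"
proof (rule that[of "\<Prod>\<alpha>\<in>R. norm \<alpha> powr k \<alpha>"])
  fix x :: "real^'n" assume x: "norm x \<le> 1"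
  show "weight x \<le> (\<Prod>\<alpha>\<in>R. norm \<alpha> powr k \<alpha>)"
    unfolding weight_def
  proof (intro prod_mono conjI)
    fix \<alpha> assume "\<alpha> \<in> R"
    have "\<bar>\<alpha> \<bullet> x\<bar> \<le> norm \<alpha> * norm x" by (rule Cauchy_Schwarz_ineq2)
    also have "\<dots> \<le> norm \<alpha>" using x by (simp add: mult_left_le)
    finally show "\<bar>\<alpha> \<bullet> x\<bar> powr k \<alpha> \<le> norm \<alpha> powr k \<alpha>" using k_nonneg \<open>\<alpha> \<in> R\<close> by (intro powr_mono2) auto
  qed simp
qed (simp add: prod_nonneg)

lemma reg_weight_mono: assumes "0 < \<epsilon>" "\<epsilon> \<le> 1" shows "reg_weight \<epsilon> x \<le> reg_weight 1 x"
proof -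
  have "k \<alpha> / 2 * ln ((\<alpha> \<bullet> x)\<^sup>2 + \<epsilon>) \<le> k \<alpha> / 2 * ln ((\<alpha> \<bullet> x)\<^sup>2 + 1)" if "\<alpha> \<in> R" for \<alpha>
  proof (rule mult_left_mono)
    have "0 < (\<alpha> \<bullet> x)\<^sup>2 + \<epsilon>" using assms by (simp add: add_nonneg_pos)
    then show "ln ((\<alpha> \<bullet> x)\<^sup>2 + \<epsilon>) \<le> ln ((\<alpha> \<bullet> x)\<^sup>2 + 1)" using assms by (subst ln_le_cancel_iff) auto
    show "0 \<le> k \<alpha> / 2" using k_nonneg that by auto
  qed
  then show ?thesis unfolding reg_weight_def exp_le_cancel_iff by (rule sum_mono)
qed

text \<open>The weight grows polynomially, so any small fraction of the Gaussian exponent absorbs it; a quarter is half of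
what \<open>gauss\<close> offers.\<close>

lemma reg_weight_bound: obtains C where "C \<ge> 0" "\<And>x. reg_weight 1 x \<le> C * exp ((norm x)\<^sup>2 / 4)"
proof -
  define S where "S = (\<Sum>\<alpha>\<in>R. k \<alpha> / 2 * (norm \<alpha>)\<^sup>2)"
  have S: "S \<ge> 0" unfolding S_def using k_nonneg by (intro sum_nonneg) auto
  \<comment> \<open>Small enough that the quadratic terms of all roots together stay below \<open>(norm x)\<^sup>2 / 4\<close>.\<close>
  define \<eta> where "\<eta> = 1 / (4 * (S + 1))"
  have \<eta>: "\<eta> > 0" using S by (simp add: \<eta>_def)
  have \<eta>S: "\<eta> * S \<le> 1 / 4" using S by (simp add: \<eta>_def divide_simps)
  define c where "c = (\<Sum>\<alpha>\<in>R. k \<alpha> / 2 * (\<eta> - 1 - ln \<eta>))"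
  show thesis
  proof (rule that[of "exp c"])
    fix x :: "real^'n"
    have "(\<Sum>\<alpha>\<in>R. k \<alpha> / 2 * ln ((\<alpha> \<bullet> x)\<^sup>2 + 1)) \<le> (\<Sum>\<alpha>\<in>R. k \<alpha> / 2 * (\<eta> * ((norm \<alpha>)\<^sup>2 * (norm x)\<^sup>2) + (\<eta> - 1 - ln \<eta>)))"
    proof (intro sum_mono mult_left_mono)
      fix \<alpha> assume "\<alpha> \<in> R"
      then show "0 \<le> k \<alpha> / 2" using k_nonneg by auto
      have "ln ((\<alpha> \<bullet> x)\<^sup>2 + 1) \<le> \<eta> * (\<alpha> \<bullet> x)\<^sup>2 + (\<eta> - 1 - ln \<eta>)" using \<eta> by (intro ln_add_one_bound) auto
      also have "(\<alpha> \<bullet> x)\<^sup>2 \<le> (norm \<alpha>)\<^sup>2 * (norm x)\<^sup>2"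
        using Cauchy_Schwarz_ineq[of \<alpha> x] by (simp add: power2_norm_eq_inner)
      finally show "ln ((\<alpha> \<bullet> x)\<^sup>2 + 1) \<le> \<eta> * ((norm \<alpha>)\<^sup>2 * (norm x)\<^sup>2) + (\<eta> - 1 - ln \<eta>)"
        using \<eta> by (simp add: mult_left_mono)
    qed
    also have "\<dots> = (\<eta> * S) * (norm x)\<^sup>2 + c"
      unfolding S_def c_def sum_distrib_left sum_distrib_right sum.distrib[symmetric]
      by (intro sum.cong) (simp_all add: field_simps)
    also have "\<dots> \<le> 1 / 4 * (norm x)\<^sup>2 + c" using \<eta>S by (intro add_right_mono mult_right_mono) auto
    finally have "reg_weight 1 x \<le> exp (1 / 4 * (norm x)\<^sup>2 + c)" by (simp add: reg_weight_def)
    then show "reg_weight 1 x \<le> exp c * exp ((norm x)\<^sup>2 / 4)" by (simp add: exp_add mult.commute)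
  qed simp
qed

lemma AE_regular: "AE x in lborel. \<forall>\<alpha>\<in>R. \<alpha> \<bullet> x \<noteq> 0"
  using AE_hyperplane root_nonzero by (intro AE_finite_allI finite_R) blast

lemma reg_weight_tendsto:
  assumes "\<forall>\<alpha>\<in>R. \<alpha> \<bullet> x \<noteq> 0"
  shows "(\<lambda>n. reg_weight (1 / real (Suc n)) x) \<longlonglongrightarrow> weight x"
proof -
  have "(\<lambda>n. reg_weight (1 / real (Suc n)) x) \<longlonglongrightarrow> exp (\<Sum>\<alpha>\<in>R. k \<alpha> / 2 * ln ((\<alpha> \<bullet> x)\<^sup>2 + 0))"
    unfolding reg_weight_def using assms LIMSEQ_inverse_real_of_nat
    by (intro tendsto_intros) (auto simp: inverse_eq_divide)
  also have "exp (\<Sum>\<alpha>\<in>R. k \<alpha> / 2 * ln ((\<alpha> \<bullet> x)\<^sup>2 + 0)) = weight x"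
    unfolding weight_def exp_sum[OF finite_R]
  proof (rule prod.cong)
    fix \<alpha> assume "\<alpha> \<in> R"
    then have "\<alpha> \<bullet> x \<noteq> 0" using assms by blast
    moreover from this have "ln ((\<alpha> \<bullet> x)\<^sup>2) = 2 * ln \<bar>\<alpha> \<bullet> x\<bar>"
      by (metis ln_realpow of_nat_numeral power2_abs zero_less_abs_iff)
    ultimately show "exp (k \<alpha> / 2 * ln ((\<alpha> \<bullet> x)\<^sup>2 + 0)) = \<bar>\<alpha> \<bullet> x\<bar> powr k \<alpha>"
      by (simp add: powr_def)
  qed simp
  finally show ?thesis .
qed

definition gauss :: "real^'n \<Rightarrow> real" where "gauss x = exp (- (norm x)\<^sup>2 / 2)"

lemma gauss_measurable[measurable]: "gauss \<in> borel_measurable borel"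
  unfolding gauss_def[abs_def] by measurable

lemma gauss_reflection: "gauss (reflection \<alpha> x) = gauss x" by (simp add: gauss_def)

text \<open>One integrable function that dominates all regularizations with \<open>\<epsilon> \<le> 1\<close>, for passing to the limit.\<close>

lemma gauss_dominate:
  assumes "hpoly m p"
  obtains g where "integrable lborel g" "\<And>x b. \<bar>b\<bar> \<le> reg_weight 1 x \<Longrightarrow> cmod (p x * complex_of_real (gauss x * b)) \<le> g x"
proof -
  obtain C where C: "C \<ge> 0" "\<And>x. cmod (p x) \<le> C * norm x ^ m" using hpoly_bound[OF assms] by blast
  obtain D where D: "D \<ge> 0" "\<And>x. reg_weight 1 x \<le> D * exp ((norm x)\<^sup>2 / 4)" using reg_weight_bound by blast
  show thesis
  proof (rule that[of "\<lambda>x. (C * D) * (norm x ^ m * exp (- (norm x)\<^sup>2 / 4))"])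
    show "integrable lborel (\<lambda>x::real^'n. (C * D) * (norm x ^ m * exp (- (norm x)\<^sup>2 / 4)))"
      by (intro integrable_mult_right integrable_poly_gaussian)
    fix x b assume b: "\<bar>b\<bar> \<le> reg_weight 1 x"
    have "cmod (p x * complex_of_real (gauss x * b)) = cmod (p x) * (gauss x * \<bar>b\<bar>)"
      by (simp add: norm_mult gauss_def)
    also have "\<dots> \<le> (C * norm x ^ m) * (gauss x * (D * exp ((norm x)\<^sup>2 / 4)))"
      using C D b order_trans[OF b D(2)] by (intro mult_mono) (auto simp: gauss_def)
    also have "gauss x * (D * exp ((norm x)\<^sup>2 / 4)) = D * exp (- (norm x)\<^sup>2 / 4)"
      by (simp add: gauss_def exp_add[symmetric])
    finally show "cmod (p x * complex_of_real (gauss x * b)) \<le> (C * D) * (norm x ^ m * exp (- (norm x)\<^sup>2 / 4))"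
      by (simp add: mult_ac)
  qed
qed

lemma gauss_integrable:
  assumes "hpoly m p" and [measurable]: "b \<in> borel_measurable borel" and "AE x in lborel. \<bar>b x\<bar> \<le> reg_weight 1 x"
  shows "integrable lborel (\<lambda>x. p x * complex_of_real (gauss x * b x))"
proof -
  have [measurable]: "p \<in> borel_measurable borel" using hpoly_measurable[OF assms(1)] .
  obtain g where g: "integrable lborel g" "\<And>x b. \<bar>b\<bar> \<le> reg_weight 1 x \<Longrightarrow> cmod (p x * complex_of_real (gauss x * b)) \<le> g x"
    using gauss_dominate[OF assms(1)] by blast
  show ?thesis
  proof (rule Bochner_Integration.integrable_bound[OF g(1)])
    show "AE x in lborel. norm (p x * complex_of_real (gauss x * b x)) \<le> norm (g x)"
      using assms(3) by eventually_elim (use g(2) in \<open>force intro: order_trans\<close>)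
  qed measurable
qed

lemma weight_le_reg_weight: "AE x in lborel. \<bar>weight x\<bar> \<le> reg_weight 1 x"
  using AE_regular
proof eventually_elim
  case (elim x)
  have "weight x \<le> reg_weight 1 x"
    by (rule LIMSEQ_le_const2[OF reg_weight_tendsto[OF elim]]) (auto intro!: exI[of _ 0] reg_weight_mono)
  then show ?case using weight_nonneg by simp
qed

lemma gauss_weight_integrable: "hpoly m p \<Longrightarrow> integrable lborel (\<lambda>x. p x * complex_of_real (gauss x * weight x))"
  by (rule gauss_integrable[OF _ weight_measurable weight_le_reg_weight])

lemma gauss_limit:
  assumes p: "hpoly m p" and b[measurable]: "\<And>n. b n \<in> borel_measurable borel"
    and bd: "\<And>n x. \<bar>b n x\<bar> \<le> 1" and lim: "AE x in lborel. (\<lambda>n. b n x) \<longlonglongrightarrow> 1"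
  shows "(\<lambda>n. \<integral>x. p x * complex_of_real (gauss x * (b n x * reg_weight (1 / real (Suc n)) x)) \<partial>lborel)
    \<longlonglongrightarrow> (\<integral>x. p x * complex_of_real (gauss x * weight x) \<partial>lborel)"
proof -
  have [measurable]: "p \<in> borel_measurable borel" using hpoly_measurable[OF p] .
  obtain g where g: "integrable lborel g" "\<And>x b. \<bar>b\<bar> \<le> reg_weight 1 x \<Longrightarrow> cmod (p x * complex_of_real (gauss x * b)) \<le> g x"
    using gauss_dominate[OF p] by blast
  have w: "\<bar>b n x * reg_weight (1 / real (Suc n)) x\<bar> \<le> reg_weight 1 x" for n x
  proof -
    have "0 \<le> reg_weight (1 / real (Suc n)) x" by (simp add: reg_weight_def)
    then have "\<bar>b n x * reg_weight (1 / real (Suc n)) x\<bar> \<le> 1 * reg_weight (1 / real (Suc n)) x"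
      using bd[of n x] by (simp add: abs_mult mult_left_le_one_le)
    also have "\<dots> \<le> reg_weight 1 x" using reg_weight_mono[of "1 / real (Suc n)" x] by simp
    finally show ?thesis .
  qed
  show ?thesis
  proof (rule integral_dominated_convergence[OF _ _ g(1)])
    show "AE x in lborel. (\<lambda>n. p x * complex_of_real (gauss x * (b n x * reg_weight (1 / real (Suc n)) x))) \<longlonglongrightarrow> p x * complex_of_real (gauss x * weight x)"
      using AE_regular lim
    proof eventually_elim
      case (elim x)
      have "(\<lambda>n. p x * complex_of_real (gauss x * (b n x * reg_weight (1 / real (Suc n)) x))) \<longlonglongrightarrow> p x * complex_of_real (gauss x * (1 * weight x))"
        by (intro tendsto_intros reg_weight_tendsto elim)
      then show ?case by simp
    qed
    show "AE x in lborel. norm (p x * complex_of_real (gauss x * (b n x * reg_weight (1 / real (Suc n)) x))) \<le> g x" for n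
      by (intro AE_I2 g(2) w)
  qed measurable
qed

end

section \<open>Integration by parts for Dunkl operators against a Gaussian\<close>

context dunkl_setting begin

text \<open>The derivative of \<open>ln (reg_weight \<epsilon> x)\<close> in direction \<open>\<xi>\<close>.\<close>

definition reg_log_deriv :: "real \<Rightarrow> real^'n \<Rightarrow> real^'n \<Rightarrow> real" where
  "reg_log_deriv \<epsilon> \<xi> x = (\<Sum>\<alpha>\<in>R. k \<alpha> * (\<alpha> \<bullet> \<xi>) * ((\<alpha> \<bullet> x) / ((\<alpha> \<bullet> x)\<^sup>2 + \<epsilon>)))"

lemma reg_weight_has_derivative:
  assumes "\<epsilon> > 0"
  shows "(reg_weight \<epsilon> has_derivative (\<lambda>h. reg_weight \<epsilon> x * reg_log_deriv \<epsilon> h x)) (at x)"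
proof -
  have pos: "(\<alpha> \<bullet> x)\<^sup>2 + \<epsilon> > 0" for \<alpha> using assms by (simp add: add_nonneg_pos)
  have "((\<lambda>x. \<Sum>\<alpha>\<in>R. k \<alpha> / 2 * ln ((\<alpha> \<bullet> x)\<^sup>2 + \<epsilon>)) has_derivative
     (\<lambda>h. \<Sum>\<alpha>\<in>R. k \<alpha> / 2 * (2 * (\<alpha> \<bullet> x) * (\<alpha> \<bullet> h) / ((\<alpha> \<bullet> x)\<^sup>2 + \<epsilon>)))) (at x)"
  proof (intro has_derivative_sum has_derivative_mult_right)
    fix \<alpha>
    show "((\<lambda>x. ln ((\<alpha> \<bullet> x)\<^sup>2 + \<epsilon>)) has_derivative (\<lambda>h. 2 * (\<alpha> \<bullet> x) * (\<alpha> \<bullet> h) / ((\<alpha> \<bullet> x)\<^sup>2 + \<epsilon>))) (at x)"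
      using pos[of \<alpha>] by (auto intro!: derivative_eq_intros simp: field_simps)
  qed
  also have "(\<lambda>h. \<Sum>\<alpha>\<in>R. k \<alpha> / 2 * (2 * (\<alpha> \<bullet> x) * (\<alpha> \<bullet> h) / ((\<alpha> \<bullet> x)\<^sup>2 + \<epsilon>))) = (\<lambda>h. reg_log_deriv \<epsilon> h x)"
    unfolding reg_log_deriv_def by (intro ext sum.cong) auto
  finally have "((\<lambda>x. \<Sum>\<alpha>\<in>R. k \<alpha> / 2 * ln ((\<alpha> \<bullet> x)\<^sup>2 + \<epsilon>)) has_derivative (\<lambda>h. reg_log_deriv \<epsilon> h x)) (at x)" .
  from has_derivative_exp[OF this] show ?thesis
    unfolding reg_weight_def[abs_def] by (simp only: mult.commute)
qed

lemma gauss_has_derivative: "(gauss has_derivative (\<lambda>h. - (x \<bullet> h) * gauss x)) (at x)"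
proof -
  have "((\<lambda>x. (- 1 / 2) * (norm x)\<^sup>2) has_derivative (\<lambda>h. (- 1 / 2) * (2 * (x \<bullet> h)))) (at (x :: real^'n))"
    by (rule has_derivative_mult_right[OF has_derivative_norm_sq])
  from has_derivative_exp[OF this] show ?thesis unfolding gauss_def[abs_def] by simp
qed

text \<open>The factor multiplying \<open>p\<close> changes sign under the reflection in \<open>\<alpha>\<close>, so only half of \<open>p - p \<circ> reflection \<alpha>\<close>
contributes to the integral; that difference is \<open>\<langle>\<alpha>, x\<rangle>\<close> times the reflection quotient. In this way the
derivative of the weight turns into the difference part of the Dunkl operator, and the factor \<open>\<langle>\<alpha>, x\<rangle>\<close>
gained tames the singularity as \<open>\<epsilon>\<close> tends to \<open>0\<close>.\<close>

lemma odd_part_integral: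
  assumes p: "hpoly m p" and \<alpha>: "\<alpha> \<in> R" and \<epsilon>: "0 < \<epsilon>" "\<epsilon> \<le> 1"
  shows "(\<integral>x. p x * complex_of_real (gauss x * ((\<alpha> \<bullet> x) / ((\<alpha> \<bullet> x)\<^sup>2 + \<epsilon>) * reg_weight \<epsilon> x)) \<partial>lborel)
    = (\<integral>x. reflection_quotient \<alpha> p x * complex_of_real (gauss x * (((\<alpha> \<bullet> x)\<^sup>2 / ((\<alpha> \<bullet> x)\<^sup>2 + \<epsilon>)) * reg_weight \<epsilon> x)) \<partial>lborel) / 2"
    and "integrable lborel (\<lambda>x. p x * complex_of_real (gauss x * ((\<alpha> \<bullet> x) / ((\<alpha> \<bullet> x)\<^sup>2 + \<epsilon>) * reg_weight \<epsilon> x)))"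
proof -
  have \<alpha>0: "\<alpha> \<noteq> 0" using root_nonzero[OF \<alpha>] .
  have [measurable]: "p \<in> borel_measurable borel" using hpoly_measurable[OF p] .
  let ?o = "\<lambda>x. complex_of_real (gauss x * ((\<alpha> \<bullet> x) / ((\<alpha> \<bullet> x)\<^sup>2 + \<epsilon>) * reg_weight \<epsilon> x))"
  have bd: "\<bar>(\<alpha> \<bullet> x) / ((\<alpha> \<bullet> x)\<^sup>2 + \<epsilon>)\<bar> \<le> 1 / \<epsilon>" for x
  proof -
    let ?t = "\<alpha> \<bullet> x"
    have pos: "?t\<^sup>2 + \<epsilon> > 0" using \<epsilon> by (simp add: add_nonneg_pos)
    have "\<epsilon> * \<bar>?t\<bar> \<le> ?t\<^sup>2 + \<epsilon>"
    proof (cases "\<bar>?t\<bar> \<le> 1")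
      case True
      then have "\<epsilon> * \<bar>?t\<bar> \<le> \<epsilon> * 1" using \<epsilon> by (intro mult_left_mono) auto
      then show ?thesis by (simp add: add_increasing)
    next
      case False
      have "\<epsilon> * \<bar>?t\<bar> \<le> \<bar>?t\<bar> * \<bar>?t\<bar>" using False \<epsilon> by (intro mult_right_mono) auto
      then show ?thesis using \<epsilon> by (simp add: power2_eq_square)
    qed
    then show ?thesis using pos \<epsilon> by (simp add: field_simps)
  qed
  have int: "integrable lborel (\<lambda>x. (1 / complex_of_real \<epsilon>) * (p x * complex_of_real (gauss x * (\<epsilon> * ((\<alpha> \<bullet> x) / ((\<alpha> \<bullet> x)\<^sup>2 + \<epsilon>)) * reg_weight \<epsilon> x))))"
  proof (intro integrable_mult_right gauss_integrable[OF p] AE_I2)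
    fix x
    have "\<bar>\<epsilon> * ((\<alpha> \<bullet> x) / ((\<alpha> \<bullet> x)\<^sup>2 + \<epsilon>)) * reg_weight \<epsilon> x\<bar> \<le> 1 * reg_weight \<epsilon> x"
    proof -
      have "\<bar>\<epsilon> * ((\<alpha> \<bullet> x) / ((\<alpha> \<bullet> x)\<^sup>2 + \<epsilon>))\<bar> \<le> \<epsilon> * (1 / \<epsilon>)"
        unfolding abs_mult using bd[of x] \<epsilon> by (intro mult_mono) auto
      then show ?thesis unfolding abs_mult[of _ "reg_weight \<epsilon> x"] using \<epsilon> by (intro mult_mono) (auto simp: reg_weight_def)
    qed
    also have "\<dots> \<le> reg_weight 1 x" using reg_weight_mono[OF \<epsilon>] by simp
    finally show "\<bar>\<epsilon> * ((\<alpha> \<bullet> x) / ((\<alpha> \<bullet> x)\<^sup>2 + \<epsilon>)) * reg_weight \<epsilon> x\<bar> \<le> reg_weight 1 x" .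
  qed measurable
  have "(\<lambda>x. (1 / complex_of_real \<epsilon>) * (p x * complex_of_real (gauss x * (\<epsilon> * ((\<alpha> \<bullet> x) / ((\<alpha> \<bullet> x)\<^sup>2 + \<epsilon>)) * reg_weight \<epsilon> x))))
     = (\<lambda>x. p x * ?o x)"
    using \<epsilon> by (auto simp: fun_eq_iff)
  then show int': "integrable lborel (\<lambda>x. p x * ?o x)" using int by simp
  have odd: "?o (reflection \<alpha> x) = - ?o x" for x
    by (simp add: gauss_reflection reg_weight_reflection[OF \<alpha>] inner_root_reflection[OF \<alpha>0])
  have "(\<integral>x. p (reflection \<alpha> x) * ?o (reflection \<alpha> x) \<partial>lborel) = (\<integral>x. p x * ?o x \<partial>lborel)"
    by (rule integral_reflection) measurable
  from arg_cong[OF this, of uminus]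
  have r: "(\<integral>x. p (reflection \<alpha> x) * ?o x \<partial>lborel) = - (\<integral>x. p x * ?o x \<partial>lborel)"
    unfolding odd mult_minus_right Bochner_Integration.integral_minus minus_minus .
  have int_r: "integrable lborel (\<lambda>x. p (reflection \<alpha> x) * ?o x)"
  proof -
    have "integrable (distr lborel borel (reflection \<alpha>)) (\<lambda>x. p x * ?o x)"
      unfolding lborel_distr_reflection by (rule int')
    then have "integrable lborel (\<lambda>x. p (reflection \<alpha> x) * ?o (reflection \<alpha> x))"
      by (subst (asm) integrable_distr_eq) auto
    then show ?thesis unfolding odd by simp
  qed
  have "2 * (\<integral>x. p x * ?o x \<partial>lborel) = (\<integral>x. p x * ?o x - p (reflection \<alpha> x) * ?o x \<partial>lborel)"
    using int' int_r r by simp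
  also have "\<dots> = (\<integral>x. reflection_quotient \<alpha> p x * complex_of_real (gauss x * (((\<alpha> \<bullet> x)\<^sup>2 / ((\<alpha> \<bullet> x)\<^sup>2 + \<epsilon>)) * reg_weight \<epsilon> x)) \<partial>lborel)"
  proof (rule Bochner_Integration.integral_cong)
    fix x
    have "p x * ?o x - p (reflection \<alpha> x) * ?o x = (p x - p (reflection \<alpha> x)) * ?o x" by (simp only: left_diff_distrib)
    also have "\<dots> = reflection_quotient \<alpha> p x * (complex_of_real (\<alpha> \<bullet> x) * ?o x)"
      unfolding hpoly_quotient_eq[OF p \<alpha>0] by (simp only: mult_ac)
    also have "complex_of_real (\<alpha> \<bullet> x) * ?o x = complex_of_real (gauss x * (((\<alpha> \<bullet> x)\<^sup>2 / ((\<alpha> \<bullet> x)\<^sup>2 + \<epsilon>)) * reg_weight \<epsilon> x))"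
      by (simp add: power2_eq_square)
    finally show "p x * ?o x - p (reflection \<alpha> x) * ?o x =
      reflection_quotient \<alpha> p x * complex_of_real (gauss x * (((\<alpha> \<bullet> x)\<^sup>2 / ((\<alpha> \<bullet> x)\<^sup>2 + \<epsilon>)) * reg_weight \<epsilon> x))" .
  qed simp
  finally have two: "2 * (\<integral>x. p x * ?o x \<partial>lborel)
    = (\<integral>x. reflection_quotient \<alpha> p x * complex_of_real (gauss x * (((\<alpha> \<bullet> x)\<^sup>2 / ((\<alpha> \<bullet> x)\<^sup>2 + \<epsilon>)) * reg_weight \<epsilon> x)) \<partial>lborel)" .
  have half: "X = Y / 2" if "2 * X = Y" for X Y :: complex using that by auto
  show "(\<integral>x. p x * ?o x \<partial>lborel)
    = (\<integral>x. reflection_quotient \<alpha> p x * complex_of_real (gauss x * (((\<alpha> \<bullet> x)\<^sup>2 / ((\<alpha> \<bullet> x)\<^sup>2 + \<epsilon>)) * reg_weight \<epsilon> x)) \<partial>lborel) / 2"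
    by (rule half[OF two])
qed

text \<open>The integral of the derivative of \<open>p * gauss * reg_weight \<epsilon>\<close> vanishes; its three kinds of terms come from \<open>p\<close>, the
Gaussian and the weight, the last ones rewritten by \<open>odd_part_integral\<close>.\<close>

lemma regularized_parts:
  assumes p: "hpoly m p" and \<epsilon>: "0 < \<epsilon>" "\<epsilon> \<le> 1"
  shows "(\<integral>x. directional_deriv \<xi> p x * complex_of_real (gauss x * (1 * reg_weight \<epsilon> x)) \<partial>lborel)
    - (\<integral>x. (complex_of_real (x \<bullet> \<xi>) * p x) * complex_of_real (gauss x * (1 * reg_weight \<epsilon> x)) \<partial>lborel)
    + (\<Sum>\<alpha>\<in>R. complex_of_real (k \<alpha> * (\<alpha> \<bullet> \<xi>) / 2) *
      (\<integral>x. reflection_quotient \<alpha> p x * complex_of_real (gauss x * (((\<alpha> \<bullet> x)\<^sup>2 / ((\<alpha> \<bullet> x)\<^sup>2 + \<epsilon>)) * reg_weight \<epsilon> x)) \<partial>lborel)) = 0"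
proof -
  let ?G = "\<lambda>x. p x * complex_of_real (gauss x * reg_weight \<epsilon> x)"
  let ?D1 = "\<lambda>x. directional_deriv \<xi> p x * complex_of_real (gauss x * (1 * reg_weight \<epsilon> x))"
  let ?D2 = "\<lambda>x. (complex_of_real (x \<bullet> \<xi>) * p x) * complex_of_real (gauss x * (1 * reg_weight \<epsilon> x))"
  let ?D3 = "\<lambda>\<alpha> x. complex_of_real (k \<alpha> * (\<alpha> \<bullet> \<xi>)) * (p x * complex_of_real (gauss x * ((\<alpha> \<bullet> x) / ((\<alpha> \<bullet> x)\<^sup>2 + \<epsilon>) * reg_weight \<epsilon> x)))"
  let ?G' = "\<lambda>x. ?D1 x - ?D2 x + (\<Sum>\<alpha>\<in>R. ?D3 \<alpha> x)"
  have w: "AE x in lborel. \<bar>1 * reg_weight \<epsilon> x\<bar> \<le> reg_weight 1 x" using reg_weight_mono[OF \<epsilon>] by (simp add: reg_weight_def)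
  have [measurable]: "(\<lambda>x. 1 * reg_weight \<epsilon> x) \<in> borel_measurable borel" by simp
  have i1: "integrable lborel ?D1" by (rule gauss_integrable[OF hpoly_directional_deriv[OF p] _ w]) simp
  have i2: "integrable lborel ?D2" by (rule gauss_integrable[OF hpoly_inner[OF p] _ w]) simp
  have i3: "integrable lborel (?D3 \<alpha>)" if "\<alpha> \<in> R" for \<alpha>
    by (intro integrable_mult_right odd_part_integral(2)[OF p that \<epsilon>])
  have iG: "integrable lborel ?G" using gauss_integrable[OF p _ w] by simp
  have iG': "integrable lborel ?G'"
    by (intro Bochner_Integration.integrable_add Bochner_Integration.integrable_diff Bochner_Integration.integrable_sum i1 i2 i3)
  have D: "(?G has_derivative (\<lambda>h. p x * complex_of_real (gauss x * (reg_weight \<epsilon> x * reg_log_deriv \<epsilon> h x) + (- (x \<bullet> h) * gauss x) * reg_weight \<epsilon> x)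
      + directional_deriv h p x * complex_of_real (gauss x * reg_weight \<epsilon> x))) (at x)" for x
    by (intro has_derivative_mult has_derivative_of_real has_derivative_directional hpoly_differentiable[OF p]
        gauss_has_derivative reg_weight_has_derivative \<epsilon>)
  have G'eq: "p x * complex_of_real (gauss x * (reg_weight \<epsilon> x * reg_log_deriv \<epsilon> \<xi> x) + (- (x \<bullet> \<xi>) * gauss x) * reg_weight \<epsilon> x)
      + directional_deriv \<xi> p x * complex_of_real (gauss x * reg_weight \<epsilon> x) = ?G' x" for x
  proof -
    have "(\<Sum>\<alpha>\<in>R. ?D3 \<alpha> x) = p x * complex_of_real (gauss x * (reg_weight \<epsilon> x * reg_log_deriv \<epsilon> \<xi> x))"
      unfolding reg_log_deriv_def of_real_mult of_real_sum sum_distrib_left by (intro sum.cong) (simp_all add: mult_ac)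
    then show ?thesis by (simp add: algebra_simps)
  qed
  have G0: "(\<integral>x. ?G' x \<partial>lborel) = 0"
  proof (rule integral_directional_derivative[OF _ _ iG iG'])
    fix x t
    have "((\<lambda>s. ?G (x + s *\<^sub>R \<xi>)) has_derivative (\<lambda>s. s *\<^sub>R ?G' (x + t *\<^sub>R \<xi>))) (at t)"
    proof -
      have 1: "((\<lambda>s. x + s *\<^sub>R \<xi>) has_derivative (\<lambda>s. s *\<^sub>R \<xi>)) (at t)" by (auto intro!: derivative_eq_intros)
      let ?F = "\<lambda>h. p (x + t *\<^sub>R \<xi>) * complex_of_real (gauss (x + t *\<^sub>R \<xi>) * (reg_weight \<epsilon> (x + t *\<^sub>R \<xi>) * reg_log_deriv \<epsilon> h (x + t *\<^sub>R \<xi>)) + (- ((x + t *\<^sub>R \<xi>) \<bullet> h) * gauss (x + t *\<^sub>R \<xi>)) * reg_weight \<epsilon> (x + t *\<^sub>R \<xi>))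
      + directional_deriv h p (x + t *\<^sub>R \<xi>) * complex_of_real (gauss (x + t *\<^sub>R \<xi>) * reg_weight \<epsilon> (x + t *\<^sub>R \<xi>))"
      have "((\<lambda>s. ?G (x + s *\<^sub>R \<xi>)) has_derivative (\<lambda>s. ?F (s *\<^sub>R \<xi>))) (at t)"
        by (rule has_derivative_compose[OF 1 D])
      moreover have "?F (s *\<^sub>R \<xi>) = s *\<^sub>R ?F \<xi>" for s
        using linear_scale[OF has_derivative_linear[OF D[of "x + t *\<^sub>R \<xi>"]]] by blast
      ultimately show ?thesis unfolding G'eq by simp
    qed
    then show "((\<lambda>t. ?G (x + t *\<^sub>R \<xi>)) has_vector_derivative ?G' (x + t *\<^sub>R \<xi>)) (at t)"
      by (simp only: has_vector_derivative_def)
  next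
    have pos: "(\<alpha> \<bullet> x)\<^sup>2 + \<epsilon> \<noteq> 0" for \<alpha> x :: "real^'n" using \<epsilon> by (metis add_pos_nonneg add.commute less_irrefl zero_le_power2)
    have cw: "continuous_on UNIV (reg_weight \<epsilon>)"
      using has_derivative_continuous[OF reg_weight_has_derivative[OF \<epsilon>(1)]] by (simp add: continuous_on_eq_continuous_at)
    have cg: "continuous_on UNIV gauss"
      using has_derivative_continuous[OF gauss_has_derivative] by (simp add: continuous_on_eq_continuous_at)
    show "continuous_on UNIV ?G'"
      by (intro continuous_intros hpoly_continuous[OF p] hpoly_continuous[OF hpoly_directional_deriv[OF p]] cw cg) (use pos in auto)
  qed
  have Gsum: "(\<integral>x. ?G' x \<partial>lborel) = (\<integral>x. ?D1 x \<partial>lborel) - (\<integral>x. ?D2 x \<partial>lborel) + (\<Sum>\<alpha>\<in>R. \<integral>x. ?D3 \<alpha> x \<partial>lborel)"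
  proof -
    have a1: "integrable lborel (\<lambda>x. ?D1 x - ?D2 x)" by (rule Bochner_Integration.integrable_diff[OF i1 i2])
    have a2: "integrable lborel (\<lambda>x. \<Sum>\<alpha>\<in>R. ?D3 \<alpha> x)" by (rule Bochner_Integration.integrable_sum[OF i3])
    have a3: "(\<integral>x. (\<Sum>\<alpha>\<in>R. ?D3 \<alpha> x) \<partial>lborel) = (\<Sum>\<alpha>\<in>R. \<integral>x. ?D3 \<alpha> x \<partial>lborel)"
      by (rule Bochner_Integration.integral_sum[OF i3])
    show ?thesis
      unfolding Bochner_Integration.integral_add[OF a1 a2] Bochner_Integration.integral_diff[OF i1 i2] a3 ..
  qed
  have D3: "(\<integral>x. ?D3 \<alpha> x \<partial>lborel) = complex_of_real (k \<alpha> * (\<alpha> \<bullet> \<xi>) / 2) *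
      (\<integral>x. reflection_quotient \<alpha> p x * complex_of_real (gauss x * (((\<alpha> \<bullet> x)\<^sup>2 / ((\<alpha> \<bullet> x)\<^sup>2 + \<epsilon>)) * reg_weight \<epsilon> x)) \<partial>lborel)"
    if "\<alpha> \<in> R" for \<alpha>
    unfolding integral_mult_right_zero odd_part_integral(1)[OF p that \<epsilon>] by simp
  have S: "(\<Sum>\<alpha>\<in>R. \<integral>x. ?D3 \<alpha> x \<partial>lborel) = (\<Sum>\<alpha>\<in>R. complex_of_real (k \<alpha> * (\<alpha> \<bullet> \<xi>) / 2) *
      (\<integral>x. reflection_quotient \<alpha> p x * complex_of_real (gauss x * (((\<alpha> \<bullet> x)\<^sup>2 / ((\<alpha> \<bullet> x)\<^sup>2 + \<epsilon>)) * reg_weight \<epsilon> x)) \<partial>lborel))"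
    by (rule sum.cong[OF HOL.refl D3])
  show ?thesis using G0 unfolding Gsum S .
qed

abbreviation gauss_integral :: "(real^'n \<Rightarrow> complex) \<Rightarrow> complex" where
  "gauss_integral f \<equiv> (\<integral>x. f x * complex_of_real (gauss x * weight x) \<partial>lborel)"

lemma gauss_integral_add: "hpoly m f \<Longrightarrow> hpoly n g \<Longrightarrow> gauss_integral (\<lambda>x. f x + g x) = gauss_integral f + gauss_integral g"
  by (simp only: distrib_right) (rule Bochner_Integration.integral_add; rule gauss_weight_integrable; assumption)

lemma gauss_integral_cmult: "gauss_integral (\<lambda>x. c * f x) = c * gauss_integral f"
  by (simp only: mult.assoc integral_mult_right_zero)

lemma gauss_integral_sum: "(\<And>i. i \<in> I \<Longrightarrow> hpoly m (f i)) \<Longrightarrow> gauss_integral (\<lambda>x. \<Sum>i\<in>I. f i x) = (\<Sum>i\<in>I. gauss_integral (f i))"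
  by (simp only: sum_distrib_right) (rule Bochner_Integration.integral_sum; rule gauss_weight_integrable; blast)

lemma gauss_integral_reflection:
  assumes "f \<in> borel_measurable borel" "\<alpha> \<in> R" shows "gauss_integral (\<lambda>x. f (reflection \<alpha> x)) = gauss_integral f"
proof -
  have [measurable]: "f \<in> borel_measurable borel" by (rule assms)
  have "(\<integral>x. f (reflection \<alpha> x) * complex_of_real (gauss (reflection \<alpha> x) * weight (reflection \<alpha> x)) \<partial>lborel) = gauss_integral f"
    by (rule integral_reflection) measurable
  then show ?thesis by (simp only: gauss_reflection weight_reflection[OF assms(2)])
qed

text \<open>The limit \<open>\<epsilon> \<longlonglongrightarrow> 0\<close> of \<open>regularized_parts\<close>. The sum over all roots counts each positive root twice, which
cancels the factor \<open>1 / 2\<close>, and what arises is exactly the difference part of the Dunkl operator.\<close>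

lemma gauss_integral_dunkl:
  assumes p: "hpoly m p"
  shows "gauss_integral (T \<xi> p) = gauss_integral (\<lambda>x. complex_of_real (x \<bullet> \<xi>) * p x)"
proof -
  let ?I = "\<lambda>f b n. \<integral>x. f x * complex_of_real (gauss x * (b n x * reg_weight (1 / real (Suc n)) x)) \<partial>lborel"
  let ?b = "\<lambda>\<alpha> n x. (\<alpha> \<bullet> x)\<^sup>2 / ((\<alpha> \<bullet> x)\<^sup>2 + 1 / real (Suc n))"
  have 1: "?I f (\<lambda>n x. 1) \<longlonglongrightarrow> gauss_integral f" if "hpoly j f" for j f
    by (rule gauss_limit[OF that]) auto
  have 2: "?I (reflection_quotient \<alpha> p) (?b \<alpha>) \<longlonglongrightarrow> gauss_integral (reflection_quotient \<alpha> p)" if "\<alpha> \<in> R" for \<alpha>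
  proof (rule gauss_limit[OF hpoly_quotient[OF p root_nonzero[OF that]]])
    show "\<bar>?b \<alpha> n x\<bar> \<le> 1" for n x
    proof -
      have "(\<alpha> \<bullet> x)\<^sup>2 + 1 / real (Suc n) > 0" by (simp add: add_nonneg_pos)
      then show ?thesis by (simp add: divide_le_eq)
    qed
    show "AE x in lborel. (\<lambda>n. ?b \<alpha> n x) \<longlonglongrightarrow> 1"
      using AE_regular
    proof eventually_elim
      case (elim x)
      then have "(\<alpha> \<bullet> x)\<^sup>2 \<noteq> 0" using that by auto
      then have "(\<lambda>n. ?b \<alpha> n x) \<longlonglongrightarrow> (\<alpha> \<bullet> x)\<^sup>2 / ((\<alpha> \<bullet> x)\<^sup>2 + 0)"
        using LIMSEQ_inverse_real_of_nat by (intro tendsto_intros) (auto simp: inverse_eq_divide)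
      then show ?case using \<open>(\<alpha> \<bullet> x)\<^sup>2 \<noteq> 0\<close> by simp
    qed
  qed measurable
  let ?x = "\<lambda>x. complex_of_real (x \<bullet> \<xi>) * p x"
  have "(\<lambda>n. ?I (directional_deriv \<xi> p) (\<lambda>n x. 1) n - ?I ?x (\<lambda>n x. 1) n
      + (\<Sum>\<alpha>\<in>R. complex_of_real (k \<alpha> * (\<alpha> \<bullet> \<xi>) / 2) * ?I (reflection_quotient \<alpha> p) (?b \<alpha>) n))
    \<longlonglongrightarrow> gauss_integral (directional_deriv \<xi> p) - gauss_integral ?x
      + (\<Sum>\<alpha>\<in>R. complex_of_real (k \<alpha> * (\<alpha> \<bullet> \<xi>) / 2) * gauss_integral (reflection_quotient \<alpha> p))"
    by (intro tendsto_intros 1[OF hpoly_directional_deriv[OF p]] 1[OF hpoly_inner[OF p]] 2)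
  moreover have "?I (directional_deriv \<xi> p) (\<lambda>n x. 1) n - ?I ?x (\<lambda>n x. 1) n
      + (\<Sum>\<alpha>\<in>R. complex_of_real (k \<alpha> * (\<alpha> \<bullet> \<xi>) / 2) * ?I (reflection_quotient \<alpha> p) (?b \<alpha>) n) = 0" for n
    by (rule regularized_parts[OF p]) auto
  ultimately have L: "gauss_integral (directional_deriv \<xi> p) - gauss_integral ?x
      + (\<Sum>\<alpha>\<in>R. complex_of_real (k \<alpha> * (\<alpha> \<bullet> \<xi>) / 2) * gauss_integral (reflection_quotient \<alpha> p)) = 0"
    by (simp add: LIMSEQ_const_iff)
  have "(\<Sum>\<alpha>\<in>R. complex_of_real (k \<alpha> * (\<alpha> \<bullet> \<xi>) / 2) * gauss_integral (reflection_quotient \<alpha> p))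
    = 2 * (\<Sum>\<alpha>\<in>P. complex_of_real (k \<alpha> * (\<alpha> \<bullet> \<xi>) / 2) * gauss_integral (reflection_quotient \<alpha> p))"
  proof (rule sum_R)
    fix \<alpha> assume "\<alpha> \<in> P"
    then have \<alpha>: "\<alpha> \<in> R" using P_subset by auto
    have "reflection_quotient (- \<alpha>) p x = - 1 * reflection_quotient \<alpha> p x" for x
      using linear_neg[OF has_derivative_linear[OF has_derivative_directional[OF hpoly_differentiable[OF p]]], of \<alpha> x]
      by (simp add: reflection_quotient_def reflection_uminus)
    then have "gauss_integral (reflection_quotient (- \<alpha>) p) = - 1 * gauss_integral (reflection_quotient \<alpha> p)"
      by (simp only: gauss_integral_cmult)
    then show "complex_of_real (k (- \<alpha>) * (- \<alpha> \<bullet> \<xi>) / 2) * gauss_integral (reflection_quotient (- \<alpha>) p)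
      = complex_of_real (k \<alpha> * (\<alpha> \<bullet> \<xi>) / 2) * gauss_integral (reflection_quotient \<alpha> p)"
      by (simp add: k_uminus[OF \<alpha>])
  qed
  also have "\<dots> = gauss_integral (\<lambda>x. \<Sum>\<alpha>\<in>P. complex_of_real (k \<alpha> * (\<alpha> \<bullet> \<xi>)) * reflection_quotient \<alpha> p x)"
  proof -
    have "gauss_integral (\<lambda>x. \<Sum>\<alpha>\<in>P. complex_of_real (k \<alpha> * (\<alpha> \<bullet> \<xi>)) * reflection_quotient \<alpha> p x)
      = (\<Sum>\<alpha>\<in>P. gauss_integral (\<lambda>x. complex_of_real (k \<alpha> * (\<alpha> \<bullet> \<xi>)) * reflection_quotient \<alpha> p x))"
      using root_nonzero P_subset by (intro gauss_integral_sum[of _ "m - 1"] hpoly_cmult hpoly_quotient[OF p]) auto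
    then show ?thesis unfolding gauss_integral_cmult by (simp add: sum_distrib_left)
  qed
  finally have S: "(\<Sum>\<alpha>\<in>R. complex_of_real (k \<alpha> * (\<alpha> \<bullet> \<xi>) / 2) * gauss_integral (reflection_quotient \<alpha> p))
    = gauss_integral (\<lambda>x. \<Sum>\<alpha>\<in>P. complex_of_real (k \<alpha> * (\<alpha> \<bullet> \<xi>)) * reflection_quotient \<alpha> p x)" .
  have "gauss_integral (T \<xi> p) = gauss_integral (directional_deriv \<xi> p) + gauss_integral (\<lambda>x. \<Sum>\<alpha>\<in>P. complex_of_real (k \<alpha> * (\<alpha> \<bullet> \<xi>)) * reflection_quotient \<alpha> p x)"
    unfolding dunkl_operator_def
    using root_nonzero P_subset
    by (intro gauss_integral_add[of "m - 1" _ "m - 1"] hpoly_sum hpoly_cmult hpoly_quotient[OF p] hpoly_directional_deriv[OF p]) auto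
  then show ?thesis using L unfolding S by (simp add: algebra_simps)
qed

end

section \<open>Orthogonality of harmonics of different degrees\<close>

context dunkl_setting begin

text \<open>Dunkl operators satisfy the Leibniz rule up to the terms
\<open>reflection_quotient \<alpha> p * (q - q \<circ> reflection \<alpha>)\<close>, which are odd under the reflection in \<open>\<alpha>\<close> and integrate to
zero.\<close>

lemma gauss_integral_dunkl_skew:
  assumes p: "hpoly m p" and q: "hpoly n q"
  shows "gauss_integral (\<lambda>x. T \<xi> p x * q x) + gauss_integral (\<lambda>x. p x * T \<xi> q x) = gauss_integral (\<lambda>x. complex_of_real (x \<bullet> \<xi>) * (p x * q x))"
proof -
  note pq = hpoly_mult[OF p q] and Tp = hpoly_dunkl_operator[OF p zero_notin_P] and Tq = hpoly_dunkl_operator[OF q zero_notin_P]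
  let ?e = "\<lambda>\<alpha> x. reflection_quotient \<alpha> p x * (q x - q (reflection \<alpha> x))"
  have he: "hpoly (m - 1 + n) (?e \<alpha>)" if "\<alpha> \<in> P" for \<alpha>
    using that zero_notin_P by (intro hpoly_mult hpoly_quotient[OF p] hpoly_diff q hpoly_reflection) auto
  have e0: "gauss_integral (?e \<alpha>) = 0" if "\<alpha> \<in> P" for \<alpha>
  proof -
    have \<alpha>: "\<alpha> \<in> R" "\<alpha> \<noteq> 0" using that P_subset root_nonzero by auto
    have rr: "reflection_quotient \<alpha> p (reflection \<alpha> x) = reflection_quotient \<alpha> p x" if "\<alpha> \<bullet> x \<noteq> 0" for x
      using that inner_root_reflection[OF \<alpha>(2), of x] by (auto simp: reflection_quotient_def field_simps)
    have "?e \<alpha> (reflection \<alpha> x) = - ?e \<alpha> x" for x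
      by (cases "\<alpha> \<bullet> x = 0") (auto simp: rr reflection_fixed algebra_simps)
    then have "gauss_integral (\<lambda>x. ?e \<alpha> (reflection \<alpha> x)) = - 1 * gauss_integral (?e \<alpha>)"
      unfolding gauss_integral_cmult[symmetric] by simp
    then show ?thesis using gauss_integral_reflection[OF hpoly_measurable[OF he[OF that]] \<alpha>(1)] by simp
  qed
  have leibniz: "T \<xi> p x * q x + p x * T \<xi> q x = T \<xi> (\<lambda>x. p x * q x) x + (\<Sum>\<alpha>\<in>P. complex_of_real (k \<alpha> * (\<alpha> \<bullet> \<xi>)) * ?e \<alpha> x)" for x
  proof -
    have d: "directional_deriv \<eta> (\<lambda>x. p x * q x) x = p x * directional_deriv \<eta> q x + directional_deriv \<eta> p x * q x" for \<eta>
      by (intro directional_deriv_eq has_derivative_mult has_derivative_directional hpoly_differentiable[OF p] hpoly_differentiable[OF q])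
    have r: "reflection_quotient \<alpha> (\<lambda>x. p x * q x) x + ?e \<alpha> x
        = reflection_quotient \<alpha> p x * q x + p x * reflection_quotient \<alpha> q x" if "\<alpha> \<in> P" for \<alpha>
      by (cases "\<alpha> \<bullet> x = 0")
        (auto simp: reflection_quotient_def d reflection_fixed scaleR_conv_of_real field_simps add_divide_distrib)
    have "T \<xi> (\<lambda>x. p x * q x) x + (\<Sum>\<alpha>\<in>P. complex_of_real (k \<alpha> * (\<alpha> \<bullet> \<xi>)) * ?e \<alpha> x)
      = directional_deriv \<xi> (\<lambda>x. p x * q x) x
        + (\<Sum>\<alpha>\<in>P. complex_of_real (k \<alpha> * (\<alpha> \<bullet> \<xi>)) * (reflection_quotient \<alpha> (\<lambda>x. p x * q x) x + ?e \<alpha> x))"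
      by (simp only: dunkl_operator_def distrib_left sum.distrib add.assoc)
    also have "(\<Sum>\<alpha>\<in>P. complex_of_real (k \<alpha> * (\<alpha> \<bullet> \<xi>)) * (reflection_quotient \<alpha> (\<lambda>x. p x * q x) x + ?e \<alpha> x))
      = (\<Sum>\<alpha>\<in>P. complex_of_real (k \<alpha> * (\<alpha> \<bullet> \<xi>)) * (reflection_quotient \<alpha> p x * q x + p x * reflection_quotient \<alpha> q x))"
      by (rule sum.cong) (simp_all only: r)
    also have "\<dots> = (\<Sum>\<alpha>\<in>P. complex_of_real (k \<alpha> * (\<alpha> \<bullet> \<xi>)) * reflection_quotient \<alpha> p x) * q x
        + p x * (\<Sum>\<alpha>\<in>P. complex_of_real (k \<alpha> * (\<alpha> \<bullet> \<xi>)) * reflection_quotient \<alpha> q x)"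
      by (simp add: sum_distrib_left sum_distrib_right sum.distrib[symmetric] distrib_left mult_ac)
    finally show ?thesis unfolding d by (simp only: dunkl_operator_def distrib_left distrib_right add_ac)
  qed
  have "gauss_integral (\<lambda>x. T \<xi> p x * q x) + gauss_integral (\<lambda>x. p x * T \<xi> q x) = gauss_integral (\<lambda>x. T \<xi> p x * q x + p x * T \<xi> q x)"
    by (rule gauss_integral_add[symmetric, OF hpoly_mult[OF Tp q] hpoly_mult[OF p Tq]])
  also have "\<dots> = gauss_integral (T \<xi> (\<lambda>x. p x * q x)) + gauss_integral (\<lambda>x. \<Sum>\<alpha>\<in>P. complex_of_real (k \<alpha> * (\<alpha> \<bullet> \<xi>)) * ?e \<alpha> x)"
    unfolding leibniz
    by (rule gauss_integral_add[OF hpoly_dunkl_operator[OF pq zero_notin_P] hpoly_sum[OF hpoly_cmult[OF he]]])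
  also have "gauss_integral (\<lambda>x. \<Sum>\<alpha>\<in>P. complex_of_real (k \<alpha> * (\<alpha> \<bullet> \<xi>)) * ?e \<alpha> x) = 0"
    by (subst gauss_integral_sum[OF hpoly_cmult[OF he]]) (auto simp only: gauss_integral_cmult e0 mult_zero_right sum.neutral_const intro!: sum.neutral)
  also have "gauss_integral (T \<xi> (\<lambda>x. p x * q x)) = gauss_integral (\<lambda>x. complex_of_real (x \<bullet> \<xi>) * (p x * q x))" by (rule gauss_integral_dunkl[OF pq])
  finally show ?thesis by simp
qed

text \<open>Euler's identity plus the difference parts, in which \<open>\<langle>\<alpha>, x\<rangle>\<close> cancels.\<close>

lemma dunkl_euler:
  assumes p: "hpoly m p"
  shows "(\<Sum>\<xi>\<in>Basis. complex_of_real (x \<bullet> \<xi>) * T \<xi> p x) = of_nat m * p x + (\<Sum>\<alpha>\<in>P. complex_of_real (k \<alpha>) * (p x - p (reflection \<alpha> x)))"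
proof -
  have "(\<Sum>\<xi>\<in>Basis. complex_of_real (x \<bullet> \<xi>) * T \<xi> p x)
    = (\<Sum>\<xi>\<in>Basis. complex_of_real (x \<bullet> \<xi>) * directional_deriv \<xi> p x)
      + (\<Sum>\<xi>\<in>Basis. \<Sum>\<alpha>\<in>P. complex_of_real (k \<alpha>) * (complex_of_real ((x \<bullet> \<xi>) * (\<alpha> \<bullet> \<xi>)) * reflection_quotient \<alpha> p x))"
    by (simp add: dunkl_operator_def distrib_left sum.distrib sum_distrib_left mult_ac)
  also have "(\<Sum>\<xi>\<in>Basis. \<Sum>\<alpha>\<in>P. complex_of_real (k \<alpha>) * (complex_of_real ((x \<bullet> \<xi>) * (\<alpha> \<bullet> \<xi>)) * reflection_quotient \<alpha> p x))
     = (\<Sum>\<alpha>\<in>P. complex_of_real (k \<alpha>) * (complex_of_real (\<Sum>\<xi>\<in>Basis. (x \<bullet> \<xi>) * (\<alpha> \<bullet> \<xi>)) * reflection_quotient \<alpha> p x))"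
    by (subst sum.swap) (simp only: of_real_sum sum_distrib_left sum_distrib_right)
  also have "\<dots> = (\<Sum>\<alpha>\<in>P. complex_of_real (k \<alpha>) * (p x - p (reflection \<alpha> x)))"
    unfolding sum_Basis_inner by (simp only: inner_commute[of x] reflection_quotient_inner_mult)
  finally show ?thesis
    by (simp only: sum_Basis_directional_deriv[OF hpoly_differentiable[OF p]] hpoly_euler[OF p])
qed

text \<open>Sum \<open>gauss_integral_dunkl_skew\<close> for \<open>T \<xi> p\<close> and \<open>q\<close> over the coordinate directions: the second-order term is \<open>Lap p = 0\<close>,
and the Gaussian term is \<open>\<Sum>\<^sub>j x\<^sub>j T\<^sub>j p\<close>, known from \<open>dunkl_euler\<close>.\<close>

lemma harmonic_gradient_form:
  assumes p: "harmonic m p" and q: "hpoly n q"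
  shows "(\<Sum>\<xi>\<in>Basis. gauss_integral (\<lambda>x. T \<xi> p x * T \<xi> q x))
    = (of_nat m + (\<Sum>\<alpha>\<in>P. complex_of_real (k \<alpha>))) * gauss_integral (\<lambda>x. p x * q x)
      - (\<Sum>\<alpha>\<in>P. complex_of_real (k \<alpha>) * gauss_integral (\<lambda>x. p (reflection \<alpha> x) * q x))"
proof -
  have hp: "hpoly m p" "\<And>x. Lap p x = 0" using p by (auto simp: harmonic_def)
  note Tp = hpoly_dunkl_operator[OF hp(1) zero_notin_P] and TTp = hpoly_dunkl_operator[OF hpoly_dunkl_operator[OF hp(1) zero_notin_P] zero_notin_P]
  note pq = hpoly_mult[OF hp(1) q] and rq = hpoly_mult[OF hpoly_reflection[OF hp(1)] q]
  have "(\<Sum>\<xi>\<in>Basis. gauss_integral (\<lambda>x. T \<xi> (T \<xi> p) x * q x)) + (\<Sum>\<xi>\<in>Basis. gauss_integral (\<lambda>x. T \<xi> p x * T \<xi> q x))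
    = (\<Sum>\<xi>\<in>Basis. gauss_integral (\<lambda>x. complex_of_real (x \<bullet> \<xi>) * (T \<xi> p x * q x)))"
    unfolding sum.distrib[symmetric] by (intro sum.cong HOL.refl gauss_integral_dunkl_skew[OF Tp q])
  also have "(\<Sum>\<xi>\<in>Basis. gauss_integral (\<lambda>x. T \<xi> (T \<xi> p) x * q x)) = gauss_integral (\<lambda>x. \<Sum>\<xi>\<in>Basis. T \<xi> (T \<xi> p) x * q x)"
    by (rule gauss_integral_sum[symmetric, OF hpoly_mult[OF TTp q]])
  also have "(\<lambda>x. \<Sum>\<xi>\<in>Basis. T \<xi> (T \<xi> p) x * q x) = (\<lambda>x. 0)"
    using hp(2) by (simp add: sum_distrib_right[symmetric] dunkl_laplacian_def)
  also have "(\<Sum>\<xi>\<in>Basis. gauss_integral (\<lambda>x. complex_of_real (x \<bullet> \<xi>) * (T \<xi> p x * q x)))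
      = gauss_integral (\<lambda>x. \<Sum>\<xi>\<in>Basis. complex_of_real (x \<bullet> \<xi>) * (T \<xi> p x * q x))"
    by (rule gauss_integral_sum[symmetric, OF hpoly_inner[OF hpoly_mult[OF Tp q]]])
  also have "(\<lambda>x. \<Sum>\<xi>\<in>Basis. complex_of_real (x \<bullet> \<xi>) * (T \<xi> p x * q x))
      = (\<lambda>x. (of_nat m + (\<Sum>\<alpha>\<in>P. complex_of_real (k \<alpha>))) * (p x * q x) - (\<Sum>\<alpha>\<in>P. complex_of_real (k \<alpha>) * (p (reflection \<alpha> x) * q x)))"
  proof
    fix x
    have "(\<Sum>\<xi>\<in>Basis. complex_of_real (x \<bullet> \<xi>) * (T \<xi> p x * q x)) = (\<Sum>\<xi>\<in>Basis. complex_of_real (x \<bullet> \<xi>) * T \<xi> p x) * q x"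
      by (simp only: sum_distrib_right mult.assoc)
    then show "(\<Sum>\<xi>\<in>Basis. complex_of_real (x \<bullet> \<xi>) * (T \<xi> p x * q x))
      = (of_nat m + (\<Sum>\<alpha>\<in>P. complex_of_real (k \<alpha>))) * (p x * q x) - (\<Sum>\<alpha>\<in>P. complex_of_real (k \<alpha>) * (p (reflection \<alpha> x) * q x))"
      unfolding dunkl_euler[OF hp(1)]
      by (simp add: right_diff_distrib sum_subtractf distrib_right left_diff_distrib sum_distrib_right mult.assoc)
  qed
  also have "gauss_integral (\<lambda>x. (of_nat m + (\<Sum>\<alpha>\<in>P. complex_of_real (k \<alpha>))) * (p x * q x) - (\<Sum>\<alpha>\<in>P. complex_of_real (k \<alpha>) * (p (reflection \<alpha> x) * q x)))
     = (of_nat m + (\<Sum>\<alpha>\<in>P. complex_of_real (k \<alpha>))) * gauss_integral (\<lambda>x. p x * q x)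
      - (\<Sum>\<alpha>\<in>P. complex_of_real (k \<alpha>) * gauss_integral (\<lambda>x. p (reflection \<alpha> x) * q x))"
  proof -
    have "gauss_integral (\<lambda>x. (of_nat m + (\<Sum>\<alpha>\<in>P. complex_of_real (k \<alpha>))) * (p x * q x) - (\<Sum>\<alpha>\<in>P. complex_of_real (k \<alpha>) * (p (reflection \<alpha> x) * q x)))
      = gauss_integral (\<lambda>x. (of_nat m + (\<Sum>\<alpha>\<in>P. complex_of_real (k \<alpha>))) * (p x * q x)) - gauss_integral (\<lambda>x. \<Sum>\<alpha>\<in>P. complex_of_real (k \<alpha>) * (p (reflection \<alpha> x) * q x))"
      unfolding left_diff_distrib
      by (intro Bochner_Integration.integral_diff gauss_weight_integrable[OF hpoly_cmult[OF pq]] gauss_weight_integrable[OF hpoly_sum[OF hpoly_cmult[OF rq]]])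
    also have "gauss_integral (\<lambda>x. \<Sum>\<alpha>\<in>P. complex_of_real (k \<alpha>) * (p (reflection \<alpha> x) * q x)) = (\<Sum>\<alpha>\<in>P. complex_of_real (k \<alpha>) * gauss_integral (\<lambda>x. p (reflection \<alpha> x) * q x))"
      by (subst gauss_integral_sum[OF hpoly_cmult[OF rq]]) (simp only: gauss_integral_cmult)
    finally show ?thesis by (simp only: gauss_integral_cmult)
  qed
  finally show ?thesis by simp
qed

text \<open>The left side of \<open>harmonic_gradient_form\<close> is symmetric in \<open>p\<close> and \<open>q\<close>, and so is the right side except for the
degree. Subtracting leaves \<open>(m - n)\<close> times the integral.\<close>

lemma harmonic_gauss_orthogonal:
  assumes p: "harmonic m p" and q: "harmonic n q" and mn: "m \<noteq> n"
  shows "gauss_integral (\<lambda>x. p x * q x) = 0"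
proof -
  have hp: "hpoly m p" and hq: "hpoly n q" using p q by (auto simp: harmonic_def)
  have sw: "gauss_integral (\<lambda>x. q (reflection \<alpha> x) * p x) = gauss_integral (\<lambda>x. p (reflection \<alpha> x) * q x)" if "\<alpha> \<in> P" for \<alpha>
    using gauss_integral_reflection[OF hpoly_measurable[OF hpoly_mult[OF hpoly_reflection[OF hp] hq]], of \<alpha> \<alpha>] that P_subset
    by (auto simp: mult.commute)
  have "(of_nat m + (\<Sum>\<alpha>\<in>P. complex_of_real (k \<alpha>))) * gauss_integral (\<lambda>x. p x * q x) - (\<Sum>\<alpha>\<in>P. complex_of_real (k \<alpha>) * gauss_integral (\<lambda>x. p (reflection \<alpha> x) * q x))
    = (of_nat n + (\<Sum>\<alpha>\<in>P. complex_of_real (k \<alpha>))) * gauss_integral (\<lambda>x. q x * p x) - (\<Sum>\<alpha>\<in>P. complex_of_real (k \<alpha>) * gauss_integral (\<lambda>x. q (reflection \<alpha> x) * p x))"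
    unfolding harmonic_gradient_form[OF p hq, symmetric] harmonic_gradient_form[OF q hp, symmetric]
    by (simp only: mult.commute)
  also have "(\<Sum>\<alpha>\<in>P. complex_of_real (k \<alpha>) * gauss_integral (\<lambda>x. q (reflection \<alpha> x) * p x)) = (\<Sum>\<alpha>\<in>P. complex_of_real (k \<alpha>) * gauss_integral (\<lambda>x. p (reflection \<alpha> x) * q x))"
    by (rule sum.cong) (simp_all only: sw)
  also have "(\<lambda>x. q x * p x) = (\<lambda>x. p x * q x)" by (simp add: mult.commute)
  finally have "(of_nat m - of_nat n) * gauss_integral (\<lambda>x. p x * q x) = 0" by (simp add: algebra_simps)
  moreover have "(of_nat m - of_nat n :: complex) \<noteq> 0" using mn by simp
  ultimately show ?thesis by simp
qed

end

section \<open>Inner products of the eigenfunctions\<close>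

lemma borel_measurable_poly[measurable (raw)]:
  fixes u :: "real poly"
  assumes "f \<in> borel_measurable N" shows "(\<lambda>x. poly u (f x)) \<in> borel_measurable N"
  by (rule measurable_compose[OF assms]) (intro borel_measurable_continuous_onI continuous_intros)

lemma mult_exp_mult_exp:
  fixes A B s t :: real
  shows "(A * exp (- s * t)) * (B * exp (- s * t)) = (A * B) * exp (- (2 * s) * t)"
proof -
  have "exp (- (2 * s) * t) = exp (- s * t) * exp (- s * t)" by (subst exp_add[symmetric]) simp
  then show ?thesis by (simp only: mult_ac)
qed

context dunkl_setting begin

lemma harmonic_cnj: assumes "harmonic m p" shows "harmonic m (\<lambda>x. cnj (p x))"
proof -
  have Tc: "T \<xi> (\<lambda>x. cnj (f x)) = (\<lambda>x. cnj (T \<xi> f x))" if f: "hpoly j f" for j f \<xi>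
  proof
    fix x
    have d: "directional_deriv \<eta> (\<lambda>x. cnj (f x)) x = cnj (directional_deriv \<eta> f x)" for \<eta>
      by (rule directional_deriv_eq) (intro has_derivative_cnj has_derivative_directional hpoly_differentiable[OF f])
    have "reflection_quotient \<alpha> (\<lambda>x. cnj (f x)) x = cnj (reflection_quotient \<alpha> f x)" for \<alpha>
      by (simp add: reflection_quotient_def d scaleR_conv_of_real)
    then show "T \<xi> (\<lambda>x. cnj (f x)) x = cnj (T \<xi> f x)" by (simp add: dunkl_operator_def d cnj_sum)
  qed
  have hp: "hpoly m p" "\<And>x. Lap p x = 0" using assms by (auto simp: harmonic_def)
  have "Lap (\<lambda>x. cnj (p x)) x = cnj (Lap p x)" for x
    unfolding dunkl_laplacian_def cnj_sum Tc[OF hp(1)] Tc[OF hpoly_dunkl_operator[OF hp(1) zero_notin_P]] ..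
  then show ?thesis unfolding harmonic_def using hpoly_cnj[OF hp(1)] hp(2) by simp
qed

text \<open>The angular constant \<open>K\<close> does not depend on the radial function. For harmonics of different degrees it is
therefore computed with the Gaussian, where the left side is zero and the radial integral is not.\<close>

lemma polar_weight:
  assumes p: "hpoly m p" and q: "hpoly n q"
  obtains K :: complex where
    "\<And>\<phi> :: real \<Rightarrow> real. \<phi> \<in> borel_measurable borel \<Longrightarrow>
      set_integrable lborel {0<..} (\<lambda>r. \<phi> r * r powr ((hdim m + hdim n) / 2 - 1)) \<Longrightarrow>
      has_bochner_integral lborel (\<lambda>x. (p x * cnj (q x) * complex_of_real (weight x)) * complex_of_real (\<phi> (norm x)))
        (K * complex_of_real (LINT r:{0<..}|lborel. \<phi> r * r powr ((hdim m + hdim n) / 2 - 1)))"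
    "harmonic m p \<Longrightarrow> harmonic n q \<Longrightarrow> m \<noteq> n \<Longrightarrow> K = 0"
proof -
  have [measurable]: "p \<in> borel_measurable borel" "(\<lambda>x. cnj (q x)) \<in> borel_measurable borel"
    using hpoly_measurable[OF p] hpoly_measurable[OF hpoly_cnj[OF q]] by auto
  let ?d = "(hdim m + hdim n) / 2"
  have d: "?d > 0" using hdim_pos[of m] hdim_pos[of n] by simp
  obtain C1 where C1: "C1 \<ge> 0" "\<And>x. cmod (p x) \<le> C1 * norm x ^ m" using hpoly_bound[OF p] by blast
  obtain C2 where C2: "C2 \<ge> 0" "\<And>x. cmod (q x) \<le> C2 * norm x ^ n" using hpoly_bound[OF q] by blast
  obtain C3 where C3: "C3 \<ge> 0" "\<And>x. norm x \<le> 1 \<Longrightarrow> weight x \<le> C3" using weight_bounded by blast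
  obtain K :: complex where K: "\<And>\<phi> :: real \<Rightarrow> real. \<phi> \<in> borel_measurable borel \<Longrightarrow>
      set_integrable lborel {0<..} (\<lambda>r. \<phi> r * r powr (?d - 1)) \<Longrightarrow>
      has_bochner_integral lborel (\<lambda>x. (p x * cnj (q x) * complex_of_real (weight x)) * complex_of_real (\<phi> (norm x)))
        (K * complex_of_real (LINT r:{0<..}|lborel. \<phi> r * r powr (?d - 1)))"
  proof (rule polar_integral[of "\<lambda>x. p x * cnj (q x) * complex_of_real (weight x)" ?d "C1 * C2 * C3"])
    show "(\<lambda>x. p x * cnj (q x) * complex_of_real (weight x)) \<in> borel_measurable borel" by measurable
    fix c :: real and x :: "real^'n" assume c: "c > 0"
    have "?d - real DIM(real^'n) = real m + (real n + 2 * ksum)" by (simp add: hdim_def field_simps)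
    then have "c powr (?d - real DIM(real^'n)) = c powr (real m + (real n + 2 * ksum))" by (simp only:)
    also have "\<dots> = c ^ m * (c ^ n * c powr (2 * ksum))" using c by (simp add: powr_add powr_realpow)
    finally show "p (c *\<^sub>R x) * cnj (q (c *\<^sub>R x)) * complex_of_real (weight (c *\<^sub>R x))
      = complex_of_real (c powr (?d - real DIM(real^'n))) * (p x * cnj (q x) * complex_of_real (weight x))"
      using c by (simp add: hpoly_homogeneous[OF p] hpoly_homogeneous[OF q] weight_homogeneous mult_ac)
  next
    fix x :: "real^'n" assume x: "norm x \<le> 1"
    have "cmod (p x) \<le> C1 * 1" using order_trans[OF C1(2)] C1(1) x by (meson mult_left_mono norm_ge_zero power_le_one)
    moreover have "cmod (q x) \<le> C2 * 1" using order_trans[OF C2(2)] C2(1) x by (meson mult_left_mono norm_ge_zero power_le_one)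
    moreover have "weight x \<le> C3" by (rule C3(2)[OF x])
    ultimately have "cmod (p x) * cmod (q x) * weight x \<le> (C1 * 1) * (C2 * 1) * C3"
      using C1 C2 C3 weight_nonneg by (intro mult_mono) auto
    then show "cmod (p x * cnj (q x) * complex_of_real (weight x)) \<le> C1 * C2 * C3"
      using weight_nonneg[of x] by (simp add: norm_mult)
  qed (use d in auto)
  have "K = 0" if "harmonic m p" "harmonic n q" "m \<noteq> n"
  proof -
    let ?\<phi> = "\<lambda>r::real. exp (- r\<^sup>2 / 2)"
    have int: "set_integrable lborel {0<..} (\<lambda>r. ?\<phi> r * r powr (?d - 1))"
    proof -
      have "set_integrable lborel {0<..} (\<lambda>r. r powr (?d - 1) * exp (- (1/2) * r powr 2))"
        by (rule powr_exp_integrable) (use d in auto)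
      also have "?this \<longleftrightarrow> ?thesis"
        by (rule set_integrable_cong) (auto simp: powr_numeral mult.commute)
      finally show ?thesis .
    qed
    let ?I = "LINT r:{0<..}|lborel. ?\<phi> r * r powr (?d - 1)"
    have "has_bochner_integral lborel (\<lambda>x. (p x * cnj (q x) * complex_of_real (weight x)) * complex_of_real (?\<phi> (norm x))) (K * complex_of_real ?I)"
      by (rule K[OF _ int]) measurable
    then have "(\<integral>x. (p x * cnj (q x) * complex_of_real (weight x)) * complex_of_real (?\<phi> (norm x)) \<partial>lborel) = K * complex_of_real ?I"
      by (rule has_bochner_integral_integral_eq)
    moreover have "(\<lambda>x. (p x * cnj (q x) * complex_of_real (weight x)) * complex_of_real (?\<phi> (norm x)))
        = (\<lambda>x. (p x * cnj (q x)) * complex_of_real (gauss x * weight x))"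
      by (simp add: gauss_def mult_ac)
    moreover have "gauss_integral (\<lambda>x. p x * cnj (q x)) = 0"
      by (rule harmonic_gauss_orthogonal[OF that(1) harmonic_cnj[OF that(2)] that(3)])
    ultimately have KI: "K * complex_of_real ?I = 0" by simp
    have "?I \<noteq> 0"
    proof
      assume "?I = 0"
      then have "AE r in lborel. indicator {0<..} r *\<^sub>R (?\<phi> r * r powr (?d - 1)) = 0"
        using int unfolding set_integrable_def set_lebesgue_integral_def
        by (subst (asm) integral_nonneg_eq_0_iff_AE) (auto simp: indicator_def)
      then have "AE r in lborel. r \<notin> {1..2::real}"
        by eventually_elim (auto simp: indicator_def)
      then have "emeasure lborel {1..2::real} = 0"
        by (subst (asm) AE_iff_measurable[of "{1..2}"]) auto
      then show False by simp
    qed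
    then show "K = 0" using KI by simp
  qed
  then show thesis using that K by blast
qed

end

context dunkl_ka begin

abbreviation M :: "(real^'n) measure" where "M \<equiv> theta_measure R k a"

lemma theta_eq: "theta_ka R k a x = norm x powr (a - 2) * weight x"
  by (simp add: theta_ka_def weight_def)

lemma theta_measurable[measurable]: "theta_ka R k a \<in> borel_measurable borel"
  unfolding theta_eq[abs_def] by measurable

lemma theta_nonneg: "theta_ka R k a x \<ge> 0" by (simp add: theta_eq weight_nonneg)

lemma sets_M[measurable_cong]: "sets M = sets borel" by (simp add: theta_measure_def)

lemma space_M: "space M = UNIV" by (simp add: theta_measure_def)

lemma AE_M: "AE x in lborel. Q x \<Longrightarrow> AE x in M. Q x"
  unfolding theta_measure_def by (subst AE_density) auto

lemma AE_M_nonzero: "AE x in M. x \<noteq> 0"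
  by (intro AE_M AE_lborel_singleton)

lemma borel_measurable_M: "f \<in> borel_measurable M \<longleftrightarrow> f \<in> borel_measurable borel"
  using measurable_cong_sets[OF sets_M HOL.refl] by blast

text \<open>The exponent of \<open>r powr (radial_exponent m n - 1)\<close>, the radial density for a product of polynomials of degrees \<open>m\<close> and \<open>n\<close>
in polar coordinates of the full measure. The assumption on \<open>a\<close> and \<open>k\<close> says that it is positive for
all degrees, that is, that the measure is finite near the origin.\<close>

definition radial_exponent :: "nat \<Rightarrow> nat \<Rightarrow> real" where "radial_exponent m n = (hdim m + hdim n) / 2 + a - 2"

lemma radial_exponent_pos: "radial_exponent m n > 0"
  using a_ksum by (simp add: radial_exponent_def hdim_def field_simps)

lemma radial_shift:
  assumes "r > 0"
  shows "(r powr (a - 2) * g) * r powr ((hdim m + hdim n) / 2 - 1) = r powr (radial_exponent m n - 1) * g"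
proof -
  have "r powr (a - 2) * r powr ((hdim m + hdim n) / 2 - 1) = r powr (radial_exponent m n - 1)"
    by (subst powr_add[symmetric]) (simp add: radial_exponent_def algebra_simps)
  then show ?thesis by (simp add: mult_ac)
qed

lemma radial_inner_integral:
  assumes p: "hpoly m p" and q: "hpoly n q"
  obtains K :: complex where
    "\<And>g :: real \<Rightarrow> real. g \<in> borel_measurable borel \<Longrightarrow> set_integrable lborel {0<..} (\<lambda>r. r powr (radial_exponent m n - 1) * g r) \<Longrightarrow>
      has_bochner_integral M (\<lambda>x. p x * cnj (q x) * complex_of_real (g (norm x)))
        (K * complex_of_real (LINT r:{0<..}|lborel. r powr (radial_exponent m n - 1) * g r))"
    "harmonic m p \<Longrightarrow> harmonic n q \<Longrightarrow> m \<noteq> n \<Longrightarrow> K = 0"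
proof -
  have [measurable]: "p \<in> borel_measurable borel" "(\<lambda>x. cnj (q x)) \<in> borel_measurable borel"
    using hpoly_measurable[OF p] hpoly_measurable[OF hpoly_cnj[OF q]] by auto
  obtain K :: complex where K: "\<And>\<phi> :: real \<Rightarrow> real. \<phi> \<in> borel_measurable borel \<Longrightarrow>
      set_integrable lborel {0<..} (\<lambda>r. \<phi> r * r powr ((hdim m + hdim n) / 2 - 1)) \<Longrightarrow>
      has_bochner_integral lborel (\<lambda>x. (p x * cnj (q x) * complex_of_real (weight x)) * complex_of_real (\<phi> (norm x)))
        (K * complex_of_real (LINT r:{0<..}|lborel. \<phi> r * r powr ((hdim m + hdim n) / 2 - 1)))"
    "harmonic m p \<Longrightarrow> harmonic n q \<Longrightarrow> m \<noteq> n \<Longrightarrow> K = 0"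
    using polar_weight[OF p q] by blast
  have "has_bochner_integral M (\<lambda>x. p x * cnj (q x) * complex_of_real (g (norm x)))
        (K * complex_of_real (LINT r:{0<..}|lborel. r powr (radial_exponent m n - 1) * g r))"
    if g[measurable]: "g \<in> borel_measurable borel" and int: "set_integrable lborel {0<..} (\<lambda>r. r powr (radial_exponent m n - 1) * g r)" for g :: "real \<Rightarrow> real"
  proof -
    have 1: "set_integrable lborel {0<..} (\<lambda>r. (r powr (a - 2) * g r) * r powr ((hdim m + hdim n) / 2 - 1))"
    proof -
      have "set_integrable lborel {0<..} (\<lambda>r. (r powr (a - 2) * g r) * r powr ((hdim m + hdim n) / 2 - 1))
          \<longleftrightarrow> set_integrable lborel {0<..} (\<lambda>r. r powr (radial_exponent m n - 1) * g r)"
        by (rule set_integrable_cong) (auto simp: radial_shift)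
      then show ?thesis using int by simp
    qed
    have 2: "(LINT r:{0<..}|lborel. (r powr (a - 2) * g r) * r powr ((hdim m + hdim n) / 2 - 1))
       = (LINT r:{0<..}|lborel. r powr (radial_exponent m n - 1) * g r)"
      by (rule set_lebesgue_integral_cong) (auto simp: radial_shift)
    have "has_bochner_integral lborel (\<lambda>x. (p x * cnj (q x) * complex_of_real (weight x)) * complex_of_real (norm x powr (a - 2) * g (norm x)))
        (K * complex_of_real (LINT r:{0<..}|lborel. r powr (radial_exponent m n - 1) * g r))"
      using K(1)[OF _ 1] unfolding 2 by simp
    also have "(\<lambda>x. (p x * cnj (q x) * complex_of_real (weight x)) * complex_of_real (norm x powr (a - 2) * g (norm x)))
      = (\<lambda>x. theta_ka R k a x *\<^sub>R (p x * cnj (q x) * complex_of_real (g (norm x))))"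
      by (simp add: theta_eq scaleR_conv_of_real mult_ac)
    finally have "has_bochner_integral (density lborel (\<lambda>x. ennreal (theta_ka R k a x)))
        (\<lambda>x. p x * cnj (q x) * complex_of_real (g (norm x)))
        (K * complex_of_real (LINT r:{0<..}|lborel. r powr (radial_exponent m n - 1) * g r))"
      by (intro has_bochner_integral_density) (auto simp: theta_nonneg)
    then show ?thesis by (simp add: theta_measure_def)
  qed
  then show thesis using that K(2) by blast
qed

lemma radial_L2:
  assumes p: "hpoly m p" and g[measurable]: "g \<in> borel_measurable borel"
    and int: "set_integrable lborel {0<..} (\<lambda>r. r powr (radial_exponent m m - 1) * (g r * g r))"
  shows "(\<lambda>x. p x * complex_of_real (g (norm x))) \<in> L2 M"
proof -
  have [measurable]: "p \<in> borel_measurable borel" using hpoly_measurable[OF p] .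
  obtain K where K: "\<And>g :: real \<Rightarrow> real. g \<in> borel_measurable borel \<Longrightarrow> set_integrable lborel {0<..} (\<lambda>r. r powr (radial_exponent m m - 1) * g r) \<Longrightarrow>
      has_bochner_integral M (\<lambda>x. p x * cnj (p x) * complex_of_real (g (norm x)))
        (K * complex_of_real (LINT r:{0<..}|lborel. r powr (radial_exponent m m - 1) * g r))"
    using radial_inner_integral[OF p p] by blast
  have "integrable M (\<lambda>x. p x * cnj (p x) * complex_of_real (g (norm x) * g (norm x)))"
    using K[of "\<lambda>r. g r * g r"] int by (auto simp: has_bochner_integral_iff)
  then have "integrable M (\<lambda>x. Re (p x * cnj (p x) * complex_of_real (g (norm x) * g (norm x))))" by (rule integrable_Re)
  also have "(\<lambda>x. Re (p x * cnj (p x) * complex_of_real (g (norm x) * g (norm x)))) = (\<lambda>x. (cmod (p x * complex_of_real (g (norm x))))\<^sup>2)"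
  proof
    fix x
    have "p x * cnj (p x) = complex_of_real ((cmod (p x))\<^sup>2)" by (rule complex_norm_square[symmetric])
    then show "Re (p x * cnj (p x) * complex_of_real (g (norm x) * g (norm x))) = (cmod (p x * complex_of_real (g (norm x))))\<^sup>2"
      by (simp only: of_real_mult[symmetric] Re_complex_of_real) (simp add: norm_mult power_mult_distrib power2_eq_square)
  qed
  finally show ?thesis unfolding L2_def by (simp add: borel_measurable_M)
qed

lemma poly_exp_radial_L2:
  assumes p: "hpoly m p" and s: "s > 0"
  shows "(\<lambda>x. p x * complex_of_real (poly u (norm x powr a) * exp (- s * norm x powr a))) \<in> L2 M"
proof (rule radial_L2[OF p])
  have "set_integrable lborel {0<..} (\<lambda>r. r powr (radial_exponent m m - 1) * (poly (u * u) (1 * r powr a) * exp (- (2 * s) * r powr a)))"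
    using a_pos s radial_exponent_pos by (intro poly_exp_integrable) auto
  also have "(\<lambda>r. r powr (radial_exponent m m - 1) * (poly (u * u) (1 * r powr a) * exp (- (2 * s) * r powr a)))
     = (\<lambda>r. r powr (radial_exponent m m - 1) * (poly u (r powr a) * exp (- s * r powr a) * (poly u (r powr a) * exp (- s * r powr a))))"
    by (simp only: mult_exp_mult_exp poly_mult mult_1)
  finally show "set_integrable lborel {0<..} (\<lambda>r. r powr (radial_exponent m m - 1) * (poly u (r powr a) * exp (- s * r powr a) * (poly u (r powr a) * exp (- s * r powr a))))" .
qed measurable

lemma profile_poly: "profile l m r = poly (pcompose (laguerre_poly l (laguerre_index m)) [:0, 2 / a:]) (r powr a) * exp (- (1 / a) * r powr a)"
  by (simp add: profile_def poly_laguerre[symmetric] poly_pcompose mult.commute)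

lemma Phi_L2: assumes "hpoly m p" shows "Phi l m p \<in> L2 M"
  unfolding Phi_def[abs_def] profile_poly
  by (rule poly_exp_radial_L2[OF assms]) (use a_pos in simp)

lemma profile_measurable[measurable]: "profile l m \<in> borel_measurable borel"
  unfolding profile_poly[abs_def] by measurable

lemma profile_mult:
  "profile l m r * profile l' m' r = poly (laguerre_poly l (laguerre_index m) * laguerre_poly l' (laguerre_index m')) (2 / a * r powr a) * exp (- (2 / a) * r powr a)"
proof -
  have 1: "profile l m r = poly (laguerre_poly l (laguerre_index m)) (2 / a * r powr a) * exp (- (1 / a) * r powr a)" for l m
    by (simp add: profile_def poly_laguerre)
  show ?thesis unfolding 1 mult_exp_mult_exp poly_mult by simp
qed

text \<open>The Wronskian argument in integrated form: for \<open>p = A' B - A B'\<close>, with the Laguerre polynomials \<open>A\<close> and \<open>B\<close> of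
degrees \<open>l\<close> and \<open>l'\<close>, Laguerre's equation makes the total derivative of \<open>radial_total_derivative\<close> equal
to \<open>(l' - l) * A * B\<close>.\<close>

lemma laguerre_profile_orthogonal:
  assumes "l \<noteq> l'"
  shows "(LINT r:{0<..}|lborel. r powr (radial_exponent m m - 1) * (profile l m r * profile l' m r)) = 0"
proof -
  let ?A = "laguerre_poly l (laguerre_index m)" and ?B = "laguerre_poly l' (laguerre_index m)"
  \<comment> \<open>The Wronskian of the two solutions.\<close>
  let ?p = "pderiv ?A * ?B - ?A * pderiv ?B"
  have c: "radial_exponent m m / a = laguerre_index m + 1" using a_pos by (simp add: radial_exponent_def laguerre_index_def field_simps)
  have gen: "X = - Y - Z" if "X + Y + Z = 0" for X Y Z :: "real poly" using that by algebra
  have A: "[:0, 1:] * pderiv (pderiv ?A) = - ([:laguerre_index m + 1, -1:] * pderiv ?A) - smult (real l) ?A"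
    by (rule gen[OF laguerre_ode[OF laguerre_index_gt, of l m]])
  have B: "[:0, 1:] * pderiv (pderiv ?B) = - ([:laguerre_index m + 1, -1:] * pderiv ?B) - smult (real l') ?B"
    by (rule gen[OF laguerre_ode[OF laguerre_index_gt, of l' m]])
  have "smult (radial_exponent m m / a) ?p + [:0, 1:] * pderiv ?p - [:0, 1:] * ?p
    = smult (laguerre_index m + 1) ?p + (([:0, 1:] * pderiv (pderiv ?A)) * ?B - ?A * ([:0, 1:] * pderiv (pderiv ?B))) - [:0, 1:] * ?p"
    unfolding c by (simp add: pderiv_diff pderiv_mult algebra_simps)
  also have "\<dots> = smult (real l' - real l) (?A * ?B)"
    unfolding A B by (simp add: algebra_simps smult_diff_right smult_diff_left smult_add_left)
  finally have e: "smult (radial_exponent m m / a) ?p + [:0, 1:] * pderiv ?p - [:0, 1:] * ?p = smult (real l' - real l) (?A * ?B)" .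
  have "(LINT r:{0<..}|lborel. r powr (radial_exponent m m - 1) * (poly (smult (real l' - real l) (?A * ?B)) (2 / a * r powr a) * exp (- (2 / a) * r powr a))) = 0"
    using radial_total_derivative[of a "2 / a" "radial_exponent m m" ?p] a_pos radial_exponent_pos unfolding e by simp
  also have "(LINT r:{0<..}|lborel. r powr (radial_exponent m m - 1) * (poly (smult (real l' - real l) (?A * ?B)) (2 / a * r powr a) * exp (- (2 / a) * r powr a)))
    = (real l' - real l) * (LINT r:{0<..}|lborel. r powr (radial_exponent m m - 1) * (profile l m r * profile l' m r))"
  proof -
    have "(\<lambda>r. r powr (radial_exponent m m - 1) * (poly (smult (real l' - real l) (?A * ?B)) (2 / a * r powr a) * exp (- (2 / a) * r powr a)))
      = (\<lambda>r. (real l' - real l) * (r powr (radial_exponent m m - 1) * (profile l m r * profile l' m r)))"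
      unfolding profile_mult by (simp only: poly_smult mult_ac)
    then show ?thesis by (simp only: set_integral_mult_right)
  qed
  finally show ?thesis using assms by simp
qed

lemma Phi_orthogonal:
  assumes p: "harmonic m p" and q: "harmonic n q" and ne: "(l, m) \<noteq> (l', n)"
  shows "L2_inner M (Phi l m p) (Phi l' n q) = 0"
proof -
  have hp: "hpoly m p" and hq: "hpoly n q" using p q by (auto simp: harmonic_def)
  obtain K :: complex where K: "\<And>g :: real \<Rightarrow> real. g \<in> borel_measurable borel \<Longrightarrow> set_integrable lborel {0<..} (\<lambda>r. r powr (radial_exponent m n - 1) * g r) \<Longrightarrow>
      has_bochner_integral M (\<lambda>x. p x * cnj (q x) * complex_of_real (g (norm x)))
        (K * complex_of_real (LINT r:{0<..}|lborel. r powr (radial_exponent m n - 1) * g r))"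
    "harmonic m p \<Longrightarrow> harmonic n q \<Longrightarrow> m \<noteq> n \<Longrightarrow> K = 0"
    using radial_inner_integral[OF hp hq] by blast
  let ?g = "\<lambda>r. profile l m r * profile l' n r"
  have "set_integrable lborel {0<..} (\<lambda>r. r powr (radial_exponent m n - 1) * ?g r)"
    unfolding profile_mult using a_pos radial_exponent_pos by (intro poly_exp_integrable) auto
  then have "has_bochner_integral M (\<lambda>x. p x * cnj (q x) * complex_of_real (?g (norm x)))
        (K * complex_of_real (LINT r:{0<..}|lborel. r powr (radial_exponent m n - 1) * ?g r))"
    by (intro K(1)) measurable
  then have "L2_inner M (Phi l m p) (Phi l' n q) = K * complex_of_real (LINT r:{0<..}|lborel. r powr (radial_exponent m n - 1) * ?g r)"
    unfolding L2_inner_def Phi_def by (intro has_bochner_integral_integral_eq) (simp add: mult_ac)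
  also have "\<dots> = 0"
    using K(2)[OF p q] laguerre_profile_orthogonal[of l l' m] ne by (cases "m = n") auto
  finally show ?thesis .
qed

text \<open>The set where neither \<open>p\<close> nor the Laguerre factor vanishes is open. It is nonempty because along a ray through a
point with \<open>p \<noteq> 0\<close> the Laguerre factor has finitely many zeros. An open nonempty set has positive Lebesgue
measure, and the density is positive off the hyperplanes.\<close>

lemma Phi_not_null:
  assumes p: "hpoly m p" and x0: "p x0 \<noteq> 0"
  shows "\<not> (AE x in M. Phi l m p x = 0)"
proof
  assume "AE x in M. Phi l m p x = 0"
  then have ae: "AE x in lborel. 0 < theta_ka R k a x \<longrightarrow> Phi l m p x = 0"
    unfolding theta_measure_def by (subst (asm) AE_density) auto
  have ae2: "AE x in lborel. x \<noteq> 0 \<longrightarrow> (\<forall>\<alpha>\<in>R. \<alpha> \<bullet> x \<noteq> 0) \<longrightarrow> p x = 0 \<or> laguerre l (laguerre_index m) (2 / a * norm x powr a) = 0"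
    using ae
  proof eventually_elim
    case (elim x)
    show ?case
    proof (intro impI)
      assume x: "x \<noteq> 0" "\<forall>\<alpha>\<in>R. \<alpha> \<bullet> x \<noteq> 0"
      have "weight x > 0" unfolding weight_def using x by (intro prod_pos) auto
      then have "theta_ka R k a x > 0" using x by (simp add: theta_eq)
      then show "p x = 0 \<or> laguerre l (laguerre_index m) (2 / a * norm x powr a) = 0"
        using elim by (auto simp: Phi_def profile_def)
    qed
  qed
  have Lnz: "laguerre_poly l (laguerre_index m) \<noteq> 0"
  proof
    assume "laguerre_poly l (laguerre_index m) = 0"
    then have "coeff (laguerre_poly l (laguerre_index m)) l = 0" by simp
    moreover have "laguerre_index m + real l + 1 > 0" using laguerre_index_gt[of m] by (simp add: add_pos_nonneg)
    then have "Gamma (laguerre_index m + real l + 1) > 0" by (rule Gamma_real_pos)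
    ultimately show False by (simp add: coeff_laguerre)
  qed
  let ?Z = "{t. poly (laguerre_poly l (laguerre_index m)) t = 0}"
  have finZ: "finite ?Z" by (rule poly_roots_finite[OF Lnz])
  define U where "U = {x::real^'n. p x \<noteq> 0 \<and> laguerre l (laguerre_index m) (2 / a * norm x powr a) \<noteq> 0 \<and> x \<noteq> 0}"
  have "\<exists>x. x \<in> U"
  proof -
    have "\<exists>y. p y \<noteq> 0 \<and> y \<noteq> 0"
    proof (cases "x0 = 0")
      case True
      have "open (p -` (- {0}))"
        using hpoly_continuous[OF p, of UNIV] by (intro open_vimage) (auto simp: open_Compl)
      moreover have "0 \<in> p -` (- {0})" using x0 True by simp
      ultimately obtain e where e: "e > 0" "ball 0 e \<subseteq> p -` (- {0})" by (rule openE)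
      obtain i :: 'n where True by blast
      have "(e / 2) *\<^sub>R axis i 1 \<in> ball (0::real^'n) e" using e(1) by simp
      from subsetD[OF e(2) this] show ?thesis
        using e(1) by (intro exI[of _ "(e / 2) *\<^sub>R axis i 1"]) (auto simp: axis_eq_0_iff)
    qed (use x0 in blast)
    then obtain y where y: "p y \<noteq> 0" "y \<noteq> 0" by blast
    let ?f = "\<lambda>c. 2 / a * (c * norm y) powr a"
    have "inj_on ?f {0<..}"
    proof (rule inj_onI)
      fix c d assume "c \<in> {0<..}" "d \<in> {0<..}" "?f c = ?f d"
      then have "(c * norm y) powr a = (d * norm y) powr a" using a_pos by simp
      from arg_cong[OF this, of "\<lambda>z. z powr (1 / a)"] have "c * norm y = d * norm y"
        using \<open>c \<in> {0<..}\<close> \<open>d \<in> {0<..}\<close> a_pos by (simp add: powr_powr)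
      then show "c = d" using y by simp
    qed
    then have "finite (?f -` ?Z \<inter> {0<..})" using finZ by (rule finite_vimage_IntI[rotated])
    moreover have "infinite {0::real<..}" by (rule infinite_Ioi)
    ultimately have "\<not> {0<..} \<subseteq> ?f -` ?Z \<inter> {0<..}" using finite_subset by blast
    then obtain c where c: "c > 0" "?f c \<notin> ?Z" by auto
    have "c *\<^sub>R y \<in> U"
      using c y by (simp add: U_def poly_laguerre hpoly_homogeneous[OF p])
    then show ?thesis by blast
  qed
  moreover have "open U"
  proof -
    have "continuous_on UNIV p" by (rule hpoly_continuous[OF p])
    moreover have "continuous_on (UNIV::(real^'n) set) (\<lambda>x. norm x powr a)"
      by (rule continuous_on_powr') (auto intro!: continuous_intros simp: a_pos)
    then have "continuous_on (UNIV::(real^'n) set) (\<lambda>x. poly (laguerre_poly l (laguerre_index m)) (2 / a * norm x powr a))"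
      by (intro continuous_on_poly continuous_on_mult continuous_on_const)
    ultimately have "open (p -` (- {0}) \<inter> (\<lambda>x. poly (laguerre_poly l (laguerre_index m)) (2 / a * norm x powr a)) -` (- {0}) \<inter> - {0})"
      by (intro open_Int open_vimage) (auto simp: open_Compl)
    also have "p -` (- {0}) \<inter> (\<lambda>x. poly (laguerre_poly l (laguerre_index m)) (2 / a * norm x powr a)) -` (- {0}) \<inter> - {0} = U"
      by (auto simp: U_def poly_laguerre)
    finally show ?thesis .
  qed
  ultimately obtain x e where xe: "e > 0" "ball x e \<subseteq> U" by (metis open_contains_ball)
  have "AE x in lborel. x \<notin> U"
    using ae2 AE_regular by eventually_elim (auto simp: U_def)
  then have "AE y in lborel. y \<notin> ball x e" by eventually_elim (use xe in auto)
  then have "emeasure lborel (ball x e) = 0"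
    by (subst (asm) AE_iff_measurable[of "ball x e"]) auto
  then have "measure lborel (ball x e) = 0" by (simp add: measure_def)
  then show False using content_ball_pos[OF xe(1), of x] by simp
qed

end

section \<open>Completeness of the eigenfunctions\<close>

definition L2_closure :: "'x measure \<Rightarrow> ('x \<Rightarrow> complex) set \<Rightarrow> ('x \<Rightarrow> complex) set" where
  "L2_closure N D = {f \<in> L2 N. \<forall>\<epsilon>>0. \<exists>u\<in>D. L2_norm N (\<lambda>x. f x - u x) < \<epsilon>}"

lemma L2_closure_L2: "f \<in> L2_closure N D \<Longrightarrow> f \<in> L2 N"
  by (simp add: L2_closure_def)

lemma L2_closure_superset:
  assumes "D \<subseteq> L2 N" "f \<in> D" shows "f \<in> L2_closure N D"
proof -
  have "L2_norm N (\<lambda>x. f x - f x) = 0" by (simp add: L2_norm_def)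
  then show ?thesis using assms unfolding L2_closure_def by force
qed

lemma L2_closure_limit:
  assumes D: "D \<subseteq> L2 N" and s: "\<And>n::nat. s n \<in> L2_closure N D" and f: "f \<in> L2 N"
    and lim: "(\<lambda>n. L2_norm N (\<lambda>x. f x - s n x)) \<longlonglongrightarrow> 0"
  shows "f \<in> L2_closure N D"
  unfolding L2_closure_def
proof (intro CollectI conjI f allI impI)
  fix \<epsilon> :: real assume \<epsilon>: "\<epsilon> > 0"
  then obtain n where n: "L2_norm N (\<lambda>x. f x - s n x) < \<epsilon> / 2"
    using LIMSEQ_D[OF lim, of "\<epsilon> / 2"] by auto
  obtain u where u: "u \<in> D" "L2_norm N (\<lambda>x. s n x - u x) < \<epsilon> / 2"
    using s[of n] \<epsilon> half_gt_zero[OF \<epsilon>] unfolding L2_closure_def by blast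
  have "L2_norm N (\<lambda>x. f x - u x) \<le> L2_norm N (\<lambda>x. f x - s n x) + L2_norm N (\<lambda>x. s n x - u x)"
    using L2_norm_triangle_diff[OF f L2_closure_L2[OF s[of n]], of u] D u(1) by auto
  then show "\<exists>u\<in>D. L2_norm N (\<lambda>x. f x - u x) < \<epsilon>" using n u by (intro bexI[of _ u]) auto
qed

text \<open>The closure is stable under dominated pointwise limits; each extension step below is an instance.\<close>

lemma L2_closure_dominated:
  assumes D: "D \<subseteq> L2 N" and s: "\<And>n::nat. s n \<in> L2_closure N D" and g: "g \<in> L2 N"
    and f: "f \<in> borel_measurable N" and lim: "AE x in N. (\<lambda>n. s n x) \<longlonglongrightarrow> f x"
    and bd: "\<And>n. AE x in N. cmod (s n x) \<le> cmod (g x)"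
  shows "f \<in> L2_closure N D"
proof -
  have m: "s n \<in> borel_measurable N" for n using L2_closure_L2[OF s[of n]] by (simp add: L2_def)
  note d = L2_dominated_convergence[OF g f m lim bd]
  show ?thesis by (rule L2_closure_limit[where s = s, OF D s d])
qed

lemma L2_closure_span_add:
  assumes D: "complex_span B \<subseteq> L2 N" and "f \<in> L2_closure N (complex_span B)" "g \<in> L2_closure N (complex_span B)"
  shows "(\<lambda>x. f x + g x) \<in> L2_closure N (complex_span B)"
  unfolding L2_closure_def
proof (intro CollectI conjI allI impI)
  note L = assms(2,3)[THEN L2_closure_L2]
  show "(\<lambda>x. f x + g x) \<in> L2 N" by (intro L2_add L)
  fix \<epsilon> :: real assume "\<epsilon> > 0"
  then have "\<epsilon> / 2 > 0" by simp
  then obtain u v where uv: "u \<in> complex_span B" "L2_norm N (\<lambda>x. f x - u x) < \<epsilon> / 2"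
     "v \<in> complex_span B" "L2_norm N (\<lambda>x. g x - v x) < \<epsilon> / 2"
    using assms(2,3) unfolding L2_closure_def by blast
  have "L2_norm N (\<lambda>x. (f x - u x) + (g x - v x)) \<le> L2_norm N (\<lambda>x. f x - u x) + L2_norm N (\<lambda>x. g x - v x)"
    using uv D L by (intro L2_norm_triangle L2_diff) auto
  also have "(\<lambda>x. (f x - u x) + (g x - v x)) = (\<lambda>x. f x + g x - (u x + v x))" by (simp add: algebra_simps)
  finally show "\<exists>u\<in>complex_span B. L2_norm N (\<lambda>x. f x + g x - u x) < \<epsilon>"
    using uv by (intro bexI[of _ "\<lambda>x. u x + v x"] complex_span_add) auto
qed

lemma L2_closure_span_cmult:
  assumes "f \<in> L2_closure N (complex_span B)"
  shows "(\<lambda>x. c * f x) \<in> L2_closure N (complex_span B)"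
  unfolding L2_closure_def
proof (intro CollectI conjI allI impI)
  show "(\<lambda>x. c * f x) \<in> L2 N" by (intro L2_cmult L2_closure_L2[OF assms])
  fix \<epsilon> :: real assume \<epsilon>: "\<epsilon> > 0"
  have pos: "cmod c + 1 > 0" by (simp add: add_nonneg_pos)
  then have "\<epsilon> / (cmod c + 1) > 0" using \<epsilon> by simp
  then obtain u where u: "u \<in> complex_span B" "L2_norm N (\<lambda>x. f x - u x) < \<epsilon> / (cmod c + 1)"
    using assms unfolding L2_closure_def by blast
  have "L2_norm N (\<lambda>x. c * f x - c * u x) = cmod c * L2_norm N (\<lambda>x. f x - u x)"
    by (simp only: right_diff_distrib[symmetric] L2_norm_cmult)
  also have "\<dots> \<le> (cmod c + 1) * L2_norm N (\<lambda>x. f x - u x)" by (intro mult_right_mono) auto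
  also have "\<dots> < \<epsilon>" using u(2) pos by (simp add: pos_less_divide_eq mult.commute)
  finally show "\<exists>u\<in>complex_span B. L2_norm N (\<lambda>x. c * f x - u x) < \<epsilon>"
    using complex_span_cmult[OF u(1), of c] by (intro bexI[of _ "\<lambda>x. c * u x"])
qed

lemma L2_closure_span_sum:
  assumes D: "complex_span B \<subseteq> L2 N" and "\<And>i. i \<in> I \<Longrightarrow> f i \<in> L2_closure N (complex_span B)"
  shows "(\<lambda>x. \<Sum>i\<in>I. c i * f i x) \<in> L2_closure N (complex_span B)"
  using assms(2)
proof (induction I rule: infinite_finite_induct)
  case (insert i I)
  have "(\<lambda>x. c i * f i x + (\<Sum>i\<in>I. c i * f i x)) \<in> L2_closure N (complex_span B)"
    by (rule L2_closure_span_add[OF D L2_closure_span_cmult]) (use insert in auto)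
  then show ?case using insert.hyps by simp
qed (use L2_closure_superset[OF D complex_span_zero] in simp_all)

text \<open>A continuous function on the unit interval that vanishes near both ends and tends to \<open>1\<close> inside. With
\<open>u = exp (- norm x powr a)\<close> it cuts off neighbourhoods of the origin (\<open>u\<close> near \<open>1\<close>) and of infinity (\<open>u\<close>
near \<open>0\<close>). The number \<open>n + 3\<close> makes the two excluded intervals disjoint from the start.\<close>

definition cutoff :: "nat \<Rightarrow> real \<Rightarrow> real" where
  "cutoff n u = min 1 (max 0 (real (n + 3) * u - 1)) * min 1 (max 0 (real (n + 3) * (1 - u) - 1))"

lemma cutoff_range: "0 \<le> cutoff n u" "cutoff n u \<le> 1"
  by (auto simp: cutoff_def mult_le_one)

lemma cutoff_support:
  assumes "cutoff n u \<noteq> 0" shows "1 / real (n + 3) < u" "u < 1 - 1 / real (n + 3)"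
proof -
  have "real (n + 3) * u - 1 > 0" "real (n + 3) * (1 - u) - 1 > 0"
    using assms by (auto simp: cutoff_def max_def split: if_splits)
  then show "1 / real (n + 3) < u" "u < 1 - 1 / real (n + 3)" by (auto simp: field_simps)
qed

lemma cutoff_tendsto:
  assumes "0 < u" "u < 1" shows "(\<lambda>n. cutoff n u) \<longlonglongrightarrow> 1"
proof (rule tendsto_eventually)
  obtain N1 where N1: "real N1 > 2 / u" using reals_Archimedean2 by blast
  obtain N2 where N2: "real N2 > 2 / (1 - u)" using reals_Archimedean2 by blast
  show "\<forall>\<^sub>F n in sequentially. cutoff n u = 1"
    using eventually_ge_at_top[of "max N1 N2"]
  proof eventually_elim
    case (elim n)
    have "real (n + 3) \<ge> 2 / u" "real (n + 3) \<ge> 2 / (1 - u)" using N1 N2 elim by auto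
    then have "real (n + 3) * u \<ge> 2" "real (n + 3) * (1 - u) \<ge> 2" using assms by (auto simp: pos_divide_le_eq)
    then show ?case by (simp add: cutoff_def)
  qed
qed

lemma continuous_cutoff: "continuous_on A (cutoff n)"
  unfolding cutoff_def[abs_def] by (intro continuous_intros)

lemma hpoly_span_coord:
  assumes "h \<in> complex_span (\<Union>m. {f. hpoly m f})"
  shows "(\<lambda>x. complex_of_real (x $ i) * h x) \<in> complex_span (\<Union>m. {f. hpoly m f})"
proof -
  obtain S c where S: "finite S" "S \<subseteq> (\<Union>m. {f. hpoly m f})" "h = lincomb S c" by (rule complex_span_cases[OF assms])
  have "(\<lambda>x. \<Sum>b\<in>S. c b * (complex_of_real (x $ i) * b x)) \<in> complex_span (\<Union>m. {f. hpoly m f})"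
    using S(2) by (intro complex_span_sum complex_span_cmult complex_span_superset) (blast intro: hpoly_coord)
  then show ?thesis unfolding S(3) by (simp add: sum_distrib_left mult.left_commute)
qed

lemma real_polynomial_function_hpoly:
  fixes f :: "real^'n \<Rightarrow> real"
  shows "real_polynomial_function f \<Longrightarrow> \<forall>h \<in> complex_span (\<Union>m. {f. hpoly m f}).
    (\<lambda>x. complex_of_real (f x) * h x) \<in> complex_span (\<Union>m. {f. hpoly m f})"
proof (induction rule: real_polynomial_function.induct)
  case (linear f)
  show ?case
  proof
    fix h :: "real^'n \<Rightarrow> complex" assume h: "h \<in> complex_span (\<Union>m. {f. hpoly m f})"
    have f_eq: "f x = (\<Sum>i\<in>UNIV. f (axis i 1) * x $ i)" for x
    proof -
      have "f x = f (\<Sum>i\<in>UNIV. x $ i *s axis i 1)" by (simp add: basis_expansion)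
      also have "\<dots> = (\<Sum>i\<in>UNIV. f (x $ i *\<^sub>R axis i 1))"
        unfolding scalar_mult_eq_scaleR by (rule linear_sum[OF bounded_linear.linear[OF linear]])
      also have "\<dots> = (\<Sum>i\<in>UNIV. f (axis i 1) * x $ i)"
      proof (rule sum.cong[OF HOL.refl])
        fix i
        have "f (x $ i *\<^sub>R axis i 1) = x $ i *\<^sub>R f (axis i 1)"
          by (rule linear_scale[OF bounded_linear.linear[OF linear]])
        also have "\<dots> = f (axis i 1) * x $ i" unfolding real_scaleR_def by (rule mult.commute)
        finally show "f (x $ i *\<^sub>R axis i 1) = f (axis i 1) * x $ i" .
      qed
      finally show ?thesis .
    qed
    have "(\<lambda>x. complex_of_real (f x) * h x) = (\<lambda>x. \<Sum>i\<in>UNIV. complex_of_real (f (axis i 1)) * (complex_of_real (x $ i) * h x))"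
    proof
      fix x
      show "complex_of_real (f x) * h x = (\<Sum>i\<in>UNIV. complex_of_real (f (axis i 1)) * (complex_of_real (x $ i) * h x))"
        by (subst f_eq) (simp add: sum_distrib_right mult.assoc)
    qed
    then show "(\<lambda>x. complex_of_real (f x) * h x) \<in> complex_span (\<Union>m. {f. hpoly m f})"
      by (simp only:) (intro complex_span_sum complex_span_cmult hpoly_span_coord h)
  qed
next
  case (const c) show ?case by (auto intro: complex_span_cmult)
next
  case (add f g)
  then show ?case by (auto simp: distrib_right intro: complex_span_add)
next
  case (mult f g)
  then show ?case by (auto simp: mult.assoc)
qed

context dunkl_ka begin

abbreviation radpow :: "real^'n \<Rightarrow> real" where "radpow x \<equiv> norm x powr a"

abbreviation eigenfunctions :: "(real^'n \<Rightarrow> complex) set" where "eigenfunctions \<equiv> {Phi l m p | l m p. harmonic m p}"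

abbreviation W :: "(real^'n \<Rightarrow> complex) set" where "W \<equiv> complex_span eigenfunctions"

abbreviation V :: "(real^'n \<Rightarrow> complex) set" where "V \<equiv> L2_closure M W"

lemma eigenfunctions_L2: "b \<in> eigenfunctions \<Longrightarrow> b \<in> L2 M"
  using Phi_L2 by (auto simp: harmonic_def)

lemma W_L2: "W \<subseteq> L2 M"
proof
  fix u assume "u \<in> W"
  then obtain S c where S: "finite S" "S \<subseteq> eigenfunctions" "u = lincomb S c" by (rule complex_span_cases)
  show "u \<in> L2 M" unfolding S(3) using S(2) by (intro L2_sum L2_cmult eigenfunctions_L2) auto
qed

lemmas V_add = L2_closure_span_add[OF W_L2]
lemmas V_sum = L2_closure_span_sum[OF W_L2]
lemmas V_dominated = L2_closure_dominated[OF W_L2]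

text \<open>The Laguerre polynomials of degrees up to \<open>n\<close> have nonzero leading coefficients and so span all polynomials of
degree at most \<open>n\<close>.\<close>

lemma poly_exp_in_W:
  assumes p: "harmonic m p"
  shows "(\<lambda>x. p x * complex_of_real (poly u (2 / a * radpow x) * exp (- (1 / a) * radpow x))) \<in> W"
proof -
  have "\<forall>u. (\<forall>i\<ge>n. coeff u i = 0) \<longrightarrow> (\<lambda>x. p x * complex_of_real (poly u (2 / a * radpow x) * exp (- (1 / a) * radpow x))) \<in> W" for n
  proof (induction n)
    case 0
    show ?case
    proof (intro allI impI)
      fix u :: "real poly" assume "\<forall>i\<ge>0. coeff u i = 0"
      then have "u = 0" by (intro poly_eqI) simp
      then show "(\<lambda>x. p x * complex_of_real (poly u (2 / a * radpow x) * exp (- (1 / a) * radpow x))) \<in> W"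
        by (simp add: complex_span_zero)
    qed
  next
    case (Suc n)
    show ?case
    proof (intro allI impI)
      fix u :: "real poly" assume u: "\<forall>i\<ge>Suc n. coeff u i = 0"
      let ?L = "laguerre_poly n (laguerre_index m)"
      have "laguerre_index m + real n + 1 > 0" using laguerre_index_gt[of m] by (simp add: add_pos_nonneg)
      then have "Gamma (laguerre_index m + real n + 1) > 0" by (rule Gamma_real_pos)
      then have Ln: "coeff ?L n \<noteq> 0" by (simp add: coeff_laguerre)
      define c where "c = coeff u n / coeff ?L n"
      have "coeff (u - smult c ?L) i = 0" if "i \<ge> n" for i
        using u that Ln by (cases "i = n") (auto simp: c_def coeff_laguerre)
      then have 1: "(\<lambda>x. p x * complex_of_real (poly (u - smult c ?L) (2 / a * radpow x) * exp (- (1 / a) * radpow x))) \<in> W"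
        using Suc by blast
      have 2: "Phi n m p \<in> W" using p by (intro complex_span_superset) blast
      have "complex_of_real c * Phi n m p x + p x * complex_of_real (poly (u - smult c ?L) (2 / a * radpow x) * exp (- (1 / a) * radpow x))
        = p x * complex_of_real (poly u (2 / a * radpow x) * exp (- (1 / a) * radpow x))" for x
        by (simp add: Phi_def profile_def poly_laguerre[symmetric] algebra_simps)
      then show "(\<lambda>x. p x * complex_of_real (poly u (2 / a * radpow x) * exp (- (1 / a) * radpow x))) \<in> W"
        using complex_span_combine[OF 2 1, of "complex_of_real c"] by simp
    qed
  qed
  moreover have "\<forall>i\<ge>Suc (degree u). coeff u i = 0" by (simp add: coeff_eq_0)
  ultimately show ?thesis by blast
qed

abbreviation power_exp :: "(real^'n \<Rightarrow> complex) \<Rightarrow> real \<Rightarrow> nat \<Rightarrow> real^'n \<Rightarrow> complex" where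
  "power_exp p s j x \<equiv> p x * complex_of_real (radpow x ^ j * exp (- s * radpow x))"

lemma power_exp_L2: assumes "hpoly m p" "s > 0" shows "power_exp p s j \<in> L2 M"
  using poly_exp_radial_L2[OF assms, of "monom 1 j"] by (simp add: poly_monom)

lemma power_exp_base: assumes "harmonic m p" shows "power_exp p (1 / a) j \<in> V"
proof -
  have "power_exp p (1 / a) j = (\<lambda>x. p x * complex_of_real (poly (monom ((a / 2) ^ j) j) (2 / a * radpow x) * exp (- (1 / a) * radpow x)))"
    using a_pos by (simp add: poly_monom power_mult_distrib[symmetric])
  then show ?thesis using poly_exp_in_W[OF assms, of "monom ((a / 2) ^ j) j"] by (intro L2_closure_superset[OF W_L2]) simp
qed

text \<open>Write \<open>exp (- s' \<tau>) = exp (- s \<tau>) * exp (\<delta> \<tau>)\<close> with \<open>\<delta> = s - s'\<close> and expand the second factor. The partial sums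
are dominated by \<open>exp (- (s - \<bar>\<delta>\<bar>) \<tau>)\<close>, which is square-integrable as long as \<open>\<bar>\<delta>\<bar> < s\<close>. So each step reaches all
rates below \<open>2 * s\<close>.\<close>

lemma power_exp_change_rate:
  assumes p: "harmonic m p" and s: "\<And>j. power_exp p s j \<in> V" and s': "0 < s'" "s' < 2 * s"
  shows "power_exp p s' j \<in> V"
proof -
  have hp: "hpoly m p" using p by (simp add: harmonic_def)
  define \<delta> where "\<delta> = s - s'"
  have \<delta>: "s - \<bar>\<delta>\<bar> > 0" using s' by (auto simp: \<delta>_def abs_if)
  let ?S = "\<lambda>n x. \<Sum>i<n. complex_of_real (\<delta> ^ i / fact i) * power_exp p s (j + i) x"
  have S: "?S n x = p x * complex_of_real (radpow x ^ j * exp (- s * radpow x) * (\<Sum>i<n. (\<delta> * radpow x) ^ i /\<^sub>R fact i))" for n x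
    by (simp add: sum_distrib_left power_add power_mult_distrib divide_inverse mult_ac)
  show ?thesis
  proof (rule V_dominated[where s = ?S and g = "power_exp p (s - \<bar>\<delta>\<bar>) j"])
    show "?S n \<in> V" for n by (intro V_sum s)
    show "power_exp p (s - \<bar>\<delta>\<bar>) j \<in> L2 M" by (rule power_exp_L2[OF hp \<delta>])
    show "power_exp p s' j \<in> borel_measurable M" using power_exp_L2[OF hp s'(1), of j] by (simp add: L2_def)
    show "AE x in M. (\<lambda>n. ?S n x) \<longlonglongrightarrow> power_exp p s' j x"
    proof (intro AE_I2)
      fix x
      have "(\<lambda>n. \<Sum>i<n. (\<delta> * radpow x) ^ i /\<^sub>R fact i) \<longlonglongrightarrow> exp (\<delta> * radpow x)"
        using exp_converges[of "\<delta> * radpow x"] by (simp add: sums_def)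
      then have "(\<lambda>n. ?S n x) \<longlonglongrightarrow> p x * complex_of_real (radpow x ^ j * exp (- s * radpow x) * exp (\<delta> * radpow x))"
        unfolding S by (intro tendsto_intros)
      also have "radpow x ^ j * exp (- s * radpow x) * exp (\<delta> * radpow x) = radpow x ^ j * exp (- s' * radpow x)"
        by (simp add: mult.assoc exp_add[symmetric]) (simp add: \<delta>_def algebra_simps)
      finally show "(\<lambda>n. ?S n x) \<longlonglongrightarrow> power_exp p s' j x" .
    qed
    show "AE x in M. cmod (?S n x) \<le> cmod (power_exp p (s - \<bar>\<delta>\<bar>) j x)" for n
    proof (intro AE_I2)
      fix x
      have "\<bar>\<Sum>i<n. (\<delta> * radpow x) ^ i /\<^sub>R fact i\<bar> \<le> (\<Sum>i<n. \<bar>(\<delta> * radpow x) ^ i /\<^sub>R fact i\<bar>)" by (rule sum_abs)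
      also have "\<dots> = (\<Sum>i<n. (\<bar>\<delta>\<bar> * radpow x) ^ i /\<^sub>R fact i)" by (simp add: abs_mult power_abs)
      also have "\<dots> \<le> (\<Sum>i. (\<bar>\<delta>\<bar> * radpow x) ^ i /\<^sub>R fact i)"
        using exp_converges[of "\<bar>\<delta>\<bar> * radpow x"] by (intro sum_le_suminf) (auto simp: sums_iff)
      also have "\<dots> = exp (\<bar>\<delta>\<bar> * radpow x)" using exp_converges[of "\<bar>\<delta>\<bar> * radpow x"] by (simp add: sums_iff)
      finally have b: "\<bar>\<Sum>i<n. (\<delta> * radpow x) ^ i /\<^sub>R fact i\<bar> \<le> exp (\<bar>\<delta>\<bar> * radpow x)" .
      have "cmod (?S n x) = cmod (p x) * (radpow x ^ j * exp (- s * radpow x) * \<bar>\<Sum>i<n. (\<delta> * radpow x) ^ i /\<^sub>R fact i\<bar>)"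
        unfolding S norm_mult norm_of_real abs_mult by simp
      also have "\<dots> \<le> cmod (p x) * (radpow x ^ j * exp (- s * radpow x) * exp (\<bar>\<delta>\<bar> * radpow x))"
        by (intro mult_left_mono b) auto
      also have "radpow x ^ j * exp (- s * radpow x) * exp (\<bar>\<delta>\<bar> * radpow x) = radpow x ^ j * exp (- (s - \<bar>\<delta>\<bar>) * radpow x)"
        by (simp add: mult.assoc exp_add[symmetric]) (simp add: algebra_simps)
      also have "cmod (p x) * (radpow x ^ j * exp (- (s - \<bar>\<delta>\<bar>) * radpow x)) = cmod (power_exp p (s - \<bar>\<delta>\<bar>) j x)"
        unfolding norm_mult norm_of_real abs_mult by simp
      finally show "cmod (?S n x) \<le> cmod (power_exp p (s - \<bar>\<delta>\<bar>) j x)" .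
    qed
  qed
qed

text \<open>Doubling the reachable range of rates at each step covers every positive rate.\<close>

lemma power_exp_in_V:
  assumes p: "harmonic m p" and s: "s > 0" shows "power_exp p s j \<in> V"
proof -
  have "\<forall>s j. 0 < s \<longrightarrow> s < 2 ^ n / a \<longrightarrow> power_exp p s j \<in> V" for n
  proof (induction n)
    case 0
    show ?case
    proof (intro allI impI)
      fix s j assume s: "0 < s" "s < 2 ^ 0 / a"
      have "0 < 1 / a" using a_pos by simp
      then have "s < 2 * (1 / a)" using s by simp
      then show "power_exp p s j \<in> V" by (rule power_exp_change_rate[OF p power_exp_base[OF p] s(1)])
    qed
  next
    case (Suc n)
    show ?case
    proof (intro allI impI)
      fix s j assume s: "0 < s" "s < 2 ^ Suc n / a"
      define Y where "Y = 2 ^ n / a"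
      define s0 where "s0 = (s / 2 + Y) / 2"
      have "2 ^ Suc n / a = 2 * Y" by (simp add: Y_def)
      then have "s / 2 < Y" using s(2) by linarith
      then have s0: "0 < s0" "s0 < Y" "s < 2 * s0" using s(1) by (simp_all add: s0_def field_simps)
      show "power_exp p s j \<in> V" by (rule power_exp_change_rate[OF p _ s(1) s0(3)]) (use Suc s0 in \<open>auto simp: Y_def\<close>)
    qed
  qed
  moreover obtain n where "s * a < 2 ^ n" using real_arch_pow[of 2 "s * a"] by auto
  then have "s < 2 ^ n / a" using a_pos by (simp add: pos_less_divide_eq)
  ultimately show ?thesis using s by blast
qed

text \<open>Polynomials in \<open>u = exp (- norm x powr a)\<close> without constant term correspond to integer rates. By the Weierstrass
theorem they approximate \<open>u * \<psi> u\<close> with an error bounded by a small multiple of \<open>u\<close>, and the factor \<open>u\<close> provides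
the square-integrable majorant.\<close>

lemma exp_continuous_in_V:
  assumes p: "harmonic m p" and \<psi>: "continuous_on {0..1} \<psi>"
  shows "(\<lambda>x. p x * complex_of_real (exp (- radpow x) * \<psi> (exp (- radpow x)))) \<in> V"
proof -
  have hp: "hpoly m p" using p by (simp add: harmonic_def)
  have u: "exp (- radpow x) \<in> {0..1}" for x by simp
  obtain C where C: "\<And>v. v \<in> {0..1} \<Longrightarrow> \<bar>\<psi> v\<bar> \<le> C"
  proof -
    have "bounded (\<psi> ` {0..1})" by (intro compact_imp_bounded compact_continuous_image[OF \<psi>]) simp
    then obtain C where "\<forall>y\<in>\<psi> ` {0..1}. norm y \<le> C" unfolding bounded_iff by blast
    then show thesis by (intro that[of C]) auto
  qed
  have "\<exists>q. real_polynomial_function q \<and> (\<forall>v\<in>{0..1}. \<bar>\<psi> v - q v\<bar> < inverse (real (Suc n)))" for n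
  proof -
    have "inverse (real (Suc n)) > 0" by simp
    from Stone_Weierstrass_real_polynomial_function[OF _ \<psi> this] show ?thesis by (metis compact_Icc)
  qed
  then obtain q where q: "\<And>n. real_polynomial_function (q n)"
    "\<And>n v. v \<in> {0..1} \<Longrightarrow> \<bar>\<psi> v - q n v\<bar> < inverse (real (Suc n))" by metis
  let ?s = "\<lambda>n x. p x * complex_of_real (exp (- radpow x) * q n (exp (- radpow x)))"
  show ?thesis
  proof (rule V_dominated[where s = ?s and g = "\<lambda>x. complex_of_real (C + 1) * power_exp p 1 0 x"])
    show "?s n \<in> V" for n
    proof -
      obtain c N where c: "q n = (\<lambda>v. \<Sum>i\<le>N. c i * v ^ i)" using q(1)[of n] real_polynomial_function_iff_sum by blast
      have "?s n = (\<lambda>x. \<Sum>i\<le>N. complex_of_real (c i) * power_exp p (real (Suc i)) 0 x)"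
      proof
        fix x
        have "exp (- radpow x) * exp (- radpow x) ^ i = exp (- real (Suc i) * radpow x)" for i
          by (simp add: exp_of_nat_mult[symmetric] exp_add[symmetric] algebra_simps)
        then have "exp (- radpow x) * q n (exp (- radpow x)) = (\<Sum>i\<le>N. c i * exp (- real (Suc i) * radpow x))"
          unfolding c by (simp only: sum_distrib_left mult.left_commute)
        then show "?s n x = (\<Sum>i\<le>N. complex_of_real (c i) * power_exp p (real (Suc i)) 0 x)"
          by (simp only: of_real_sum sum_distrib_left of_real_mult power_0 mult_1 of_real_1 mult.left_commute)
      qed
      then show ?thesis by (simp only:) (intro V_sum power_exp_in_V[OF p], simp)
    qed
    show "(\<lambda>x. complex_of_real (C + 1) * power_exp p 1 0 x) \<in> L2 M" by (intro L2_cmult power_exp_L2[OF hp]) simp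
    have [measurable]: "p \<in> borel_measurable borel" using hpoly_measurable[OF hp] .
    have "(\<lambda>x. \<psi> (exp (- radpow x))) \<in> borel_measurable (borel :: (real^'n) measure)"
    proof -
      have "(\<lambda>v. indicator {0..1} v *\<^sub>R \<psi> v) \<in> borel_measurable borel"
        using \<psi> by (intro borel_measurable_continuous_on_indicator) auto
      then have "(\<lambda>x::real^'n. indicator {0..1} (exp (- radpow x)) *\<^sub>R \<psi> (exp (- radpow x))) \<in> borel_measurable borel"
        by (rule measurable_compose[rotated]) measurable
      then show ?thesis using u by simp
    qed
    then show "(\<lambda>x. p x * complex_of_real (exp (- radpow x) * \<psi> (exp (- radpow x)))) \<in> borel_measurable M"
      by (simp add: borel_measurable_M)
    show "AE x in M. (\<lambda>n. ?s n x) \<longlonglongrightarrow> p x * complex_of_real (exp (- radpow x) * \<psi> (exp (- radpow x)))"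
    proof (intro AE_I2 tendsto_intros)
      fix x
      have "(\<lambda>n. \<psi> (exp (- radpow x)) - q n (exp (- radpow x))) \<longlonglongrightarrow> 0"
        by (rule Lim_null_comparison[OF always_eventually LIMSEQ_inverse_real_of_nat])
          (use q(2)[OF u] in \<open>auto intro: less_imp_le\<close>)
      then show "(\<lambda>n. q n (exp (- radpow x))) \<longlonglongrightarrow> \<psi> (exp (- radpow x))"
        using tendsto_diff[OF tendsto_const, of _ 0 sequentially "\<psi> (exp (- radpow x))"] by force
    qed
    show "AE x in M. cmod (?s n x) \<le> cmod (complex_of_real (C + 1) * power_exp p 1 0 x)" for n
    proof (intro AE_I2)
      fix x
      have "inverse (real (Suc n)) \<le> 1" by (simp add: inverse_le_1_iff)
      then have "\<bar>q n (exp (- radpow x))\<bar> \<le> C + 1" using q(2)[OF u[of x], of n] C[OF u[of x]] by linarith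
      moreover have "0 \<le> C" using C[of 0] by auto
      ultimately have "\<bar>exp (- radpow x) * q n (exp (- radpow x))\<bar> \<le> (C + 1) * exp (- radpow x)"
        by (simp add: abs_mult mult.commute mult_right_mono)
      then have "cmod (p x) * \<bar>exp (- radpow x) * q n (exp (- radpow x))\<bar> \<le> cmod (p x) * ((C + 1) * exp (- radpow x))"
        by (intro mult_left_mono) auto
      moreover have "cmod (complex_of_real (C + 1) * power_exp p 1 0 x) = cmod (p x) * ((C + 1) * exp (- radpow x))"
        using \<open>0 \<le> C\<close> unfolding norm_mult norm_of_real abs_mult by simp
      ultimately show "cmod (?s n x) \<le> cmod (complex_of_real (C + 1) * power_exp p 1 0 x)"
        by (simp only: norm_mult norm_of_real)
    qed
  qed
qed

end

context dunkl_ka begin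

abbreviation chi :: "nat \<Rightarrow> real^'n \<Rightarrow> real" where "chi n x \<equiv> cutoff n (exp (- radpow x))"

lemma chi_measurable[measurable]: "chi n \<in> borel_measurable borel"
  unfolding cutoff_def by measurable

text \<open>On the support of the cutoff, \<open>norm x\<close> is a continuous function of \<open>exp (- norm x powr a)\<close>; clamping the argument
to that region extends this function continuously to the closed interval.\<close>

lemma harmonic_cutoff_in_V:
  assumes p: "harmonic m p" and G: "continuous_on {0<..} G"
  shows "(\<lambda>x. p x * complex_of_real (G (norm x) * chi n x)) \<in> V"
proof -
  define \<delta> where "\<delta> = 1 / real (n + 3)"
  have "real (n + 3) \<ge> 3" by simp
  then have \<delta>: "0 < \<delta>" "\<delta> \<le> 1 / 3" unfolding \<delta>_def by (auto simp: divide_simps)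
  define clamp where "clamp u = max \<delta> (min u (1 - \<delta>))" for u
  have cl: "\<delta> \<le> clamp u" "clamp u \<le> 1 - \<delta>" for u using \<delta> by (auto simp: clamp_def)
  have cl0: "0 < clamp u" "clamp u < 1" for u using cl[of u] \<delta> by linarith+
  have ccl: "continuous_on {0..1} clamp" unfolding clamp_def by (intro continuous_intros)
  define \<psi> where "\<psi> u = cutoff n u * G ((- ln (clamp u)) powr (1 / a)) / clamp u" for u
  have lnpos: "- ln (clamp u) > 0" for u using cl0[of u] by simp
  have ne: "clamp u \<noteq> 0" "clamp u \<noteq> 1" "- ln (clamp u) \<noteq> 0" "ln (clamp u) \<noteq> 0" "\<not> clamp u \<le> 0" for u
    using cl0[of u] lnpos[of u] by auto
  have lnp: "(- ln (clamp u)) powr (1 / a) > 0" for u unfolding powr_gt_zero by (rule ne(3))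
  have "continuous_on {0..1} (\<lambda>u. (- ln (clamp u)) powr (1 / a))"
    by (intro continuous_intros ccl) (use ne in \<open>simp_all\<close>)
  then have "continuous_on {0..1} (\<lambda>u. G ((- ln (clamp u)) powr (1 / a)))"
    by (rule continuous_on_compose2[OF G]) (use lnp in \<open>simp only: image_subset_iff greaterThan_iff, blast\<close>)
  then have "continuous_on {0..1} \<psi>"
    unfolding \<psi>_def by (intro continuous_intros ccl continuous_cutoff) (use ne in simp_all)
  from exp_continuous_in_V[OF p this]
  have 1: "(\<lambda>x. p x * complex_of_real (exp (- radpow x) * \<psi> (exp (- radpow x)))) \<in> V" .
  have "exp (- radpow x) * \<psi> (exp (- radpow x)) = G (norm x) * chi n x" for x
  proof (cases "chi n x = 0")
    case True then show ?thesis by (simp add: \<psi>_def)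
  next
    case False
    from cutoff_support[OF this] have "clamp (exp (- radpow x)) = exp (- radpow x)" by (simp add: clamp_def \<delta>_def)
    then have "\<psi> (exp (- radpow x)) = chi n x * G (radpow x powr (1 / a)) / exp (- radpow x)" by (simp add: \<psi>_def)
    moreover have "radpow x powr (1 / a) = norm x" using a_pos by (simp add: powr_powr)
    ultimately show ?thesis by simp
  qed
  then show ?thesis using 1 by simp
qed

text \<open>Split off the harmonic part by Fischer's decomposition and absorb \<open>(norm x)\<^sup>2\<close> into the radial function \<open>G\<close>. This is
why \<open>G\<close> has to be arbitrary in the induction.\<close>

lemma hpoly_cutoff_in_V:
  "hpoly m q \<Longrightarrow> continuous_on {0<..} G \<Longrightarrow> (\<lambda>x. q x * complex_of_real (G (norm x) * chi n x)) \<in> V"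
proof (induction m arbitrary: q G rule: less_induct)
  case (less m)
  show ?case
  proof (cases "m < 2")
    case True
    then show ?thesis by (intro harmonic_cutoff_in_V[OF harmonic_low[OF less.prems(1)] less.prems(2)])
  next
    case False
    then obtain j where m: "m = j + 2" by (metis add.commute le_iff_add not_less)
    obtain p r where pr: "harmonic m p" "hpoly j r" "\<And>x. q x = p x + complex_of_real ((norm x)\<^sup>2) * r x"
      using fischer_decomposition less.prems(1) unfolding m by blast
    have 1: "(\<lambda>x. p x * complex_of_real (G (norm x) * chi n x)) \<in> V"
      by (rule harmonic_cutoff_in_V[OF pr(1) less.prems(2)])
    have 2: "(\<lambda>x. r x * complex_of_real (((norm x)\<^sup>2 * G (norm x)) * chi n x)) \<in> V"
      by (rule less.IH[OF _ pr(2), of "\<lambda>r. r\<^sup>2 * G r"]) (auto intro!: continuous_intros less.prems simp: m)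
    have "q x * complex_of_real (G (norm x) * chi n x)
      = p x * complex_of_real (G (norm x) * chi n x) + r x * complex_of_real (((norm x)\<^sup>2 * G (norm x)) * chi n x)" for x
      unfolding pr(3) by (simp add: algebra_simps)
    then show ?thesis using V_add[OF 1 2] by simp
  qed
qed

lemma real_polynomial_cutoff_in_V:
  assumes "real_polynomial_function f" shows "(\<lambda>x. complex_of_real (f x * chi n x)) \<in> V"
proof -
  have "(\<lambda>x::real^'n. 1::complex) \<in> complex_span (\<Union>m. {f. hpoly m f})"
    by (rule complex_span_superset) (auto intro: hpoly_const)
  from bspec[OF real_polynomial_function_hpoly[OF assms] this]
  have "(\<lambda>x. complex_of_real (f x)) \<in> complex_span (\<Union>m. {f. hpoly m f})" by simp
  then obtain S c where S: "finite S" "S \<subseteq> (\<Union>m. {f. hpoly m f})" "(\<lambda>x. complex_of_real (f x)) = lincomb S c"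
    by (rule complex_span_cases)
  have "(\<lambda>x. \<Sum>b\<in>S. c b * (b x * complex_of_real (1 * chi n x))) \<in> V"
  proof (rule V_sum)
    fix b assume "b \<in> S"
    then obtain m where "hpoly m b" using S(2) by blast
    from hpoly_cutoff_in_V[OF this continuous_on_const[of _ 1], of n]
    show "(\<lambda>x. b x * complex_of_real (1 * chi n x)) \<in> V" .
  qed
  also have "(\<lambda>x. \<Sum>b\<in>S. c b * (b x * complex_of_real (1 * chi n x))) = (\<lambda>x. complex_of_real (f x * chi n x))"
    using fun_cong[OF S(3)] by (simp add: sum_distrib_right mult.assoc)
  finally show ?thesis .
qed

lemma chi_L2: "(\<lambda>x. complex_of_real (chi n x)) \<in> L2 M"
  using L2_closure_L2[OF real_polynomial_cutoff_in_V[OF real_polynomial_function.intros(2)[of 1]]] by simp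

text \<open>The cutoff has support in a ball, on which polynomials approximate uniformly.\<close>

lemma continuous_cutoff_in_V:
  assumes f: "continuous_on UNIV f" and C: "\<And>x. \<bar>f x\<bar> \<le> C"
  shows "(\<lambda>x. complex_of_real (f x * chi n x)) \<in> V"
proof -
  \<comment> \<open>The radius of a ball containing the support of the cutoff.\<close>
  define \<rho> where "\<rho> = (ln (real (n + 3))) powr (1 / a)"
  have supp: "x \<in> cball 0 \<rho>" if "chi n x \<noteq> 0" for x
  proof -
    have "1 / real (n + 3) < exp (- radpow x)" by (rule cutoff_support[OF that])
    then have "ln (1 / real (n + 3)) < - radpow x" by (subst (asm) ln_less_cancel_iff[symmetric]) auto
    then have "radpow x \<le> ln (real (n + 3))" by (simp add: ln_div)
    then have "radpow x powr (1 / a) \<le> \<rho>" unfolding \<rho>_def using a_pos by (intro powr_mono2) auto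
    then show ?thesis using a_pos by (simp add: powr_powr)
  qed
  have "\<exists>g. real_polynomial_function g \<and> (\<forall>x\<in>cball 0 \<rho>. \<bar>f x - g x\<bar> < inverse (real (Suc j)))" for j
  proof -
    have "inverse (real (Suc j)) > 0" by simp
    from Stone_Weierstrass_real_polynomial_function[OF compact_cball continuous_on_subset[OF f] this]
    show ?thesis by (metis subset_UNIV)
  qed
  then obtain g where g: "\<And>j. real_polynomial_function (g j)"
    "\<And>j x. x \<in> cball 0 \<rho> \<Longrightarrow> \<bar>f x - g j x\<bar> < inverse (real (Suc j))" by metis
  show ?thesis
  proof (rule V_dominated[where s = "\<lambda>j x. complex_of_real (g j x * chi n x)" and g = "\<lambda>x. complex_of_real (C + 1) * complex_of_real (chi n x)"])
    show "(\<lambda>x. complex_of_real (g j x * chi n x)) \<in> V" for j by (rule real_polynomial_cutoff_in_V[OF g(1)])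
    show "(\<lambda>x. complex_of_real (C + 1) * complex_of_real (chi n x)) \<in> L2 M" by (intro L2_cmult chi_L2)
    have [measurable]: "f \<in> borel_measurable borel" by (rule borel_measurable_continuous_onI[OF f])
    show "(\<lambda>x. complex_of_real (f x * chi n x)) \<in> borel_measurable M" by (simp add: borel_measurable_M)
    show "AE x in M. (\<lambda>j. complex_of_real (g j x * chi n x)) \<longlonglongrightarrow> complex_of_real (f x * chi n x)"
    proof (intro AE_I2)
      fix x
      show "(\<lambda>j. complex_of_real (g j x * chi n x)) \<longlonglongrightarrow> complex_of_real (f x * chi n x)"
      proof (cases "chi n x = 0")
        case False
        have "(\<lambda>j. f x - g j x) \<longlonglongrightarrow> 0"
          by (rule Lim_null_comparison[OF always_eventually LIMSEQ_inverse_real_of_nat])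
            (use g(2)[OF supp[OF False]] in \<open>auto intro: less_imp_le\<close>)
        then have "(\<lambda>j. g j x) \<longlonglongrightarrow> f x"
          using tendsto_diff[OF tendsto_const, of _ 0 sequentially "f x"] by force
        then show ?thesis by (intro tendsto_intros)
      qed simp
    qed
    show "AE x in M. cmod (complex_of_real (g j x * chi n x)) \<le> cmod (complex_of_real (C + 1) * complex_of_real (chi n x))" for j
    proof (intro AE_I2)
      fix x
      have "0 \<le> C" using C[of x] by linarith
      have "\<bar>g j x * chi n x\<bar> \<le> \<bar>(C + 1) * chi n x\<bar>"
      proof (cases "chi n x = 0")
        case False
        have "inverse (real (Suc j)) \<le> 1" by (simp add: inverse_le_1_iff)
        then have "\<bar>g j x\<bar> \<le> C + 1" using g(2)[OF supp[OF False], of j] C[of x] by linarith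
        then show ?thesis using \<open>0 \<le> C\<close> by (simp add: abs_mult mult_right_mono)
      qed simp
      then show "cmod (complex_of_real (g j x * chi n x)) \<le> cmod (complex_of_real (C + 1) * complex_of_real (chi n x))"
        by (simp only: of_real_mult[symmetric] norm_of_real)
    qed
  qed
qed

text \<open>The sets for which this holds form a Dynkin class that contains the open sets, whose indicators are limits of the
continuous functions \<open>min 1 (j * infdist x (- U))\<close>.\<close>

lemma indicator_cutoff_in_V:
  assumes "A \<in> sets borel"
  shows "(\<lambda>x. complex_of_real (indicator A x * chi n x)) \<in> V"
proof -
  have dom: "cmod (complex_of_real (b * chi n x)) \<le> cmod (complex_of_real (chi n x))" if "0 \<le> b" "b \<le> 1" for b x
    unfolding norm_of_real abs_mult using that by (intro mult_left_le_one_le) auto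
  have one: "(\<lambda>x. complex_of_real (chi n x)) \<in> V"
    using continuous_cutoff_in_V[of "\<lambda>_. 1" 1 n] by simp
  have sig: "A \<in> sigma_sets UNIV {S. open S}" using assms by (simp add: borel_def)
  have subset_Pow_UNIV: "{S :: (real^'n) set. open S} \<subseteq> Pow UNIV" by simp
  have "Int_stable {S :: (real^'n) set. open S}" by (auto simp: Int_stable_def)
  from this subset_Pow_UNIV sig show ?thesis
  proof (induction A rule: sigma_sets_induct_disjoint)
    case (basic U)
    then have U: "open U" by simp
    show ?case
    proof (cases "U = UNIV")
      case True then show ?thesis using one by simp
    next
      case False
      then have ne: "- U \<noteq> {}" by auto
      let ?f = "\<lambda>j x. min 1 (real j * infdist x (- U))"
      show ?thesis
      proof (rule V_dominated[where s = "\<lambda>j x. complex_of_real (?f j x * chi n x)" and g = "\<lambda>x. complex_of_real (chi n x)"])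
        show "(\<lambda>x. complex_of_real (?f j x * chi n x)) \<in> V" for j
          by (rule continuous_cutoff_in_V[of _ 1]) (auto intro!: continuous_intros simp: infdist_nonneg)
        show "(\<lambda>x. complex_of_real (chi n x)) \<in> L2 M" by (rule chi_L2)
        have [measurable]: "U \<in> sets borel" using U by simp
        show "(\<lambda>x. complex_of_real (indicator U x * chi n x)) \<in> borel_measurable M" unfolding borel_measurable_M by measurable
        show "AE x in M. (\<lambda>j. complex_of_real (?f j x * chi n x)) \<longlonglongrightarrow> complex_of_real (indicator U x * chi n x)"
        proof (intro AE_I2 tendsto_of_real tendsto_mult tendsto_const)
          fix x
          show "(\<lambda>j. ?f j x) \<longlonglongrightarrow> indicator U x"
          proof (cases "x \<in> U")
            case True
            then have "infdist x (- U) \<noteq> 0" using U ne by (simp add: in_closed_iff_infdist_zero[symmetric] closed_Compl)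
            then have d: "infdist x (- U) > 0" using infdist_nonneg[of x "- U"] by simp
            obtain N where N: "real N > 1 / infdist x (- U)" using reals_Archimedean2 by blast
            have "\<forall>\<^sub>F j in sequentially. ?f j x = indicator U x"
              using eventually_ge_at_top[of N]
            proof eventually_elim
              case (elim j)
              have "real j > 1 / infdist x (- U)" using N elim by simp
              then have "real j * infdist x (- U) > 1" using d by (simp add: pos_divide_less_eq)
              then show ?case using True by simp
            qed
            then show ?thesis by (rule tendsto_eventually)
          next
            case False
            then show ?thesis by simp
          qed
        qed
        show "AE x in M. cmod (complex_of_real (?f j x * chi n x)) \<le> cmod (complex_of_real (chi n x))" for j
          by (intro AE_I2 dom) (auto simp: infdist_nonneg)
      qed
    qed
  next
    case empty
    show ?case using L2_closure_superset[OF W_L2 complex_span_zero] by simp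
  next
    case (compl A)
    have "(\<lambda>x. complex_of_real (chi n x) + (-1) * complex_of_real (indicator A x * chi n x)) \<in> V"
      by (rule V_add[OF one L2_closure_span_cmult[OF compl.IH]])
    also have "(\<lambda>x. complex_of_real (chi n x) + (-1) * complex_of_real (indicator A x * chi n x)) = (\<lambda>x. complex_of_real (indicator (UNIV - A) x * chi n x))"
      by (auto simp: indicator_def)
    finally show ?case .
  next
    case (union A)
    have A[measurable]: "A i \<in> sets borel" for i using union(2) by (auto simp: borel_def)
    let ?s = "\<lambda>j x. \<Sum>i<j. 1 * complex_of_real (indicator (A i) x * chi n x)"
    have s: "?s j x = complex_of_real (indicator (\<Union>i<j. A i) x * chi n x)" for j x
    proof -
      have "(\<Sum>i<j. indicator (A i) x) = (indicator (\<Union>i<j. A i) x :: real)"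
        using union(1) by (intro indicator_UN_disjoint[symmetric]) (auto simp: disjoint_family_on_def)
      then show ?thesis by (simp add: sum_distrib_right[symmetric] flip: of_real_mult of_real_sum)
    qed
    show ?case
    proof (rule V_dominated[where s = ?s and g = "\<lambda>x. complex_of_real (chi n x)"])
      show "?s j \<in> V" for j by (intro V_sum union.IH)
      show "(\<lambda>x. complex_of_real (chi n x)) \<in> L2 M" by (rule chi_L2)
      show "(\<lambda>x. complex_of_real (indicator (\<Union> (range A)) x * chi n x)) \<in> borel_measurable M"
        unfolding borel_measurable_M by measurable
      show "AE x in M. (\<lambda>j. ?s j x) \<longlonglongrightarrow> complex_of_real (indicator (\<Union> (range A)) x * chi n x)"
        unfolding s by (intro AE_I2 tendsto_of_real tendsto_mult tendsto_const LIMSEQ_indicator_UN)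
      show "AE x in M. cmod (?s j x) \<le> cmod (complex_of_real (chi n x))" for j
        unfolding s by (intro AE_I2 dom) auto
    qed
  qed
qed

text \<open>Simple functions approximate \<open>f\<close> pointwise under the bound \<open>2 * \<bar>f\<bar>\<close>, and the cutoffs tend to \<open>1\<close> off the
origin.\<close>

theorem W_dense: "L2_dense M W"
  unfolding L2_dense_def
proof (intro ballI)
  fix f assume f: "f \<in> L2 M"
  then have fm: "f \<in> borel_measurable M" by (simp add: L2_def)
  from borel_measurable_implies_sequence_metric[OF this, of 0]
  obtain s where s: "\<And>i. simple_function M (s i)" "\<And>x. (\<lambda>i. s i x) \<longlonglongrightarrow> f x"
    "\<And>i x. cmod (s i x) \<le> 2 * cmod (f x)"
    by (auto simp: space_M)
  have "f \<in> V"
  proof (rule V_dominated[where s = "\<lambda>i x. s i x * complex_of_real (chi i x)" and g = "\<lambda>x. 2 * f x"])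
    show "(\<lambda>x. s i x * complex_of_real (chi i x)) \<in> V" for i
    proof -
      have fin: "finite (range (s i))" using simple_functionD(1)[OF s(1)] by (simp add: space_M)
      have sm: "s i -` {y} \<in> sets borel" for y using simple_functionD(2)[OF s(1), of i "{y}"] by (simp add: space_M sets_M)
      have "s i x * complex_of_real (chi i x) = (\<Sum>y\<in>range (s i). y * complex_of_real (indicator (s i -` {y}) x * chi i x))" for x
      proof -
        have "(\<Sum>y\<in>range (s i). y * complex_of_real (indicator (s i -` {y}) x * chi i x))
          = (\<Sum>y\<in>range (s i). if y = s i x then y * complex_of_real (chi i x) else 0)"
          by (intro sum.cong) (auto simp: indicator_def)
        also have "\<dots> = s i x * complex_of_real (chi i x)" using fin by simp
        finally show ?thesis by simp
      qed
      then show ?thesis by (simp only:) (intro V_sum indicator_cutoff_in_V sm)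
    qed
    show "(\<lambda>x. 2 * f x) \<in> L2 M" by (intro L2_cmult f)
    show "AE x in M. (\<lambda>i. s i x * complex_of_real (chi i x)) \<longlonglongrightarrow> f x"
      using AE_M_nonzero
    proof eventually_elim
      case (elim x)
      then have "0 < exp (- radpow x)" "exp (- radpow x) < 1" by auto
      from tendsto_mult[OF s(2)[of x] tendsto_of_real[OF cutoff_tendsto[OF this]]]
      show ?case by simp
    qed
    show "AE x in M. cmod (s i x * complex_of_real (chi i x)) \<le> cmod (2 * f x)" for i
    proof (intro AE_I2)
      fix x
      have "cmod (s i x * complex_of_real (chi i x)) \<le> cmod (s i x) * 1"
        unfolding norm_mult norm_of_real using cutoff_range[of i "exp (- radpow x)"] by (intro mult_left_mono) auto
      also have "\<dots> \<le> cmod (2 * f x)" using s(3)[of i x] by (simp add: norm_mult)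
      finally show "cmod (s i x * complex_of_real (chi i x)) \<le> cmod (2 * f x)" .
    qed
  qed (rule fm)
  then show "\<forall>\<epsilon>>0. \<exists>u\<in>W. L2_norm M (\<lambda>x. f x - u x) < \<epsilon>" by (simp add: L2_closure_def)
qed

end

section \<open>The spectrum\<close>

context dunkl_ka begin

text \<open>The eigenvalue as a function of the eigenfunction alone. A null function has many representations as \<open>Phi l m p\<close>
with different eigenvalues, and one of them is chosen; for all other functions \<open>eig_Phi\<close> shows that the value is
unambiguous.\<close>

definition eig :: "(real^'n \<Rightarrow> complex) \<Rightarrow> real" where
  "eig b = (SOME \<mu>. \<exists>l m p. harmonic m p \<and> b = Phi l m p \<and> \<mu> = eigval l m)"

lemma eig_cases:
  assumes "b \<in> eigenfunctions"
  obtains l m p where "harmonic m p" "b = Phi l m p" "eig b = eigval l m"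
proof -
  have "\<exists>\<mu> l m p. harmonic m p \<and> b = Phi l m p \<and> \<mu> = eigval l m" using assms by blast
  then have "\<exists>l m p. harmonic m p \<and> b = Phi l m p \<and> eig b = eigval l m" unfolding eig_def by (rule someI_ex)
  then show thesis using that by blast
qed

lemma Delta_ka_eig:
  assumes "b \<in> eigenfunctions" "x \<noteq> 0" shows "Delta_ka P k a b x = complex_of_real (eig b) * b x"
  using assms(1)
proof (cases rule: eig_cases)
  case (1 l m p)
  then show ?thesis using Phi_eigenfunction[OF 1(1) assms(2), of l] by simp
qed

lemma eig_Phi:
  assumes p: "harmonic m p" and nn: "\<not> (AE x in M. Phi l m p x = 0)"
  shows "eig (Phi l m p) = eigval l m"
proof -
  have "\<not> (\<forall>x. x \<noteq> 0 \<longrightarrow> Phi l m p x = 0)"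
  proof
    assume *: "\<forall>x. x \<noteq> 0 \<longrightarrow> Phi l m p x = 0"
    have "AE x in M. Phi l m p x = 0" using AE_M_nonzero by eventually_elim (use * in blast)
    with nn show False ..
  qed
  then obtain x where x: "x \<noteq> 0" "Phi l m p x \<noteq> 0" by blast
  have "Phi l m p \<in> eigenfunctions" using p by blast
  from Delta_ka_eig[OF this x(1)] Phi_eigenfunction[OF p x(1), of l] x(2) show ?thesis by simp
qed

text \<open>By positivity of \<open>a + 2 \<langle>k\<rangle> + N - 2\<close>, \<open>\<bar>eigval l m\<bar>\<close> exceeds \<open>2 a l + 2 m\<close>, so only finitely many index pairs come within
distance \<open>1\<close> of \<open>z\<close>. The sign \<open>s\<close> serves the operator and its negative together.\<close>

lemma eigval_discrete:
  "\<exists>\<delta>>0. \<forall>l m. complex_of_real (s * eigval l m) \<noteq> z \<longrightarrow> \<delta> \<le> cmod (complex_of_real (s * eigval l m) - z)"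
  if s: "\<bar>s\<bar> = 1"
proof -
  define C where "C = cmod z + 1"
  define F where "F = {(l, m). complex_of_real (s * eigval l m) \<noteq> z \<and> cmod (complex_of_real (s * eigval l m) - z) < 1}"
  have "F \<subseteq> {..nat \<lceil>C / (2 * a)\<rceil>} \<times> {..nat \<lceil>C\<rceil>}"
  proof (intro subrelI)
    fix l m assume "(l, m) \<in> F"
    then have "cmod (complex_of_real (s * eigval l m) - z) < 1" by (simp add: F_def)
    then have "cmod (complex_of_real (s * eigval l m)) < C"
      using norm_triangle_ineq2[of "complex_of_real (s * eigval l m)" z] unfolding C_def by linarith
    then have "\<bar>eigval l m\<bar> < C" unfolding norm_of_real abs_mult s by simp
    then have *: "2 * a * real l + 2 * real m < C" using a_ksum unfolding eigval_def hdim_def by linarith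
    have "0 \<le> 2 * a * real l" using a_pos by simp
    then have "real m \<le> C" using * by linarith
    moreover have "real l * (2 * a) \<le> C" using * by (simp add: mult.commute)
    then have "real l \<le> C / (2 * a)" using a_pos by (simp add: pos_le_divide_eq)
    ultimately show "(l, m) \<in> {..nat \<lceil>C / (2 * a)\<rceil>} \<times> {..nat \<lceil>C\<rceil>}"
      by (auto simp flip: of_nat_le_iff[where ?'a = real] intro: order.trans[OF _ le_of_int_ceiling])
  qed
  then have fin: "finite F" by (rule finite_subset) simp
  \<comment> \<open>Inserting \<open>1\<close> makes the set nonempty and covers the pairs outside \<open>F\<close>.\<close>
  define D where "D = insert 1 ((\<lambda>(l, m). cmod (complex_of_real (s * eigval l m) - z)) ` F)"
  have D: "finite D" "D \<noteq> {}" "\<And>d. d \<in> D \<Longrightarrow> 0 < d" using fin by (auto simp: D_def F_def)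
  show ?thesis
  proof (intro exI[of _ "Min D"] conjI allI impI)
    show "0 < Min D" using D by simp
    fix l m assume ne: "complex_of_real (s * eigval l m) \<noteq> z"
    show "Min D \<le> cmod (complex_of_real (s * eigval l m) - z)"
    proof (cases "(l, m) \<in> F")
      case True
      then have "cmod (complex_of_real (s * eigval l m) - z) \<in> D" unfolding D_def by force
      then show ?thesis by (rule Min_le[OF D(1)])
    next
      case False
      then have "1 \<le> cmod (complex_of_real (s * eigval l m) - z)" using ne by (simp add: F_def)
      moreover have "Min D \<le> 1" by (rule Min_le[OF D(1)]) (simp add: D_def)
      ultimately show ?thesis by linarith
    qed
  qed
qed

text \<open>At the origin the value is \<open>0\<close>, because real powers of \<open>0\<close> are \<open>0\<close>; the case distinction is only for the
sake of measurability.\<close>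

lemma Delta_ka_lincomb:
  assumes S: "finite S" "S \<subseteq> eigenfunctions"
  shows "Delta_ka P k a (lincomb S c) x = (if x = 0 then 0 else lincomb S (\<lambda>b. c b * complex_of_real (eig b)) x)"
proof (cases "x = 0")
  case True then show ?thesis by (simp add: Delta_ka_def)
next
  case False
  have "Delta_ka P k a (lincomb S c) x = (\<Sum>b\<in>S. c b * Delta_ka P k a b x)"
    by (rule Delta_lincomb[OF S(1) _ False]) (use S(2) in blast)
  also have "\<dots> = lincomb S (\<lambda>b. c b * complex_of_real (eig b)) x"
    by (intro sum.cong HOL.refl) (simp add: Delta_ka_eig[OF subsetD[OF S(2)] False] mult.assoc)
  finally show ?thesis using False by simp
qed

text \<open>Stated for the operator times \<open>s = 1\<close> or \<open>s = - 1\<close>, since the theorem speaks about the operator and about its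
negative.\<close>

lemma eigensystem:
  assumes s: "\<bar>s\<bar> = 1"
  shows "L2_eigensystem M eigenfunctions (\<lambda>f x. complex_of_real s * Delta_ka P k a f x) (\<lambda>b. s * eig b)"
proof
  show "b \<in> L2 M" if "b \<in> eigenfunctions" for b by (rule eigenfunctions_L2[OF that])
next
  fix u assume "u \<in> W"
  then obtain S c where S: "finite S" "S \<subseteq> eigenfunctions" "u = lincomb S c" by (rule complex_span_cases)
  have "lincomb S (\<lambda>b. c b * complex_of_real (eig b)) \<in> W"
    unfolding complex_span_def using S(1,2) by (intro CollectI exI[of _ S] exI[of _ "\<lambda>b. c b * complex_of_real (eig b)"]) simp
  then have [measurable]: "lincomb S (\<lambda>b. c b * complex_of_real (eig b)) \<in> borel_measurable borel"
    using W_L2 borel_measurable_M by (auto simp: L2_def)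
  show "(\<lambda>x. complex_of_real s * Delta_ka P k a u x) \<in> borel_measurable M"
    unfolding S(3) Delta_ka_lincomb[OF S(1,2)] borel_measurable_M by measurable
next
  fix S c assume S: "finite S" "S \<subseteq> eigenfunctions"
  show "AE x in M. complex_of_real s * Delta_ka P k a (lincomb S c) x = lincomb S (\<lambda>b. c b * complex_of_real (s * eig b)) x"
    using AE_M_nonzero
    by eventually_elim (simp add: Delta_ka_lincomb[OF S] sum_distrib_left mult.assoc mult.left_commute[of "complex_of_real s"])
next
  fix b b' assume b: "b \<in> eigenfunctions" "b' \<in> eigenfunctions" "s * eig b \<noteq> s * eig b'"
  obtain l m p where 1: "harmonic m p" "b = Phi l m p" "eig b = eigval l m" by (rule eig_cases[OF b(1)])
  obtain l' m' p' where 2: "harmonic m' p'" "b' = Phi l' m' p'" "eig b' = eigval l' m'" by (rule eig_cases[OF b(2)])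
  have "(l, m) \<noteq> (l', m')" using b(3) 1(3) 2(3) by auto
  then show "L2_inner M b b' = 0" unfolding 1(2) 2(2) by (rule Phi_orthogonal[OF 1(1) 2(1)])
next
  show "L2_dense M W" by (rule W_dense)
next
  fix z
  obtain \<delta> where d: "\<delta> > 0" "\<And>l m. complex_of_real (s * eigval l m) \<noteq> z \<Longrightarrow> \<delta> \<le> cmod (complex_of_real (s * eigval l m) - z)"
    using eigval_discrete[OF s, of z] by blast
  have "\<delta> \<le> cmod (complex_of_real (s * eig b) - z)" if b: "b \<in> eigenfunctions" "complex_of_real (s * eig b) \<noteq> z" for b
  proof -
    obtain l m p where 1: "eig b = eigval l m" by (rule eig_cases[OF b(1)])
    show ?thesis using d(2) b(2) unfolding 1 by blast
  qed
  then show "\<exists>\<delta>>0. \<forall>b\<in>eigenfunctions. complex_of_real (s * eig b) \<noteq> z \<longrightarrow> \<delta> \<le> cmod (complex_of_real (s * eig b) - z)"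
    using d(1) by blast
qed

lemma minus_Delta_ka_point_spectrum:
  "point_spectrum M (op_closure M (op_on M W (\<lambda>f x. - Delta_ka P k a f x)))
    = {complex_of_real (- eigval l m) | l m. \<exists>p. harmonic m p \<and> \<not> (AE x in M. Phi l m p x = 0)}"
proof -
  interpret L2_eigensystem M eigenfunctions "\<lambda>f x. complex_of_real (-1) * Delta_ka P k a f x" "\<lambda>b. (-1) * eig b"
    by (rule eigensystem) simp
  have "point_spectrum M (op_closure M (op_on M W (\<lambda>f x. - Delta_ka P k a f x)))
    = {complex_of_real (- eig b) | b. b \<in> eigenfunctions \<and> \<not> (AE x in M. b x = 0)}"
    using point_spectrum_eq unfolding A_def by simp
  also have "\<dots> = {complex_of_real (- eigval l m) | l m. \<exists>p. harmonic m p \<and> \<not> (AE x in M. Phi l m p x = 0)}"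
  proof (intro set_eqI iffI)
    fix z assume "z \<in> {complex_of_real (- eig b) | b. b \<in> eigenfunctions \<and> \<not> (AE x in M. b x = 0)}"
    then obtain b where b: "z = complex_of_real (- eig b)" "b \<in> eigenfunctions" "\<not> (AE x in M. b x = 0)" by blast
    obtain l m p where 1: "harmonic m p" "b = Phi l m p" "eig b = eigval l m" by (rule eig_cases[OF b(2)])
    show "z \<in> {complex_of_real (- eigval l m) | l m. \<exists>p. harmonic m p \<and> \<not> (AE x in M. Phi l m p x = 0)}"
      using b(1,3) 1 by (intro CollectI exI[of _ l] exI[of _ m] conjI exI[of _ p]) simp_all
  next
    fix z assume "z \<in> {complex_of_real (- eigval l m) | l m. \<exists>p. harmonic m p \<and> \<not> (AE x in M. Phi l m p x = 0)}"
    then obtain l m p where p: "z = complex_of_real (- eigval l m)" "harmonic m p" "\<not> (AE x in M. Phi l m p x = 0)" by blast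
    have "z = complex_of_real (- eig (Phi l m p))" using p(1) eig_Phi[OF p(2,3)] by simp
    then show "z \<in> {complex_of_real (- eig b) | b. b \<in> eigenfunctions \<and> \<not> (AE x in M. b x = 0)}" using p(2,3) by blast
  qed
  finally show ?thesis .
qed

text \<open>A function \<open>Phi l m p\<close> is null only if \<open>p = 0\<close>, so this is the existence of nonzero harmonics in degree \<open>m\<close>.\<close>

lemma nonnull_harmonic_iff:
  "(\<exists>p. harmonic m p \<and> \<not> (AE x in M. Phi l m p x = 0)) \<longleftrightarrow> m < 2 \<or> CARD('n) \<ge> 2"
proof
  assume "\<exists>p. harmonic m p \<and> \<not> (AE x in M. Phi l m p x = 0)"
  then obtain p where p: "harmonic m p" "\<not> (AE x in M. Phi l m p x = 0)" by blast
  show "m < 2 \<or> CARD('n) \<ge> 2"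
  proof (rule ccontr)
    assume *: "\<not> (m < 2 \<or> CARD('n) \<ge> 2)"
    moreover have "CARD('n) \<noteq> 0" by simp
    ultimately have "CARD('n) = 1" "m \<ge> 2" by linarith+
    then have "Phi l m p x = 0" for x unfolding Phi_def using harmonic_trivial_dim1[OF _ p(1)] by simp
    then show False using p(2) by simp
  qed
next
  assume "m < 2 \<or> CARD('n) \<ge> 2"
  then obtain p x where p: "harmonic m p" "p x \<noteq> 0" by (rule harmonic_exists)
  then have "\<not> (AE x in M. Phi l m p x = 0)" by (intro Phi_not_null[of m p x l]) (simp_all add: harmonic_def)
  then show "\<exists>p. harmonic m p \<and> \<not> (AE x in M. Phi l m p x = 0)" using p(1) by blast
qed

end

theorem corollary3p22:
  fixes R P :: "(real^'n) set" and k :: "real^'n \<Rightarrow> real" and a :: real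
  assumes "root_system R"
    and "positive_subsystem R P"
    and "multiplicity_function R k"
    and "\<forall>\<alpha>\<in>R. k \<alpha> \<ge> 0"
    and "a > 0"
    and "a + 2 * (\<Sum>\<alpha>\<in>P. k \<alpha>) + real CARD('n) - 2 > 0"
  shows "essentially_self_adjoint (theta_measure R k a) (W_ka P k a) (Delta_ka P k a)
    \<and> continuous_spectrum (theta_measure R k a)
        (op_closure (theta_measure R k a)
          (op_on (theta_measure R k a) (W_ka P k a) (Delta_ka P k a))) = {}
    \<and> (CARD('n) \<ge> 2 \<longrightarrow>
        point_spectrum (theta_measure R k a)
          (op_closure (theta_measure R k a)
            (op_on (theta_measure R k a) (W_ka P k a) (\<lambda>f x. - Delta_ka P k a f x)))
        = complex_of_real ` {2 * a * real l + 2 * real m + 2 * (\<Sum>\<alpha>\<in>P. k \<alpha>)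
              + real CARD('n) - 2 + a | l m :: nat. True})
    \<and> (CARD('n) = 1 \<longrightarrow>
        point_spectrum (theta_measure R k a)
          (op_closure (theta_measure R k a)
            (op_on (theta_measure R k a) (W_ka P k a) (\<lambda>f x. - Delta_ka P k a f x)))
        = complex_of_real `
            ({2 * a * real l + 2 * (\<Sum>\<alpha>\<in>P. k \<alpha>) + a + 1 | l :: nat. True}
             \<union> {2 * a * real l + 2 * (\<Sum>\<alpha>\<in>P. k \<alpha>) + a - 1 | l :: nat. True}))"
proof -
  interpret S: dunkl_setting R P k using assms(1-4) by unfold_locales
  interpret dunkl_ka R P k a by unfold_locales (use assms(5,6) in \<open>simp_all add: S.ksum_def\<close>)
  interpret L2_eigensystem M eigenfunctions "\<lambda>f x. complex_of_real 1 * Delta_ka P k a f x" "\<lambda>b. 1 * eig b"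
    by (rule eigensystem) simp
  have sa: "essentially_self_adjoint M (W_ka P k a) (Delta_ka P k a)"
    using essentially_self_adjoint by (simp add: W_eq)
  have cs: "continuous_spectrum M (op_closure M (op_on M (W_ka P k a) (Delta_ka P k a))) = {}"
    using continuous_spectrum_empty unfolding A_def W_eq by simp
  have ps: "point_spectrum M (op_closure M (op_on M (W_ka P k a) (\<lambda>f x. - Delta_ka P k a f x)))
    = {complex_of_real (- eigval l m) | l m. m < 2 \<or> CARD('n) \<ge> 2}"
    unfolding W_eq minus_Delta_ka_point_spectrum nonnull_harmonic_iff ..
  have ev: "- eigval l m = 2 * a * real l + 2 * real m + 2 * (\<Sum>\<alpha>\<in>P. k \<alpha>) + real CARD('n) - 2 + a" for l m
    by (simp add: eigval_def S.hdim_def S.ksum_def)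
  have "{complex_of_real (- eigval l m) | l m. m < 2 \<or> CARD('n) \<ge> 2} =
    complex_of_real ` {2 * a * real l + 2 * real m + 2 * (\<Sum>\<alpha>\<in>P. k \<alpha>) + real CARD('n) - 2 + a | l m. True}"
    if "CARD('n) \<ge> 2"
    unfolding ev using that by blast
  moreover have "{complex_of_real (- eigval l m) | l m. m < 2 \<or> CARD('n) \<ge> 2} =
    complex_of_real ` ({2 * a * real l + 2 * (\<Sum>\<alpha>\<in>P. k \<alpha>) + a + 1 | l. True}
      \<union> {2 * a * real l + 2 * (\<Sum>\<alpha>\<in>P. k \<alpha>) + a - 1 | l. True})" if n: "CARD('n) = 1"
  proof -
    have e1: "- eigval l 1 = 2 * a * real l + 2 * (\<Sum>\<alpha>\<in>P. k \<alpha>) + a + 1" for l unfolding ev n by simp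
    have e0: "- eigval l 0 = 2 * a * real l + 2 * (\<Sum>\<alpha>\<in>P. k \<alpha>) + a - 1" for l unfolding ev n by simp
    have "{complex_of_real (- eigval l m) | l m. m < 2 \<or> CARD('n) \<ge> 2}
      = {complex_of_real (- eigval l 1) | l. True} \<union> {complex_of_real (- eigval l 0) | l. True}"
      using n by (auto simp: less_2_cases_iff)
    then show ?thesis unfolding e1 e0 by blast
  qed
  ultimately show ?thesis using sa cs ps by simp
qed

end
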